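(* Consider the quasilinear wave equation $$\partial_t^2u=\partial_x^2u-u+\kappa a(u)\partial_x^2u+\kappa g(u,\partial_xu),\quad x\in\mathbb{T},\ t\in[0,T],\qquad u(\cdot,0)=u_0,\ \ \partial_tu(\cdot,0)=\dot u_0,$$ with smooth real-valued functions $a,g$ satisfying $a(0)=0$, $g(0,0)=0$. Assume that the coefficient functions $b_1,\bar b_1$ of the fully discrete trigonometric integrator (context) satisfy the coefficient assumption (context) with constant $c$. Fix $s\ge0$ and assume that the exact solution satisfies $(u(\cdot,t),\partial_tu(\cdot,t))\in H^{5+s}\times H^{4+s}$ with $$|||(u(\cdot,t),\partial_tu(\cdot,t))|||_{4+s}\le M\quad\text{for }0\le t\le T,$$ where $M>0$, and that there are $0<\delta<1$ and $A_0\ge0$ such that $1+\kappa a(u(\cdot,t))\ge\delta>0$ and $\kappa a(u(\cdot,t))\le A_0$ for $0\le t\le T$. Then there is $h_0>0$ such that for $0<\kappa\ll1$ and for all $h$ with $\kappa\lesssim h<h_0$, the numerical solution $(u^K_n,\dot u^K_n)$ of the fully discrete trigonometric integrator satisfies $$|||(u^K_n,\dot u^K_n)-(u(\cdot,t_n),\partial_tu(\cdot,t_n))|||_1\le Ch^2+CK^{-s-2}\qquad\text{for }0\le t_n=nh\le T,$$ where the constant $C$ depends on $a$, $g$, $c$ and $M$ (for the fixed $s$), but is independent of the time step-size $h$, the final time $T$ and the spatial discretization parameter $K$.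
   Context: $\mathbb{T}=\mathbb{R}/(2\pi\mathbb{Z})$; solutions are real-valued. For $v(x)=\sum_{j\in\mathbb{Z}}\hat v_je^{\mathrm{i}jx}$ put $\langle j\rangle=\sqrt{j^2+1}$ and $\|v\|_s^2=\sum_j\langle j\rangle^{2s}|\hat v_j|^2$, the norm of $H^s=H^s(\mathbb{T})$; $|||(u,\dot u)|||_s=(\|u\|_{s+1}^2+\|\dot u\|_s^2)^{1/2}$ is the norm of $H^{s+1}\times H^s$. $0<\kappa\ll1$ means that $\kappa>0$ is small; $\kappa\lesssim h$ means $\kappa\le\mathrm{const}\cdot h$. $\Omega=\sqrt{-\partial_x^2+1}$; functions of $h\Omega$ act as Fourier multipliers ($\Omega e^{\mathrm{i}jx}=\langle j\rangle e^{\mathrm{i}jx}$); $V=h^2\Omega^2$; $\mathrm{sinc}(\xi)=\sin(\xi)/\xi$. $\mathcal{V}^K=\{\sum_{j=-K}^K\hat v_je^{\mathrm{i}jx}:\hat v_j\in\mathbb{C}\}$ is the space of trigonometric polynomials of degree $K$; $\mathcal{P}^K$ is the $L^2$-orthogonal projection onto $\mathcal{V}^K$; $\mathcal{I}^K$ is trigonometric interpolation in $\mathcal{V}^K$. Put $f^K(u)=\mathcal{I}^K(a(u))\,\partial_x^2u+\mathcal{I}^K(g(u,\partial_xu))$ and $\hat f^K(u)=\mathcal{P}^K(f^K(u))$. Fully discrete trigonometric integrator with step size $h$, started from $u^K_0=\mathcal{P}^K(u_0)$, $\dot u^K_0=\mathcal{P}^K(\dot u_0)$: $u^K_{n+1/2}=\cos(\tfrac12h\Omega)u^K_n+\tfrac12h\,\mathrm{sinc}(\tfrac12h\Omega)\dot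 u^K_n$, $u^K_{n+1}=\cos(h\Omega)u^K_n+h\,\mathrm{sinc}(h\Omega)\dot u^K_n+\kappa h^2\bar b_1(V)\hat f^K(u^K_{n+1/2})$, $\dot u^K_{n+1}=-\Omega\sin(h\Omega)u^K_n+\cos(h\Omega)\dot u^K_n+\kappa h\,b_1(V)\hat f^K(u^K_{n+1/2})$. Coefficient assumption: the symmetry condition $\mathrm{sinc}(h\Omega)b_1(V)=(I+\cos(h\Omega))\bar b_1(V)$ holds, and there is a constant $c$ such that for all $\xi\ge0$: $|\xi\bar b_1(\xi^2)|\le c$, $|\xi^2\bar b_1(\xi^2)|\le c$, $|\bar b_1(\xi^2)-\tfrac12\mathrm{sinc}(\tfrac12\xi)|\le c\,\xi$, $|\xi b_1(\xi^2)|\le c$, $|b_1(\xi^2)-\cos(\tfrac12\xi)|\le c\,\xi^2$, $|\xi\,\mathrm{sinc}(\xi)^{-1}b_1(\xi^2)|\le c$. *)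

theory Defs
  imports "HOL-Probability.Sinc_Integral"
begin

section \<open>Smooth functions\<close>

primrec C_diff :: "nat \<Rightarrow> ('a::euclidean_space \<Rightarrow> real) \<Rightarrow> bool" where
  "C_diff 0 f \<longleftrightarrow> continuous_on UNIV f"
| "C_diff (Suc n) f \<longleftrightarrow>
     (\<forall>x. f differentiable (at x)) \<and> (\<forall>v. C_diff n (\<lambda>x. frechet_derivative f (at x) v))"

definition smooth_fun :: "('a::euclidean_space \<Rightarrow> real) \<Rightarrow> bool" where
  "smooth_fun f \<longleftrightarrow> (\<forall>n. C_diff n f)"

section \<open>Fourier analysis on the torus\<close>

text \<open>Real-valued functions on the torus of length \<open>2\<pi>\<close> are \<open>2\<pi>\<close>-periodic functions on the
  real line.\<close>

definition torus_fun :: "(real \<Rightarrow> real) \<Rightarrow> bool" where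
  "torus_fun v \<longleftrightarrow> (\<forall>x. v (x + 2 * pi) = v x)"

definition fourier_coeff :: "(real \<Rightarrow> real) \<Rightarrow> int \<Rightarrow> complex" where
  "fourier_coeff v j =
     (LINT x:{0..2*pi}|lborel. of_real (v x) * cis (- (of_int j * x))) / of_real (2 * pi)"

definition jap :: "int \<Rightarrow> real" where
  "jap j = sqrt ((of_int j)\<^sup>2 + 1)"

text \<open>Only used for \<open>r \<ge> 0\<close>, where the elements of \<open>H\<^sup>r\<close> are square integrable functions.\<close>

definition in_sobolev :: "real \<Rightarrow> (real \<Rightarrow> real) \<Rightarrow> bool" where
  "in_sobolev r v \<longleftrightarrow>
     torus_fun v \<and> v \<in> borel_measurable borel \<and>
     set_integrable lborel {0..2*pi} (\<lambda>x. (v x)\<^sup>2) \<and>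
     (\<lambda>j. jap j powr (2 * r) * (cmod (fourier_coeff v j))\<^sup>2) summable_on UNIV"

text \<open>The infinite sum is 0 if it diverges, so the norm is meaningful only together with
  \<^const>\<open>in_sobolev\<close>.\<close>

definition sobolev_norm :: "real \<Rightarrow> (real \<Rightarrow> real) \<Rightarrow> real" where
  "sobolev_norm r v =
     sqrt (\<Sum>\<^sub>\<infinity>j\<in>UNIV. jap j powr (2 * r) * (cmod (fourier_coeff v j))\<^sup>2)"

definition energy_norm :: "real \<Rightarrow> (real \<Rightarrow> real) \<times> (real \<Rightarrow> real) \<Rightarrow> real" where
  "energy_norm r w = sqrt ((sobolev_norm (r + 1) (fst w))\<^sup>2 + (sobolev_norm r (snd w))\<^sup>2)"

text \<open>\<open>omega_mult m\<close> is the operator \<open>m(\<Omega>)\<close>. Symbols are real and even in \<open>j\<close>, so on real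
  functions the sum is real and \<^const>\<open>Re\<close> only changes the type. The operator is only applied to
  trigonometric polynomials, for which the sum has finitely many nonzero terms.\<close>

definition omega_mult :: "(real \<Rightarrow> real) \<Rightarrow> (real \<Rightarrow> real) \<Rightarrow> real \<Rightarrow> real" where
  "omega_mult m v x =
     Re (\<Sum>\<^sub>\<infinity>j\<in>UNIV. of_real (m (jap j)) * fourier_coeff v j * cis (of_int j * x))"

section \<open>Trigonometric polynomials, projection and interpolation\<close>

text \<open>The real-valued elements of the space of trigonometric polynomials of degree \<open>K\<close>.\<close>

definition trig_polys :: "nat \<Rightarrow> (real \<Rightarrow> real) set" where
  "trig_polys K =
     {v. \<exists>c::int \<Rightarrow> complex. \<forall>x. of_real (v x) = (\<Sum>j\<in>{- int K..int K}. c j * cis (of_int j * x))}"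

definition trig_proj :: "nat \<Rightarrow> (real \<Rightarrow> real) \<Rightarrow> real \<Rightarrow> real" where
  "trig_proj K v x = Re (\<Sum>j\<in>{- int K..int K}. fourier_coeff v j * cis (of_int j * x))"

definition trig_node :: "nat \<Rightarrow> nat \<Rightarrow> real" where
  "trig_node K k = 2 * pi * real k / real (2 * K + 1)"

definition discrete_coeff :: "nat \<Rightarrow> (real \<Rightarrow> real) \<Rightarrow> int \<Rightarrow> complex" where
  "discrete_coeff K v j =
     (\<Sum>k<2 * K + 1. of_real (v (trig_node K k)) * cis (- (of_int j * trig_node K k)))
       / of_nat (2 * K + 1)"

definition trig_interp :: "nat \<Rightarrow> (real \<Rightarrow> real) \<Rightarrow> real \<Rightarrow> real" where
  "trig_interp K v x = Re (\<Sum>j\<in>{- int K..int K}. discrete_coeff K v j * cis (of_int j * x))"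

text \<open>The following lemmas confirm that \<^const>\<open>trig_proj\<close> is the orthogonal projection onto, and
  \<^const>\<open>trig_interp\<close> the interpolation in, \<^const>\<open>trig_polys\<close>.\<close>

lemma real_trig_sum:
  assumes "\<And>j. c (- j) = cnj (c j)"
  shows "of_real (Re (\<Sum>j\<in>{- int K..int K}. c j * cis (of_int j * x)))
       = (\<Sum>j\<in>{- int K..int K}. c j * cis (of_int j * x))"
proof -
  let ?S = "\<Sum>j\<in>{- int K..int K}. c j * cis (of_int j * x)"
  have "cnj ?S = (\<Sum>j\<in>{- int K..int K}. c (- j) * cis (of_int (- j) * x))"
    by (simp add: assms cis_cnj)
  also have "\<dots> = ?S"
    by (rule sum.reindex_bij_witness[of _ uminus uminus]) auto
  finally have "cnj ?S = ?S" .
  then have "?S \<in> \<real>"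
    by (simp only: Reals_cnj_iff)
  then show ?thesis
    by (rule of_real_Re)
qed

lemma fourier_coeff_uminus: "fourier_coeff v (- j) = cnj (fourier_coeff v j)"
proof -
  let ?f = "\<lambda>x. indicator {0..2*pi} x *\<^sub>R (of_real (v x) * cis (- (of_int j * x)))"
  have "(LINT x|lborel. cnj (?f x)) = cnj (LINT x|lborel. ?f x)"
    by (rule Bochner_Integration.integral_cnj)
  then show ?thesis
    unfolding fourier_coeff_def set_lebesgue_integral_def
    by (simp add: cis_cnj scaleR_conv_of_real)
qed

lemma discrete_coeff_uminus: "discrete_coeff K v (- j) = cnj (discrete_coeff K v j)"
  unfolding discrete_coeff_def by (simp add: cis_cnj)

lemma trig_proj_complex:
  "of_real (trig_proj K v x) = (\<Sum>j\<in>{- int K..int K}. fourier_coeff v j * cis (of_int j * x))"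
  unfolding trig_proj_def by (rule real_trig_sum) (rule fourier_coeff_uminus)

lemma trig_interp_complex:
  "of_real (trig_interp K v x) = (\<Sum>j\<in>{- int K..int K}. discrete_coeff K v j * cis (of_int j * x))"
  unfolding trig_interp_def by (rule real_trig_sum) (rule discrete_coeff_uminus)

lemma trig_proj_in: "trig_proj K v \<in> trig_polys K"
  unfolding trig_polys_def using trig_proj_complex by blast

lemma trig_interp_in: "trig_interp K v \<in> trig_polys K"
  unfolding trig_polys_def using trig_interp_complex by blast

lemma integral_cis:
  "(LINT x:{0..2*pi}|lborel. cis (of_int j * x)) = (if j = 0 then of_real (2 * pi) else 0)"
proof (cases "j = 0")
  case True
  then show ?thesis by (simp add: set_lebesgue_integral_def scaleR_conv_of_real)
next
  case False
  let ?F = "\<lambda>x. cis (of_int j * x) / (\<i> * of_int j)"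
  have deriv: "((\<lambda>x. cis (of_int j * x)) has_vector_derivative \<i> * of_int j * cis (of_int j * x)) (at x within A)"
    for x :: real and A
  proof -
    have "((\<lambda>z. exp (\<i> * of_int j * z)) has_field_derivative \<i> * of_int j * exp (\<i> * of_int j * of_real x))
        (at (of_real x))"
      by (auto intro!: derivative_eq_intros)
    from has_vector_derivative_real_field[OF this, of A] show ?thesis
      by (simp add: cis_conv_exp mult_ac)
  qed
  have "((\<lambda>x. cis (of_int j * x)) has_integral (?F (2 * pi) - ?F 0)) {0..2*pi}"
  proof (rule fundamental_theorem_of_calculus)
    fix x :: real
    have "(?F has_vector_derivative (\<i> * of_int j * cis (of_int j * x)) / (\<i> * of_int j))
        (at x within {0..2*pi})"
      by (rule has_vector_derivative_divide[OF deriv])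
    then show "(?F has_vector_derivative cis (of_int j * x)) (at x within {0..2*pi})"
      using False by simp
  qed simp
  moreover have "?F (2 * pi) = ?F 0"
    using cis_multiple_2pi[of "of_int j"] by (simp add: mult.commute mult.left_commute)
  ultimately have "integral {0..2*pi} (\<lambda>x. cis (of_int j * x)) = 0"
    by (simp add: integral_unique)
  moreover have "set_integrable lborel {0..2*pi} (\<lambda>x. cis (of_int j * x))"
    by (rule borel_integrable_compact[unfolded set_integrable_def[symmetric]])
       (auto intro!: continuous_intros)
  ultimately show ?thesis
    using False by (simp add: set_borel_integral_eq_integral)
qed

lemma fourier_coeff_mult_cis:
  "(LINT x:{0..2*pi}|lborel. of_real (v x) * cis (of_int j * x))
     = of_real (2 * pi) * fourier_coeff v (- j)"
  by (simp add: fourier_coeff_def)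

lemma trig_polys_continuous:
  assumes "v \<in> trig_polys K"
  shows "continuous_on A v"
proof -
  obtain c :: "int \<Rightarrow> complex"
    where c: "\<And>x. of_real (v x) = (\<Sum>j\<in>{- int K..int K}. c j * cis (of_int j * x))"
    using assms by (auto simp: trig_polys_def)
  have "v = (\<lambda>x. Re (\<Sum>j\<in>{- int K..int K}. c j * cis (of_int j * x)))"
    by (simp flip: c)
  moreover have "continuous_on A (\<lambda>x. Re (\<Sum>j\<in>{- int K..int K}. c j * cis (of_int j * x)))"
    unfolding cis_conv_exp by (intro continuous_intros)
  ultimately show ?thesis by simp
qed

lemma set_integrable_cis: "set_integrable lborel {0..2*pi} (\<lambda>x. cis (of_int j * x))"
  unfolding set_integrable_def
  by (rule borel_integrable_compact) (auto simp: cis_conv_exp intro!: continuous_intros)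

lemma fourier_coeff_trig_proj:
  assumes "k \<in> {- int K..int K}"
  shows "fourier_coeff (trig_proj K v) k = fourier_coeff v k"
proof -
  have "(LINT x:{0..2*pi}|lborel. of_real (trig_proj K v x) * cis (- (of_int k * x)))
      = (LINT x:{0..2*pi}|lborel.
          (\<Sum>j\<in>{- int K..int K}. fourier_coeff v j * cis (of_int (j - k) * x)))"
    by (simp add: trig_proj_complex sum_distrib_right mult.assoc cis_mult left_diff_distrib)
  also have "\<dots> = (\<Sum>j\<in>{- int K..int K}.
      LINT x:{0..2*pi}|lborel. fourier_coeff v j * cis (of_int (j - k) * x))"
    unfolding set_lebesgue_integral_def scaleR_sum_right
    by (rule Bochner_Integration.integral_sum)
       (use set_integrable_mult_right[OF set_integrable_cis] in
         \<open>simp add: set_integrable_def del: of_int_diff\<close>)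
  also have "\<dots> = (\<Sum>j\<in>{- int K..int K}. fourier_coeff v j * (if j - k = 0 then of_real (2 * pi) else 0))"
    by (simp only: set_integral_mult_right integral_cis)
  also have "\<dots> = fourier_coeff v k * of_real (2 * pi)"
    using assms by (simp add: if_distrib cong: if_cong)
  finally show ?thesis
    by (simp add: fourier_coeff_def)
qed

lemma trig_proj_orthogonal:
  assumes v: "set_integrable lborel {0..2*pi} v" and "q \<in> trig_polys K"
  shows "(LINT x:{0..2*pi}|lborel. (v x - trig_proj K v x) * q x) = 0"
proof -
  obtain c :: "int \<Rightarrow> complex"
    where c: "\<And>x. of_real (q x) = (\<Sum>j\<in>{- int K..int K}. c j * cis (of_int j * x))"
    using assms by (auto simp: trig_polys_def)
  define w where "w = (\<lambda>x. v x - trig_proj K v x)"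
  have int_cis: "set_integrable lborel {0..2*pi} (\<lambda>x. of_real (f x) * cis (of_int j * x))"
    if f: "set_integrable lborel {0..2*pi} f" for f j
    unfolding set_integrable_def
  proof (rule Bochner_Integration.integrable_bound)
    show "integrable lborel (\<lambda>x. indicator {0..2*pi} x *\<^sub>R f x)"
      using f by (simp add: set_integrable_def)
    have [measurable]: "(\<lambda>x. indicator {0..2*pi} x *\<^sub>R f x) \<in> borel_measurable borel"
      using borel_measurable_integrable[OF f[unfolded set_integrable_def]] by simp
    have [measurable]: "(\<lambda>x. cis (of_int j * x)) \<in> borel_measurable borel"
      by (auto simp: cis_conv_exp intro!: borel_measurable_continuous_onI continuous_intros)
    have "(\<lambda>x. complex_of_real (indicator {0..2*pi} x *\<^sub>R f x) * cis (of_int j * x)) \<in> borel_measurable lborel"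
      by measurable
    then show "(\<lambda>x. indicator {0..2*pi} x *\<^sub>R (complex_of_real (f x) * cis (of_int j * x))) \<in> borel_measurable lborel"
      by (simp add: scaleR_conv_of_real mult.assoc)
  qed (auto simp: norm_mult)
  have p: "set_integrable lborel {0..2*pi} (trig_proj K v)"
    unfolding set_integrable_def
    by (rule borel_integrable_compact) (auto intro: trig_polys_continuous[OF trig_proj_in])
  have w: "set_integrable lborel {0..2*pi} w"
    unfolding w_def using v p by (rule set_integral_diff)
  have zero: "(LINT x:{0..2*pi}|lborel. of_real (w x) * cis (of_int j * x)) = 0"
    if "j \<in> {- int K..int K}" for j
  proof -
    have "(LINT x:{0..2*pi}|lborel. of_real (w x) * cis (of_int j * x))
        = (LINT x:{0..2*pi}|lborel. of_real (v x) * cis (of_int j * x))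
        - (LINT x:{0..2*pi}|lborel. of_real (trig_proj K v x) * cis (of_int j * x))"
      unfolding w_def of_real_diff left_diff_distrib
      by (rule set_integral_diff(2)[OF int_cis[OF v] int_cis[OF p]])
    then show ?thesis
      using that by (simp add: fourier_coeff_mult_cis fourier_coeff_trig_proj)
  qed
  have "complex_of_real (LINT x:{0..2*pi}|lborel. w x * q x)
      = (LINT x:{0..2*pi}|lborel. of_real (w x * q x))"
    by (rule set_integral_complex_of_real[symmetric])
  also have "\<dots> = (LINT x:{0..2*pi}|lborel.
      (\<Sum>j\<in>{- int K..int K}. c j * (of_real (w x) * cis (of_int j * x))))"
    by (simp add: c sum_distrib_left mult_ac)
  also have "\<dots> = (\<Sum>j\<in>{- int K..int K}.
      LINT x:{0..2*pi}|lborel. c j * (of_real (w x) * cis (of_int j * x)))"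
    unfolding set_lebesgue_integral_def scaleR_sum_right
    by (rule Bochner_Integration.integral_sum)
       (use set_integrable_mult_right[OF int_cis[OF w]] in \<open>simp add: set_integrable_def\<close>)
  also have "\<dots> = 0"
    by (simp only: set_integral_mult_right) (simp add: zero)
  finally show ?thesis
    by (simp add: w_def)
qed

lemma sum_cis_roots:
  fixes d :: int
  assumes "\<bar>d\<bar> < int N" "N > 0"
  shows "(\<Sum>k<N. cis (of_int d * (2 * pi * real k / real N))) = (if d = 0 then of_nat N else 0)"
proof (cases "d = 0")
  case False
  define w where "w = cis (of_int d * (2 * pi / real N))"
  have wN: "w ^ N = 1"
    using assms(2) cis_multiple_2pi[of "of_int d"]
    unfolding w_def Complex.DeMoivre by (simp add: mult_ac)
  have "w \<noteq> 1"
  proof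
    assume "w = 1"
    then have "cos (of_int d * (2 * pi / real N)) = 1"
      by (simp add: w_def complex_eq_iff)
    then obtain m :: int where "of_int d * (2 * pi / real N) = of_int m * 2 * pi"
      by (auto simp: cos_one_2pi_int)
    then have "of_int d = (of_int (m * int N) :: real)"
      using assms(2) by (simp add: field_simps)
    then have "d = m * int N"
      by (simp only: of_int_eq_iff)
    then show False
      using assms False by (auto simp: abs_mult)
  qed
  have "(\<Sum>k<N. cis (of_int d * (2 * pi * real k / real N))) = (\<Sum>k<N. w ^ k)"
    by (intro sum.cong) (simp_all add: w_def Complex.DeMoivre mult_ac)
  also have "\<dots> = 0"
    using \<open>w \<noteq> 1\<close> wN by (simp add: geometric_sum)
  finally show ?thesis using False by simp
qed simp

lemma trig_interp_node:
  assumes "m < 2 * K + 1"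
  shows "trig_interp K v (trig_node K m) = v (trig_node K m)"
proof -
  let ?N = "2 * K + 1"
  let ?J = "{- int K..int K}"
  have kernel: "(\<Sum>j\<in>?J. cis (of_int j * trig_node K m) * cis (- (of_int j * trig_node K k)))
      = (if k = m then of_nat ?N else 0)" if "k < ?N" for k
  proof -
    define \<theta> where "\<theta> = trig_node K m - trig_node K k"
    have "(\<Sum>j\<in>?J. cis (of_int j * trig_node K m) * cis (- (of_int j * trig_node K k)))
        = (\<Sum>j\<in>?J. cis (of_int j * \<theta>))"
      by (simp add: cis_mult \<theta>_def algebra_simps)
    also have "\<dots> = (\<Sum>l<?N. cis (of_int (int l - int K) * \<theta>))"
      by (rule sum.reindex_bij_witness[of _ "\<lambda>l. int l - int K" "\<lambda>j. nat (j + int K)"]) auto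
    also have "\<dots> = cis (- (real K * \<theta>)) * (\<Sum>l<?N. cis (real l * \<theta>))"
      by (simp add: sum_distrib_left cis_mult algebra_simps)
    also have "(\<Sum>l<?N. cis (real l * \<theta>))
        = (\<Sum>l<?N. cis (of_int (int m - int k) * (2 * pi * real l / real ?N)))"
      by (intro sum.cong arg_cong[where f = cis] refl)
         (simp add: \<theta>_def trig_node_def left_diff_distrib right_diff_distrib diff_divide_distrib mult_ac
           del: of_nat_Suc of_nat_add)
    also have "\<dots> = (if int m - int k = 0 then of_nat ?N else 0)"
      by (rule sum_cis_roots) (use assms that in auto)
    finally show ?thesis by (auto simp: \<theta>_def)
  qed
  have "of_nat ?N * complex_of_real (trig_interp K v (trig_node K m))
      = (\<Sum>j\<in>?J. (\<Sum>k<?N. of_real (v (trig_node K k)) * cis (- (of_int j * trig_node K k)))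
          * cis (of_int j * trig_node K m))"
    by (simp add: trig_interp_complex discrete_coeff_def sum_distrib_left del: of_nat_Suc of_nat_add)
  also have "\<dots> = (\<Sum>k<?N. of_real (v (trig_node K k)) *
      (\<Sum>j\<in>?J. cis (of_int j * trig_node K m) * cis (- (of_int j * trig_node K k))))"
    unfolding sum_distrib_left sum_distrib_right
    by (subst sum.swap) (simp add: mult_ac)
  also have "\<dots> = (\<Sum>k<?N. of_real (v (trig_node K k)) * (if k = m then of_nat ?N else 0))"
    by (intro sum.cong) (simp_all add: kernel)
  also have "\<dots> = of_nat ?N * of_real (v (trig_node K m))"
    using assms by (simp add: if_distrib cong: if_cong)
  finally show ?thesis
    by (metis mult_cancel_left of_nat_eq_0_iff of_real_eq_iff add_is_0 one_neq_zero)
qed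

lemma trig_interp_ident:
  assumes "v \<in> trig_polys K"
  shows "trig_interp K v = v"
proof -
  let ?N = "2 * K + 1"
  let ?J = "{- int K..int K}"
  obtain c :: "int \<Rightarrow> complex" where c: "\<And>x. of_real (v x) = (\<Sum>l\<in>?J. c l * cis (of_int l * x))"
    using assms by (auto simp: trig_polys_def)
  have "discrete_coeff K v j = c j" if j: "j \<in> ?J" for j
  proof -
    have "of_nat ?N * discrete_coeff K v j
        = (\<Sum>k<?N. \<Sum>l\<in>?J. c l * cis (of_int (l - j) * (2 * pi * real k / real ?N)))"
    proof -
      have "cis (of_int l * trig_node K k) * cis (- (of_int j * trig_node K k))
          = cis (of_int (l - j) * (2 * pi * real k / real ?N))" for l k
        by (simp add: cis_mult trig_node_def left_diff_distrib diff_divide_distrib)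
      moreover have "of_nat ?N * discrete_coeff K v j
          = (\<Sum>k<?N. of_real (v (trig_node K k)) * cis (- (of_int j * trig_node K k)))"
        by (simp add: discrete_coeff_def del: sum.lessThan_Suc of_nat_Suc of_nat_add)
      ultimately show ?thesis
        by (simp only: c sum_distrib_right mult.assoc)
    qed
    also have "\<dots> = (\<Sum>l\<in>?J. c l * (\<Sum>k<?N. cis (of_int (l - j) * (2 * pi * real k / real ?N))))"
      unfolding sum_distrib_left by (rule sum.swap)
    also have "\<dots> = (\<Sum>l\<in>?J. c l * (if l - j = 0 then of_nat ?N else 0))"
      by (intro sum.cong refl arg_cong2[where f = "(*)"] sum_cis_roots) (use j in auto)
    also have "\<dots> = of_nat ?N * c j"
      using j by (simp add: if_distrib cong: if_cong)
    finally show ?thesis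
      by (metis mult_cancel_left of_nat_eq_0_iff add_is_0 one_neq_zero)
  qed
  then have "complex_of_real (trig_interp K v x) = of_real (v x)" for x
    by (simp add: trig_interp_complex c)
  then show ?thesis
    by (auto simp only: of_real_eq_iff)
qed

lemma trig_interp_unique:
  assumes "p \<in> trig_polys K" "\<And>k. k < 2 * K + 1 \<Longrightarrow> p (trig_node K k) = v (trig_node K k)"
  shows "p = trig_interp K v"
proof -
  have "discrete_coeff K p = discrete_coeff K v"
    by (simp add: fun_eq_iff discrete_coeff_def assms(2))
  then have "trig_interp K p = trig_interp K v"
    by (simp add: fun_eq_iff trig_interp_def)
  then show ?thesis
    using trig_interp_ident[OF assms(1)] by simp
qed

section \<open>The equation and the trigonometric integrator\<close>

text \<open>\<open>u\<close> and \<open>ut\<close> map the time \<open>t\<close> to the functions \<open>u(\<cdot>,t)\<close> and \<open>\<partial>\<^sub>tu(\<cdot>,t)\<close>. For the regularity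
  \<open>H\<^sup>5 \<times> H\<^sup>4\<close> and higher these are, by Sobolev embedding, of class \<open>C\<^sup>4\<close> and \<open>C\<^sup>3\<close> in \<open>x\<close> (for
  the continuous representatives), so that the equation holds in the classical sense.\<close>

definition qwave_solution ::
  "(real \<Rightarrow> real) \<Rightarrow> (real \<times> real \<Rightarrow> real) \<Rightarrow> real \<Rightarrow> real \<Rightarrow> (real \<Rightarrow> real) \<Rightarrow> (real \<Rightarrow> real)
    \<Rightarrow> (real \<Rightarrow> real \<Rightarrow> real) \<Rightarrow> (real \<Rightarrow> real \<Rightarrow> real) \<Rightarrow> bool" where
  "qwave_solution a g \<kappa> T u0 v0 u ut \<longleftrightarrow>
     u 0 = u0 \<and> ut 0 = v0 \<and>
     (\<forall>t\<in>{0..T}.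
        torus_fun (u t) \<and> torus_fun (ut t) \<and> C_diff 2 (u t) \<and> continuous_on UNIV (ut t) \<and>
        (\<forall>x. ((\<lambda>\<tau>. u \<tau> x) has_real_derivative ut t x) (at t within {0..T}) \<and>
             ((\<lambda>\<tau>. ut \<tau> x) has_real_derivative
                deriv (deriv (u t)) x - u t x + \<kappa> * a (u t x) * deriv (deriv (u t)) x
                  + \<kappa> * g (u t x, deriv (u t) x)) (at t within {0..T})))"

text \<open>The bound on \<open>\<xi> sinc(\<xi>)\<^sup>-\<^sup>1 b\<^sub>1(\<xi>\<^sup>2)\<close> is written without division: at the zeros of
  \<open>sinc\<close> it requires that \<open>b\<^sub>1(\<xi>\<^sup>2)\<close> vanishes.\<close>

definition coeff_assumption :: "real \<Rightarrow> (real \<Rightarrow> real) \<Rightarrow> (real \<Rightarrow> real) \<Rightarrow> bool" where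
  "coeff_assumption c b1 bb1 \<longleftrightarrow>
     (\<forall>\<xi>\<ge>0. sinc \<xi> * b1 (\<xi>\<^sup>2) = (1 + cos \<xi>) * bb1 (\<xi>\<^sup>2) \<and>
        \<bar>\<xi> * bb1 (\<xi>\<^sup>2)\<bar> \<le> c \<and>
        \<bar>\<xi>\<^sup>2 * bb1 (\<xi>\<^sup>2)\<bar> \<le> c \<and>
        \<bar>bb1 (\<xi>\<^sup>2) - 1/2 * sinc (\<xi>/2)\<bar> \<le> c * \<xi> \<and>
        \<bar>\<xi> * b1 (\<xi>\<^sup>2)\<bar> \<le> c \<and>
        \<bar>b1 (\<xi>\<^sup>2) - cos (\<xi>/2)\<bar> \<le> c * \<xi>\<^sup>2 \<and>
        \<bar>\<xi> * b1 (\<xi>\<^sup>2)\<bar> \<le> c * \<bar>sinc \<xi>\<bar>)"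

definition f_disc ::
  "(real \<Rightarrow> real) \<Rightarrow> (real \<times> real \<Rightarrow> real) \<Rightarrow> nat \<Rightarrow> (real \<Rightarrow> real) \<Rightarrow> real \<Rightarrow> real" where
  "f_disc a g K u x =
     trig_interp K (\<lambda>y. a (u y)) x * deriv (deriv u) x
       + trig_interp K (\<lambda>y. g (u y, deriv u y)) x"

definition f_hat ::
  "(real \<Rightarrow> real) \<Rightarrow> (real \<times> real \<Rightarrow> real) \<Rightarrow> nat \<Rightarrow> (real \<Rightarrow> real) \<Rightarrow> real \<Rightarrow> real" where
  "f_hat a g K u = trig_proj K (f_disc a g K u)"

definition midpoint_value :: "real \<Rightarrow> (real \<Rightarrow> real) \<times> (real \<Rightarrow> real) \<Rightarrow> real \<Rightarrow> real" where
  "midpoint_value h w x =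
     omega_mult (\<lambda>\<omega>. cos (h * \<omega> / 2)) (fst w) x
       + h / 2 * omega_mult (\<lambda>\<omega>. sinc (h * \<omega> / 2)) (snd w) x"

definition trig_step ::
  "(real \<Rightarrow> real) \<Rightarrow> (real \<times> real \<Rightarrow> real) \<Rightarrow> (real \<Rightarrow> real) \<Rightarrow> (real \<Rightarrow> real) \<Rightarrow> real \<Rightarrow> real \<Rightarrow> nat
    \<Rightarrow> (real \<Rightarrow> real) \<times> (real \<Rightarrow> real) \<Rightarrow> (real \<Rightarrow> real) \<times> (real \<Rightarrow> real)" where
  "trig_step a g b1 bb1 \<kappa> h K w =
     (let F = f_hat a g K (midpoint_value h w) in
      (\<lambda>x. omega_mult (\<lambda>\<omega>. cos (h * \<omega>)) (fst w) x
             + h * omega_mult (\<lambda>\<omega>. sinc (h * \<omega>)) (snd w) x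
             + \<kappa> * h\<^sup>2 * omega_mult (\<lambda>\<omega>. bb1 (h\<^sup>2 * \<omega>\<^sup>2)) F x,
       \<lambda>x. - omega_mult (\<lambda>\<omega>. \<omega> * sin (h * \<omega>)) (fst w) x
             + omega_mult (\<lambda>\<omega>. cos (h * \<omega>)) (snd w) x
             + \<kappa> * h * omega_mult (\<lambda>\<omega>. b1 (h\<^sup>2 * \<omega>\<^sup>2)) F x))"

primrec trig_integrator ::
  "(real \<Rightarrow> real) \<Rightarrow> (real \<times> real \<Rightarrow> real) \<Rightarrow> (real \<Rightarrow> real) \<Rightarrow> (real \<Rightarrow> real) \<Rightarrow> real \<Rightarrow> real \<Rightarrow> nat
    \<Rightarrow> (real \<Rightarrow> real) \<Rightarrow> (real \<Rightarrow> real) \<Rightarrow> nat \<Rightarrow> (real \<Rightarrow> real) \<times> (real \<Rightarrow> real)" where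
  "trig_integrator a g b1 bb1 \<kappa> h K u0 v0 0 = (trig_proj K u0, trig_proj K v0)"
| "trig_integrator a g b1 bb1 \<kappa> h K u0 v0 (Suc n) =
     trig_step a g b1 bb1 \<kappa> h K (trig_integrator a g b1 bb1 \<kappa> h K u0 v0 n)"

end

theory Submission
  imports Defs
begin

text \<open>
  The threshold for \<open>\<kappa>\<close> may depend on \<open>T\<close> and on the constant \<open>L\<close> in \<open>\<kappa> \<le> L h\<close>. This makes a direct stability
  argument sufficient. Compare the numerical solution with the projection of the exact solution onto
  trigonometric polynomials. Their difference \<open>E\<^sub>n\<close>, measured in the energy norm, vanishes for \<open>n = 0\<close>. The
  linear flow preserves the energy norm, and the bounds on \<open>\<xi>\<^sup>2 bb1 (\<xi>\<^sup>2)\<close> and \<open>\<xi> b1 (\<xi>\<^sup>2)\<close> gain the two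
  derivatives, respectively the one derivative, that the quasilinear term loses, at the price of the factor \<open>h\<close>
  that turns \<open>\<kappa> h\<close> into \<open>\<kappa>\<close>. Hence
  \<open>E\<^sub>n\<^sub>+\<^sub>1 \<le> (1 + O(\<kappa>)) E\<^sub>n + \<kappa> h O(h powr (4/3) + \<kappa> h + K powr (- s - 2))\<close>.
  Since \<open>n h \<le> T\<close> and \<open>\<kappa> \<le> L h\<close>, summation gives
  \<open>E\<^sub>n \<le> exp(O(L T)) \<kappa> T O(h powr (4/3) + \<kappa> h + K powr (- s - 2))\<close>. The prefactor \<open>\<kappa> T\<close> absorbs the exponential:
  small \<open>\<kappa>\<close> handles the spatial part, and \<open>\<kappa> h powr (4/3) \<le> L h powr (7/3)\<close> leaves a factor \<open>h powr (1/3)\<close>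
  to spare over \<open>h\<^sup>2\<close>. So it is enough to know the local quadrature error up to \<open>h powr (4/3)\<close>, which follows by
  interpolation from \<open>L\<^sup>2\<close> bounds of time increments and an \<open>H\<^sup>3\<close> bound.
\<close>

section \<open>Fourier coefficients and Bessel's inequality\<close>

text \<open>The rate h powr (4/3) is what remains when no composition is ever differentiated in
  time. Differences of \<open>nonlin\<close> at nearby times are estimated pointwise from
  differences of the jet (u, u_x, u_xx), and Bessel's inequality turns sup bounds into L^2 bounds:
  O(h) for first and O(h^2) for symmetric second differences. The defect, however, carries the
  weight of H^1. With h = \<eta>^3 and an H^3 bound, interpolation gives \<eta> for first
  differences in H^2 and \<eta>^4 for second differences in H^1; this \<eta>^4 is the power of h
  above. In space two scales of norms alternate. Weighted l^1 norms of coefficients form algebras,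
  give sup bounds and are stable under aliasing; weighted l^2 norms carry the energy and are reached
  from sup bounds. Passing from l^2 to l^1 costs one derivative, which H^5 can afford. Nonlinear
  estimates are proved for trigonometric polynomials with constants independent of the degree, so
  that products are finite convolutions; the exact solution enters through its truncations.\<close>

definition cfc :: "(real \<Rightarrow> complex) \<Rightarrow> int \<Rightarrow> complex" where
  "cfc \<phi> j = (LINT x:{0..2*pi}|lborel. \<phi> x * cis (- (of_int j * x))) / of_real (2 * pi)"

text \<open>Complex-valued functions are unavoidable: Bessel's inequality integrates against
  conjugated partial sums, and the proof of pointwise convergence divides by
  \<open>cis (x - x0) - 1\<close>.\<close>

lemma fourier_coeff_cfc: "fourier_coeff v = cfc (\<lambda>x. of_real (v x))"
  by (simp add: fun_eq_iff fourier_coeff_def cfc_def)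

lemma measurable_cis [measurable]: "cis \<in> borel_measurable borel"
  by (auto simp: cis_conv_exp intro!: borel_measurable_continuous_onI continuous_intros)

lemma set_integrable_bounded:
  fixes \<phi> :: "real \<Rightarrow> 'b::euclidean_space"
  assumes [measurable]: "\<phi> \<in> borel_measurable borel" and "\<And>x. norm (\<phi> x) \<le> B"
  shows "set_integrable lborel {0..2*pi} \<phi>"
  unfolding set_integrable_def
proof (rule Bochner_Integration.integrable_bound)
  show "integrable lborel (\<lambda>x. indicator {0..2*pi} x *\<^sub>R B)"
    using set_integrable_def[of lborel "{0..2*pi}" "\<lambda>_. B"] by (auto intro!: borel_integrable_compact)
  show "AE x in lborel. norm (indicator {0..2*pi} x *\<^sub>R \<phi> x) \<le> norm (indicator {0..2*pi} x *\<^sub>R B)"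
    using assms(2) by (auto simp: indicator_def intro!: AE_I2 order.trans[OF _ abs_ge_self])
qed simp

lemma cfc_add:
  assumes "\<phi> \<in> borel_measurable borel" "\<And>x. cmod (\<phi> x) \<le> B"
    and "\<psi> \<in> borel_measurable borel" "\<And>x. cmod (\<psi> x) \<le> B'"
  shows "cfc (\<lambda>x. \<phi> x + \<psi> x) j = cfc \<phi> j + cfc \<psi> j"
proof -
  have "set_integrable lborel {0..2*pi} (\<lambda>x. \<phi> x * cis (- (of_int j * x)))"
    by (rule set_integrable_bounded[where B = B]) (use assms in \<open>auto simp: norm_mult\<close>)
  moreover have "set_integrable lborel {0..2*pi} (\<lambda>x. \<psi> x * cis (- (of_int j * x)))"
    by (rule set_integrable_bounded[where B = B']) (use assms in \<open>auto simp: norm_mult\<close>)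
  ultimately show ?thesis
    by (simp add: cfc_def distrib_right set_integral_add(2) add_divide_distrib)
qed

lemma cfc_mult_left: "cfc (\<lambda>x. z * \<phi> x) j = z * cfc \<phi> j"
  by (simp add: cfc_def mult.assoc del: set_integral_mult_right)
     (simp add: set_integral_mult_right)

lemma cfc_shift: "cfc (\<lambda>x. \<phi> x * cis (of_int l * x)) j = cfc \<phi> (j - l)"
proof -
  have "\<phi> x * cis (of_int l * x) * cis (- (of_int j * x)) = \<phi> x * cis (- (of_int (j - l) * x))" for x
    by (simp add: mult.assoc cis_mult algebra_simps)
  then show ?thesis
    by (simp only: cfc_def)
qed

lemma cfc_one: "cfc (\<lambda>x. 1) j = (if j = 0 then 1 else 0)"
  using integral_cis[of "- j"] by (simp add: cfc_def)

text \<open>The frequencies \<open>m l\<close> are arbitrary because the conjugate of a partial sum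
  has the frequencies \<open>- l\<close>.\<close>

lemma cfc_mult_sum:
  assumes [measurable]: "\<phi> \<in> borel_measurable borel" and B: "\<And>x. cmod (\<phi> x) \<le> B" and "finite J"
  shows "cfc (\<lambda>x. \<phi> x * (\<Sum>l\<in>J. c l * cis (of_int (m l) * x))) j = (\<Sum>l\<in>J. c l * cfc \<phi> (j - m l))"
  using \<open>finite J\<close>
proof (induction J rule: finite_induct)
  case empty
  then show ?case by (simp add: cfc_def)
next
  case (insert i J)
  have B0: "0 \<le> B"
    using B[of 0] norm_ge_zero order.trans by blast
  have "cfc (\<lambda>x. \<phi> x * (\<Sum>l\<in>insert i J. c l * cis (of_int (m l) * x))) j
      = cfc (\<lambda>x. c i * (\<phi> x * cis (of_int (m i) * x)) + \<phi> x * (\<Sum>l\<in>J. c l * cis (of_int (m l) * x))) j"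
    using insert.hyps by (simp add: distrib_left mult_ac)
  also have "\<dots> = cfc (\<lambda>x. c i * (\<phi> x * cis (of_int (m i) * x))) j
      + cfc (\<lambda>x. \<phi> x * (\<Sum>l\<in>J. c l * cis (of_int (m l) * x))) j"
  proof (rule cfc_add[where B = "cmod (c i) * B" and B' = "B * (\<Sum>l\<in>J. cmod (c l))"])
    show "cmod (\<phi> x * (\<Sum>l\<in>J. c l * cis (of_int (m l) * x))) \<le> B * (\<Sum>l\<in>J. cmod (c l))" for x
      unfolding norm_mult by (intro mult_mono B sum_norm_le B0) (auto simp: norm_mult)
  qed (use B in \<open>auto simp: norm_mult intro: mult_left_mono\<close>)
  finally show ?case
    using insert by (simp add: cfc_mult_left cfc_shift)
qed

lemma cfc_trig_sum:
  assumes "finite J"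
  shows "cfc (\<lambda>x. \<Sum>l\<in>J. c l * cis (of_int l * x)) j = (if j \<in> J then c j else 0)"
proof -
  have "cfc (\<lambda>x. 1 * (\<Sum>l\<in>J. c l * cis (of_int l * x))) j = (\<Sum>l\<in>J. c l * cfc (\<lambda>_. 1) (j - l))"
    by (rule cfc_mult_sum[where B = 1 and m = "\<lambda>l. l"]) (use assms in auto)
  also have "\<dots> = (\<Sum>l\<in>J. if l = j then c j else 0)"
    by (intro sum.cong) (auto simp: cfc_one)
  finally show ?thesis
    using assms by simp
qed

lemma mult_cnj_cmod: "z * cnj z = of_real ((cmod z)\<^sup>2)" "cnj z * z = of_real ((cmod z)\<^sup>2)"
  using complex_norm_square[of z] by (simp_all add: mult.commute)

text \<open>Integrate 0 \<le> |\<phi> - p|^2 for the partial sum \<open>p\<close>: the cross term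
  and |p|^2 have the same mean \<open>S\<close>, so \<open>S\<close> is at most the mean of
  |\<phi>|^2. Only bounded functions occur later, hence the sup bound in place of the L^2
  norm.\<close>

lemma bessel_inequality:
  assumes [measurable]: "\<phi> \<in> borel_measurable borel" and B: "\<And>x. cmod (\<phi> x) \<le> B" and "finite J"
  shows "(\<Sum>j\<in>J. (cmod (cfc \<phi> j))\<^sup>2) \<le> B\<^sup>2"
proof -
  define p where "p x = (\<Sum>l\<in>J. cfc \<phi> l * cis (of_int l * x))" for x
  define S where "S = (\<Sum>j\<in>J. (cmod (cfc \<phi> j))\<^sup>2)"
  have cnj_p: "cnj (p x) = (\<Sum>l\<in>J. cnj (cfc \<phi> l) * cis (of_int (- l) * x))" for x
    by (simp add: p_def cis_cnj)
  have [measurable]: "p \<in> borel_measurable borel"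
    unfolding p_def by measurable
  have [measurable]: "(\<lambda>x. cnj (p x)) \<in> borel_measurable borel"
    unfolding cnj_p by measurable
  have p_le: "cmod (p x) \<le> (\<Sum>l\<in>J. cmod (cfc \<phi> l))" for x
    unfolding p_def by (rule sum_norm_le) (simp add: norm_mult)
  have B0: "0 \<le> B"
    using B[of 0] norm_ge_zero order.trans by blast
  have S1: "cfc (\<lambda>x. \<phi> x * cnj (p x)) 0 = of_real S"
    unfolding cnj_p by (subst cfc_mult_sum[where B = B])
      (use assms in \<open>auto simp: S_def mult_cnj_cmod mult.commute\<close>)
  have "cfc p = (\<lambda>l. if l \<in> J then cfc \<phi> l else 0)"
    unfolding p_def using \<open>finite J\<close> by (simp add: cfc_trig_sum fun_eq_iff)
  then have S2: "cfc (\<lambda>x. p x * cnj (p x)) 0 = of_real S"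
    unfolding cnj_p by (subst cfc_mult_sum[where B = "\<Sum>l\<in>J. cmod (cfc \<phi> l)"])
      (use assms p_le in \<open>auto simp: S_def mult_cnj_cmod intro!: sum.cong\<close>)
  have le: "(LINT x:{0..2*pi}|lborel. 2 * Re (\<phi> x * cnj (p x)))
      \<le> (LINT x:{0..2*pi}|lborel. B\<^sup>2 + Re (p x * cnj (p x)))"
  proof (rule set_integral_mono)
    show "set_integrable lborel {0..2*pi} (\<lambda>x. 2 * Re (\<phi> x * cnj (p x)))"
    proof (rule set_integrable_bounded[where B = "2 * (B * (\<Sum>l\<in>J. cmod (cfc \<phi> l)))"])
      fix x
      have "\<bar>Re (\<phi> x * cnj (p x))\<bar> \<le> cmod (\<phi> x) * cmod (p x)"
        using abs_Re_le_cmod[of "\<phi> x * cnj (p x)"] by (simp add: norm_mult)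
      also have "\<dots> \<le> B * (\<Sum>l\<in>J. cmod (cfc \<phi> l))"
        by (intro mult_mono B p_le B0) auto
      finally show "norm (2 * Re (\<phi> x * cnj (p x))) \<le> 2 * (B * (\<Sum>l\<in>J. cmod (cfc \<phi> l)))"
        by (simp add: abs_mult)
    qed measurable
    show "set_integrable lborel {0..2*pi} (\<lambda>x. B\<^sup>2 + Re (p x * cnj (p x)))"
    proof (rule set_integrable_bounded[where B = "B\<^sup>2 + (\<Sum>l\<in>J. cmod (cfc \<phi> l))\<^sup>2"])
      fix x
      have "(cmod (p x))\<^sup>2 \<le> (\<Sum>l\<in>J. cmod (cfc \<phi> l))\<^sup>2"
        by (intro power_mono p_le) auto
      then show "norm (B\<^sup>2 + Re (p x * cnj (p x))) \<le> B\<^sup>2 + (\<Sum>l\<in>J. cmod (cfc \<phi> l))\<^sup>2"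
        by (simp add: complex_norm_square[symmetric] flip: of_real_power)
    qed measurable
    fix x :: real
    have "0 \<le> Re ((\<phi> x - p x) * cnj (\<phi> x - p x))"
      by (simp only: mult_cnj_cmod Re_complex_of_real zero_le_power2)
    also have "\<dots> = Re (\<phi> x * cnj (\<phi> x)) - 2 * Re (\<phi> x * cnj (p x)) + Re (p x * cnj (p x))"
      by (simp add: algebra_simps)
    also have "Re (\<phi> x * cnj (\<phi> x)) = (cmod (\<phi> x))\<^sup>2"
      by (simp add: complex_norm_square[symmetric] flip: of_real_power)
    finally show "2 * Re (\<phi> x * cnj (p x)) \<le> B\<^sup>2 + Re (p x * cnj (p x))"
      using power_mono[OF B[of x], of 2] by simp
  qed
  have Re_int: "(LINT x:{0..2*pi}|lborel. Re (\<psi> x)) = 2 * pi * Re (cfc \<psi> 0)"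
    if [measurable]: "\<psi> \<in> borel_measurable borel" and "\<And>x. cmod (\<psi> x) \<le> D" for \<psi> D
  proof -
    have "set_integrable lborel {0..2*pi} \<psi>"
      using that by (rule set_integrable_bounded)
    then have "Re (LINT x:{0..2*pi}|lborel. \<psi> x) = (LINT x:{0..2*pi}|lborel. Re (\<psi> x))"
      unfolding set_integrable_def set_lebesgue_integral_def
      by (subst integral_Re[symmetric]) (simp_all add: mult.commute)
    then show ?thesis
      by (simp add: cfc_def)
  qed
  have i1: "(LINT x:{0..2*pi}|lborel. 2 * Re (\<phi> x * cnj (p x))) = 2 * (2 * pi * S)"
    unfolding set_integral_mult_right
    by (subst Re_int[where D = "B * (\<Sum>l\<in>J. cmod (cfc \<phi> l))"])
       (use S1 p_le B B0 in \<open>auto simp: norm_mult intro!: mult_mono\<close>)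
  have i2: "(LINT x:{0..2*pi}|lborel. Re (p x * cnj (p x))) = 2 * pi * S"
    by (subst Re_int[where D = "(\<Sum>l\<in>J. cmod (cfc \<phi> l)) * (\<Sum>l\<in>J. cmod (cfc \<phi> l))"])
       (use S2 p_le in \<open>auto simp: norm_mult intro!: mult_mono sum_nonneg\<close>)
  have "set_integrable lborel {0..2*pi} (\<lambda>x. Re (p x * cnj (p x)))"
    by (rule set_integrable_bounded[where B = "(\<Sum>l\<in>J. cmod (cfc \<phi> l)) * (\<Sum>l\<in>J. cmod (cfc \<phi> l))"])
       (auto simp: norm_mult intro!: order.trans[OF abs_Re_le_cmod] mult_mono sum_nonneg p_le
         simp del: times_complex.sel complex_mult_cnj)
  then have i3: "(LINT x:{0..2*pi}|lborel. B\<^sup>2 + Re (p x * cnj (p x))) = 2 * pi * B\<^sup>2 + 2 * pi * S"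
    using i2 by (subst set_integral_add(2)) (auto simp: set_lebesgue_integral_def intro!: set_integrable_bounded)
  have "2 * pi * S \<le> 2 * pi * B\<^sup>2"
    using le unfolding i1 i3 by simp
  then show ?thesis
    by (simp add: S_def)
qed

section \<open>Pointwise convergence of Fourier series\<close>

lemma torus_fun_shift:
  assumes "torus_fun v"
  shows "v (x + 2 * pi * of_int k) = v x"
proof -
  have nat: "v (x + 2 * pi * real n) = v x" for x n
  proof (induction n)
    case (Suc n)
    have "v (x + 2 * pi * real (Suc n)) = v ((x + 2 * pi * real n) + 2 * pi)"
      by (simp add: algebra_simps)
    then show ?case
      using assms Suc by (simp add: torus_fun_def)
  qed simp
  show ?thesis
  proof (cases "0 \<le> k")
    case True
    then show ?thesis using nat[of x "nat k"] by simp
  next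
    case False
    then show ?thesis using nat[of "x + 2 * pi * of_int k" "nat (- k)"] by simp
  qed
qed

lemma torus_fun_bounded:
  assumes "torus_fun v" and "continuous_on UNIV v"
  obtains B where "0 \<le> B" "\<And>x. \<bar>v x\<bar> \<le> B"
proof -
  have "compact (v ` {0..2*pi})"
    by (intro compact_continuous_image continuous_on_subset[OF assms(2)]) auto
  then obtain B where "\<forall>y\<in>v ` {0..2*pi}. norm y \<le> B"
    using compact_imp_bounded bounded_iff by metis
  then have B: "\<And>y. y \<in> {0..2*pi} \<Longrightarrow> \<bar>v y\<bar> \<le> B"
    by auto
  have "\<bar>v x\<bar> \<le> B" for x
  proof -
    define k where "k = \<lfloor>x / (2 * pi)\<rfloor>"
    have "of_int k \<le> x / (2 * pi)" "x / (2 * pi) < of_int k + 1"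
      by (auto simp: k_def)
    then have "x - 2 * pi * of_int k \<in> {0..2*pi}"
      by (auto simp: field_simps)
    from B[OF this] show ?thesis
      using torus_fun_shift[OF assms(1), of x "- k"] by simp
  qed
  then show ?thesis
    using that[of B] abs_ge_zero[of "v 0"] order.trans by blast
qed

lemma torus_fun_deriv:
  assumes "torus_fun V" and "\<And>x. (V has_real_derivative v x) (at x)"
  shows "torus_fun v"
  unfolding torus_fun_def
proof
  fix x
  have "((\<lambda>y. V (y + 2 * pi)) has_real_derivative v (x + 2 * pi)) (at x)"
    using assms(2)[of "x + 2 * pi"] DERIV_shift by blast
  moreover have "(\<lambda>y. V (y + 2 * pi)) = V"
    using assms(1) by (auto simp: torus_fun_def)
  ultimately show "v (x + 2 * pi) = v x"
    using assms(2)[of x] DERIV_unique by metis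
qed

lemma has_vector_derivative_cis:
  "((\<lambda>x. cis (of_int j * x)) has_vector_derivative \<i> * of_int j * cis (of_int j * x)) (at x within A)"
proof -
  have "((\<lambda>z. exp (\<i> * of_int j * z)) has_field_derivative \<i> * of_int j * exp (\<i> * of_int j * of_real x))
      (at (of_real x))"
    by (auto intro!: derivative_eq_intros)
  from has_vector_derivative_real_field[OF this, of A] show ?thesis
    by (simp add: cis_conv_exp mult_ac)
qed

lemma set_integrable_continuous:
  fixes f :: "real \<Rightarrow> 'a::euclidean_space"
  assumes "continuous_on UNIV f"
  shows "set_integrable lborel {0..2*pi} f"
  unfolding set_integrable_def
  by (rule borel_integrable_compact) (auto intro: continuous_on_subset[OF assms])

text \<open>Integration by parts: \<open>?f\<close> is the derivative of \<open>?F\<close>, and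
  \<open>?F\<close> takes equal values at both ends of a period, so the integral of
  \<open>?f\<close> vanishes.\<close>

lemma fourier_coeff_deriv:
  assumes V: "torus_fun V" "\<And>x. (V has_real_derivative v x) (at x)" and v: "continuous_on UNIV v"
  shows "fourier_coeff v j = \<i> * of_int j * fourier_coeff V j"
proof -
  let ?F = "\<lambda>x. complex_of_real (V x) * cis (of_int (- j) * x)"
  let ?f1 = "\<lambda>x. complex_of_real (v x) * cis (of_int (- j) * x)"
  let ?f = "\<lambda>x. ?f1 x - \<i> * of_int j * ?F x"
  have contV: "continuous_on UNIV V"
    using V(2) by (intro continuous_at_imp_continuous_on) (auto intro: DERIV_isCont)
  have "(?f has_integral (?F (2 * pi) - ?F 0)) {0..2*pi}"
  proof (rule fundamental_theorem_of_calculus)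
    fix x :: real
    have "((\<lambda>x. complex_of_real (V x)) has_vector_derivative of_real (v x)) (at x)"
      using V(2)[of x] by (simp add: has_vector_derivative_of_real flip: has_real_derivative_iff_has_vector_derivative)
    from has_vector_derivative_mult[OF this has_vector_derivative_cis[of "- j" x UNIV]]
    have "(?F has_vector_derivative ?f x) (at x)"
      by (rule has_vector_derivative_eq_rhs) (simp add: algebra_simps)
    then show "(?F has_vector_derivative ?f x) (at x within {0..2*pi})"
      by (rule has_vector_derivative_at_within)
  qed simp
  moreover have "?F (2 * pi) = ?F 0"
  proof -
    have "V (2 * pi) = V 0"
      using V(1) unfolding torus_fun_def by (metis add_0)
    moreover have "cis (of_int (- j) * (2 * pi)) = 1"
      using cis_multiple_2pi[of "of_int (- j)"] by (simp add: mult_ac)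
    ultimately show ?thesis by simp
  qed
  ultimately have "integral {0..2*pi} ?f = 0"
    by (simp add: integral_unique)
  moreover have f1: "set_integrable lborel {0..2*pi} ?f1" and F: "set_integrable lborel {0..2*pi} ?F"
    by (intro set_integrable_continuous continuous_intros v contV; simp add: cis_conv_exp; intro continuous_intros v contV)+
  have F': "set_integrable lborel {0..2*pi} (\<lambda>x. \<i> * of_int j * ?F x)"
    using F by (rule set_integrable_mult_right)
  have "set_integrable lborel {0..2*pi} ?f"
    using f1 F' by (rule set_integral_diff)
  ultimately have "(LINT x:{0..2*pi}|lborel. ?f x) = 0"
    by (simp only: set_borel_integral_eq_integral)
  then have "(LINT x:{0..2*pi}|lborel. ?f1 x) = \<i> * of_int j * (LINT x:{0..2*pi}|lborel. ?F x)"
    unfolding set_integral_diff(2)[OF f1 F'] set_integral_mult_right by simp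
  then show ?thesis
    by (simp add: fourier_coeff_def)
qed

text \<open>From the cubic Taylor remainder, which is at most |z|/2 as long as |z| \<le> 1.6; this
  range covers pi/2. The constant is weaker than the sharp 2/pi.\<close>

lemma abs_sin_ge: "\<bar>z\<bar> \<le> pi / 2 \<Longrightarrow> \<bar>z\<bar> / 2 \<le> \<bar>sin z\<bar>" for z :: real
proof -
  assume z: "\<bar>z\<bar> \<le> pi / 2"
  have "(\<Sum>m<3. sin_coeff m * z ^ m) = z"
    by (simp add: sin_coeff_def numeral_3_eq_3)
  then have "\<bar>sin z - z\<bar> \<le> \<bar>z\<bar> ^ 3 / 6"
    using Maclaurin_sin_bound[of z 3] by (simp add: fact_numeral)
  also have "\<dots> = \<bar>z\<bar> * (z\<^sup>2 / 6)"
    by (simp add: power3_eq_cube power2_eq_square)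
  also have "\<dots> \<le> \<bar>z\<bar> * (1 / 2)"
  proof (rule mult_left_mono)
    have "\<bar>z\<bar> \<le> 1.6" using z pi_less_4 pi_approx by simp
    then have "\<bar>z\<bar>\<^sup>2 \<le> 1.6\<^sup>2" by (intro power_mono) auto
    then show "z\<^sup>2 / 6 \<le> 1 / 2" by (simp add: power2_eq_square)
  qed simp
  finally show ?thesis by linarith
qed

lemma cmod_cis_diff_one: "cmod (cis y - 1) = 2 * \<bar>sin (y / 2)\<bar>"
  using dist_exp_i_1[of y] by (simp add: cis_conv_exp)

lemma sum_telescope_int:
  fixes f :: "int \<Rightarrow> 'a::ab_group_add"
  shows "(\<Sum>j\<in>{- int N..int N}. f (j - 1) - f j) = f (- int N - 1) - f (int N)"
proof (induction N)
  case (Suc N)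
  have cancel: "(p - q) + ((r - t) + (q - r)) = p - t" for p q r t :: 'a
    by (simp add: algebra_simps)
  have e: "- int (Suc N) - 1 = - int N - 2" "int (Suc N) = int N + 1" "- 2 - int N = - int N - 2"
    by auto
  have "(\<Sum>j\<in>{- int (Suc N)..int (Suc N)}. f (j - 1) - f j)
      = (\<Sum>j\<in>insert (- int N - 1) (insert (int N + 1) {- int N..int N}). f (j - 1) - f j)"
    by (rule sum.cong) auto
  also have "\<dots> = (f (- int N - 2) - f (- int N - 1)) + ((f (int N) - f (int N + 1)) + (f (- int N - 1) - f (int N)))"
    by (simp add: Suc e(3))
  also have "\<dots> = f (- int N - 2) - f (int N + 1)"
    by (rule cancel)
  finally show ?case
    using e(1,2) by metis
qed simp

text \<open>Dividing \<open>v x - v x0\<close> by \<open>cis (x - x0) - 1\<close> gives a bounded function \<open>\<phi>\<close>. The partial sums at \<open>x0\<close>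
  telescope in the coefficients of \<open>\<phi>\<close>, which tend to 0 by Bessel's inequality.\<close>

lemma fourier_series_Lipschitz:
  assumes v: "torus_fun v" and lip: "\<And>x y. \<bar>v x - v y\<bar> \<le> B * \<bar>x - y\<bar>"
  shows "(\<lambda>N. \<Sum>j\<in>{- int N..int N}. fourier_coeff v j * cis (of_int j * x0)) \<longlonglongrightarrow> of_real (v x0)"
proof -
  have B: "0 \<le> B"
    using lip[of 1 0] by simp
  have cont: "continuous_on UNIV v"
  proof (rule continuous_on_iff[THEN iffD2], intro ballI allI impI)
    fix x e :: real assume "e > 0"
    then have "dist (v y) (v x) < e" if "dist y x < e / (B + 1)" for y
    proof -
      have "B * \<bar>y - x\<bar> \<le> (B + 1) * \<bar>y - x\<bar>" by (simp add: distrib_right)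
      also have "\<dots> < e" using that B by (simp add: dist_real_def field_simps)
      finally show ?thesis using lip[of y x] by (simp add: dist_real_def)
    qed
    then show "\<exists>d>0. \<forall>y\<in>UNIV. dist y x < d \<longrightarrow> dist (v y) (v x) < e"
      using \<open>e > 0\<close> B by (intro exI[of _ "e / (B + 1)"]) auto
  qed
  then have [measurable]: "v \<in> borel_measurable borel"
    by (rule borel_measurable_continuous_onI)
  obtain D where D: "\<And>x. \<bar>v x\<bar> \<le> D"
    using torus_fun_bounded[OF v cont] by metis
  define \<phi> where "\<phi> x = of_real (v x - v x0) / (cis (x - x0) - 1)" for x
  have [measurable]: "\<phi> \<in> borel_measurable borel"
    unfolding \<phi>_def by measurable
  \<comment> \<open>The denominator has period 2 pi, so \<open>x - x0\<close> is first reduced to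
    \<open>y\<close> with |y| \<le> pi; there the chord is at least |y|/2.\<close>
  have quot: "\<bar>v x - v x0\<bar> \<le> 2 * B * cmod (cis (x - x0) - 1)" for x
  proof -
    define k where "k = round ((x - x0) / (2 * pi))"
    define y where "y = x - x0 - 2 * pi * of_int k"
    have "\<bar>of_int k - (x - x0) / (2 * pi)\<bar> \<le> 1 / 2"
      unfolding k_def by (rule of_int_round_abs_le)
    moreover have "y = 2 * pi * ((x - x0) / (2 * pi) - of_int k)"
      by (simp add: y_def field_simps)
    ultimately have "\<bar>y\<bar> \<le> 2 * pi * (1 / 2)"
      by (simp add: abs_mult abs_minus_commute)
    then have "\<bar>y / 2\<bar> / 2 \<le> \<bar>sin (y / 2)\<bar>"
      by (intro abs_sin_ge) auto
    then have "\<bar>y\<bar> \<le> 2 * cmod (cis y - 1)"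
      by (simp add: cmod_cis_diff_one)
    moreover have "cis y = cis (x - x0)"
    proof -
      have "cis (x - x0) = cis y * cis (2 * pi * of_int k)"
        by (subst cis_mult) (simp add: y_def)
      then show ?thesis
        using cis_multiple_2pi[of "of_int k"] by (metis Ints_of_int mult_1_right)
    qed
    moreover have "v x = v (x0 + y)"
      using torus_fun_shift[OF v, of "x0 + y" k] by (simp add: y_def)
    ultimately show ?thesis
      using lip[of "x0 + y" x0] B by (metis (no_types, opaque_lifting) add_diff_cancel_left' mult.assoc mult.left_commute mult_left_mono order.trans)
  qed
  have \<phi>_le: "cmod (\<phi> x) \<le> 2 * B" for x
  proof (cases "cis (x - x0) = 1")
    case False
    then have "cmod (cis (x - x0) - 1) > 0"
      by simp
    moreover have "cmod (\<phi> x) = \<bar>v x - v x0\<bar> / cmod (cis (x - x0) - 1)"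
      unfolding \<phi>_def norm_divide norm_of_real ..
    ultimately show ?thesis
      using quot[of x] by (simp add: pos_divide_le_eq)
  qed (use B in \<open>simp add: \<phi>_def\<close>)
  \<comment> \<open>Where the denominator vanishes, \<open>\<phi>\<close> has the default value 0
    and \<open>quot\<close> forces \<open>v x = v x0\<close>, so the identity holds there as
    well.\<close>
  have v_eq: "of_real (v x) = (of_real (v x0) + \<phi> x * (cis (- x0) * cis (of_int 1 * x))) + - \<phi> x" for x
  proof (cases "cis (x - x0) = 1")
    case True
    then show ?thesis
      using quot[of x] by (simp add: \<phi>_def)
  next
    case False
    then have "of_real (v x - v x0) = \<phi> x * (cis (x - x0) - 1)"
      by (simp add: \<phi>_def)
    then show ?thesis
      by (simp add: cis_mult algebra_simps)
  qed
  have v_fun: "(\<lambda>x. complex_of_real (v x))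
      = (\<lambda>x. (of_real (v x0) + \<phi> x * (cis (- x0) * cis (of_int 1 * x))) + - \<phi> x)"
    using v_eq by (rule ext)
  have coeff: "fourier_coeff v j = (if j = 0 then of_real (v x0) else 0) + cis (- x0) * cfc \<phi> (j - 1) - cfc \<phi> j" for j
  proof -
    have "fourier_coeff v j = cfc (\<lambda>x. of_real (v x0) + \<phi> x * (cis (- x0) * cis (of_int 1 * x))) j + cfc (\<lambda>x. - \<phi> x) j"
      unfolding fourier_coeff_cfc v_fun
    proof (rule cfc_add)
      show "cmod (of_real (v x0) + \<phi> x * (cis (- x0) * cis (of_int 1 * x))) \<le> D + 2 * B" for x
        using \<phi>_le[of x] D[of x0] by (intro norm_triangle_le add_mono) (auto simp: norm_mult)
      show "cmod (- \<phi> x) \<le> 2 * B" for x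
        using \<phi>_le by simp
    qed measurable
    also have "cfc (\<lambda>x. of_real (v x0) + \<phi> x * (cis (- x0) * cis (of_int 1 * x))) j
        = cfc (\<lambda>x. of_real (v x0) * 1) j + cfc (\<lambda>x. cis (- x0) * (\<phi> x * cis (of_int 1 * x))) j"
      by (subst cfc_add[symmetric, where B = D and B' = "2 * B"])
         (use D \<phi>_le in \<open>auto simp: norm_mult mult_ac\<close>)
    also have "\<dots> = (if j = 0 then of_real (v x0) else 0) + cis (- x0) * cfc \<phi> (j - 1)"
      by (simp only: cfc_mult_left cfc_one cfc_shift) simp
    also have "cfc (\<lambda>x. - \<phi> x) j = - cfc \<phi> j"
      using cfc_mult_left[of "- 1" \<phi> j] by simp
    finally show ?thesis by simp
  qed
  define \<psi> where "\<psi> j = cis (of_int j * x0) * cfc \<phi> j" for j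
  have "fourier_coeff v j * cis (of_int j * x0) = (if j = 0 then of_real (v x0) else 0) + (\<psi> (j - 1) - \<psi> j)" for j
    unfolding coeff \<psi>_def by (auto simp: algebra_simps cis_mult)
  then have "(\<Sum>j\<in>{- int N..int N}. fourier_coeff v j * cis (of_int j * x0))
      = of_real (v x0) + (\<psi> (- int N - 1) - \<psi> (int N))" for N
    by (simp only: sum.distrib sum_telescope_int) simp
  moreover have lim0: "(\<lambda>N. \<psi> (m N)) \<longlonglongrightarrow> 0" if "inj m" for m :: "nat \<Rightarrow> int"
  proof -
    have "summable (\<lambda>N. (cmod (cfc \<phi> (m N)))\<^sup>2)"
    proof (rule summableI_nonneg_bounded)
      fix n
      have "(\<Sum>i<n. (cmod (cfc \<phi> (m i)))\<^sup>2) = (\<Sum>j\<in>m ` {..<n}. (cmod (cfc \<phi> j))\<^sup>2)"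
        using that by (subst sum.reindex) (auto intro: inj_on_subset)
      also have "\<dots> \<le> (2 * B)\<^sup>2"
        by (rule bessel_inequality) (use \<phi>_le in auto)
      finally show "(\<Sum>i<n. (cmod (cfc \<phi> (m i)))\<^sup>2) \<le> (2 * B)\<^sup>2" .
    qed simp
    then have "(\<lambda>N. (cmod (\<psi> (m N)))\<^sup>2) \<longlonglongrightarrow> 0"
      by (auto simp: \<psi>_def norm_mult dest: summable_LIMSEQ_zero)
    then have "(\<lambda>N. sqrt ((cmod (\<psi> (m N)))\<^sup>2)) \<longlonglongrightarrow> sqrt 0"
      by (rule tendsto_real_sqrt)
    then show ?thesis
      by (simp add: tendsto_norm_zero_iff)
  qed
  have "(\<lambda>N. of_real (v x0) + (\<psi> (- int N - 1) - \<psi> (int N))) \<longlonglongrightarrow> of_real (v x0) + (0 - 0)"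
    by (intro tendsto_intros lim0) (auto simp: inj_def)
  ultimately show ?thesis
    by simp
qed

lemma antiderivative_continuous_UNIV:
  fixes f :: "real \<Rightarrow> real"
  assumes "continuous_on UNIV f"
  obtains F where "\<And>x. (F has_real_derivative f x) (at x)"
proof -
  have "\<exists>F. \<forall>x::real. (-\<infinity>::ereal) < x \<longrightarrow> x < (\<infinity>::ereal) \<longrightarrow> (F has_vector_derivative f x) (at x)"
    by (rule einterval_antiderivative) (use assms in \<open>auto simp: continuous_on_eq_continuous_at\<close>)
  then show ?thesis
    using that by (auto simp: has_real_derivative_iff_has_vector_derivative)
qed

lemma sum_symmetric_int:
  fixes f :: "int \<Rightarrow> 'a::ab_group_add"
  shows "(\<Sum>j\<in>{- int N..int N}. f j) = (\<Sum>n<Suc N. if n = 0 then f 0 else f (int n) + f (- int n))"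
proof (induction N)
  case (Suc N)
  have "{- int (Suc N)..int (Suc N)} = insert (- int (Suc N)) (insert (int (Suc N)) {- int N..int N})"
    by auto
  then show ?case
    using Suc by (simp add: algebra_simps)
qed simp

text \<open>The Lipschitz case applies to an antiderivative, whose series can be differentiated term by term.\<close>

theorem fourier_series_abs_summable:
  assumes v: "torus_fun v" "continuous_on UNIV v"
    and B: "\<And>J. finite J \<Longrightarrow> (\<Sum>j\<in>J. cmod (fourier_coeff v j)) \<le> B"
  shows "(\<lambda>N. \<Sum>j\<in>{- int N..int N}. fourier_coeff v j * cis (of_int j * x)) \<longlonglongrightarrow> of_real (v x)"
proof -
  \<comment> \<open>The mean has to be removed, since an antiderivative of \<open>v\<close> is
    periodic only if \<open>v\<close> has mean 0.\<close>
  define m where "m = Re (fourier_coeff v 0)"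
  have m: "fourier_coeff v 0 = of_real m"
    using fourier_coeff_uminus[of v 0] by (simp add: m_def complex_eq_iff)
  obtain F where F: "\<And>x. (F has_real_derivative v x) (at x)"
    using antiderivative_continuous_UNIV[OF v(2)] by metis
  define V where "V x = F x - m * x" for x
  have V': "(V has_real_derivative v x - m) (at x)" for x
    unfolding V_def by (auto intro!: derivative_eq_intros F)
  have V: "torus_fun V"
    unfolding torus_fun_def
  proof
    fix x
    have "((\<lambda>x. V (x + 2 * pi) - V x) has_real_derivative 0) (at x)" for x
    proof -
      have "((\<lambda>x. V (x + 2 * pi)) has_real_derivative v (x + 2 * pi) - m) (at x)"
        using V'[of "x + 2 * pi"] DERIV_shift by blast
      from DERIV_diff[OF this V'[of x]] show ?thesis
        using v(1) by (simp add: torus_fun_def)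
    qed
    then have "V (x + 2 * pi) - V x = V (0 + 2 * pi) - V 0"
      using DERIV_isconst_all[of "\<lambda>x. V (x + 2 * pi) - V x" x 0] by blast
    moreover have "V (2 * pi) = V 0"
    proof -
      have "(v has_integral (F (2 * pi) - F 0)) {0..2*pi}"
        using F by (intro fundamental_theorem_of_calculus)
          (auto simp: has_real_derivative_iff_has_vector_derivative intro: has_vector_derivative_at_within)
      then have "(LINT x:{0..2*pi}|lborel. v x) = F (2 * pi) - F 0"
        using set_integrable_continuous[OF v(2)] by (simp add: set_borel_integral_eq_integral integral_unique)
      moreover have "of_real (LINT x:{0..2*pi}|lborel. v x) = (2 * pi) * fourier_coeff v 0"
        using set_integral_complex_of_real[of lborel "{0..2*pi}" v] by (simp add: fourier_coeff_def)
      ultimately have "F (2 * pi) - F 0 = 2 * pi * m"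
        unfolding m by (metis of_real_eq_iff of_real_mult of_real_numeral)
      then show ?thesis
        by (simp add: V_def algebra_simps)
    qed
    ultimately show "V (x + 2 * pi) = V x" by simp
  qed
  obtain D where D: "\<And>x. \<bar>v x\<bar> \<le> D"
    using torus_fun_bounded[OF v] by metis
  have lip: "\<bar>V x - V y\<bar> \<le> (D + \<bar>m\<bar>) * \<bar>x - y\<bar>" for x y
  proof -
    have "\<bar>v z - m\<bar> \<le> D + \<bar>m\<bar>" for z
      using D[of z] by linarith
    then show ?thesis
      using field_differentiable_bound[of UNIV V "\<lambda>x. v x - m" "D + \<bar>m\<bar>" x y] V' by simp
  qed
  define z where "z N x = (\<Sum>j\<in>{- int N..int N}. fourier_coeff v j * cis (of_int j * x))" for N x
  define f where "f n x = (if n = 0 then fourier_coeff v 0 else fourier_coeff v (int n) * cis (of_int (int n) * x)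
      + fourier_coeff v (- int n) * cis (of_int (- int n) * x))" for n x
  have z_f: "z N x = (\<Sum>n<Suc N. f n x)" for N x
    unfolding z_def sum_symmetric_int f_def by (intro sum.cong) auto
  have "uniform_limit UNIV (\<lambda>n x. \<Sum>i<n. f i x) (\<lambda>x. \<Sum>i. f i x) sequentially"
  proof (rule Weierstrass_m_test)
    define M where "M n = (if n = 0 then cmod (fourier_coeff v 0)
        else cmod (fourier_coeff v (int n)) + cmod (fourier_coeff v (- int n)))" for n
    show "norm (f n x) \<le> M n" for n x
      by (auto simp: f_def M_def norm_mult intro!: order.trans[OF norm_triangle_ineq])
    show "summable M"
    proof (rule summableI_nonneg_bounded)
      fix n
      have "(\<Sum>i<n. M i) \<le> (\<Sum>i<Suc n. M i)"
        by (auto simp: M_def)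
      also have "\<dots> = (\<Sum>j\<in>{- int n..int n}. cmod (fourier_coeff v j))"
        unfolding sum_symmetric_int M_def by (intro sum.cong) auto
      also have "\<dots> \<le> B"
        by (rule B) simp
      finally show "(\<Sum>i<n. M i) \<le> B" .
    qed (auto simp: M_def)
  qed
  then have unif: "uniform_limit UNIV z (\<lambda>x. \<Sum>i. f i x) sequentially"
    unfolding z_f[abs_def] by (rule filterlim_compose) (rule filterlim_Suc)
  let ?z = "\<lambda>x. \<Sum>i. f i x"
  have lim: "(\<lambda>N. z N x) \<longlonglongrightarrow> ?z x"
    using tendsto_uniform_limitI[OF unif] by simp
  define Z where "Z N x = (\<Sum>j\<in>{- int N..int N}. fourier_coeff V j * cis (of_int j * x))" for N x
  have Z_lim: "(\<lambda>N. Z N x) \<longlonglongrightarrow> of_real (V x)" for x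
    unfolding Z_def by (rule fourier_series_Lipschitz[OF V lip])
  have coeffs: "fourier_coeff v j = (if j = 0 then of_real m else \<i> * of_int j * fourier_coeff V j)" for j
  proof -
    have "fourier_coeff (\<lambda>x. v x - m) j = \<i> * of_int j * fourier_coeff V j"
      by (rule fourier_coeff_deriv[OF V V']) (intro continuous_intros v)
    moreover have "fourier_coeff (\<lambda>x. v x - m) j = fourier_coeff v j - (if j = 0 then of_real m else 0)"
    proof -
      have [measurable]: "v \<in> borel_measurable borel"
        by (rule borel_measurable_continuous_onI[OF v(2)])
      have "fourier_coeff (\<lambda>x. v x - m) j = cfc (\<lambda>x. of_real (v x) + of_real (- m) * 1) j"
        by (simp add: fourier_coeff_cfc)
      also have "\<dots> = fourier_coeff v j + cfc (\<lambda>x. of_real (- m) * 1) j"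
        unfolding fourier_coeff_cfc by (rule cfc_add[where B = D and B' = "\<bar>m\<bar>"]) (use D in auto)
      also have "\<dots> = fourier_coeff v j - (if j = 0 then of_real m else 0)"
        by (simp only: cfc_mult_left cfc_one) simp
      finally show ?thesis .
    qed
    ultimately show ?thesis
      using m by auto
  qed
  have Z': "(Z N has_vector_derivative z N x - of_real m) (at x)" for N x
  proof -
    have "(Z N has_vector_derivative (\<Sum>j\<in>{- int N..int N}. fourier_coeff V j * (\<i> * of_int j * cis (of_int j * x)))) (at x)"
      unfolding Z_def
      by (intro has_vector_derivative_sum has_vector_derivative_mult_right has_vector_derivative_cis)
    moreover have "(\<Sum>j\<in>{- int N..int N}. fourier_coeff V j * (\<i> * of_int j * cis (of_int j * x)))
        = (\<Sum>j\<in>{- int N..int N}. fourier_coeff v j * cis (of_int j * x) - (if j = 0 then of_real m else 0))"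
      by (intro sum.cong) (auto simp: coeffs)
    ultimately show ?thesis
      by (simp add: z_def sum_subtractf)
  qed
  have "\<exists>g. \<forall>x\<in>UNIV. (\<lambda>N. Z N x) \<longlonglongrightarrow> g x \<and> (g has_derivative (\<lambda>h. h *\<^sub>R (?z x - of_real m))) (at x within UNIV)"
  proof (rule has_derivative_sequence[where f' = "\<lambda>N x h. h *\<^sub>R (z N x - of_real m)"])
    show "(Z N has_derivative (\<lambda>h. h *\<^sub>R (z N x - of_real m))) (at x within UNIV)" for N x
      using Z'[of N x] by (simp add: has_vector_derivative_def)
    show "(\<lambda>N. Z N 0) \<longlonglongrightarrow> of_real (V 0)"
      by (rule Z_lim)
    fix e :: real assume "e > 0"
    then have "\<forall>\<^sub>F n in sequentially. \<forall>x\<in>UNIV. dist (z n x) (?z x) < e"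
      using unif by (auto simp: uniform_limit_iff)
    then show "\<forall>\<^sub>F n in sequentially. \<forall>x\<in>UNIV. \<forall>h. norm (h *\<^sub>R (z n x - of_real m) - h *\<^sub>R (?z x - of_real m)) \<le> e * norm h"
    proof eventually_elim
      case (elim n)
      show ?case
      proof (intro ballI allI)
        fix x h
        have "h *\<^sub>R (z n x - of_real m) - h *\<^sub>R (?z x - of_real m) = h *\<^sub>R (z n x - ?z x)"
          by (simp add: scaleR_diff_right)
        moreover have "cmod (z n x - ?z x) \<le> e"
          using elim[rule_format, of x] by (simp add: dist_norm)
        ultimately show "norm (h *\<^sub>R (z n x - of_real m) - h *\<^sub>R (?z x - of_real m)) \<le> e * norm h"
          by (simp add: mult.commute[of e] mult_left_mono)
      qed
    qed
  qed auto
  then obtain g where g: "\<And>x. (\<lambda>N. Z N x) \<longlonglongrightarrow> g x" "\<And>x. (g has_vector_derivative ?z x - of_real m) (at x)"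
    by (auto simp: has_vector_derivative_def)
  have "g = (\<lambda>x. of_real (V x))"
    using LIMSEQ_unique[OF g(1) Z_lim] by auto
  then have "((\<lambda>x. complex_of_real (V x)) has_vector_derivative ?z x - of_real m) (at x)"
    using g(2) by simp
  moreover have "((\<lambda>x. complex_of_real (V x)) has_vector_derivative of_real (v x - m)) (at x)"
    using V'[of x] by (intro has_vector_derivative_of_real) (simp add: has_real_derivative_iff_has_vector_derivative)
  ultimately have "?z x - of_real m = of_real (v x - m)"
    by (rule vector_derivative_unique_at)
  then show ?thesis
    using lim by (simp add: z_def)
qed

section \<open>Weighted norms of Fourier coefficients\<close>

lemma jap_ge_1: "1 \<le> jap j"
  by (simp add: jap_def)

lemma jap_pos [simp]: "0 < jap j"
  using jap_ge_1[of j] by linarith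

lemma jap_nonneg [simp]: "0 \<le> jap j"
  by (rule less_imp_le) simp

lemma jap_neq_0 [simp]: "jap j \<noteq> 0"
  using jap_pos[of j] by linarith

lemma jap_0 [simp]: "jap 0 = 1"
  by (simp add: jap_def)

lemma jap_uminus [simp]: "jap (- j) = jap j"
  by (simp add: jap_def)

lemma jap_square: "(jap j)\<^sup>2 = (of_int j)\<^sup>2 + 1"
  by (simp add: jap_def)

lemma abs_le_jap: "\<bar>of_int j\<bar> \<le> jap j"
  unfolding jap_def by (rule real_le_rsqrt) simp

lemma jap_le_two_abs: "j \<noteq> 0 \<Longrightarrow> jap j \<le> 2 * \<bar>of_int j\<bar>"
proof -
  assume "j \<noteq> 0"
  then have "1 \<le> \<bar>real_of_int j\<bar>" by linarith
  then have "1\<^sup>2 \<le> \<bar>real_of_int j\<bar>\<^sup>2" by (intro power_mono) auto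
  then show ?thesis
    unfolding jap_def by (intro real_le_lsqrt) (auto simp: power_mult_distrib)
qed

lemma jap_le_one_plus: "jap j \<le> 1 + \<bar>of_int j\<bar>"
  unfolding jap_def by (rule real_le_lsqrt) (auto simp: power2_sum)

lemma jap_le_of_abs_le: "\<bar>j\<bar> \<le> int K \<Longrightarrow> 1 \<le> K \<Longrightarrow> jap j \<le> 2 * real K"
  using jap_le_one_plus[of j] by linarith

lemma jap_ge_of_abs_gt: "\<not> \<bar>j\<bar> \<le> int K \<Longrightarrow> real K \<le> jap j"
  using abs_le_jap[of j] by linarith

text \<open>Peetre's inequality in product form; after squaring, the difference of the two sides is
  a sum of squares. Raised to a power it distributes the weight of a convolution over both factors,
  which is the origin of the factors \<open>2 powr \<sigma>\<close> in the product
  estimates.\<close>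

lemma jap_add_le: "jap (j + l) \<le> 2 * jap j * jap l"
proof -
  have "jap (j + l) \<le> 1 + (\<bar>of_int j\<bar> + \<bar>of_int l\<bar>)"
    using jap_le_one_plus[of "j + l"] by simp
  also have "\<dots> \<le> jap j * jap l + jap j * jap l"
  proof -
    have "(jap j * jap l)\<^sup>2 = (of_int j)\<^sup>2 * (of_int l)\<^sup>2 + ((of_int j)\<^sup>2 + (of_int l)\<^sup>2) + 1"
      by (simp add: power_mult_distrib jap_square algebra_simps)
    also have "\<dots> \<ge> ((1 + (\<bar>of_int j\<bar> + \<bar>of_int l\<bar>)) / 2)\<^sup>2"
    proof -
      have "a\<^sup>2 * b\<^sup>2 + (a\<^sup>2 + b\<^sup>2) + 1 - ((1 + (a + b)) / 2)\<^sup>2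
          = ((2 * a * b)\<^sup>2 + (a - b)\<^sup>2 + (a - 1)\<^sup>2 + (b - 1)\<^sup>2 + a\<^sup>2 + b\<^sup>2 + 1) / 4" for a b :: real
        by (simp add: power2_eq_square field_simps)
      moreover have "0 \<le> ((2 * a * b)\<^sup>2 + (a - b)\<^sup>2 + (a - 1)\<^sup>2 + (b - 1)\<^sup>2 + a\<^sup>2 + b\<^sup>2 + 1) / 4" for a b :: real
        by simp
      ultimately have "((1 + (a + b)) / 2)\<^sup>2 \<le> a\<^sup>2 * b\<^sup>2 + (a\<^sup>2 + b\<^sup>2) + 1" for a b :: real
        by (metis diff_ge_0_iff_ge)
      from this[of "\<bar>of_int j\<bar>" "\<bar>of_int l\<bar>"] show ?thesis
        by simp
    qed
    finally have "(1 + (\<bar>of_int j\<bar> + \<bar>of_int l\<bar>)) / 2 \<le> jap j * jap l"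
      by (rule power2_le_imp_le) simp
    then show ?thesis by simp
  qed
  finally show ?thesis by simp
qed

text \<open>Telescoping: the pair of indices N + 1 and -(N + 1) contributes at most 4/(N + 1) - 4/(N
  + 2), and the index 0 contributes 1 = 5 - 4. The root of 5 is at most 3, which becomes the
  constant in \<open>wiener_le_sob_le\<close>.\<close>

lemma sum_inverse_jap_square_le:
  assumes "finite J"
  shows "(\<Sum>j\<in>J. (inverse (jap j))\<^sup>2) \<le> 5"
proof -
  define N where "N = (\<Sum>j\<in>J. nat \<bar>j\<bar>)"
  have "J \<subseteq> {- int N..int N}"
  proof
    fix j assume "j \<in> J"
    then have "nat \<bar>j\<bar> \<le> N"
      unfolding N_def using assms by (intro member_le_sum) auto
    then show "j \<in> {- int N..int N}" by auto
  qed
  then have "(\<Sum>j\<in>J. (inverse (jap j))\<^sup>2) \<le> (\<Sum>j\<in>{- int N..int N}. (inverse (jap j))\<^sup>2)"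
    by (intro sum_mono2) auto
  also have "\<dots> \<le> 5 - 4 / (real N + 1)"
  proof (induction N)
    case (Suc N)
    have "{- int (Suc N)..int (Suc N)} = insert (- int (Suc N)) (insert (int (Suc N)) {- int N..int N})"
      by auto
    then have "(\<Sum>j\<in>{- int (Suc N)..int (Suc N)}. (inverse (jap j))\<^sup>2)
        = 2 * (inverse (jap (int (Suc N))))\<^sup>2 + (\<Sum>j\<in>{- int N..int N}. (inverse (jap j))\<^sup>2)"
      using jap_uminus[of "int (Suc N)"] by (simp del: jap_uminus of_nat_Suc)
    also have "\<dots> \<le> (4 / (real N + 1) - 4 / (real N + 2)) + (5 - 4 / (real N + 1))"
    proof (intro add_mono Suc)
      have "2 * (inverse (jap (int (Suc N))))\<^sup>2 = 2 / ((real N + 1)\<^sup>2 + 1)"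
        by (simp add: power_inverse jap_square divide_inverse add.commute)
      also have "\<dots> \<le> 4 / ((real N + 1) * (real N + 2))"
      proof -
        have "2 / x \<le> 4 / y" if "0 < x" "0 < y" "2 * y \<le> 4 * x" for x y :: real
          using that by (simp add: field_simps)
        then show ?thesis
          by this (auto simp: power2_eq_square algebra_simps intro!: add_pos_nonneg)
      qed
      also have "\<dots> = 4 / (real N + 1) - 4 / (real N + 2)"
        by (simp add: divide_simps)
      finally show "2 * (inverse (jap (int (Suc N))))\<^sup>2 \<le> 4 / (real N + 1) - 4 / (real N + 2)" .
    qed
    finally show ?case by (simp add: add.commute)
  qed simp
  also have "\<dots> \<le> 5" by simp
  finally show ?thesis .
qed

text \<open>Bounds on weighted l^1 norms, and with \<open>sob_le\<close> on weighted l^2 norms, are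
  required on all finite index sets. This includes summability, avoids infinite sums with their
  default value, and passes to pointwise limits.\<close>

definition wiener_le :: "real \<Rightarrow> (int \<Rightarrow> complex) \<Rightarrow> real \<Rightarrow> bool" where
  "wiener_le \<sigma> c B \<longleftrightarrow> (\<forall>J. finite J \<longrightarrow> (\<Sum>j\<in>J. jap j powr \<sigma> * cmod (c j)) \<le> B)"

definition sob_le :: "real \<Rightarrow> (int \<Rightarrow> complex) \<Rightarrow> real \<Rightarrow> bool" where
  "sob_le \<sigma> c B \<longleftrightarrow> (\<forall>J. finite J \<longrightarrow> L2_set (\<lambda>j. jap j powr \<sigma> * cmod (c j)) J \<le> B)"

lemma wiener_leI: "(\<And>J. finite J \<Longrightarrow> (\<Sum>j\<in>J. jap j powr \<sigma> * cmod (c j)) \<le> B) \<Longrightarrow> wiener_le \<sigma> c B"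
  by (simp add: wiener_le_def)

lemma wiener_leD: "wiener_le \<sigma> c B \<Longrightarrow> finite J \<Longrightarrow> (\<Sum>j\<in>J. jap j powr \<sigma> * cmod (c j)) \<le> B"
  by (simp add: wiener_le_def)

lemma sob_leI: "(\<And>J. finite J \<Longrightarrow> L2_set (\<lambda>j. jap j powr \<sigma> * cmod (c j)) J \<le> B) \<Longrightarrow> sob_le \<sigma> c B"
  by (simp add: sob_le_def)

lemma sob_leD: "sob_le \<sigma> c B \<Longrightarrow> finite J \<Longrightarrow> L2_set (\<lambda>j. jap j powr \<sigma> * cmod (c j)) J \<le> B"
  by (simp add: sob_le_def)

lemma wiener_le_nonneg: "wiener_le \<sigma> c B \<Longrightarrow> 0 \<le> B"
  using wiener_leD[of \<sigma> c B "{}"] by simp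

lemma sob_le_nonneg: "sob_le \<sigma> c B \<Longrightarrow> 0 \<le> B"
  using sob_leD[of \<sigma> c B "{}"] by simp

lemma wiener_le_mono:
  assumes "wiener_le \<tau> d B" and "\<And>j. jap j powr \<sigma> * cmod (c j) \<le> D * (jap j powr \<tau> * cmod (d j))"
    and "0 \<le> D" and "D * B \<le> B'"
  shows "wiener_le \<sigma> c B'"
proof (rule wiener_leI)
  fix J :: "int set" assume J: "finite J"
  have "(\<Sum>j\<in>J. jap j powr \<sigma> * cmod (c j)) \<le> (\<Sum>j\<in>J. D * (jap j powr \<tau> * cmod (d j)))"
    by (rule sum_mono) (rule assms)
  also have "\<dots> \<le> D * B"
    unfolding sum_distrib_left[symmetric] by (intro mult_left_mono wiener_leD[OF assms(1) J] assms)
  finally show "(\<Sum>j\<in>J. jap j powr \<sigma> * cmod (c j)) \<le> B'"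
    using assms(4) by linarith
qed

lemma sob_le_mono:
  assumes "sob_le \<tau> d B" and "\<And>j. jap j powr \<sigma> * cmod (c j) \<le> D * (jap j powr \<tau> * cmod (d j))"
    and "0 \<le> D" and "D * B \<le> B'"
  shows "sob_le \<sigma> c B'"
proof (rule sob_leI)
  fix J :: "int set" assume J: "finite J"
  have "L2_set (\<lambda>j. jap j powr \<sigma> * cmod (c j)) J \<le> L2_set (\<lambda>j. D * (jap j powr \<tau> * cmod (d j))) J"
    by (rule L2_set_mono) (use assms in auto)
  also have "\<dots> \<le> D * B"
    unfolding L2_set_right_distrib[OF assms(3), symmetric]
    by (intro mult_left_mono sob_leD[OF assms(1) J] assms)
  finally show "L2_set (\<lambda>j. jap j powr \<sigma> * cmod (c j)) J \<le> B'"
    using assms(4) by linarith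
qed

lemma jap_powr_mono: "\<sigma> \<le> \<tau> \<Longrightarrow> jap j powr \<sigma> \<le> jap j powr \<tau>"
  using jap_ge_1 by (intro powr_mono) auto

lemma wiener_le_weaken:
  assumes "wiener_le \<tau> c B" "\<sigma> \<le> \<tau>" "B \<le> B'"
  shows "wiener_le \<sigma> c B'"
  by (rule wiener_le_mono[OF assms(1), where D = 1]) (use assms jap_powr_mono in \<open>auto intro!: mult_right_mono\<close>)

lemma sob_le_weaken:
  assumes "sob_le \<tau> c B" "\<sigma> \<le> \<tau>" "B \<le> B'"
  shows "sob_le \<sigma> c B'"
  by (rule sob_le_mono[OF assms(1), where D = 1]) (use assms jap_powr_mono in \<open>auto intro!: mult_right_mono\<close>)

lemma wiener_le_add:
  assumes "wiener_le \<sigma> c B" "wiener_le \<sigma> d B'"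
  shows "wiener_le \<sigma> (\<lambda>j. c j + d j) (B + B')"
proof (rule wiener_leI)
  fix J :: "int set" assume J: "finite J"
  have "(\<Sum>j\<in>J. jap j powr \<sigma> * cmod (c j + d j))
      \<le> (\<Sum>j\<in>J. jap j powr \<sigma> * cmod (c j) + jap j powr \<sigma> * cmod (d j))"
    by (intro sum_mono) (auto simp flip: distrib_left intro!: mult_left_mono norm_triangle_ineq)
  also have "\<dots> \<le> B + B'"
    unfolding sum.distrib by (intro add_mono wiener_leD assms J)
  finally show "(\<Sum>j\<in>J. jap j powr \<sigma> * cmod (c j + d j)) \<le> B + B'" .
qed

lemma sob_le_add:
  assumes "sob_le \<sigma> c B" "sob_le \<sigma> d B'"
  shows "sob_le \<sigma> (\<lambda>j. c j + d j) (B + B')"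
proof (rule sob_leI)
  fix J :: "int set" assume J: "finite J"
  have "L2_set (\<lambda>j. jap j powr \<sigma> * cmod (c j + d j)) J
      \<le> L2_set (\<lambda>j. jap j powr \<sigma> * cmod (c j) + jap j powr \<sigma> * cmod (d j)) J"
    by (intro L2_set_mono) (auto simp flip: distrib_left intro!: mult_left_mono norm_triangle_ineq)
  also have "\<dots> \<le> B + B'"
    by (intro order.trans[OF L2_set_triangle_ineq] add_mono sob_leD assms J)
  finally show "L2_set (\<lambda>j. jap j powr \<sigma> * cmod (c j + d j)) J \<le> B + B'" .
qed

lemma wiener_le_diff:
  assumes "wiener_le \<sigma> c B" "wiener_le \<sigma> d B'"
  shows "wiener_le \<sigma> (\<lambda>j. c j - d j) (B + B')"
  using wiener_le_add[OF assms(1), of "\<lambda>j. - d j" B'] assms(2) by (simp add: wiener_le_def)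

lemma sob_le_diff:
  assumes "sob_le \<sigma> c B" "sob_le \<sigma> d B'"
  shows "sob_le \<sigma> (\<lambda>j. c j - d j) (B + B')"
  using sob_le_add[OF assms(1), of "\<lambda>j. - d j" B'] assms(2) by (simp add: sob_le_def)

lemma sob_le_wiener_le:
  assumes "wiener_le \<sigma> c B"
  shows "sob_le \<sigma> c B"
proof (rule sob_leI)
  fix J :: "int set" assume J: "finite J"
  have "L2_set (\<lambda>j. jap j powr \<sigma> * cmod (c j)) J \<le> (\<Sum>j\<in>J. jap j powr \<sigma> * cmod (c j))"
    by (rule L2_set_le_sum) auto
  then show "L2_set (\<lambda>j. jap j powr \<sigma> * cmod (c j)) J \<le> B"
    using wiener_leD[OF assms J] by linarith
qed

text \<open>Cauchy-Schwarz against \<open>inverse (jap j)\<close>. Any loss above one half of a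
  derivative would do; a full one keeps the exponents simple. Most factors 3 below, such as that in
  \<open>3 * M\<close>, come from here.\<close>

lemma wiener_le_sob_le:
  assumes "sob_le (\<sigma> + 1) c B"
  shows "wiener_le \<sigma> c (3 * B)"
proof (rule wiener_leI)
  fix J :: "int set" assume J: "finite J"
  have "(\<Sum>j\<in>J. jap j powr \<sigma> * cmod (c j))
      = (\<Sum>j\<in>J. \<bar>inverse (jap j)\<bar> * \<bar>jap j powr (\<sigma> + 1) * cmod (c j)\<bar>)"
    by (intro sum.cong) (auto simp: powr_add abs_mult)
  also have "\<dots> \<le> L2_set (\<lambda>j. inverse (jap j)) J * L2_set (\<lambda>j. jap j powr (\<sigma> + 1) * cmod (c j)) J"
    by (rule L2_set_mult_ineq)
  also have "\<dots> \<le> 3 * B"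
  proof (intro mult_mono sob_leD[OF assms J])
    show "L2_set (\<lambda>j. inverse (jap j)) J \<le> 3"
      unfolding L2_set_def using sum_inverse_jap_square_le[OF J] by (intro real_le_lsqrt) auto
  qed auto
  finally show "(\<Sum>j\<in>J. jap j powr \<sigma> * cmod (c j)) \<le> 3 * B" .
qed

lemma wiener_le_deriv:
  assumes "wiener_le (\<sigma> + 1) c B"
  shows "wiener_le \<sigma> (\<lambda>j. \<i> * of_int j * c j) B"
  by (rule wiener_le_mono[OF assms, where D = 1])
     (auto simp: norm_mult powr_add mult.assoc intro!: mult_left_mono mult_right_mono abs_le_jap)

lemma sob_le_deriv:
  assumes "sob_le (\<sigma> + 1) c B"
  shows "sob_le \<sigma> (\<lambda>j. \<i> * of_int j * c j) B"
  by (rule sob_le_mono[OF assms, where D = 1])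
     (auto simp: norm_mult powr_add mult.assoc intro!: mult_left_mono mult_right_mono abs_le_jap)

lemma jap_mult_le_deriv: "jap j * cmod z \<le> (if j = 0 then cmod z else 0) + 2 * cmod (\<i> * of_int j * z)"
  using mult_right_mono[OF jap_le_two_abs[of j] norm_ge_zero[of z]] by (auto simp: norm_mult)

text \<open>The derivative sees every mode except j = 0, which therefore needs the separate bound
  \<open>B0\<close>. For the others \<open>jap j\<close> is at most 2|j|.\<close>

lemma wiener_le_integrate:
  assumes "wiener_le \<sigma> (\<lambda>j. \<i> * of_int j * c j) B" and "cmod (c 0) \<le> B0"
  shows "wiener_le (\<sigma> + 1) c (B0 + 2 * B)"
proof (rule wiener_leI)
  fix J :: "int set" assume J: "finite J"
  have "(\<Sum>j\<in>J. jap j powr (\<sigma> + 1) * cmod (c j))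
      \<le> (\<Sum>j\<in>J. (if j = 0 then cmod (c 0) else 0) + 2 * (jap j powr \<sigma> * cmod (\<i> * of_int j * c j)))"
  proof (rule sum_mono)
    fix j
    have "jap j powr (\<sigma> + 1) * cmod (c j) = jap j powr \<sigma> * (jap j * cmod (c j))"
      by (simp add: powr_add)
    also have "\<dots> \<le> jap j powr \<sigma> * ((if j = 0 then cmod (c j) else 0) + 2 * cmod (\<i> * of_int j * c j))"
      by (intro mult_left_mono jap_mult_le_deriv) auto
    finally show "jap j powr (\<sigma> + 1) * cmod (c j)
        \<le> (if j = 0 then cmod (c 0) else 0) + 2 * (jap j powr \<sigma> * cmod (\<i> * of_int j * c j))"
      by (auto simp: algebra_simps split: if_splits)
  qed
  also have "\<dots> \<le> B0 + 2 * B"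
    unfolding sum.distrib sum_distrib_left[symmetric]
    using assms(2) J wiener_leD[OF assms(1) J] norm_ge_zero[of "c 0"]
    by (intro add_mono mult_left_mono) (auto simp del: norm_ge_zero)
  finally show "(\<Sum>j\<in>J. jap j powr (\<sigma> + 1) * cmod (c j)) \<le> B0 + 2 * B" .
qed

definition freq_trunc :: "nat \<Rightarrow> (int \<Rightarrow> complex) \<Rightarrow> int \<Rightarrow> complex" where
  "freq_trunc K c j = (if \<bar>j\<bar> \<le> int K then c j else 0)"

text \<open>Beyond \<open>K\<close> the ratio \<open>jap j / real K\<close> is at least 1, so any
  nonnegative power of it may be inserted.\<close>

lemma tail_powr_le:
  assumes "1 \<le> K" "0 \<le> \<tau>"
  shows "jap j powr \<sigma> * cmod (c j - freq_trunc K c j) \<le> real K powr (- \<tau>) * (jap j powr (\<sigma> + \<tau>) * cmod (c j))"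
proof (cases "\<bar>j\<bar> \<le> int K")
  case False
  have "1 \<le> (jap j / real K) powr \<tau>"
    using jap_ge_of_abs_gt[OF False] assms by (intro ge_one_powr_ge_zero) auto
  also have "\<dots> = real K powr (- \<tau>) * jap j powr \<tau>"
    using assms by (simp add: powr_divide powr_minus field_simps)
  finally have "jap j powr \<sigma> * cmod (c j) * 1 \<le> jap j powr \<sigma> * cmod (c j) * (real K powr (- \<tau>) * jap j powr \<tau>)"
    by (rule mult_left_mono) auto
  then show ?thesis
    using False by (simp add: freq_trunc_def powr_add mult_ac)
qed (auto simp: freq_trunc_def)

lemma wiener_le_tail:
  assumes "wiener_le (\<sigma> + \<tau>) c B" "1 \<le> K" "0 \<le> \<tau>"
  shows "wiener_le \<sigma> (\<lambda>j. c j - freq_trunc K c j) (real K powr (- \<tau>) * B)"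
  by (rule wiener_le_mono[OF assms(1)], rule tail_powr_le) (use assms in auto)

lemma sob_le_tail:
  assumes "sob_le (\<sigma> + \<tau>) c B" "1 \<le> K" "0 \<le> \<tau>"
  shows "sob_le \<sigma> (\<lambda>j. c j - freq_trunc K c j) (real K powr (- \<tau>) * B)"
  by (rule sob_le_mono[OF assms(1)], rule tail_powr_le) (use assms in auto)

lemma wiener_le_trunc: "wiener_le \<sigma> c B \<Longrightarrow> wiener_le \<sigma> (freq_trunc K c) B"
  by (rule wiener_le_mono[where D = 1]) (auto simp: freq_trunc_def)

lemma sob_le_trunc: "sob_le \<sigma> c B \<Longrightarrow> sob_le \<sigma> (freq_trunc K c) B"
  by (rule sob_le_mono[where D = 1]) (auto simp: freq_trunc_def)

text \<open>The inverse estimate for trigonometric polynomials. The base is 2K because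
  \<open>jap j\<close> is at most 1 + |j|, hence at most 2K for the retained modes.\<close>

lemma sob_le_inverse:
  assumes "sob_le \<sigma> c B" "1 \<le> K" "0 \<le> \<tau>"
  shows "sob_le (\<sigma> + \<tau>) (freq_trunc K c) ((2 * real K) powr \<tau> * B)"
proof (rule sob_le_mono[OF assms(1)])
  fix j
  show "jap j powr (\<sigma> + \<tau>) * cmod (freq_trunc K c j) \<le> (2 * real K) powr \<tau> * (jap j powr \<sigma> * cmod (c j))"
  proof (cases "\<bar>j\<bar> \<le> int K")
    case True
    have "jap j powr \<tau> \<le> (2 * real K) powr \<tau>"
      using jap_le_of_abs_le[OF True assms(2)] assms(3) by (intro powr_mono2) auto
    then have "jap j powr \<tau> * (jap j powr \<sigma> * cmod (c j)) \<le> (2 * real K) powr \<tau> * (jap j powr \<sigma> * cmod (c j))"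
      by (rule mult_right_mono) auto
    then show ?thesis
      using True by (simp add: freq_trunc_def powr_add mult_ac)
  qed (simp add: freq_trunc_def)
qed auto

lemma L2_set_sum_le: "finite L \<Longrightarrow> L2_set (\<lambda>j. \<Sum>l\<in>L. f l j) J \<le> (\<Sum>l\<in>L. L2_set (f l) J)"
proof (induction L rule: finite_induct)
  case empty
  then show ?case by (simp add: L2_set_def)
next
  case (insert l L)
  then show ?case
    using L2_set_triangle_ineq[of "f l" "\<lambda>j. \<Sum>l\<in>L. f l j" J] by simp
qed

lemma L2_set_shift: "L2_set (\<lambda>j. f (j - l)) J = L2_set f ((\<lambda>j. j - l) ` J)" for l :: int
  unfolding L2_set_def by (subst sum.reindex) (auto simp: inj_on_def)

lemma jap_powr_conv: "0 \<le> \<sigma> \<Longrightarrow> jap j powr \<sigma> \<le> 2 powr \<sigma> * (jap l powr \<sigma> * jap (j - l) powr \<sigma>)"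
  using jap_add_le[of l "j - l"] powr_mono2[of \<sigma> "jap j" "2 * jap l * jap (j - l)"]
  by (simp add: powr_mult mult.assoc)

lemma conv_term_le:
  assumes "cmod e \<le> (\<Sum>l\<in>L. cmod (x l) * cmod (y (j - l)))" "0 \<le> \<sigma>"
  shows "jap j powr \<sigma> * cmod e
    \<le> (\<Sum>l\<in>L. (2 powr \<sigma> * (jap l powr \<sigma> * cmod (x l))) * (jap (j - l) powr \<sigma> * cmod (y (j - l))))"
proof -
  have "jap j powr \<sigma> * cmod e \<le> (\<Sum>l\<in>L. jap j powr \<sigma> * (cmod (x l) * cmod (y (j - l))))"
    unfolding sum_distrib_left[symmetric] by (intro mult_left_mono assms) auto
  also have "\<dots> \<le> (\<Sum>l\<in>L. (2 powr \<sigma> * (jap l powr \<sigma> * jap (j - l) powr \<sigma>)) * (cmod (x l) * cmod (y (j - l))))"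
    by (intro sum_mono mult_right_mono jap_powr_conv assms) auto
  finally show ?thesis
    by (simp add: mult_ac)
qed

text \<open>Young's inequality for l^1 and l^2, after the weight has been distributed over the
  factors. The last hypothesis asks only for a finite range of summation that may depend on
  \<open>J\<close>, since the l^1 factor may have infinitely many modes.\<close>

lemma sob_le_conv:
  assumes x: "wiener_le \<sigma> x A" and y: "sob_le \<sigma> y B" and "0 \<le> \<sigma>"
    and e: "\<And>J. finite J \<Longrightarrow> \<exists>L. finite L \<and> (\<forall>j\<in>J. cmod (e j) \<le> (\<Sum>l\<in>L. cmod (x l) * cmod (y (j - l))))"
  shows "sob_le \<sigma> e (2 powr \<sigma> * A * B)"
proof (rule sob_leI)
  fix J :: "int set" assume J: "finite J"
  then obtain L where L: "finite L" "\<And>j. j \<in> J \<Longrightarrow> cmod (e j) \<le> (\<Sum>l\<in>L. cmod (x l) * cmod (y (j - l)))"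
    using e by metis
  have "L2_set (\<lambda>j. jap j powr \<sigma> * cmod (e j)) J
      \<le> L2_set (\<lambda>j. \<Sum>l\<in>L. (2 powr \<sigma> * (jap l powr \<sigma> * cmod (x l))) * (jap (j - l) powr \<sigma> * cmod (y (j - l)))) J"
    by (intro L2_set_mono conv_term_le L) (use assms in auto)
  also have "\<dots> \<le> (\<Sum>l\<in>L. (2 powr \<sigma> * (jap l powr \<sigma> * cmod (x l))) * L2_set (\<lambda>j. jap (j - l) powr \<sigma> * cmod (y (j - l))) J)"
    by (rule order.trans[OF L2_set_sum_le[OF L(1)]]) (simp add: L2_set_right_distrib)
  also have "\<dots> \<le> (\<Sum>l\<in>L. (2 powr \<sigma> * (jap l powr \<sigma> * cmod (x l))) * B)"
  proof (intro sum_mono mult_left_mono)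
    fix l
    show "L2_set (\<lambda>j. jap (j - l) powr \<sigma> * cmod (y (j - l))) J \<le> B"
      using L2_set_shift[of "\<lambda>j. jap j powr \<sigma> * cmod (y j)" l J] sob_leD[OF y, of "(\<lambda>j. j - l) ` J"] J by simp
  qed auto
  also have "\<dots> = 2 powr \<sigma> * (\<Sum>l\<in>L. jap l powr \<sigma> * cmod (x l)) * B"
    by (simp add: sum_distrib_left sum_distrib_right mult.assoc)
  also have "\<dots> \<le> 2 powr \<sigma> * A * B"
    by (intro mult_right_mono mult_left_mono wiener_leD[OF x L(1)] sob_le_nonneg[OF y]) auto
  finally show "L2_set (\<lambda>j. jap j powr \<sigma> * cmod (e j)) J \<le> 2 powr \<sigma> * A * B" .
qed

lemma wiener_le_conv:
  assumes x: "wiener_le \<sigma> x A" and y: "wiener_le \<sigma> y B" and "0 \<le> \<sigma>"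
    and e: "\<And>J. finite J \<Longrightarrow> \<exists>L. finite L \<and> (\<forall>j\<in>J. cmod (e j) \<le> (\<Sum>l\<in>L. cmod (x l) * cmod (y (j - l))))"
  shows "wiener_le \<sigma> e (2 powr \<sigma> * A * B)"
proof (rule wiener_leI)
  fix J :: "int set" assume J: "finite J"
  then obtain L where L: "finite L" "\<And>j. j \<in> J \<Longrightarrow> cmod (e j) \<le> (\<Sum>l\<in>L. cmod (x l) * cmod (y (j - l)))"
    using e by metis
  have "(\<Sum>j\<in>J. jap j powr \<sigma> * cmod (e j))
      \<le> (\<Sum>j\<in>J. \<Sum>l\<in>L. (2 powr \<sigma> * (jap l powr \<sigma> * cmod (x l))) * (jap (j - l) powr \<sigma> * cmod (y (j - l))))"
    by (intro sum_mono conv_term_le L) (use assms in auto)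
  also have "\<dots> = (\<Sum>l\<in>L. (2 powr \<sigma> * (jap l powr \<sigma> * cmod (x l))) * (\<Sum>j\<in>J. jap (j - l) powr \<sigma> * cmod (y (j - l))))"
    by (subst sum.swap) (simp add: sum_distrib_left)
  also have "\<dots> \<le> (\<Sum>l\<in>L. (2 powr \<sigma> * (jap l powr \<sigma> * cmod (x l))) * B)"
  proof (intro sum_mono mult_left_mono)
    fix l
    have "(\<Sum>j\<in>J. jap (j - l) powr \<sigma> * cmod (y (j - l))) = (\<Sum>j\<in>(\<lambda>j. j - l) ` J. jap j powr \<sigma> * cmod (y j))"
      by (subst sum.reindex) (auto simp: inj_on_def)
    then show "(\<Sum>j\<in>J. jap (j - l) powr \<sigma> * cmod (y (j - l))) \<le> B"
      using wiener_leD[OF y, of "(\<lambda>j. j - l) ` J"] J by simp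
  qed auto
  also have "\<dots> = 2 powr \<sigma> * (\<Sum>l\<in>L. jap l powr \<sigma> * cmod (x l)) * B"
    by (simp add: sum_distrib_left sum_distrib_right mult.assoc)
  also have "\<dots> \<le> 2 powr \<sigma> * A * B"
    by (intro mult_right_mono mult_left_mono wiener_leD[OF x L(1)] wiener_le_nonneg[OF y]) auto
  finally show "(\<Sum>j\<in>J. jap j powr \<sigma> * cmod (e j)) \<le> 2 powr \<sigma> * A * B" .
qed

section \<open>Coefficients of continuous periodic functions\<close>

definition torus_cont :: "(real \<Rightarrow> real) \<Rightarrow> bool" where
  "torus_cont v \<longleftrightarrow> torus_fun v \<and> continuous_on UNIV v"

lemma torus_cont_measurable: "torus_cont v \<Longrightarrow> v \<in> borel_measurable borel"
  by (auto simp: torus_cont_def intro: borel_measurable_continuous_onI)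

lemma torus_cont_bounded:
  assumes "torus_cont v"
  obtains B where "0 \<le> B" "\<And>x. \<bar>v x\<bar> \<le> B"
  using torus_fun_bounded assms by (metis torus_cont_def)

lemma torus_cont_add: "torus_cont v \<Longrightarrow> torus_cont w \<Longrightarrow> torus_cont (\<lambda>x. v x + w x)"
  and torus_cont_diff: "torus_cont v \<Longrightarrow> torus_cont w \<Longrightarrow> torus_cont (\<lambda>x. v x - w x)"
  and torus_cont_mult: "torus_cont v \<Longrightarrow> torus_cont w \<Longrightarrow> torus_cont (\<lambda>x. v x * w x)"
  by (auto simp: torus_cont_def torus_fun_def intro!: continuous_intros)

lemma fourier_coeff_add:
  assumes "torus_cont v" "torus_cont w"
  shows "fourier_coeff (\<lambda>x. v x + w x) j = fourier_coeff v j + fourier_coeff w j"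
proof -
  note [measurable] = assms[THEN torus_cont_measurable]
  obtain B B' where "\<And>x. \<bar>v x\<bar> \<le> B" "\<And>x. \<bar>w x\<bar> \<le> B'"
    using assms torus_cont_bounded by metis
  then show ?thesis
    unfolding fourier_coeff_cfc of_real_add by (intro cfc_add[where B = B and B' = B']) auto
qed

lemma fourier_coeff_cmult: "fourier_coeff (\<lambda>x. z * v x) j = of_real z * fourier_coeff v j"
  by (simp add: fourier_coeff_cfc cfc_mult_left)

lemma fourier_coeff_diff:
  assumes "torus_cont v" "torus_cont w"
  shows "fourier_coeff (\<lambda>x. v x - w x) j = fourier_coeff v j - fourier_coeff w j"
proof -
  have "torus_cont (\<lambda>x. - 1 * w x)"
    using assms(2) by (auto simp: torus_cont_def torus_fun_def intro!: continuous_intros)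
  from fourier_coeff_add[OF assms(1) this, of j] show ?thesis
    unfolding fourier_coeff_cmult by simp
qed

lemma sob_le_0_bessel:
  assumes "torus_cont v" "\<And>x. \<bar>v x\<bar> \<le> B"
  shows "sob_le 0 (fourier_coeff v) B"
proof (rule sob_leI)
  fix J :: "int set" assume J: "finite J"
  have "(\<Sum>j\<in>J. (cmod (fourier_coeff v j))\<^sup>2) \<le> B\<^sup>2"
    unfolding fourier_coeff_cfc
    by (rule bessel_inequality) (use assms J torus_cont_measurable[OF assms(1)] in auto)
  moreover have "0 \<le> B"
    using assms(2)[of 0] abs_ge_zero order.trans by blast
  ultimately show "L2_set (\<lambda>j. jap j powr 0 * cmod (fourier_coeff v j)) J \<le> B"
    by (simp add: L2_set_def real_le_lsqrt)
qed

text \<open>Since \<open>jap j\<close> is at most 1 + |j|, Bessel's inequality for the function and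
  for its derivative suffices. Compositions with smooth functions, which are accessible only
  pointwise, enter the Fourier side in this way.\<close>

lemma sob_le_1_bessel:
  assumes V: "torus_fun V" "\<And>x. (V has_real_derivative v x) (at x)" and v: "continuous_on UNIV v"
    and B: "\<And>x. \<bar>V x\<bar> \<le> B" "\<And>x. \<bar>v x\<bar> \<le> B'"
  shows "sob_le 1 (fourier_coeff V) (B + B')"
proof -
  have "torus_cont V"
    using V by (auto simp: torus_cont_def intro!: continuous_at_imp_continuous_on DERIV_isCont)
  then have 0: "sob_le 0 (fourier_coeff V) B"
    using B by (intro sob_le_0_bessel)
  have "torus_cont v"
    using v torus_fun_deriv[OF V] by (simp add: torus_cont_def)
  then have 1: "sob_le 0 (fourier_coeff v) B'"
    using B by (intro sob_le_0_bessel)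
  show ?thesis
  proof (rule sob_leI)
    fix J :: "int set" assume J: "finite J"
    have "L2_set (\<lambda>j. jap j powr 1 * cmod (fourier_coeff V j)) J
      \<le> L2_set (\<lambda>j. jap j powr 0 * cmod (fourier_coeff V j) + jap j powr 0 * cmod (fourier_coeff v j)) J"
    proof (rule L2_set_mono)
      fix j
      have "jap j * cmod (fourier_coeff V j) \<le> (1 + \<bar>of_int j\<bar>) * cmod (fourier_coeff V j)"
        by (intro mult_right_mono jap_le_one_plus) auto
      then show "jap j powr 1 * cmod (fourier_coeff V j)
          \<le> jap j powr 0 * cmod (fourier_coeff V j) + jap j powr 0 * cmod (fourier_coeff v j)"
        by (simp add: fourier_coeff_deriv[OF V v] norm_mult algebra_simps)
    qed auto
    also have "\<dots> \<le> B + B'"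
      by (intro order.trans[OF L2_set_triangle_ineq] add_mono sob_leD[OF 0 J] sob_leD[OF 1 J])
    finally show "L2_set (\<lambda>j. jap j powr 1 * cmod (fourier_coeff V j)) J \<le> B + B'" .
  qed
qed

text \<open>The way back from coefficients to sup bounds. It rests on the pointwise convergence of
  the Fourier series to \<open>v\<close>.\<close>

lemma torus_cont_abs_le:
  assumes "torus_cont v" "wiener_le 0 (fourier_coeff v) B"
  shows "\<bar>v x\<bar> \<le> B"
proof -
  have B: "(\<Sum>j\<in>J. cmod (fourier_coeff v j)) \<le> B" if "finite J" for J
    using wiener_leD[OF assms(2) that] by simp
  have "(\<lambda>N. \<Sum>j\<in>{- int N..int N}. fourier_coeff v j * cis (of_int j * x)) \<longlonglongrightarrow> of_real (v x)"
    by (rule fourier_series_abs_summable) (use assms B in \<open>auto simp: torus_cont_def\<close>)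
  then have "cmod (of_real (v x)) \<le> B"
  proof (rule LIMSEQ_le_const2[OF tendsto_norm], intro exI allI impI)
    fix N
    show "cmod (\<Sum>j\<in>{- int N..int N}. fourier_coeff v j * cis (of_int j * x)) \<le> B"
      by (rule order.trans[OF norm_sum]) (use B in \<open>simp add: norm_mult\<close>)
  qed
  then show ?thesis by simp
qed

section \<open>Trigonometric polynomials and Fourier multipliers\<close>

lemma trig_polys_coeffs:
  assumes "v \<in> trig_polys K"
  shows "of_real (v x) = (\<Sum>j\<in>{- int K..int K}. fourier_coeff v j * cis (of_int j * x))"
    and "\<not> \<bar>j\<bar> \<le> int K \<Longrightarrow> fourier_coeff v j = 0"
proof -
  obtain c where c: "\<And>x. of_real (v x) = (\<Sum>j\<in>{- int K..int K}. c j * cis (of_int j * x))"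
    using assms by (auto simp: trig_polys_def)
  have coeff: "fourier_coeff v j = (if j \<in> {- int K..int K} then c j else 0)" for j
    unfolding fourier_coeff_cfc c by (subst cfc_trig_sum) auto
  show "of_real (v x) = (\<Sum>j\<in>{- int K..int K}. fourier_coeff v j * cis (of_int j * x))"
    unfolding c by (intro sum.cong) (auto simp: coeff)
  show "fourier_coeff v j = 0" if "\<not> \<bar>j\<bar> \<le> int K"
    using that by (auto simp: coeff)
qed

text \<open>Hermitian symmetry makes the sum real, so taking \<open>Re\<close> loses nothing and the
  coefficients can be read off.\<close>

lemma trig_polysI:
  assumes "\<And>j. c (- j) = cnj (c j)" and "\<And>x. v x = Re (\<Sum>j\<in>{- int K..int K}. c j * cis (of_int j * x))"
  shows "v \<in> trig_polys K" and "fourier_coeff v = freq_trunc K c"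
proof -
  have v: "of_real (v x) = (\<Sum>j\<in>{- int K..int K}. c j * cis (of_int j * x))" for x
    unfolding assms(2) by (rule real_trig_sum) (rule assms(1))
  then show "v \<in> trig_polys K"
    by (auto simp: trig_polys_def)
  show "fourier_coeff v = freq_trunc K c"
    unfolding fourier_coeff_cfc v by (subst fun_eq_iff, subst cfc_trig_sum) (auto simp: freq_trunc_def)
qed

lemma trig_polys_Re:
  "v \<in> trig_polys K \<Longrightarrow> v x = Re (\<Sum>j\<in>{- int K..int K}. fourier_coeff v j * cis (of_int j * x))"
  by (metis Re_complex_of_real trig_polys_coeffs(1))

lemma trig_polys_torus_cont:
  assumes "v \<in> trig_polys K"
  shows "torus_cont v"
proof -
  have "cis (of_int j * (x + 2 * pi)) = cis (of_int j * x)" for j :: int and x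
    using cis_multiple_2pi[of "of_int j"] by (simp add: distrib_left mult_ac flip: cis_mult)
  then have "v (x + 2 * pi) = v x" for x
    by (simp only: trig_polys_Re[OF assms])
  then show ?thesis
    using trig_polys_continuous[OF assms] by (auto simp: torus_cont_def torus_fun_def)
qed

lemma trig_polys_deriv:
  assumes "v \<in> trig_polys K"
  shows "deriv v \<in> trig_polys K" and "(v has_real_derivative deriv v x) (at x)"
    and "fourier_coeff (deriv v) = (\<lambda>j. \<i> * of_int j * fourier_coeff v j)"
proof -
  let ?c = "\<lambda>j. \<i> * of_int j * fourier_coeff v j"
  let ?v' = "\<lambda>x. Re (\<Sum>j\<in>{- int K..int K}. ?c j * cis (of_int j * x))"
  have d: "(v has_real_derivative ?v' x) (at x)" for x
  proof -
    have "((\<lambda>x. Re (\<Sum>j\<in>{- int K..int K}. fourier_coeff v j * cis (of_int j * x))) has_vector_derivative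
        Re (\<Sum>j\<in>{- int K..int K}. fourier_coeff v j * (\<i> * of_int j * cis (of_int j * x)))) (at x)"
      by (intro bounded_linear.has_vector_derivative[OF bounded_linear_Re] has_vector_derivative_sum
            has_vector_derivative_mult_right has_vector_derivative_cis)
    moreover have "v = (\<lambda>x. Re (\<Sum>j\<in>{- int K..int K}. fourier_coeff v j * cis (of_int j * x)))"
      using trig_polys_Re[OF assms] by (rule ext)
    ultimately show ?thesis
      by (simp add: has_real_derivative_iff_has_vector_derivative mult_ac)
  qed
  then have v': "deriv v x = ?v' x" for x
    by (rule DERIV_imp_deriv)
  then show "(v has_real_derivative deriv v x) (at x)"
    using d by metis
  have h: "?c (- j) = cnj (?c j)" for j
    by (simp add: fourier_coeff_uminus)
  from trig_polysI[OF h v'] show "deriv v \<in> trig_polys K"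
    "fourier_coeff (deriv v) = (\<lambda>j. \<i> * of_int j * fourier_coeff v j)"
    using trig_polys_coeffs(2)[OF assms] by (auto simp: freq_trunc_def fun_eq_iff)
qed

lemma trig_polys_add: "v \<in> trig_polys K \<Longrightarrow> w \<in> trig_polys K \<Longrightarrow> (\<lambda>x. v x + w x) \<in> trig_polys K"
proof -
  assume v: "v \<in> trig_polys K" and w: "w \<in> trig_polys K"
  show ?thesis
    by (rule trig_polysI(1)[where c = "\<lambda>j. fourier_coeff v j + fourier_coeff w j"])
       (simp_all add: fourier_coeff_uminus trig_polys_Re[OF v] trig_polys_Re[OF w] distrib_right sum.distrib)
qed

lemma trig_polys_cmult: "v \<in> trig_polys K \<Longrightarrow> (\<lambda>x. z * v x) \<in> trig_polys K"
proof -
  assume v: "v \<in> trig_polys K"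
  have "z * v x = Re (of_real z * (\<Sum>j\<in>{- int K..int K}. fourier_coeff v j * cis (of_int j * x)))" for x
    using trig_polys_coeffs(1)[OF v, of x] by (metis Re_complex_of_real of_real_mult)
  then show ?thesis
    by (intro trig_polysI(1)[where c = "\<lambda>j. of_real z * fourier_coeff v j"])
       (simp_all add: fourier_coeff_uminus sum_distrib_left mult.assoc)
qed

lemma trig_polys_diff: "v \<in> trig_polys K \<Longrightarrow> w \<in> trig_polys K \<Longrightarrow> (\<lambda>x. v x - w x) \<in> trig_polys K"
  using trig_polys_add[of v K "\<lambda>x. - 1 * w x"] trig_polys_cmult[of w K "- 1"] by simp

lemma trig_polys_mono: "v \<in> trig_polys K \<Longrightarrow> K \<le> N \<Longrightarrow> v \<in> trig_polys N"
proof -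
  assume v: "v \<in> trig_polys K" and "K \<le> N"
  have "v x = Re (\<Sum>j\<in>{- int N..int N}. fourier_coeff v j * cis (of_int j * x))" for x
    unfolding trig_polys_Re[OF v, of x] using \<open>K \<le> N\<close> trig_polys_coeffs(2)[OF v]
    by (intro arg_cong[where f = Re] sum.mono_neutral_left) (auto simp: abs_le_iff)
  from trig_polysI(1)[OF fourier_coeff_uminus this] show ?thesis .
qed

lemma fourier_coeff_trig_proj_trunc: "fourier_coeff (trig_proj K v) = freq_trunc K (fourier_coeff v)"
  by (rule trig_polysI(2)[where c = "fourier_coeff v"]) (simp_all add: fourier_coeff_uminus trig_proj_def)

lemma fourier_coeff_trig_interp: "fourier_coeff (trig_interp K v) = freq_trunc K (discrete_coeff K v)"
  by (rule trig_polysI(2)[where c = "discrete_coeff K v"]) (simp_all add: discrete_coeff_uminus trig_interp_def)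

lemma omega_mult_trig_polys:
  assumes v: "v \<in> trig_polys K"
  shows "omega_mult m v \<in> trig_polys K"
    and "fourier_coeff (omega_mult m v) = (\<lambda>j. of_real (m (jap j)) * fourier_coeff v j)"
proof -
  have "omega_mult m v x
      = Re (\<Sum>j\<in>{- int K..int K}. (of_real (m (jap j)) * fourier_coeff v j) * cis (of_int j * x))" for x
  proof -
    have "(\<Sum>\<^sub>\<infinity>j\<in>UNIV. of_real (m (jap j)) * fourier_coeff v j * cis (of_int j * x))
        = (\<Sum>\<^sub>\<infinity>j\<in>{- int K..int K}. of_real (m (jap j)) * fourier_coeff v j * cis (of_int j * x))"
      by (rule infsum_cong_neutral) (use trig_polys_coeffs(2)[OF v] in auto)
    then show ?thesis
      by (simp add: omega_mult_def)
  qed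
  from trig_polysI[OF _ this] show "omega_mult m v \<in> trig_polys K"
    "fourier_coeff (omega_mult m v) = (\<lambda>j. of_real (m (jap j)) * fourier_coeff v j)"
    using trig_polys_coeffs(2)[OF v] by (auto simp: fourier_coeff_uminus freq_trunc_def fun_eq_iff)
qed

section \<open>Products as finite convolutions\<close>

lemma fourier_coeff_mult_trig:
  assumes v: "torus_cont v" and w: "w \<in> trig_polys K"
  shows "fourier_coeff (\<lambda>x. v x * w x) j
    = (\<Sum>l\<in>{- int K..int K}. fourier_coeff w l * fourier_coeff v (j - l))"
proof -
  obtain B where B: "\<And>x. \<bar>v x\<bar> \<le> B"
    using torus_cont_bounded[OF v] by metis
  define c where "c = fourier_coeff w"
  have "of_real (w x) = (\<Sum>l\<in>{- int K..int K}. c l * cis (of_int l * x))" for x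
    unfolding c_def by (rule trig_polys_coeffs(1)[OF w])
  then have "fourier_coeff (\<lambda>x. v x * w x) j
      = cfc (\<lambda>x. of_real (v x) * (\<Sum>l\<in>{- int K..int K}. c l * cis (of_int l * x))) j"
    by (simp add: fourier_coeff_cfc)
  also have "\<dots> = (\<Sum>l\<in>{- int K..int K}. c l * cfc (\<lambda>x. of_real (v x)) (j - l))"
    by (intro cfc_mult_sum[where m = "\<lambda>l. l" and B = B]) (use torus_cont_measurable[OF v] B in auto)
  finally show ?thesis
    by (simp add: c_def fourier_coeff_cfc)
qed

lemma conv_bound_right:
  assumes v: "torus_cont v" and w: "w \<in> trig_polys K"
  shows "\<exists>L. finite L \<and> (\<forall>j\<in>J. cmod (fourier_coeff (\<lambda>x. v x * w x) j)
      \<le> (\<Sum>l\<in>L. cmod (fourier_coeff w l) * cmod (fourier_coeff v (j - l))))"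
  by (rule exI[of _ "{- int K..int K}"])
     (auto simp: fourier_coeff_mult_trig[OF assms] norm_mult intro!: order.trans[OF norm_sum])

text \<open>Here the summation runs over the modes of \<open>v\<close>, of which there may be
  infinitely many. For a finite \<open>J\<close> only those within distance \<open>K\<close> of
  \<open>J\<close> meet a mode of \<open>w\<close>, so the range depends on
  \<open>J\<close>.\<close>

lemma conv_bound_left:
  assumes v: "torus_cont v" and w: "w \<in> trig_polys K" and J: "finite J"
  shows "\<exists>L. finite L \<and> (\<forall>j\<in>J. cmod (fourier_coeff (\<lambda>x. v x * w x) j)
      \<le> (\<Sum>l\<in>L. cmod (fourier_coeff v l) * cmod (fourier_coeff w (j - l))))"
proof (intro exI conjI ballI)
  define L where "L = (\<Union>j\<in>J. (\<lambda>l. j - l) ` {- int K..int K})"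
  show "finite L"
    using J by (simp add: L_def)
  fix j assume "j \<in> J"
  have "fourier_coeff (\<lambda>x. v x * w x) j
      = (\<Sum>l\<in>(\<lambda>l. j - l) ` {- int K..int K}. fourier_coeff v l * fourier_coeff w (j - l))"
    unfolding fourier_coeff_mult_trig[OF v w] by (subst sum.reindex) (auto simp: inj_on_def mult.commute)
  also have "\<dots> = (\<Sum>l\<in>L. fourier_coeff v l * fourier_coeff w (j - l))"
  proof (rule sum.mono_neutral_left)
    show "\<forall>l\<in>L - (\<lambda>l. j - l) ` {- int K..int K}. fourier_coeff v l * fourier_coeff w (j - l) = 0"
    proof
      fix l assume "l \<in> L - (\<lambda>l. j - l) ` {- int K..int K}"
      then have "\<not> \<bar>j - l\<bar> \<le> int K"
        by (auto simp: image_iff abs_le_iff dest!: bspec[of _ _ "j - l"])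
      then show "fourier_coeff v l * fourier_coeff w (j - l) = 0"
        using trig_polys_coeffs(2)[OF w] by simp
    qed
  qed (use \<open>finite L\<close> \<open>j \<in> J\<close> in \<open>auto simp: L_def\<close>)
  finally show "cmod (fourier_coeff (\<lambda>x. v x * w x) j)
      \<le> (\<Sum>l\<in>L. cmod (fourier_coeff v l) * cmod (fourier_coeff w (j - l)))"
    by (simp add: order.trans[OF norm_sum] norm_mult)
qed

lemma wiener_le_mult:
  assumes "torus_cont v" "w \<in> trig_polys K" "0 \<le> \<sigma>"
    and "wiener_le \<sigma> (fourier_coeff v) A" "wiener_le \<sigma> (fourier_coeff w) B"
  shows "wiener_le \<sigma> (fourier_coeff (\<lambda>x. v x * w x)) (2 powr \<sigma> * A * B)"
  using wiener_le_conv[OF assms(4,5,3)] conv_bound_left[OF assms(1,2)] by blast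

lemma sob_le_mult_wiener_sob:
  assumes "torus_cont v" "w \<in> trig_polys K" "0 \<le> \<sigma>"
    and "wiener_le \<sigma> (fourier_coeff v) A" "sob_le \<sigma> (fourier_coeff w) B"
  shows "sob_le \<sigma> (fourier_coeff (\<lambda>x. v x * w x)) (2 powr \<sigma> * A * B)"
  using sob_le_conv[OF assms(4,5,3)] conv_bound_left[OF assms(1,2)] by blast

lemma sob_le_mult_sob_wiener:
  assumes "torus_cont v" "w \<in> trig_polys K" "0 \<le> \<sigma>"
    and "sob_le \<sigma> (fourier_coeff v) A" "wiener_le \<sigma> (fourier_coeff w) B"
  shows "sob_le \<sigma> (fourier_coeff (\<lambda>x. v x * w x)) (2 powr \<sigma> * B * A)"
  using sob_le_conv[OF assms(5,4,3)] conv_bound_right[OF assms(1,2)] by blast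

section \<open>Composition with smooth functions\<close>

definition partial_1 :: "(real \<times> real \<Rightarrow> real) \<Rightarrow> real \<times> real \<Rightarrow> real" where
  "partial_1 G p = frechet_derivative G (at p) (1, 0)"

definition partial_2 :: "(real \<times> real \<Rightarrow> real) \<Rightarrow> real \<times> real \<Rightarrow> real" where
  "partial_2 G p = frechet_derivative G (at p) (0, 1)"

lemma smooth_fun_frechet:
  assumes "smooth_fun G"
  shows "smooth_fun (\<lambda>p. frechet_derivative G (at p) v)"
  unfolding smooth_fun_def
proof
  fix n
  have "C_diff (Suc n) G"
    using assms by (simp add: smooth_fun_def del: C_diff.simps)
  then show "C_diff n (\<lambda>p. frechet_derivative G (at p) v)"
    by simp
qed

lemma smooth_fun_partial_1: "smooth_fun G \<Longrightarrow> smooth_fun (partial_1 G)"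
  and smooth_fun_partial_2: "smooth_fun G \<Longrightarrow> smooth_fun (partial_2 G)"
  unfolding partial_1_def[abs_def] partial_2_def[abs_def] by (erule smooth_fun_frechet)+

lemma smooth_fun_continuous:
  assumes "smooth_fun G"
  shows "continuous_on A G"
proof -
  have "C_diff 0 G"
    using assms by (simp add: smooth_fun_def del: C_diff.simps)
  then show ?thesis
    using continuous_on_subset[of UNIV G A] by simp
qed

lemma smooth_fun_has_derivative_frechet:
  assumes "smooth_fun G"
  shows "(G has_derivative frechet_derivative G (at p)) (at p)"
proof -
  have "C_diff (Suc 0) G"
    using assms by (simp add: smooth_fun_def del: C_diff.simps)
  then show ?thesis
    by (simp flip: frechet_derivative_works)
qed

lemma smooth_fun_has_derivative:
  assumes "smooth_fun G"
  shows "(G has_derivative (\<lambda>d. fst d * partial_1 G p + snd d * partial_2 G p)) (at p)"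
proof -
  note d = smooth_fun_has_derivative_frechet[OF assms, of p]
  interpret linear "frechet_derivative G (at p)"
    by (rule has_derivative_linear[OF d])
  have "frechet_derivative G (at p) d = fst d * partial_1 G p + snd d * partial_2 G p" for d
  proof -
    have "frechet_derivative G (at p) d
        = frechet_derivative G (at p) (fst d *\<^sub>R (1, 0) + snd d *\<^sub>R (0, 1))"
      by simp
    also have "\<dots> = fst d * partial_1 G p + snd d * partial_2 G p"
      by (simp only: add scale partial_1_def partial_2_def real_scaleR_def)
    finally show ?thesis .
  qed
  then show ?thesis
    using d by presburger
qed

lemma smooth_fun_comp_fst:
  fixes a :: "real \<Rightarrow> real"
  assumes "smooth_fun a"
  shows "smooth_fun (\<lambda>p::real \<times> real. a (fst p))"
proof -
  have "C_diff n (\<lambda>p::real \<times> real. a (fst p))" if "smooth_fun a" for n and a :: "real \<Rightarrow> real"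
    using that
  proof (induction n arbitrary: a)
    case 0
    then show ?case
      by (auto intro!: continuous_on_compose2[OF smooth_fun_continuous[of a UNIV]] continuous_intros)
  next
    case (Suc n)
    have d: "((\<lambda>p::real \<times> real. a (fst p)) has_derivative (\<lambda>v. frechet_derivative a (at (fst x)) (fst v))) (at x)" for x
      by (rule has_derivative_compose[OF has_derivative_fst[OF has_derivative_ident]
            smooth_fun_has_derivative_frechet[OF Suc.prems]])
    then have "frechet_derivative (\<lambda>p::real \<times> real. a (fst p)) (at x) = (\<lambda>v. frechet_derivative a (at (fst x)) (fst v))" for x
      by (rule frechet_derivative_at[symmetric])
    moreover have "(\<lambda>p::real \<times> real. a (fst p)) differentiable (at x)" for x
      using d by (rule differentiableI)
    ultimately show ?case
      using Suc.IH[OF smooth_fun_frechet[OF Suc.prems]] by simp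
  qed
  then show ?thesis
    using assms by (simp add: smooth_fun_def)
qed

definition box2 :: "real \<Rightarrow> (real \<times> real) set" where
  "box2 R = {p. \<bar>fst p\<bar> \<le> R \<and> \<bar>snd p\<bar> \<le> R}"

lemma box2_cbox: "box2 R = cbox (- R, - R) (R, R)"
  by (auto simp: box2_def cbox_Pair_eq abs_le_iff)

lemma convex_box2: "convex (box2 R)"
  unfolding box2_cbox by (rule convex_box)

lemma smooth_fun_bounded_box2:
  assumes "smooth_fun G"
  obtains B where "0 \<le> B" "\<And>p. p \<in> box2 R \<Longrightarrow> \<bar>G p\<bar> \<le> B"
proof -
  have "compact (G ` box2 R)"
    unfolding box2_cbox by (intro compact_continuous_image smooth_fun_continuous assms compact_cbox)
  then obtain B where "\<forall>y\<in>G ` box2 R. norm y \<le> B"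
    using compact_imp_bounded bounded_iff by metis
  then show ?thesis
    by (intro that[of "\<bar>B\<bar>"]) auto
qed

text \<open>The mean value theorem on the segment from \<open>q\<close> to \<open>p\<close>. The
  intermediate point is kept close to \<open>q\<close> because the Taylor estimate compares partial
  derivatives at \<open>z\<close> and at \<open>q\<close>.\<close>

lemma smooth_fun_mvt:
  assumes G: "smooth_fun G" and "p \<in> box2 R" "q \<in> box2 R"
  obtains z where "z \<in> box2 R" "\<bar>fst z - fst q\<bar> \<le> \<bar>fst p - fst q\<bar>" "\<bar>snd z - snd q\<bar> \<le> \<bar>snd p - snd q\<bar>"
    "G p - G q = (fst p - fst q) * partial_1 G z + (snd p - snd q) * partial_2 G z"
proof -
  define \<gamma> where "\<gamma> t = q + t *\<^sub>R (p - q)" for t :: real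
  have \<gamma>: "(\<gamma> has_derivative (\<lambda>t. t *\<^sub>R (p - q))) (at t)" for t
    unfolding \<gamma>_def by (auto intro!: derivative_eq_intros)
  have d: "((\<lambda>t. G (\<gamma> t)) has_derivative
      (\<lambda>t. fst (t *\<^sub>R (p - q)) * partial_1 G (\<gamma> x) + snd (t *\<^sub>R (p - q)) * partial_2 G (\<gamma> x))) (at x within {0..1})" for x
    by (rule has_derivative_at_withinI) (rule has_derivative_compose[OF \<gamma> smooth_fun_has_derivative[OF G]])
  from mvt_very_simple[OF zero_le_one d] obtain t where t: "t \<in> {0..1}"
    and eq: "G (\<gamma> 1) - G (\<gamma> 0) = (fst p - fst q) * partial_1 G (\<gamma> t) + (snd p - snd q) * partial_2 G (\<gamma> t)"
    by auto
  have "\<gamma> t = (1 - t) *\<^sub>R q + t *\<^sub>R p"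
    by (simp add: \<gamma>_def algebra_simps)
  then have "\<gamma> t \<in> box2 R"
    using convexD[OF convex_box2, of q R p "1 - t" t] assms t by simp
  moreover have "\<bar>fst (\<gamma> t) - fst q\<bar> \<le> \<bar>fst p - fst q\<bar>" "\<bar>snd (\<gamma> t) - snd q\<bar> \<le> \<bar>snd p - snd q\<bar>"
    using t by (auto simp: \<gamma>_def abs_mult mult_left_le_one_le)
  ultimately show ?thesis
    using that[of "\<gamma> t"] eq by (simp add: \<gamma>_def)
qed

lemma smooth_fun_Lipschitz_box2:
  assumes "smooth_fun G"
  obtains B where "0 \<le> B"
    "\<And>p q. p \<in> box2 R \<Longrightarrow> q \<in> box2 R \<Longrightarrow> \<bar>G p - G q\<bar> \<le> B * (\<bar>fst p - fst q\<bar> + \<bar>snd p - snd q\<bar>)"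
proof -
  obtain B1 where B1: "0 \<le> B1" "\<And>p. p \<in> box2 R \<Longrightarrow> \<bar>partial_1 G p\<bar> \<le> B1"
    using smooth_fun_bounded_box2[OF smooth_fun_partial_1[OF assms]] by metis
  obtain B2 where B2: "0 \<le> B2" "\<And>p. p \<in> box2 R \<Longrightarrow> \<bar>partial_2 G p\<bar> \<le> B2"
    using smooth_fun_bounded_box2[OF smooth_fun_partial_2[OF assms]] by metis
  show ?thesis
  proof (rule that[of "B1 + B2"])
    fix p q assume "p \<in> box2 R" "q \<in> box2 R"
    from smooth_fun_mvt[OF assms this] obtain z where z: "z \<in> box2 R"
      "G p - G q = (fst p - fst q) * partial_1 G z + (snd p - snd q) * partial_2 G z"
      by metis
    have "\<bar>G p - G q\<bar> \<le> \<bar>fst p - fst q\<bar> * \<bar>partial_1 G z\<bar> + \<bar>snd p - snd q\<bar> * \<bar>partial_2 G z\<bar>"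
      unfolding z(2) by (rule order.trans[OF abs_triangle_ineq]) (simp add: abs_mult)
    also have "\<dots> \<le> \<bar>fst p - fst q\<bar> * (B1 + B2) + \<bar>snd p - snd q\<bar> * (B1 + B2)"
      using B1 B2 z(1) by (intro add_mono mult_left_mono) (auto simp: add_increasing add_increasing2)
    finally show "\<bar>G p - G q\<bar> \<le> (B1 + B2) * (\<bar>fst p - fst q\<bar> + \<bar>snd p - snd q\<bar>)"
      by (simp add: algebra_simps)
  qed (use B1 B2 in auto)
qed

lemma smooth_fun_taylor_box2:
  assumes "smooth_fun G"
  obtains B where "0 \<le> B"
    "\<And>p q. p \<in> box2 R \<Longrightarrow> q \<in> box2 R \<Longrightarrow>
      \<bar>G p - G q - ((fst p - fst q) * partial_1 G q + (snd p - snd q) * partial_2 G q)\<bar>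
        \<le> B * (\<bar>fst p - fst q\<bar> + \<bar>snd p - snd q\<bar>)\<^sup>2"
proof -
  obtain B1 where B1: "0 \<le> B1" "\<And>p q. p \<in> box2 R \<Longrightarrow> q \<in> box2 R \<Longrightarrow>
      \<bar>partial_1 G p - partial_1 G q\<bar> \<le> B1 * (\<bar>fst p - fst q\<bar> + \<bar>snd p - snd q\<bar>)"
    using smooth_fun_Lipschitz_box2[OF smooth_fun_partial_1[OF assms]] by metis
  obtain B2 where B2: "0 \<le> B2" "\<And>p q. p \<in> box2 R \<Longrightarrow> q \<in> box2 R \<Longrightarrow>
      \<bar>partial_2 G p - partial_2 G q\<bar> \<le> B2 * (\<bar>fst p - fst q\<bar> + \<bar>snd p - snd q\<bar>)"
    using smooth_fun_Lipschitz_box2[OF smooth_fun_partial_2[OF assms]] by metis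
  show ?thesis
  proof (rule that[of "B1 + B2"])
    fix p q assume pq: "p \<in> box2 R" "q \<in> box2 R"
    define x y where "x = \<bar>fst p - fst q\<bar>" and "y = \<bar>snd p - snd q\<bar>"
    have xy: "0 \<le> x" "0 \<le> y" by (auto simp: x_def y_def)
    from smooth_fun_mvt[OF assms pq] obtain z where z: "z \<in> box2 R"
      "\<bar>fst z - fst q\<bar> \<le> x" "\<bar>snd z - snd q\<bar> \<le> y"
      "G p - G q = (fst p - fst q) * partial_1 G z + (snd p - snd q) * partial_2 G z"
      unfolding x_def y_def by metis
    have 1: "\<bar>partial_1 G z - partial_1 G q\<bar> \<le> B1 * (x + y)"
      using B1(2)[OF z(1) pq(2)] mult_left_mono[OF add_mono[OF z(2,3)] B1(1)] by linarith
    have 2: "\<bar>partial_2 G z - partial_2 G q\<bar> \<le> B2 * (x + y)"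
      using B2(2)[OF z(1) pq(2)] mult_left_mono[OF add_mono[OF z(2,3)] B2(1)] by linarith
    have "G p - G q - ((fst p - fst q) * partial_1 G q + (snd p - snd q) * partial_2 G q)
        = (fst p - fst q) * (partial_1 G z - partial_1 G q) + (snd p - snd q) * (partial_2 G z - partial_2 G q)"
      unfolding z(4) by (simp add: algebra_simps)
    also have "\<bar>\<dots>\<bar> \<le> x * \<bar>partial_1 G z - partial_1 G q\<bar> + y * \<bar>partial_2 G z - partial_2 G q\<bar>"
      by (rule order.trans[OF abs_triangle_ineq]) (simp add: abs_mult x_def y_def)
    also have "\<dots> \<le> x * (B1 * (x + y)) + y * (B2 * (x + y))"
      by (intro add_mono mult_left_mono 1 2 xy)
    also have "\<dots> \<le> (x + y) * (B1 * (x + y)) + (x + y) * (B2 * (x + y))"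
      using xy B1 B2 by (intro add_mono mult_right_mono) auto
    also have "\<dots> = (B1 + B2) * (x + y)\<^sup>2"
      by (simp add: power2_eq_square algebra_simps)
    finally show "\<bar>G p - G q - ((fst p - fst q) * partial_1 G q + (snd p - snd q) * partial_2 G q)\<bar>
        \<le> (B1 + B2) * (\<bar>fst p - fst q\<bar> + \<bar>snd p - snd q\<bar>)\<^sup>2"
      by (simp only: x_def y_def)
  qed (use B1 B2 in auto)
qed

text \<open>Expand at \<open>q\<close> towards \<open>p\<close> and towards \<open>r\<close>. The
  linear terms add up to the second difference of the argument, and the remainders are
  quadratic.\<close>

lemma smooth_fun_second_difference:
  assumes "smooth_fun G"
  obtains B where "0 \<le> B"
    "\<And>p q r. p \<in> box2 R \<Longrightarrow> q \<in> box2 R \<Longrightarrow> r \<in> box2 R \<Longrightarrow>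
      \<bar>G p + G r - 2 * G q\<bar> \<le> B * (\<bar>fst p + fst r - 2 * fst q\<bar> + \<bar>snd p + snd r - 2 * snd q\<bar>
        + (\<bar>fst p - fst q\<bar> + \<bar>snd p - snd q\<bar>)\<^sup>2 + (\<bar>fst r - fst q\<bar> + \<bar>snd r - snd q\<bar>)\<^sup>2)"
proof -
  obtain B where B: "0 \<le> B" "\<And>p q. p \<in> box2 R \<Longrightarrow> q \<in> box2 R \<Longrightarrow>
      \<bar>G p - G q - ((fst p - fst q) * partial_1 G q + (snd p - snd q) * partial_2 G q)\<bar>
        \<le> B * (\<bar>fst p - fst q\<bar> + \<bar>snd p - snd q\<bar>)\<^sup>2"
    using smooth_fun_taylor_box2[OF assms] by metis
  obtain B1 where B1: "0 \<le> B1" "\<And>p. p \<in> box2 R \<Longrightarrow> \<bar>partial_1 G p\<bar> \<le> B1"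
    using smooth_fun_bounded_box2[OF smooth_fun_partial_1[OF assms]] by metis
  obtain B2 where B2: "0 \<le> B2" "\<And>p. p \<in> box2 R \<Longrightarrow> \<bar>partial_2 G p\<bar> \<le> B2"
    using smooth_fun_bounded_box2[OF smooth_fun_partial_2[OF assms]] by metis
  show ?thesis
  proof (rule that[of "B + B1 + B2"])
    fix p q r assume pqr: "p \<in> box2 R" "q \<in> box2 R" "r \<in> box2 R"
    let ?x = "\<bar>fst p + fst r - 2 * fst q\<bar>" and ?y = "\<bar>snd p + snd r - 2 * snd q\<bar>"
    let ?d = "(\<bar>fst p - fst q\<bar> + \<bar>snd p - snd q\<bar>)\<^sup>2" and ?e = "(\<bar>fst r - fst q\<bar> + \<bar>snd r - snd q\<bar>)\<^sup>2"
    let ?T = "\<lambda>p. G p - G q - ((fst p - fst q) * partial_1 G q + (snd p - snd q) * partial_2 G q)"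
    have "G p + G r - 2 * G q = ?T p + ?T r
        + ((fst p + fst r - 2 * fst q) * partial_1 G q + (snd p + snd r - 2 * snd q) * partial_2 G q)"
      by (simp add: algebra_simps)
    then have "\<bar>G p + G r - 2 * G q\<bar> \<le> \<bar>?T p\<bar> + \<bar>?T r\<bar> + (?x * \<bar>partial_1 G q\<bar> + ?y * \<bar>partial_2 G q\<bar>)"
      unfolding abs_mult[symmetric] by linarith
    also have "\<dots> \<le> B * ?d + B * ?e + (?x * B1 + ?y * B2)"
      using B1 B2 pqr by (intro add_mono B mult_left_mono) auto
    also have "\<dots> \<le> (B + B1 + B2) * ?d + (B + B1 + B2) * ?e + (?x * (B + B1 + B2) + ?y * (B + B1 + B2))"
      using B(1) B1(1) B2(1) by (intro add_mono mult_right_mono mult_left_mono) auto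
    finally show "\<bar>G p + G r - 2 * G q\<bar> \<le> (B + B1 + B2) * (?x + ?y + ?d + ?e)"
      by (simp add: algebra_simps)
  qed (use B B1 B2 in auto)
qed

text \<open>Composition with the first-order jet. It covers a(u) and g(u, u_x) at once, and
  differentiation only produces compositions of the same form times q' and q''.\<close>

definition comp_jet :: "(real \<times> real \<Rightarrow> real) \<Rightarrow> (real \<Rightarrow> real) \<Rightarrow> real \<Rightarrow> real" where
  "comp_jet G q x = G (q x, deriv q x)"

lemma trig_polys_has_derivative_jet:
  assumes "smooth_fun G" and q: "q \<in> trig_polys K"
  shows "(comp_jet G q has_real_derivative
    comp_jet (partial_1 G) q x * deriv q x + comp_jet (partial_2 G) q x * deriv (deriv q) x) (at x)"
proof -
  have "((\<lambda>x. (q x, deriv q x)) has_derivative (\<lambda>h. (deriv q x * h, deriv (deriv q) x * h))) (at x)"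
    using trig_polys_deriv(2)[OF q, of x] trig_polys_deriv(2)[OF trig_polys_deriv(1)[OF q], of x]
    by (auto simp: has_field_derivative_def intro!: has_derivative_Pair)
  from has_derivative_compose[OF this smooth_fun_has_derivative[OF assms(1)]] show ?thesis
    unfolding has_field_derivative_def comp_jet_def
    by (rule has_derivative_eq_rhs) (simp add: fun_eq_iff algebra_simps)
qed

lemma torus_cont_comp_jet:
  assumes "smooth_fun G" and q: "q \<in> trig_polys K"
  shows "torus_cont (comp_jet G q)"
proof -
  have "torus_cont q" "torus_cont (deriv q)"
    using trig_polys_torus_cont q trig_polys_deriv(1) by auto
  then show ?thesis
    unfolding torus_cont_def torus_fun_def comp_jet_def
    by (auto intro!: continuous_on_compose2[OF smooth_fun_continuous[OF assms(1), of UNIV]] continuous_intros)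
qed

lemma trig_polys_abs_le:
  assumes "q \<in> trig_polys K" "wiener_le 0 (fourier_coeff q) R"
  shows "\<bar>q x\<bar> \<le> R"
  by (rule torus_cont_abs_le[OF trig_polys_torus_cont[OF assms(1)] assms(2)])

lemma wiener_le_deriv_trig:
  assumes "q \<in> trig_polys K" "wiener_le (\<sigma> + 1) (fourier_coeff q) R"
  shows "wiener_le \<sigma> (fourier_coeff (deriv q)) R"
  unfolding trig_polys_deriv(3)[OF assms(1)] by (rule wiener_le_deriv[OF assms(2)])

lemma sob_le_deriv_trig:
  assumes "q \<in> trig_polys K" "sob_le (\<sigma> + 1) (fourier_coeff q) R"
  shows "sob_le \<sigma> (fourier_coeff (deriv q)) R"
  unfolding trig_polys_deriv(3)[OF assms(1)] by (rule sob_le_deriv[OF assms(2)])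

lemma jet_in_box2:
  assumes q: "q \<in> trig_polys K" and R: "wiener_le 1 (fourier_coeff q) R"
  shows "(q x, deriv q x) \<in> box2 R"
proof -
  have "wiener_le 0 (fourier_coeff (deriv q)) R" "wiener_le 0 (fourier_coeff q) R"
    using wiener_le_deriv_trig[of q K 0 R] wiener_le_weaken[OF R] q R by auto
  then show ?thesis
    using trig_polys_abs_le[OF q] trig_polys_abs_le[OF trig_polys_deriv(1)[OF q]] by (simp add: box2_def)
qed

text \<open>Sup bounds on the composition and its derivative give H^1, which embeds into l^1. The
  derivative contains q'', hence the weight 2 on \<open>q\<close>.\<close>

lemma wiener_le_0_comp_jet:
  assumes G: "smooth_fun G"
  obtains C where "\<And>K q. q \<in> trig_polys K \<Longrightarrow> wiener_le 2 (fourier_coeff q) R \<Longrightarrow>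
    wiener_le 0 (fourier_coeff (comp_jet G q)) C \<and> (\<forall>x. \<bar>comp_jet G q x\<bar> \<le> C)"
proof -
  obtain B where B: "0 \<le> B" "\<And>p. p \<in> box2 R \<Longrightarrow> \<bar>G p\<bar> \<le> B"
    using smooth_fun_bounded_box2[OF G] by metis
  obtain B1 where B1: "0 \<le> B1" "\<And>p. p \<in> box2 R \<Longrightarrow> \<bar>partial_1 G p\<bar> \<le> B1"
    using smooth_fun_bounded_box2[OF smooth_fun_partial_1[OF G]] by metis
  obtain B2 where B2: "0 \<le> B2" "\<And>p. p \<in> box2 R \<Longrightarrow> \<bar>partial_2 G p\<bar> \<le> B2"
    using smooth_fun_bounded_box2[OF smooth_fun_partial_2[OF G]] by metis
  show ?thesis
  proof (rule that)
    fix K q assume q: "q \<in> trig_polys K" and R: "wiener_le 2 (fourier_coeff q) R"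
    note q' = trig_polys_deriv(1)[OF q] and q'' = trig_polys_deriv(1)[OF trig_polys_deriv(1)[OF q]]
    have w1: "wiener_le 1 (fourier_coeff q) R" "wiener_le 1 (fourier_coeff (deriv q)) R"
      using wiener_le_weaken[OF R] wiener_le_deriv_trig[OF q, of 1 R] R by auto
    then have "wiener_le 0 (fourier_coeff (deriv q)) R" "wiener_le 0 (fourier_coeff (deriv (deriv q))) R"
      using wiener_le_weaken[OF w1(2)] wiener_le_deriv_trig[OF q', of 0 R] by auto
    then have ab: "\<bar>deriv q x\<bar> \<le> R" "\<bar>deriv (deriv q) x\<bar> \<le> R" for x
      using trig_polys_abs_le q' q'' by auto
    have box: "(q x, deriv q x) \<in> box2 R" for x
      by (rule jet_in_box2[OF q w1(1)])
    have b: "\<bar>comp_jet G q x\<bar> \<le> B" for x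
      unfolding comp_jet_def by (rule B(2)[OF box])
    have "\<bar>comp_jet (partial_1 G) q x * deriv q x + comp_jet (partial_2 G) q x * deriv (deriv q) x\<bar>
        \<le> B1 * R + B2 * R" for x
      unfolding comp_jet_def
      by (intro order.trans[OF abs_triangle_ineq] add_mono) (auto simp: abs_mult intro!: mult_mono B1 B2 box ab)
    then have "sob_le 1 (fourier_coeff (comp_jet G q)) (B + (B1 * R + B2 * R))"
      using torus_cont_comp_jet[OF G q] torus_cont_comp_jet[OF smooth_fun_partial_1[OF G] q]
        torus_cont_comp_jet[OF smooth_fun_partial_2[OF G] q] trig_polys_torus_cont[OF q'] trig_polys_torus_cont[OF q'']
      by (intro sob_le_1_bessel[OF _ trig_polys_has_derivative_jet[OF G q]] b)
         (auto simp: torus_cont_def intro!: continuous_intros)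
    then have w: "wiener_le 0 (fourier_coeff (comp_jet G q)) (3 * (B + (B1 * R + B2 * R)))"
      using wiener_le_sob_le[of 0 "fourier_coeff (comp_jet G q)" "B + (B1 * R + B2 * R)"] by simp
    have "0 \<le> R"
      using wiener_le_nonneg[OF R] .
    then have "B \<le> 3 * (B + (B1 * R + B2 * R))"
      using B(1) B1(1) B2(1) by (simp add: add_increasing2)
    then show "wiener_le 0 (fourier_coeff (comp_jet G q)) (3 * (B + (B1 * R + B2 * R)))
        \<and> (\<forall>x. \<bar>comp_jet G q x\<bar> \<le> 3 * (B + (B1 * R + B2 * R)))"
      using w b order.trans by blast
  qed
qed

text \<open>The derivative of \<open>G (q, q')\<close> is linear in \<open>q'\<close> and \<open>q''\<close> with coefficients of the same form, and the
  weighted spaces are algebras. So one derivative at a time can be traded against the weight, and no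
  higher chain rule is needed.\<close>

lemma wiener_le_comp_jet_aux:
  assumes "2 \<le> \<rho>"
  shows "smooth_fun G \<Longrightarrow> 0 \<le> \<sigma> \<Longrightarrow> \<sigma> \<le> real n \<Longrightarrow> \<sigma> + 1 \<le> \<rho> \<Longrightarrow>
    \<exists>C. \<forall>K q. q \<in> trig_polys K \<longrightarrow> wiener_le \<rho> (fourier_coeff q) R \<longrightarrow> wiener_le \<sigma> (fourier_coeff (comp_jet G q)) C"
proof (induction n arbitrary: G \<sigma>)
  case 0
  then have "\<sigma> = 0" by simp
  moreover obtain C where "\<And>K q. q \<in> trig_polys K \<Longrightarrow> wiener_le 2 (fourier_coeff q) R \<Longrightarrow>
      wiener_le 0 (fourier_coeff (comp_jet G q)) C"
    using wiener_le_0_comp_jet[OF 0(1)] by metis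
  ultimately show ?case
    using wiener_le_weaken[OF _ assms] by blast
next
  case (Suc n)
  \<comment> \<open>The weight is real, so the last reduction may be by less than 1. It then ends at
    weight 0, and the surplus is given away at the end by \<open>wiener_le_weaken\<close>.\<close>
  define \<sigma>' where "\<sigma>' = max (\<sigma> - 1) 0"
  have \<sigma>': "0 \<le> \<sigma>'" "\<sigma>' \<le> real n" "\<sigma>' + 1 \<le> \<rho>" "\<sigma>' + 2 \<le> \<rho>" "\<sigma> \<le> \<sigma>' + 1"
    using Suc.prems assms by (auto simp: \<sigma>'_def)
  obtain C1 where C1: "\<And>K q. q \<in> trig_polys K \<Longrightarrow> wiener_le \<rho> (fourier_coeff q) R \<Longrightarrow>
      wiener_le \<sigma>' (fourier_coeff (comp_jet (partial_1 G) q)) C1"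
    using Suc.IH[OF smooth_fun_partial_1[OF Suc.prems(1)] \<sigma>'(1-3)] by metis
  obtain C2 where C2: "\<And>K q. q \<in> trig_polys K \<Longrightarrow> wiener_le \<rho> (fourier_coeff q) R \<Longrightarrow>
      wiener_le \<sigma>' (fourier_coeff (comp_jet (partial_2 G) q)) C2"
    using Suc.IH[OF smooth_fun_partial_2[OF Suc.prems(1)] \<sigma>'(1-3)] by metis
  obtain C0 where C0: "\<And>K q. q \<in> trig_polys K \<Longrightarrow> wiener_le 2 (fourier_coeff q) R \<Longrightarrow>
      wiener_le 0 (fourier_coeff (comp_jet G q)) C0"
    using wiener_le_0_comp_jet[OF Suc.prems(1)] by metis
  show ?case
  proof (intro exI allI impI)
    fix K q assume q: "q \<in> trig_polys K" and R: "wiener_le \<rho> (fourier_coeff q) R"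
    note q' = trig_polys_deriv(1)[OF q] and q'' = trig_polys_deriv(1)[OF trig_polys_deriv(1)[OF q]]
    let ?G = "comp_jet G q" and ?G1 = "comp_jet (partial_1 G) q" and ?G2 = "comp_jet (partial_2 G) q"
    let ?D = "\<lambda>x. ?G1 x * deriv q x + ?G2 x * deriv (deriv q) x"
    have tc: "torus_cont ?G" "torus_cont ?G1" "torus_cont ?G2" "torus_cont (deriv q)" "torus_cont (deriv (deriv q))"
      by (rule torus_cont_comp_jet[OF Suc.prems(1) q] torus_cont_comp_jet[OF smooth_fun_partial_1[OF Suc.prems(1)] q]
          torus_cont_comp_jet[OF smooth_fun_partial_2[OF Suc.prems(1)] q]
          trig_polys_torus_cont[OF q'] trig_polys_torus_cont[OF q''])+
    have w': "wiener_le (\<sigma>' + 1) (fourier_coeff (deriv q)) R"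
      by (rule wiener_le_deriv_trig[OF q], rule wiener_le_weaken[OF R]) (use \<sigma>' in auto)
    have w'': "wiener_le \<sigma>' (fourier_coeff (deriv (deriv q))) R"
      by (rule wiener_le_deriv_trig[OF q' w'])
    have m1: "wiener_le \<sigma>' (fourier_coeff (\<lambda>x. ?G1 x * deriv q x)) (2 powr \<sigma>' * C1 * R)"
      by (rule wiener_le_mult[OF tc(2) q' \<sigma>'(1) C1[OF q R]], rule wiener_le_weaken[OF w']) auto
    have m2: "wiener_le \<sigma>' (fourier_coeff (\<lambda>x. ?G2 x * deriv (deriv q) x)) (2 powr \<sigma>' * C2 * R)"
      by (rule wiener_le_mult[OF tc(3) q'' \<sigma>'(1) C2[OF q R] w''])
    have "fourier_coeff ?D
        = (\<lambda>j. fourier_coeff (\<lambda>x. ?G1 x * deriv q x) j + fourier_coeff (\<lambda>x. ?G2 x * deriv (deriv q) x) j)"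
      by (intro ext fourier_coeff_add torus_cont_mult tc)
    then have "wiener_le \<sigma>' (fourier_coeff ?D) (2 powr \<sigma>' * C1 * R + 2 powr \<sigma>' * C2 * R)"
      using wiener_le_add[OF m1 m2] by simp
    moreover have "fourier_coeff ?D = (\<lambda>j. \<i> * of_int j * fourier_coeff ?G j)"
      using tc by (intro ext fourier_coeff_deriv[OF _ trig_polys_has_derivative_jet[OF Suc.prems(1) q]])
        (auto simp: torus_cont_def intro!: continuous_intros)
    moreover have "cmod (fourier_coeff ?G 0) \<le> C0"
      using wiener_leD[OF C0[OF q wiener_le_weaken[OF R assms]], of "{0}"] by simp
    ultimately have "wiener_le (\<sigma>' + 1) (fourier_coeff ?G) (C0 + 2 * (2 powr \<sigma>' * C1 * R + 2 powr \<sigma>' * C2 * R))"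
      using wiener_le_integrate by metis
    then show "wiener_le \<sigma> (fourier_coeff ?G) (C0 + 2 * (2 powr \<sigma>' * C1 * R + 2 powr \<sigma>' * C2 * R))"
      using \<sigma>'(5) by (rule wiener_le_weaken) simp
  qed
qed

lemma wiener_le_comp_jet:
  assumes "smooth_fun G" "0 \<le> \<sigma>" "1 \<le> \<sigma>"
  obtains C where "\<And>K q. q \<in> trig_polys K \<Longrightarrow> wiener_le (\<sigma> + 1) (fourier_coeff q) R \<Longrightarrow>
    wiener_le \<sigma> (fourier_coeff (comp_jet G q)) C"
proof -
  have "\<sigma> \<le> real (nat \<lceil>\<sigma>\<rceil>)" by linarith
  then show ?thesis
    using wiener_le_comp_jet_aux[of "\<sigma> + 1" G \<sigma> "nat \<lceil>\<sigma>\<rceil>" R] assms that by auto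
qed

lemma comp_jet_diff:
  assumes G: "smooth_fun G"
  obtains C where "0 \<le> C" "\<And>N p q d x. p \<in> trig_polys N \<Longrightarrow> q \<in> trig_polys N \<Longrightarrow>
    wiener_le 1 (fourier_coeff p) R \<Longrightarrow> wiener_le 1 (fourier_coeff q) R \<Longrightarrow>
    wiener_le 1 (\<lambda>j. fourier_coeff p j - fourier_coeff q j) d \<Longrightarrow>
    \<bar>comp_jet G p x - comp_jet G q x\<bar> \<le> C * d"
proof -
  obtain B where B: "0 \<le> B" "\<And>p q. p \<in> box2 R \<Longrightarrow> q \<in> box2 R \<Longrightarrow>
      \<bar>G p - G q\<bar> \<le> B * (\<bar>fst p - fst q\<bar> + \<bar>snd p - snd q\<bar>)"
    using smooth_fun_Lipschitz_box2[OF G] by metis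
  show ?thesis
  proof (rule that[of "B * 2"])
    fix N p q d x assume p: "p \<in> trig_polys N" and q: "q \<in> trig_polys N"
      and R: "wiener_le 1 (fourier_coeff p) R" "wiener_le 1 (fourier_coeff q) R"
      and d: "wiener_le 1 (\<lambda>j. fourier_coeff p j - fourier_coeff q j) d"
    define r where "r = (\<lambda>x. p x - q x)"
    have r: "r \<in> trig_polys N"
      unfolding r_def by (rule trig_polys_diff[OF p q])
    have fr: "fourier_coeff r = (\<lambda>j. fourier_coeff p j - fourier_coeff q j)"
      unfolding r_def by (intro ext fourier_coeff_diff trig_polys_torus_cont[OF p] trig_polys_torus_cont[OF q])
    have r': "deriv r x = deriv p x - deriv q x"
      unfolding r_def by (intro DERIV_imp_deriv DERIV_diff trig_polys_deriv(2)[OF p] trig_polys_deriv(2)[OF q])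
    have "(r x, deriv r x) \<in> box2 d"
      by (rule jet_in_box2[OF r]) (use d fr in simp)
    then have "\<bar>p x - q x\<bar> + \<bar>deriv p x - deriv q x\<bar> \<le> 2 * d"
      unfolding r' by (auto simp: r_def box2_def)
    then have "B * (\<bar>p x - q x\<bar> + \<bar>deriv p x - deriv q x\<bar>) \<le> B * (2 * d)"
      by (rule mult_left_mono) (rule B(1))
    then show "\<bar>comp_jet G p x - comp_jet G q x\<bar> \<le> B * 2 * d"
      using B(2)[OF jet_in_box2[OF p R(1)] jet_in_box2[OF q R(2)], of x x] by (simp add: comp_jet_def)
  qed (use B in simp)
qed

text \<open>Only pointwise bounds are used: the derivative of the difference is expanded by the
  product rule with the difference falling on one factor at a time. This involves second derivatives
  of \<open>p\<close> and \<open>q\<close>, so \<open>d\<close> is measured in l^1 with weight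
  2.\<close>

lemma sob_le_comp_jet_diff:
  assumes G: "smooth_fun G"
  obtains C where "0 \<le> C" "\<And>N p q d. p \<in> trig_polys N \<Longrightarrow> q \<in> trig_polys N \<Longrightarrow>
    wiener_le 2 (fourier_coeff p) R \<Longrightarrow> wiener_le 2 (fourier_coeff q) R \<Longrightarrow>
    wiener_le 2 (\<lambda>j. fourier_coeff p j - fourier_coeff q j) d \<Longrightarrow>
    sob_le 1 (fourier_coeff (\<lambda>x. comp_jet G p x - comp_jet G q x)) (C * d)"
proof -
  note G1 = smooth_fun_partial_1[OF G] and G2 = smooth_fun_partial_2[OF G]
  obtain B where B: "0 \<le> B" "\<And>N p q d x. p \<in> trig_polys N \<Longrightarrow> q \<in> trig_polys N \<Longrightarrow>
    wiener_le 1 (fourier_coeff p) R \<Longrightarrow> wiener_le 1 (fourier_coeff q) R \<Longrightarrow>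
    wiener_le 1 (\<lambda>j. fourier_coeff p j - fourier_coeff q j) d \<Longrightarrow>
    \<bar>comp_jet G p x - comp_jet G q x\<bar> \<le> B * d"
    by (rule comp_jet_diff[OF G, where R = R], rule that)
  obtain B1 where B1: "0 \<le> B1" "\<And>N p q d x. p \<in> trig_polys N \<Longrightarrow> q \<in> trig_polys N \<Longrightarrow>
    wiener_le 1 (fourier_coeff p) R \<Longrightarrow> wiener_le 1 (fourier_coeff q) R \<Longrightarrow>
    wiener_le 1 (\<lambda>j. fourier_coeff p j - fourier_coeff q j) d \<Longrightarrow>
    \<bar>comp_jet (partial_1 G) p x - comp_jet (partial_1 G) q x\<bar> \<le> B1 * d"
    by (rule comp_jet_diff[OF G1, where R = R], rule that)
  obtain B2 where B2: "0 \<le> B2" "\<And>N p q d x. p \<in> trig_polys N \<Longrightarrow> q \<in> trig_polys N \<Longrightarrow>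
    wiener_le 1 (fourier_coeff p) R \<Longrightarrow> wiener_le 1 (fourier_coeff q) R \<Longrightarrow>
    wiener_le 1 (\<lambda>j. fourier_coeff p j - fourier_coeff q j) d \<Longrightarrow>
    \<bar>comp_jet (partial_2 G) p x - comp_jet (partial_2 G) q x\<bar> \<le> B2 * d"
    by (rule comp_jet_diff[OF G2, where R = R], rule that)
  obtain D1 where D1: "0 \<le> D1" "\<And>p. p \<in> box2 R \<Longrightarrow> \<bar>partial_1 G p\<bar> \<le> D1"
    using smooth_fun_bounded_box2[OF G1] by metis
  obtain D2 where D2: "0 \<le> D2" "\<And>p. p \<in> box2 R \<Longrightarrow> \<bar>partial_2 G p\<bar> \<le> D2"
    using smooth_fun_bounded_box2[OF G2] by metis
  show ?thesis
  proof (rule that[of "B + (B1 * \<bar>R\<bar> + D1 + B2 * \<bar>R\<bar> + D2)"])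
    fix N p q d assume p: "p \<in> trig_polys N" and q: "q \<in> trig_polys N"
      and R: "wiener_le 2 (fourier_coeff p) R" "wiener_le 2 (fourier_coeff q) R"
      and d: "wiener_le 2 (\<lambda>j. fourier_coeff p j - fourier_coeff q j) d"
    note p' = trig_polys_deriv(1)[OF p] and p'' = trig_polys_deriv(1)[OF trig_polys_deriv(1)[OF p]]
    note q' = trig_polys_deriv(1)[OF q] and q'' = trig_polys_deriv(1)[OF trig_polys_deriv(1)[OF q]]
    have d0: "0 \<le> d" and R0: "0 \<le> R"
      using d R wiener_le_nonneg by auto
    have R1: "wiener_le 1 (fourier_coeff p) R" "wiener_le 1 (fourier_coeff q) R"
      and d1: "wiener_le 1 (\<lambda>j. fourier_coeff p j - fourier_coeff q j) d"
      using wiener_le_weaken R d by auto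
    define r where "r = (\<lambda>x. p x - q x)"
    have r: "r \<in> trig_polys N"
      unfolding r_def by (rule trig_polys_diff[OF p q])
    have fr: "fourier_coeff r = (\<lambda>j. fourier_coeff p j - fourier_coeff q j)"
      unfolding r_def by (intro ext fourier_coeff_diff trig_polys_torus_cont[OF p] trig_polys_torus_cont[OF q])
    have r': "deriv r = (\<lambda>x. deriv p x - deriv q x)"
      unfolding r_def by (intro ext DERIV_imp_deriv DERIV_diff trig_polys_deriv(2)[OF p] trig_polys_deriv(2)[OF q])
    have r'': "deriv (deriv r) = (\<lambda>x. deriv (deriv p) x - deriv (deriv q) x)"
      unfolding r' by (intro ext DERIV_imp_deriv DERIV_diff trig_polys_deriv(2)[OF p'] trig_polys_deriv(2)[OF q'])
    have dr: "wiener_le 1 (fourier_coeff (deriv r)) d"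
      using wiener_le_deriv_trig[OF r, of 1 d] d fr by simp
    have "\<bar>deriv r x\<bar> \<le> d" "\<bar>deriv (deriv r) x\<bar> \<le> d" for x
      using jet_in_box2[OF trig_polys_deriv(1)[OF r] dr, of x] by (simp_all add: box2_def)
    then have rb: "\<bar>deriv p x - deriv q x\<bar> \<le> d" "\<bar>deriv (deriv p) x - deriv (deriv q) x\<bar> \<le> d" for x
      by (simp_all only: r'' flip: fun_cong[OF r'])
    have "wiener_le 1 (fourier_coeff (deriv q)) R"
      using wiener_le_deriv_trig[OF q, of 1 R] R by simp
    then have qb: "\<bar>deriv q x\<bar> \<le> R" "\<bar>deriv (deriv q) x\<bar> \<le> R" for x
      using jet_in_box2[OF q', of R x] by (auto simp: box2_def)
    let ?D = "\<lambda>p x. comp_jet (partial_1 G) p x * deriv p x + comp_jet (partial_2 G) p x * deriv (deriv p) x"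
    have eq: "?D p x - ?D q x
        = (comp_jet (partial_1 G) p x - comp_jet (partial_1 G) q x) * deriv q x
        + comp_jet (partial_1 G) p x * (deriv p x - deriv q x)
        + (comp_jet (partial_2 G) p x - comp_jet (partial_2 G) q x) * deriv (deriv q) x
        + comp_jet (partial_2 G) p x * (deriv (deriv p) x - deriv (deriv q) x)" for x
      by (simp add: algebra_simps)
    have e1: "\<bar>(comp_jet (partial_1 G) p x - comp_jet (partial_1 G) q x) * deriv q x\<bar> \<le> B1 * d * R" for x
      unfolding abs_mult using B1(1) d0 by (intro mult_mono B1(2)[OF p q R1 d1] qb) auto
    have e2: "\<bar>comp_jet (partial_1 G) p x * (deriv p x - deriv q x)\<bar> \<le> D1 * d" for x
      unfolding abs_mult comp_jet_def using D1(1) by (intro mult_mono D1(2)[OF jet_in_box2[OF p R1(1)]] rb) auto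
    have e3: "\<bar>(comp_jet (partial_2 G) p x - comp_jet (partial_2 G) q x) * deriv (deriv q) x\<bar> \<le> B2 * d * R" for x
      unfolding abs_mult using B2(1) d0 by (intro mult_mono B2(2)[OF p q R1 d1] qb) auto
    have e4: "\<bar>comp_jet (partial_2 G) p x * (deriv (deriv p) x - deriv (deriv q) x)\<bar> \<le> D2 * d" for x
      unfolding abs_mult comp_jet_def using D2(1) by (intro mult_mono D2(2)[OF jet_in_box2[OF p R1(1)]] rb) auto
    have abs4: "\<bar>w1 + w2 + w3 + w4\<bar> \<le> c1 + c2 + c3 + c4"
      if "\<bar>w1\<bar> \<le> c1" "\<bar>w2\<bar> \<le> c2" "\<bar>w3\<bar> \<le> c3" "\<bar>w4\<bar> \<le> c4" for w1 w2 w3 w4 c1 c2 c3 c4 :: real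
      using that by linarith
    have Db: "\<bar>?D p x - ?D q x\<bar> \<le> B1 * d * R + D1 * d + B2 * d * R + D2 * d" for x
      unfolding eq by (rule abs4[OF e1 e2 e3 e4])
    have tc: "torus_cont (comp_jet G p)" "torus_cont (comp_jet G q)"
      "torus_cont (comp_jet (partial_1 G) p)" "torus_cont (comp_jet (partial_1 G) q)"
      "torus_cont (comp_jet (partial_2 G) p)" "torus_cont (comp_jet (partial_2 G) q)"
      "torus_cont (deriv p)" "torus_cont (deriv q)" "torus_cont (deriv (deriv p))" "torus_cont (deriv (deriv q))"
      by (rule torus_cont_comp_jet[OF G p] torus_cont_comp_jet[OF G q] torus_cont_comp_jet[OF G1 p]
          torus_cont_comp_jet[OF G1 q] torus_cont_comp_jet[OF G2 p] torus_cont_comp_jet[OF G2 q]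
          trig_polys_torus_cont[OF p'] trig_polys_torus_cont[OF q']
          trig_polys_torus_cont[OF p''] trig_polys_torus_cont[OF q''])+
    have "sob_le 1 (fourier_coeff (\<lambda>x. comp_jet G p x - comp_jet G q x))
        (B * d + (B1 * d * R + D1 * d + B2 * d * R + D2 * d))"
    proof (rule sob_le_1_bessel)
      show "torus_fun (\<lambda>x. comp_jet G p x - comp_jet G q x)"
        using torus_cont_diff[OF tc(1,2)] by (simp add: torus_cont_def)
      show "((\<lambda>x. comp_jet G p x - comp_jet G q x) has_real_derivative ?D p x - ?D q x) (at x)" for x
        by (intro DERIV_diff trig_polys_has_derivative_jet[OF G p] trig_polys_has_derivative_jet[OF G q])
      show "continuous_on UNIV (\<lambda>x. ?D p x - ?D q x)"
        using tc by (auto simp: torus_cont_def intro!: continuous_intros)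
      show "\<bar>comp_jet G p x - comp_jet G q x\<bar> \<le> B * d" for x
        by (rule B(2)[OF p q R1 d1])
    qed (rule Db)
    then show "sob_le 1 (fourier_coeff (\<lambda>x. comp_jet G p x - comp_jet G q x))
        ((B + (B1 * \<bar>R\<bar> + D1 + B2 * \<bar>R\<bar> + D2)) * d)"
      using R0 by (simp add: algebra_simps)
  qed (use B B1 B2 D1 D2 in auto)
qed

section \<open>Trigonometric interpolation\<close>

lemma cis_mod_nat:
  assumes "0 < N"
  shows "cis (of_int d * (2 * pi * real k / real N)) = cis (of_int (d mod int N) * (2 * pi * real k / real N))"
proof -
  have "of_int d * (2 * pi * real k / real N)
      = of_int (d mod int N) * (2 * pi * real k / real N) + 2 * pi * of_int (d div int N * int k)"
  proof -
    have "real_of_int d = of_int (d div int N) * real N + of_int (d mod int N)"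
      using arg_cong[OF div_mult_mod_eq[of d "int N"], of real_of_int, symmetric]
      by (simp only: of_int_add of_int_mult of_int_of_nat_eq)
    then show ?thesis
      using assms by (simp add: field_simps)
  qed
  then show ?thesis
    using cis_multiple_2pi[of "of_int (d div int N * int k)"] by (simp only: flip: cis_mult) simp
qed

lemma sum_cis_roots_dvd:
  assumes "0 < N"
  shows "(\<Sum>k<N. cis (of_int d * (2 * pi * real k / real N))) = (if int N dvd d then of_nat N else 0)"
proof -
  have "(\<Sum>k<N. cis (of_int d * (2 * pi * real k / real N)))
      = (\<Sum>k<N. cis (of_int (d mod int N) * (2 * pi * real k / real N)))"
    using cis_mod_nat[OF assms] by simp
  also have "\<dots> = (if d mod int N = 0 then of_nat N else 0)"
    by (rule sum_cis_roots) (use assms in auto)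
  finally show ?thesis
    by (simp add: dvd_eq_mod_eq_0)
qed

text \<open>Samples on 2K + 1 equidistant nodes cannot tell apart frequencies that are congruent
  modulo 2K + 1. The sum over the congruence class is a limit of symmetric partial sums, the form in
  which the Fourier series converges.\<close>

lemma discrete_coeff_aliasing:
  assumes v: "torus_cont v" and B: "wiener_le 0 (fourier_coeff v) B"
  shows "(\<lambda>N. \<Sum>m\<in>{- int N..int N}. if int (2 * K + 1) dvd (m - j) then fourier_coeff v m else 0)
    \<longlonglongrightarrow> discrete_coeff K v j"
proof -
  let ?P = "2 * K + 1"
  have lim: "(\<lambda>N. \<Sum>m\<in>{- int N..int N}. fourier_coeff v m * cis (of_int m * x)) \<longlonglongrightarrow> of_real (v x)" for x
    by (rule fourier_series_abs_summable[where B = B]) (use v wiener_leD[OF B] in \<open>auto simp: torus_cont_def\<close>)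
  have "(\<lambda>N. (\<Sum>k<?P. (\<Sum>m\<in>{- int N..int N}. fourier_coeff v m * cis (of_int m * trig_node K k))
      * cis (- (of_int j * trig_node K k))) / of_nat ?P) \<longlonglongrightarrow> discrete_coeff K v j"
    unfolding discrete_coeff_def by (intro tendsto_intros lim) (simp only: of_nat_eq_0_iff)
  moreover have "(\<Sum>k<?P. (\<Sum>m\<in>{- int N..int N}. fourier_coeff v m * cis (of_int m * trig_node K k))
      * cis (- (of_int j * trig_node K k))) / of_nat ?P
      = (\<Sum>m\<in>{- int N..int N}. if int ?P dvd (m - j) then fourier_coeff v m else 0)" for N
  proof -
    have e: "cis (of_int m * trig_node K k) * cis (- (of_int j * trig_node K k))
        = cis (of_int (m - j) * (2 * pi * real k / real ?P))" for m k
      by (simp add: cis_mult trig_node_def left_diff_distrib diff_divide_distrib)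
    have "(\<Sum>k<?P. (\<Sum>m\<in>{- int N..int N}. fourier_coeff v m * cis (of_int m * trig_node K k))
        * cis (- (of_int j * trig_node K k)))
        = (\<Sum>m\<in>{- int N..int N}. fourier_coeff v m * (\<Sum>k<?P. cis (of_int (m - j) * (2 * pi * real k / real ?P))))"
      unfolding sum_distrib_right sum_distrib_left mult.assoc e by (rule sum.swap)
    also have "\<dots> = (\<Sum>m\<in>{- int N..int N}. fourier_coeff v m * (if int ?P dvd (m - j) then of_nat ?P else 0))"
      by (subst sum_cis_roots_dvd) auto
    also have "\<dots> = of_nat ?P * (\<Sum>m\<in>{- int N..int N}. if int ?P dvd (m - j) then fourier_coeff v m else 0)"
      unfolding sum_distrib_left by (intro sum.cong) auto
    finally show ?thesis
      by (simp del: of_nat_Suc of_nat_add)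
  qed
  ultimately show ?thesis
    by simp
qed

lemma card_congruent_le_1:
  assumes "finite J" "J \<subseteq> {- int K..int K}"
  shows "card {j \<in> J. int (2 * K + 1) dvd (m - j)} \<le> 1"
proof -
  have "j = i" if "j \<in> J" "i \<in> J" "int (2 * K + 1) dvd (m - j)" "int (2 * K + 1) dvd (m - i)" for i j
  proof (rule ccontr)
    assume "j \<noteq> i"
    have "int (2 * K + 1) dvd (m - j) - (m - i)"
      by (rule dvd_diff[OF that(3,4)])
    then have "int (2 * K + 1) \<le> \<bar>i - j\<bar>"
      using \<open>j \<noteq> i\<close> dvd_imp_le_int[of "i - j" "int (2 * K + 1)"] by simp
    moreover have "\<bar>i - j\<bar> \<le> 2 * int K"
    proof -
      have "j \<in> {- int K..int K}" "i \<in> {- int K..int K}"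
        using that assms(2) by blast+
      then show ?thesis by auto
    qed
    ultimately show False by simp
  qed
  then have "\<forall>x\<in>{j \<in> J. int (2 * K + 1) dvd (m - j)}. \<forall>y\<in>{j \<in> J. int (2 * K + 1) dvd (m - j)}. x = y"
    by blast
  then show ?thesis
    using assms(1) card_le_Suc0_iff_eq[of "{j \<in> J. int (2 * K + 1) dvd (m - j)}"] by simp
qed

text \<open>Each frequency \<open>m\<close> has at most one alias in -K..K, so the double sum counts
  it at most once.\<close>

lemma sum_aliasing_le:
  fixes f :: "int \<Rightarrow> real"
  assumes J: "finite J" "J \<subseteq> {- int K..int K}" and "finite I" and f: "\<And>m. 0 \<le> f m"
  shows "(\<Sum>j\<in>J. \<Sum>m\<in>I. if int (2 * K + 1) dvd (m - j) then f m else 0) \<le> (\<Sum>m\<in>I. f m)"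
proof -
  have "(\<Sum>j\<in>J. \<Sum>m\<in>I. if int (2 * K + 1) dvd (m - j) then f m else 0)
      = (\<Sum>m\<in>I. \<Sum>j\<in>J. if int (2 * K + 1) dvd (m - j) then f m else 0)"
    by (rule sum.swap)
  also have "\<dots> = (\<Sum>m\<in>I. real (card {j \<in> J. int (2 * K + 1) dvd (m - j)}) * f m)"
    using J(1) by (intro sum.cong refl) (simp flip: sum.inter_filter)
  also have "\<dots> \<le> (\<Sum>m\<in>I. 1 * f m)"
    using card_congruent_le_1[OF J] by (intro sum_mono mult_right_mono f) simp
  finally show ?thesis by simp
qed

text \<open>Folding coefficients onto -K..K cannot increase their l^1 norm, so interpolation is a
  contraction in this norm.\<close>

lemma wiener_le_0_interp:
  assumes v: "torus_cont v" and B: "wiener_le 0 (fourier_coeff v) B"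
  shows "wiener_le 0 (freq_trunc K (discrete_coeff K v)) B"
proof (rule wiener_leI)
  fix J :: "int set" assume J: "finite J"
  define J' where "J' = J \<inter> {- int K..int K}"
  have "(\<lambda>N. \<Sum>j\<in>J'. cmod (\<Sum>m\<in>{- int N..int N}. if int (2 * K + 1) dvd (m - j) then fourier_coeff v m else 0))
      \<longlonglongrightarrow> (\<Sum>j\<in>J'. cmod (discrete_coeff K v j))"
    by (intro tendsto_sum tendsto_norm discrete_coeff_aliasing[OF v B])
  then have "(\<Sum>j\<in>J'. cmod (discrete_coeff K v j)) \<le> B"
  proof (rule LIMSEQ_le_const2, intro exI allI impI)
    fix N
    have "(\<Sum>j\<in>J'. cmod (\<Sum>m\<in>{- int N..int N}. if int (2 * K + 1) dvd (m - j) then fourier_coeff v m else 0))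
        \<le> (\<Sum>j\<in>J'. \<Sum>m\<in>{- int N..int N}. if int (2 * K + 1) dvd (m - j) then cmod (fourier_coeff v m) else 0)"
      by (intro sum_mono order.trans[OF norm_sum]) (auto intro!: sum_mono)
    also have "\<dots> \<le> (\<Sum>m\<in>{- int N..int N}. cmod (fourier_coeff v m))"
      by (rule sum_aliasing_le) (use J in \<open>auto simp: J'_def\<close>)
    also have "\<dots> \<le> B"
      using wiener_leD[OF B, of "{- int N..int N}"] by simp
    finally show "(\<Sum>j\<in>J'. cmod (\<Sum>m\<in>{- int N..int N}. if int (2 * K + 1) dvd (m - j) then fourier_coeff v m else 0)) \<le> B" .
  qed
  moreover have "(\<Sum>j\<in>J. jap j powr 0 * cmod (freq_trunc K (discrete_coeff K v) j)) = (\<Sum>j\<in>J'. cmod (discrete_coeff K v j))"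
    unfolding J'_def using J by (intro sum.mono_neutral_cong_right) (auto simp: freq_trunc_def)
  ultimately show "(\<Sum>j\<in>J. jap j powr 0 * cmod (freq_trunc K (discrete_coeff K v) j)) \<le> B"
    by simp
qed

text \<open>On -K..K the discrete coefficients differ from the exact ones by the aliases from beyond
  \<open>K\<close> only, so the error inherits the bound on the tail.\<close>

lemma wiener_le_0_interp_error:
  assumes v: "torus_cont v" and B: "wiener_le 0 (fourier_coeff v) B"
    and T: "wiener_le 0 (\<lambda>j. fourier_coeff v j - freq_trunc K (fourier_coeff v) j) T"
  shows "wiener_le 0 (\<lambda>j. freq_trunc K (discrete_coeff K v) j - freq_trunc K (fourier_coeff v) j) T"
proof (rule wiener_leI)
  let ?t = "\<lambda>m. fourier_coeff v m - freq_trunc K (fourier_coeff v) m"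
  let ?A = "\<lambda>N j. \<Sum>m\<in>{- int N..int N}. if int (2 * K + 1) dvd (m - j) then fourier_coeff v m else 0"
  fix J :: "int set" assume J: "finite J"
  define J' where "J' = J \<inter> {- int K..int K}"
  have "(\<lambda>N. \<Sum>j\<in>J'. cmod (?A N j - fourier_coeff v j)) \<longlonglongrightarrow> (\<Sum>j\<in>J'. cmod (discrete_coeff K v j - fourier_coeff v j))"
    by (intro tendsto_sum tendsto_norm tendsto_diff discrete_coeff_aliasing[OF v B] tendsto_const)
  then have "(\<Sum>j\<in>J'. cmod (discrete_coeff K v j - fourier_coeff v j)) \<le> T"
  \<comment> \<open>From N = K on, the partial sum contains the mode \<open>j\<close> itself, which
    cancels against \<open>fourier_coeff v j\<close>.\<close>
  proof (rule LIMSEQ_le_const2, intro exI[of _ K] allI impI)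
    fix N assume "K \<le> N"
    have "?A N j - fourier_coeff v j = (\<Sum>m\<in>{- int N..int N}. if int (2 * K + 1) dvd (m - j) then ?t m else 0)"
      if "j \<in> J'" for j
    proof -
      have j: "j \<in> {- int K..int K}" "j \<in> {- int N..int N}"
        using that \<open>K \<le> N\<close> by (auto simp: J'_def)
      have "fourier_coeff v j = (\<Sum>m\<in>{- int N..int N}. if m = j then fourier_coeff v m else 0)"
        using j by simp
      also have "\<dots> = (\<Sum>m\<in>{- int N..int N}. if int (2 * K + 1) dvd (m - j) then freq_trunc K (fourier_coeff v) m else 0)"
      proof (intro sum.cong refl)
        fix m
        have "m = j" if "int (2 * K + 1) dvd (m - j)" "\<bar>m\<bar> \<le> int K"
        proof (rule ccontr)
          assume "m \<noteq> j"
          then have "int (2 * K + 1) \<le> \<bar>m - j\<bar>"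
            using that(1) dvd_imp_le_int[of "m - j" "int (2 * K + 1)"] by simp
          then show False
            using that(2) j by auto
        qed
        then show "(if m = j then fourier_coeff v m else 0)
            = (if int (2 * K + 1) dvd (m - j) then freq_trunc K (fourier_coeff v) m else 0)"
          using j by (auto simp: freq_trunc_def abs_le_iff)
      qed
      finally show ?thesis
        by (simp add: sum_subtractf[symmetric] if_distrib cong: if_cong)
    qed
    then have "(\<Sum>j\<in>J'. cmod (?A N j - fourier_coeff v j))
        \<le> (\<Sum>j\<in>J'. \<Sum>m\<in>{- int N..int N}. if int (2 * K + 1) dvd (m - j) then cmod (?t m) else 0)"
      by (intro sum_mono) (auto intro!: order.trans[OF norm_sum] sum_mono)
    also have "\<dots> \<le> (\<Sum>m\<in>{- int N..int N}. cmod (?t m))"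
      by (rule sum_aliasing_le) (use J in \<open>auto simp: J'_def\<close>)
    also have "\<dots> \<le> T"
      using wiener_leD[OF T, of "{- int N..int N}"] by simp
    finally show "(\<Sum>j\<in>J'. cmod (?A N j - fourier_coeff v j)) \<le> T" .
  qed
  moreover have "(\<Sum>j\<in>J. jap j powr 0 * cmod (freq_trunc K (discrete_coeff K v) j - freq_trunc K (fourier_coeff v) j))
      = (\<Sum>j\<in>J'. cmod (discrete_coeff K v j - fourier_coeff v j))"
    unfolding J'_def using J by (intro sum.mono_neutral_cong_right) (auto simp: freq_trunc_def)
  ultimately show "(\<Sum>j\<in>J. jap j powr 0 * cmod (freq_trunc K (discrete_coeff K v) j - freq_trunc K (fourier_coeff v) j)) \<le> T"
    by simp
qed

text \<open>The 3 is 1 + 2: the truncated tail contributes 1, and raising the weight of the aliasing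
  error from 0 to 1 on modes up to \<open>K\<close> costs a factor 2K.\<close>

lemma wiener_le_1_interp_error:
  assumes v: "torus_cont v" and B: "wiener_le (\<tau> + 1) (fourier_coeff v) B" and K: "1 \<le> K" and \<tau>: "0 \<le> \<tau>"
  shows "wiener_le 1 (\<lambda>j. fourier_coeff (trig_interp K v) j - fourier_coeff v j) (3 * (real K powr (- \<tau>) * B))"
proof -
  let ?t = "\<lambda>j. fourier_coeff v j - freq_trunc K (fourier_coeff v) j"
  let ?d = "\<lambda>j. freq_trunc K (discrete_coeff K v) j - freq_trunc K (fourier_coeff v) j"
  have B0: "wiener_le 0 (fourier_coeff v) B"
    by (rule wiener_le_weaken[OF B]) (use \<tau> in auto)
  have t1: "wiener_le 1 ?t (real K powr (- \<tau>) * B)"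
    by (rule wiener_le_tail) (use B K \<tau> in \<open>auto simp: add.commute\<close>)
  have "wiener_le 0 ?t (real K powr (- (\<tau> + 1)) * B)"
    by (rule wiener_le_tail) (use B K \<tau> in auto)
  then have "wiener_le 0 ?d (real K powr (- (\<tau> + 1)) * B)"
    by (rule wiener_le_0_interp_error[OF v B0])
  then have d: "wiener_le 1 ?d (2 * real K * (real K powr (- (\<tau> + 1)) * B))"
  proof (rule wiener_le_mono)
    fix j
    show "jap j powr 1 * cmod (?d j) \<le> 2 * real K * (jap j powr 0 * cmod (?d j))"
      using jap_le_of_abs_le[OF _ K, of j] by (cases "\<bar>j\<bar> \<le> int K") (auto simp: freq_trunc_def intro!: mult_right_mono)
  qed auto
  have eq: "2 * real K * (real K powr (- (\<tau> + 1)) * B) = 2 * (real K powr (- \<tau>) * B)"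
  proof -
    have "real K powr (- \<tau>) = real K powr 1 * real K powr (- (\<tau> + 1))"
      unfolding powr_add[symmetric] by simp
    then show ?thesis
      using K by simp
  qed
  have "(\<lambda>j. ?d j - ?t j) = (\<lambda>j. freq_trunc K (discrete_coeff K v) j - fourier_coeff v j)"
    by simp
  then show ?thesis
    using wiener_le_diff[OF d t1] unfolding eq fourier_coeff_trig_interp by (simp add: mult.commute)
qed

lemma sum_discrete_coeff_square:
  "(\<Sum>j\<in>{- int K..int K}. (cmod (discrete_coeff K v j))\<^sup>2)
    = (\<Sum>k<2 * K + 1. (v (trig_node K k))\<^sup>2) / of_nat (2 * K + 1)"
proof -
  let ?P = "2 * K + 1"
  have "complex_of_real (\<Sum>j\<in>{- int K..int K}. (cmod (discrete_coeff K v j))\<^sup>2)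
      = (\<Sum>j\<in>{- int K..int K}. discrete_coeff K v j * cnj (discrete_coeff K v j))"
    unfolding of_real_sum mult_cnj_cmod ..
  also have "\<dots> = (\<Sum>j\<in>{- int K..int K}. discrete_coeff K v j *
      (\<Sum>k<?P. of_real (v (trig_node K k)) * cis (of_int j * trig_node K k)) / of_nat ?P)"
    by (intro sum.cong refl) (simp add: discrete_coeff_def cis_cnj del: sum.lessThan_Suc)
  also have "\<dots> = (\<Sum>k<?P. of_real (v (trig_node K k)) *
      (\<Sum>j\<in>{- int K..int K}. discrete_coeff K v j * cis (of_int j * trig_node K k))) / of_nat ?P"
    unfolding sum_divide_distrib[symmetric] sum_distrib_left
    by (subst sum.swap) (simp add: mult_ac del: sum.lessThan_Suc)
  also have "\<dots> = (\<Sum>k<?P. of_real (v (trig_node K k)) * of_real (v (trig_node K k))) / of_nat ?P"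
    unfolding trig_interp_complex[symmetric]
    by (intro arg_cong2[where f = "(/)"] sum.cong refl) (simp add: trig_interp_node)
  also have "\<dots> = of_real ((\<Sum>k<?P. (v (trig_node K k))\<^sup>2) / of_nat ?P)"
    by (simp add: power2_eq_square del: sum.lessThan_Suc)
  finally show ?thesis
    by (simp only: of_real_eq_iff)
qed

text \<open>By the discrete Parseval identity the l^2 norm of the coefficients is the root mean
  square of the nodal values. A sup bound on \<open>v\<close> therefore suffices, which matters for
  compositions with the numerical solution, whose error is controlled only in H^2.\<close>

lemma sob_le_0_interp:
  assumes "\<And>x. \<bar>v x\<bar> \<le> B"
  shows "sob_le 0 (fourier_coeff (trig_interp K v)) B"
proof (rule sob_leI)
  fix J :: "int set" assume J: "finite J"
  have B: "0 \<le> B"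
    using assms[of 0] by linarith
  have sq: "(v y)\<^sup>2 \<le> B\<^sup>2" for y
    using power_mono[OF assms[of y] abs_ge_zero, of 2] by simp
  have "(\<Sum>j\<in>J. (cmod (freq_trunc K (discrete_coeff K v) j))\<^sup>2)
      = (\<Sum>j\<in>J \<inter> {- int K..int K}. (cmod (discrete_coeff K v j))\<^sup>2)"
    using J by (intro sum.mono_neutral_cong_right) (auto simp: freq_trunc_def)
  also have "\<dots> \<le> (\<Sum>j\<in>{- int K..int K}. (cmod (discrete_coeff K v j))\<^sup>2)"
    by (rule sum_mono2) auto
  also have "\<dots> \<le> (\<Sum>k<2 * K + 1. B\<^sup>2) / of_nat (2 * K + 1)"
    unfolding sum_discrete_coeff_square
    by (intro divide_right_mono sum_mono sq) auto
  also have "\<dots> = B\<^sup>2"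
    unfolding sum_constant card_lessThan by (subst nonzero_mult_div_cancel_left) (auto simp del: of_nat_add of_nat_Suc)
  finally show "L2_set (\<lambda>j. jap j powr 0 * cmod (fourier_coeff (trig_interp K v) j)) J \<le> B"
    unfolding L2_set_def fourier_coeff_trig_interp using B by (intro real_le_lsqrt) auto
qed

lemma trig_interp_diff: "trig_interp K (\<lambda>x. v x - w x) y = trig_interp K v y - trig_interp K w y"
  unfolding trig_interp_def discrete_coeff_def
  by (simp add: left_diff_distrib sum_subtractf diff_divide_distrib del: sum.lessThan_Suc)

lemma fourier_coeff_tendsto:
  assumes v: "\<And>N. torus_cont (v N)" "\<And>N x. \<bar>v N x\<bar> \<le> B" and w: "torus_cont w" and lim: "\<And>x. (\<lambda>N. v N x) \<longlonglongrightarrow> w x"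
  shows "(\<lambda>N. fourier_coeff (v N) j) \<longlonglongrightarrow> fourier_coeff w j"
  unfolding fourier_coeff_def set_lebesgue_integral_def
proof (intro tendsto_divide tendsto_const integral_dominated_convergence)
  note [measurable] = v(1)[THEN torus_cont_measurable] w[THEN torus_cont_measurable]
  show "(\<lambda>x. indicator {0..2*pi} x *\<^sub>R (complex_of_real (w x) * cis (- (of_int j * x)))) \<in> borel_measurable lborel"
    by measurable
  show "(\<lambda>x. indicator {0..2*pi} x *\<^sub>R (complex_of_real (v N x) * cis (- (of_int j * x)))) \<in> borel_measurable lborel" for N
    by measurable
  show "integrable lborel (\<lambda>x. indicator {0..2*pi} x *\<^sub>R B)"
    by (auto intro!: borel_integrable_compact)
  show "AE x in lborel. (\<lambda>N. indicator {0..2*pi} x *\<^sub>R (complex_of_real (v N x) * cis (- (of_int j * x))))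
      \<longlonglongrightarrow> indicator {0..2*pi} x *\<^sub>R (complex_of_real (w x) * cis (- (of_int j * x)))"
    by (intro AE_I2 tendsto_intros lim)
  show "AE x in lborel. norm (indicator {0..2*pi} x *\<^sub>R (complex_of_real (v N x) * cis (- (of_int j * x))))
      \<le> indicator {0..2*pi} x *\<^sub>R B" for N
    using v(2) by (intro AE_I2) (auto simp: norm_mult indicator_def)
qed simp

section \<open>The continuous nonlinearity\<close>

definition nonlin :: "(real \<Rightarrow> real) \<Rightarrow> (real \<times> real \<Rightarrow> real) \<Rightarrow> (real \<Rightarrow> real) \<Rightarrow> real \<Rightarrow> real" where
  "nonlin a g u x = a (u x) * deriv (deriv u) x + g (u x, deriv u x)"

locale quasilinear =
  fixes a :: "real \<Rightarrow> real" and g :: "real \<times> real \<Rightarrow> real"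
  assumes a: "smooth_fun a" and g: "smooth_fun g"
begin

abbreviation a1 :: "real \<times> real \<Rightarrow> real" where
  "a1 \<equiv> \<lambda>p. a (fst p)"

lemma a1: "smooth_fun a1"
  by (rule smooth_fun_comp_fst[OF a])

lemma nonlin_comp_jet: "nonlin a g u = (\<lambda>x. comp_jet a1 u x * deriv (deriv u) x + comp_jet g u x)"
  by (simp add: nonlin_def comp_jet_def fun_eq_iff)

lemma torus_cont_nonlin:
  assumes "q \<in> trig_polys K"
  shows "torus_cont (nonlin a g q)"
  unfolding nonlin_comp_jet
  by (intro torus_cont_add torus_cont_mult torus_cont_comp_jet[OF a1 assms] torus_cont_comp_jet[OF g assms]
        trig_polys_torus_cont[OF trig_polys_deriv(1)[OF trig_polys_deriv(1)[OF assms]]])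

lemma fourier_coeff_nonlin:
  assumes "q \<in> trig_polys K"
  shows "fourier_coeff (nonlin a g q)
    = (\<lambda>j. fourier_coeff (\<lambda>x. comp_jet a1 q x * deriv (deriv q) x) j + fourier_coeff (comp_jet g q) j)"
  unfolding nonlin_comp_jet
  by (intro ext fourier_coeff_add torus_cont_mult torus_cont_comp_jet[OF a1 assms] torus_cont_comp_jet[OF g assms]
        trig_polys_torus_cont[OF trig_polys_deriv(1)[OF trig_polys_deriv(1)[OF assms]]])

lemma sob_le_3_nonlin:
  obtains C where "\<And>K q. q \<in> trig_polys K \<Longrightarrow> wiener_le 4 (fourier_coeff q) R \<Longrightarrow> sob_le 5 (fourier_coeff q) R
    \<Longrightarrow> sob_le 3 (fourier_coeff (nonlin a g q)) C"
proof -
  obtain C1 where C1: "\<And>K q. q \<in> trig_polys K \<Longrightarrow> wiener_le 4 (fourier_coeff q) R \<Longrightarrow>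
      wiener_le 3 (fourier_coeff (comp_jet a1 q)) C1"
    by (rule wiener_le_comp_jet[OF a1, where \<sigma> = 3 and R = R, simplified], rule that)
  obtain C2 where C2: "\<And>K q. q \<in> trig_polys K \<Longrightarrow> wiener_le 4 (fourier_coeff q) R \<Longrightarrow>
      wiener_le 3 (fourier_coeff (comp_jet g q)) C2"
    by (rule wiener_le_comp_jet[OF g, where \<sigma> = 3 and R = R, simplified], rule that)
  show ?thesis
  proof (rule that)
    fix K q assume q: "q \<in> trig_polys K" and R: "wiener_le 4 (fourier_coeff q) R" "sob_le 5 (fourier_coeff q) R"
    note q' = trig_polys_deriv(1)[OF q] and q'' = trig_polys_deriv(1)[OF trig_polys_deriv(1)[OF q]]
    have "sob_le 3 (fourier_coeff (deriv (deriv q))) R"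
      using sob_le_deriv_trig[OF q', of 3 R] sob_le_deriv_trig[OF q, of 4 R] R(2) by simp
    then have "sob_le 3 (fourier_coeff (\<lambda>x. comp_jet a1 q x * deriv (deriv q) x)) (2 powr 3 * C1 * R)"
      by (intro sob_le_mult_wiener_sob[OF torus_cont_comp_jet[OF a1 q] q''] C1[OF q R(1)]) auto
    from sob_le_add[OF this sob_le_wiener_le[OF C2[OF q R(1)]]]
    show "sob_le 3 (fourier_coeff (nonlin a g q)) (2 powr 3 * C1 * R + C2)"
      unfolding fourier_coeff_nonlin[OF q] .
  qed
qed

text \<open>Each product in a(p) p'' - a(q) q'' needs one factor in l^1 with weight 1. So a(p) -
  a(q) is paired with p'', and p'' - q'' with a(q), which explains the two different bounds on the
  difference of \<open>p\<close> and \<open>q\<close>.\<close>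

lemma sob_le_1_nonlin_diff:
  obtains C where "0 \<le> C" "\<And>N p q d. p \<in> trig_polys N \<Longrightarrow> q \<in> trig_polys N \<Longrightarrow>
    wiener_le 4 (fourier_coeff p) R \<Longrightarrow> wiener_le 4 (fourier_coeff q) R \<Longrightarrow>
    wiener_le 2 (\<lambda>j. fourier_coeff p j - fourier_coeff q j) d \<Longrightarrow>
    sob_le 3 (\<lambda>j. fourier_coeff p j - fourier_coeff q j) d \<Longrightarrow>
    sob_le 1 (\<lambda>j. fourier_coeff (nonlin a g p) j - fourier_coeff (nonlin a g q) j) (C * d)"
proof -
  obtain C1 where C1: "0 \<le> C1" "\<And>N p q d. p \<in> trig_polys N \<Longrightarrow> q \<in> trig_polys N \<Longrightarrow>
    wiener_le 2 (fourier_coeff p) R \<Longrightarrow> wiener_le 2 (fourier_coeff q) R \<Longrightarrow>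
    wiener_le 2 (\<lambda>j. fourier_coeff p j - fourier_coeff q j) d \<Longrightarrow>
    sob_le 1 (fourier_coeff (\<lambda>x. comp_jet a1 p x - comp_jet a1 q x)) (C1 * d)"
    by (rule sob_le_comp_jet_diff[OF a1, where R = R], rule that)
  obtain C2 where C2: "0 \<le> C2" "\<And>N p q d. p \<in> trig_polys N \<Longrightarrow> q \<in> trig_polys N \<Longrightarrow>
    wiener_le 2 (fourier_coeff p) R \<Longrightarrow> wiener_le 2 (fourier_coeff q) R \<Longrightarrow>
    wiener_le 2 (\<lambda>j. fourier_coeff p j - fourier_coeff q j) d \<Longrightarrow>
    sob_le 1 (fourier_coeff (\<lambda>x. comp_jet g p x - comp_jet g q x)) (C2 * d)"
    by (rule sob_le_comp_jet_diff[OF g, where R = R], rule that)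
  obtain C3 where C3: "\<And>K q. q \<in> trig_polys K \<Longrightarrow> wiener_le 2 (fourier_coeff q) R \<Longrightarrow>
      wiener_le 1 (fourier_coeff (comp_jet a1 q)) C3"
    by (rule wiener_le_comp_jet[OF a1, where \<sigma> = 1 and R = R, simplified], rule that)
  show ?thesis
  proof (rule that[of "2 powr 1 * \<bar>R\<bar> * C1 + 2 powr 1 * \<bar>C3\<bar> + C2"])
    fix N p q d assume p: "p \<in> trig_polys N" and q: "q \<in> trig_polys N"
      and R: "wiener_le 4 (fourier_coeff p) R" "wiener_le 4 (fourier_coeff q) R"
      and d: "wiener_le 2 (\<lambda>j. fourier_coeff p j - fourier_coeff q j) d"
      and d3: "sob_le 3 (\<lambda>j. fourier_coeff p j - fourier_coeff q j) d"
    note p' = trig_polys_deriv(1)[OF p] and p'' = trig_polys_deriv(1)[OF trig_polys_deriv(1)[OF p]]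
    note q' = trig_polys_deriv(1)[OF q] and q'' = trig_polys_deriv(1)[OF trig_polys_deriv(1)[OF q]]
    have R2: "wiener_le 2 (fourier_coeff p) R" "wiener_le 2 (fourier_coeff q) R"
      using R wiener_le_weaken by auto
    define r where "r = (\<lambda>x. p x - q x)"
    have r: "r \<in> trig_polys N"
      unfolding r_def by (rule trig_polys_diff[OF p q])
    note rr = trig_polys_deriv(1)[OF r] and rrr = trig_polys_deriv(1)[OF trig_polys_deriv(1)[OF r]]
    have fr: "fourier_coeff r = (\<lambda>j. fourier_coeff p j - fourier_coeff q j)"
      unfolding r_def by (intro ext fourier_coeff_diff trig_polys_torus_cont[OF p] trig_polys_torus_cont[OF q])
    have r': "deriv r = (\<lambda>x. deriv p x - deriv q x)"
      unfolding r_def by (intro ext DERIV_imp_deriv DERIV_diff trig_polys_deriv(2)[OF p] trig_polys_deriv(2)[OF q])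
    have r'': "deriv (deriv r) = (\<lambda>x. deriv (deriv p) x - deriv (deriv q) x)"
      unfolding r' by (intro ext DERIV_imp_deriv DERIV_diff trig_polys_deriv(2)[OF p'] trig_polys_deriv(2)[OF q'])
    have d1: "sob_le 1 (fourier_coeff (deriv (deriv r))) d"
      using sob_le_deriv_trig[OF rr, of 1 d] sob_le_deriv_trig[OF r, of 2 d] d3 fr by simp
    have Rp: "wiener_le 1 (fourier_coeff (deriv (deriv p))) R"
      using wiener_le_weaken[OF R(1), of 3 R] wiener_le_deriv_trig[OF p', of 1 R] wiener_le_deriv_trig[OF p, of 2 R] by simp
    have tc: "torus_cont (comp_jet a1 p)" "torus_cont (comp_jet a1 q)" "torus_cont (comp_jet g p)" "torus_cont (comp_jet g q)"
      "torus_cont (deriv (deriv p))" "torus_cont (deriv (deriv r))"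
      by (rule torus_cont_comp_jet[OF a1 p] torus_cont_comp_jet[OF a1 q] torus_cont_comp_jet[OF g p]
          torus_cont_comp_jet[OF g q] trig_polys_torus_cont[OF p''] trig_polys_torus_cont[OF rrr])+
    let ?e1 = "\<lambda>x. (comp_jet a1 p x - comp_jet a1 q x) * deriv (deriv p) x"
    let ?e2 = "\<lambda>x. comp_jet a1 q x * deriv (deriv r) x"
    let ?e3 = "\<lambda>x. comp_jet g p x - comp_jet g q x"
    have e1: "sob_le 1 (fourier_coeff ?e1) (2 powr 1 * R * (C1 * d))"
      by (rule sob_le_mult_sob_wiener[OF torus_cont_diff[OF tc(1,2)] p'' _ C1(2)[OF p q R2 d] Rp]) simp
    have e2: "sob_le 1 (fourier_coeff ?e2) (2 powr 1 * C3 * d)"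
      by (rule sob_le_mult_wiener_sob[OF tc(2) rrr _ C3[OF q R2(2)] d1]) simp
    have e3: "sob_le 1 (fourier_coeff ?e3) (C2 * d)"
      by (rule C2(2)[OF p q R2 d])
    have "nonlin a g p x - nonlin a g q x = (?e1 x + ?e2 x) + ?e3 x" for x
      unfolding nonlin_comp_jet r'' by (simp add: algebra_simps)
    then have "fourier_coeff (nonlin a g p) j - fourier_coeff (nonlin a g q) j
        = (fourier_coeff ?e1 j + fourier_coeff ?e2 j) + fourier_coeff ?e3 j" for j
      unfolding fourier_coeff_diff[OF torus_cont_nonlin[OF p] torus_cont_nonlin[OF q], symmetric]
      by (simp add: fourier_coeff_add torus_cont_add torus_cont_mult torus_cont_diff tc)
    then have "sob_le 1 (\<lambda>j. fourier_coeff (nonlin a g p) j - fourier_coeff (nonlin a g q) j)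
        ((2 powr 1 * R * (C1 * d) + 2 powr 1 * C3 * d) + C2 * d)"
      using sob_le_add[OF sob_le_add[OF e1 e2] e3] by simp
    moreover have "0 \<le> R" "0 \<le> C3"
      using wiener_le_nonneg[OF R(1)] wiener_le_nonneg[OF C3[OF q R2(2)]] by auto
    ultimately show "sob_le 1 (\<lambda>j. fourier_coeff (nonlin a g p) j - fourier_coeff (nonlin a g q) j)
        ((2 powr 1 * \<bar>R\<bar> * C1 + 2 powr 1 * \<bar>C3\<bar> + C2) * d)"
      by (simp add: algebra_simps)
  qed (use C1 C2 in auto)
qed

end

section \<open>The discrete nonlinearity\<close>

lemma C_diff_Suc_real:
  assumes "C_diff (Suc n) u"
  shows "(u has_real_derivative deriv u x) (at x)" and "C_diff n (deriv u)"
proof -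
  have d: "(u has_real_derivative deriv u x) (at x)" for x
    using assms DERIV_deriv_iff_real_differentiable by auto
  then show "(u has_real_derivative deriv u x) (at x)" .
  have "frechet_derivative u (at x) 1 = deriv u x" for x
    using frechet_derivative_at[OF d[unfolded has_field_derivative_def], of x] by (metis mult_1_right)
  moreover have "C_diff n (\<lambda>x. frechet_derivative u (at x) 1)"
    using assms by simp
  ultimately show "C_diff n (deriv u)"
    by simp
qed

lemma C_diff_2_real:
  assumes "C_diff 2 u"
  shows "(u has_real_derivative deriv u x) (at x)" and "(deriv u has_real_derivative deriv (deriv u) x) (at x)"
    and "continuous_on UNIV u" and "continuous_on UNIV (deriv u)" and "continuous_on UNIV (deriv (deriv u))"
proof -
  have 2: "C_diff (Suc (Suc 0)) u"
    using assms by (simp only: numeral_2_eq_2)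
  note 1 = C_diff_Suc_real[OF 2] and 0 = C_diff_Suc_real[OF C_diff_Suc_real(2)[OF 2]]
  show "(u has_real_derivative deriv u x) (at x)" "(deriv u has_real_derivative deriv (deriv u) x) (at x)"
    by (rule 1 0)+
  show "continuous_on UNIV u" "continuous_on UNIV (deriv u)"
    by (intro continuous_at_imp_continuous_on ballI DERIV_isCont, rule 1 0)+
  show "continuous_on UNIV (deriv (deriv u))"
    using 0(2) by simp
qed

lemma C_diff_2_fourier_coeff:
  assumes "torus_fun u" "C_diff 2 u"
  shows "torus_cont u" "torus_cont (deriv u)" "torus_cont (deriv (deriv u))"
    and "fourier_coeff (deriv u) = (\<lambda>j. \<i> * of_int j * fourier_coeff u j)"
    and "fourier_coeff (deriv (deriv u)) = (\<lambda>j. \<i> * of_int j * fourier_coeff (deriv u) j)"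
proof -
  note d = C_diff_2_real[OF assms(2)]
  have u': "torus_fun (deriv u)"
    by (rule torus_fun_deriv[OF assms(1) d(1)])
  have u'': "torus_fun (deriv (deriv u))"
    by (rule torus_fun_deriv[OF u' d(2)])
  show "torus_cont u" "torus_cont (deriv u)" "torus_cont (deriv (deriv u))"
    using assms(1) u' u'' d by (auto simp: torus_cont_def)
  show "fourier_coeff (deriv u) = (\<lambda>j. \<i> * of_int j * fourier_coeff u j)"
    by (intro ext fourier_coeff_deriv[OF assms(1) d(1) d(4)])
  show "fourier_coeff (deriv (deriv u)) = (\<lambda>j. \<i> * of_int j * fourier_coeff (deriv u) j)"
    by (intro ext fourier_coeff_deriv[OF u' d(2) d(5)])
qed

lemma trig_polys_eqI:
  assumes "v \<in> trig_polys K" "w \<in> trig_polys K" "fourier_coeff v = fourier_coeff w"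
  shows "v = w"
  using trig_polys_Re[OF assms(1)] trig_polys_Re[OF assms(2)] assms(3) by (simp add: fun_eq_iff)

lemma trig_proj_tendsto:
  assumes "torus_cont v" "wiener_le 0 (fourier_coeff v) B"
  shows "(\<lambda>N. trig_proj N v x) \<longlonglongrightarrow> v x"
proof -
  have "(\<lambda>N. \<Sum>j\<in>{- int N..int N}. fourier_coeff v j * cis (of_int j * x)) \<longlonglongrightarrow> of_real (v x)"
    by (rule fourier_series_abs_summable[where B = B])
       (use assms wiener_leD[OF assms(2)] in \<open>auto simp: torus_cont_def\<close>)
  from tendsto_Re[OF this] show ?thesis
    by (simp add: trig_proj_def)
qed

lemma deriv_trig_proj:
  assumes "fourier_coeff u' = (\<lambda>j. \<i> * of_int j * fourier_coeff u j)"
  shows "deriv (trig_proj N u) = trig_proj N u'"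
  by (rule trig_polys_eqI[OF trig_polys_deriv(1)[OF trig_proj_in] trig_proj_in])
     (simp add: trig_polys_deriv(3)[OF trig_proj_in] fourier_coeff_trig_proj_trunc assms freq_trunc_def fun_eq_iff)

lemma sob_le_limit:
  assumes lim: "\<And>j. (\<lambda>N. c N j) \<longlonglongrightarrow> d j" and B: "\<And>N. K \<le> N \<Longrightarrow> sob_le \<sigma> (c N) B"
  shows "sob_le \<sigma> d B"
proof (rule sob_leI)
  fix J :: "int set" assume J: "finite J"
  have "(\<lambda>N. L2_set (\<lambda>j. jap j powr \<sigma> * cmod (c N j)) J) \<longlonglongrightarrow> L2_set (\<lambda>j. jap j powr \<sigma> * cmod (d j)) J"
    unfolding L2_set_def by (intro tendsto_intros lim)
  then show "L2_set (\<lambda>j. jap j powr \<sigma> * cmod (d j)) J \<le> B"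
    by (rule LIMSEQ_le_const2) (use sob_leD[OF B J] in blast)
qed

context quasilinear begin

lemma nonlin_bounded:
  obtains B where "\<And>K q x. q \<in> trig_polys K \<Longrightarrow> wiener_le 2 (fourier_coeff q) R \<Longrightarrow> \<bar>nonlin a g q x\<bar> \<le> B"
proof -
  obtain B1 where B1: "0 \<le> B1" "\<And>p. p \<in> box2 R \<Longrightarrow> \<bar>a1 p\<bar> \<le> B1"
    using smooth_fun_bounded_box2[OF a1] by metis
  obtain B2 where B2: "0 \<le> B2" "\<And>p. p \<in> box2 R \<Longrightarrow> \<bar>g p\<bar> \<le> B2"
    using smooth_fun_bounded_box2[OF g] by metis
  show ?thesis
  proof (rule that)
    fix K q x assume q: "q \<in> trig_polys K" and R: "wiener_le 2 (fourier_coeff q) R"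
    have "wiener_le 1 (fourier_coeff (deriv q)) R"
      using wiener_le_deriv_trig[OF q, of 1 R] R by simp
    then have "\<bar>deriv (deriv q) x\<bar> \<le> R"
      using jet_in_box2[OF trig_polys_deriv(1)[OF q], of R x] by (simp add: box2_def)
    moreover have box: "(q x, deriv q x) \<in> box2 R"
      using wiener_le_weaken[OF R] by (intro jet_in_box2[OF q]) auto
    ultimately have "\<bar>a (q x)\<bar> * \<bar>deriv (deriv q) x\<bar> \<le> B1 * R"
      using B1(1) B1(2)[OF box] by (intro mult_mono) auto
    then show "\<bar>nonlin a g q x\<bar> \<le> B1 * R + B2"
      unfolding nonlin_def by (intro order.trans[OF abs_triangle_ineq] add_mono) (auto simp: abs_mult B2 box)
  qed
qed

lemma torus_cont_nonlin_C_diff: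
  assumes "torus_fun u" "C_diff 2 u"
  shows "torus_cont (nonlin a g u)"
  using C_diff_2_fourier_coeff(1-3)[OF assms]
  unfolding torus_cont_def torus_fun_def nonlin_def
  by (auto intro!: continuous_intros continuous_on_compose2[OF smooth_fun_continuous[OF g, of UNIV]]
      continuous_on_compose2[OF smooth_fun_continuous[OF a, of UNIV]])

lemma nonlin_trig_proj_tendsto:
  assumes u: "torus_fun u" "C_diff 2 u" and B: "wiener_le 2 (fourier_coeff u) B"
  shows "(\<lambda>N. nonlin a g (trig_proj N u) x) \<longlonglongrightarrow> nonlin a g u x"
proof -
  note fc = C_diff_2_fourier_coeff[OF u]
  have w: "wiener_le 0 (fourier_coeff u) B"
    using wiener_le_weaken[OF B] by simp
  have w1: "wiener_le 1 (fourier_coeff (deriv u)) B"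
    unfolding fc by (rule wiener_le_deriv) (use B in simp)
  then have w': "wiener_le 0 (fourier_coeff (deriv u)) B"
    using wiener_le_weaken[OF w1] by simp
  have w'': "wiener_le 0 (fourier_coeff (deriv (deriv u))) B"
    unfolding fc(5) by (rule wiener_le_deriv) (use w1 in simp)
  have d: "deriv (trig_proj N u) = trig_proj N (deriv u)" "deriv (trig_proj N (deriv u)) = trig_proj N (deriv (deriv u))" for N
    using deriv_trig_proj fc(4,5) by blast+
  have "isCont a (u x)" "isCont g (u x, deriv u x)"
    using smooth_fun_continuous[OF a, of UNIV] smooth_fun_continuous[OF g, of UNIV]
    by (auto simp: continuous_on_eq_continuous_at)
  then show ?thesis
    unfolding nonlin_def d
    by (intro tendsto_intros isCont_tendsto_compose[of _ a] isCont_tendsto_compose[of _ g]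
        trig_proj_tendsto[OF fc(1) w] trig_proj_tendsto[OF fc(2) w'] trig_proj_tendsto[OF fc(3) w''])
qed

text \<open>The truncations at \<open>K\<close> and at \<open>N \<ge> K\<close> are compared and then \<open>N\<close> tends to infinity, so that all
  products have a trigonometric polynomial as a factor and all convolutions are finite.\<close>

lemma sob_le_1_nonlin_truncation:
  assumes s: "0 \<le> s"
  obtains C where "0 \<le> C" "\<And>K u. torus_fun u \<Longrightarrow> C_diff 2 u \<Longrightarrow> 1 \<le> K \<Longrightarrow> sob_le (5 + s) (fourier_coeff u) M \<Longrightarrow>
    sob_le 1 (\<lambda>j. fourier_coeff (nonlin a g u) j - fourier_coeff (nonlin a g (trig_proj K u)) j) (C * real K powr (- s - 2))"
proof -
  obtain C where C: "0 \<le> C" "\<And>N p q d. p \<in> trig_polys N \<Longrightarrow> q \<in> trig_polys N \<Longrightarrow>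
    wiener_le 4 (fourier_coeff p) (3 * M) \<Longrightarrow> wiener_le 4 (fourier_coeff q) (3 * M) \<Longrightarrow>
    wiener_le 2 (\<lambda>j. fourier_coeff p j - fourier_coeff q j) d \<Longrightarrow>
    sob_le 3 (\<lambda>j. fourier_coeff p j - fourier_coeff q j) d \<Longrightarrow>
    sob_le 1 (\<lambda>j. fourier_coeff (nonlin a g p) j - fourier_coeff (nonlin a g q) j) (C * d)"
    by (rule sob_le_1_nonlin_diff[where R = "3 * M"], rule that)
  obtain B where B: "\<And>K q x. q \<in> trig_polys K \<Longrightarrow> wiener_le 2 (fourier_coeff q) (3 * M) \<Longrightarrow> \<bar>nonlin a g q x\<bar> \<le> B"
    by (rule nonlin_bounded[where R = "3 * M"], rule that)
  show ?thesis
  proof (rule that[of "C * (3 * \<bar>M\<bar>)"])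
    fix K :: nat and u assume u: "torus_fun u" "C_diff 2 u" and K: "1 \<le> K" and M: "sob_le (5 + s) (fourier_coeff u) M"
    have M0: "0 \<le> M"
      using sob_le_nonneg[OF M] .
    let ?t = "\<lambda>j. fourier_coeff u j - freq_trunc K (fourier_coeff u) j"
    let ?d = "3 * M * real K powr (- s - 2)"
    have w: "wiener_le (4 + s) (fourier_coeff u) (3 * M)"
      by (rule wiener_le_sob_le) (use M in \<open>simp add: add_ac\<close>)
    have w4: "wiener_le 4 (fourier_coeff (trig_proj N u)) (3 * M)" for N
      unfolding fourier_coeff_trig_proj_trunc
      by (intro wiener_le_trunc wiener_le_weaken[OF w]) (use s in auto)
    have w2: "wiener_le 2 (fourier_coeff u) (3 * M)"
      by (rule wiener_le_weaken[OF w]) (use s in auto)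
    have t2: "wiener_le 2 ?t (real K powr (- (s + 2)) * (3 * M))"
      by (rule wiener_le_tail) (use w K s in \<open>auto simp: add_ac\<close>)
    have t3: "sob_le 3 ?t (real K powr (- (s + 2)) * M)"
      by (rule sob_le_tail) (use M K s in \<open>auto simp: add_ac\<close>)
    \<comment> \<open>The modes between \<open>K\<close> and \<open>N\<close> are part of the tail
      beyond \<open>K\<close>, so the resulting bounds do not depend on \<open>N\<close>.\<close>
    have le: "cmod (freq_trunc N (fourier_coeff u) j - freq_trunc K (fourier_coeff u) j) \<le> cmod (?t j)" if "K \<le> N" for N j
      using that by (auto simp: freq_trunc_def)
    have e: "- (s + 2) = - s - 2" by simp
    have sob: "sob_le 1 (\<lambda>j. fourier_coeff (nonlin a g (trig_proj N u)) j - fourier_coeff (nonlin a g (trig_proj K u)) j) (C * ?d)"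
      if "K \<le> N" for N
    proof (rule C(2)[OF trig_proj_in trig_polys_mono[OF trig_proj_in that] w4 w4])
      show "wiener_le 2 (\<lambda>j. fourier_coeff (trig_proj N u) j - fourier_coeff (trig_proj K u) j) ?d"
        unfolding fourier_coeff_trig_proj_trunc using t2 unfolding e
        by (rule wiener_le_mono[where D = 1]) (auto intro!: mult_left_mono le that)
      show "sob_le 3 (\<lambda>j. fourier_coeff (trig_proj N u) j - fourier_coeff (trig_proj K u) j) ?d"
        unfolding fourier_coeff_trig_proj_trunc using t3 unfolding e
        by (rule sob_le_mono[where D = 1]) (use M0 in \<open>auto intro!: mult_left_mono le that\<close>)
    qed
    have lim: "(\<lambda>N. fourier_coeff (nonlin a g (trig_proj N u)) j) \<longlonglongrightarrow> fourier_coeff (nonlin a g u) j" for j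
    proof (rule fourier_coeff_tendsto)
      show "torus_cont (nonlin a g (trig_proj N u))" for N
        by (rule torus_cont_nonlin[OF trig_proj_in])
      show "\<bar>nonlin a g (trig_proj N u) x\<bar> \<le> B" for N x
        by (rule B[OF trig_proj_in]) (rule wiener_le_weaken[OF w4], auto)
    qed (rule torus_cont_nonlin_C_diff[OF u] nonlin_trig_proj_tendsto[OF u w2])+
    have "sob_le 1 (\<lambda>j. fourier_coeff (nonlin a g u) j - fourier_coeff (nonlin a g (trig_proj K u)) j) (C * ?d)"
      by (rule sob_le_limit[OF tendsto_diff[OF lim tendsto_const] sob])
    then show "sob_le 1 (\<lambda>j. fourier_coeff (nonlin a g u) j - fourier_coeff (nonlin a g (trig_proj K u)) j)
        (C * (3 * \<bar>M\<bar>) * real K powr (- s - 2))"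
      using M0 by (simp add: mult_ac)
  qed (use C in simp)
qed

section \<open>Consistency and stability of the interpolated nonlinearity\<close>

lemma f_disc_comp_jet: "f_disc a g K u
    = (\<lambda>x. trig_interp K (comp_jet a1 u) x * deriv (deriv u) x + trig_interp K (comp_jet g u) x)"
  by (simp add: f_disc_def comp_jet_def[abs_def] fun_eq_iff)

lemma torus_cont_f_disc:
  assumes "q \<in> trig_polys K"
  shows "torus_cont (f_disc a g K q)"
  unfolding f_disc_comp_jet
  by (intro torus_cont_add torus_cont_mult trig_polys_torus_cont[OF trig_interp_in]
        trig_polys_torus_cont[OF trig_polys_deriv(1)[OF trig_polys_deriv(1)[OF assms]]])

text \<open>The jet uses up one derivative, so the compositions have weight s + 3 in l^1.
  Interpolation trades s + 2 of these for the power of \<open>K\<close> and leaves the weight 1 in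
  which the error is measured.\<close>

lemma wiener_le_1_f_disc_consistency:
  assumes s: "0 \<le> s"
  obtains C where "0 \<le> C" "\<And>K q. q \<in> trig_polys K \<Longrightarrow> 1 \<le> K \<Longrightarrow> wiener_le (4 + s) (fourier_coeff q) R \<Longrightarrow>
    wiener_le 1 (\<lambda>j. fourier_coeff (f_disc a g K q) j - fourier_coeff (nonlin a g q) j) (C * real K powr (- s - 2))"
proof -
  have e: "- (s + 2) = - s - 2" "s + 2 + 1 = s + 3" "s + 3 + 1 = 4 + s"
    by auto
  have s3: "0 \<le> s + 3" "1 \<le> s + 3"
    using s by auto
  obtain C1 where C1: "\<And>K q. q \<in> trig_polys K \<Longrightarrow> wiener_le (4 + s) (fourier_coeff q) R \<Longrightarrow>
      wiener_le (s + 3) (fourier_coeff (comp_jet a1 q)) C1"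
    by (rule wiener_le_comp_jet[OF a1 s3, where R = R, unfolded e], rule that)
  obtain C2 where C2: "\<And>K q. q \<in> trig_polys K \<Longrightarrow> wiener_le (4 + s) (fourier_coeff q) R \<Longrightarrow>
      wiener_le (s + 3) (fourier_coeff (comp_jet g q)) C2"
    by (rule wiener_le_comp_jet[OF g s3, where R = R, unfolded e], rule that)
  show ?thesis
  proof (rule that[of "2 powr 1 * (3 * \<bar>C1\<bar>) * \<bar>R\<bar> + 3 * \<bar>C2\<bar>"])
    fix K :: nat and q assume q: "q \<in> trig_polys K" and K: "1 \<le> K" and R: "wiener_le (4 + s) (fourier_coeff q) R"
    note q' = trig_polys_deriv(1)[OF q] and q'' = trig_polys_deriv(1)[OF trig_polys_deriv(1)[OF q]]
    have R3: "wiener_le 3 (fourier_coeff q) R"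
      by (rule wiener_le_weaken[OF R]) (use s in auto)
    have Rq: "wiener_le 1 (fourier_coeff (deriv (deriv q))) R"
      using wiener_le_deriv_trig[OF q', of 1 R] wiener_le_deriv_trig[OF q, of 2 R] R3 by simp
    have tc: "torus_cont (comp_jet a1 q)" "torus_cont (comp_jet g q)" "torus_cont (deriv (deriv q))"
      "torus_cont (trig_interp K (comp_jet a1 q))" "torus_cont (trig_interp K (comp_jet g q))"
      by (rule torus_cont_comp_jet[OF a1 q] torus_cont_comp_jet[OF g q] trig_polys_torus_cont[OF q'']
          trig_polys_torus_cont[OF trig_interp_in])+
    let ?k = "real K powr (- s - 2)"
    let ?a = "\<lambda>x. trig_interp K (comp_jet a1 q) x - comp_jet a1 q x"
    let ?g = "\<lambda>x. trig_interp K (comp_jet g q) x - comp_jet g q x"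
    have s2: "0 \<le> s + 2" using s by simp
    have fa: "fourier_coeff ?a = (\<lambda>j. fourier_coeff (trig_interp K (comp_jet a1 q)) j - fourier_coeff (comp_jet a1 q) j)"
      and fg: "fourier_coeff ?g = (\<lambda>j. fourier_coeff (trig_interp K (comp_jet g q)) j - fourier_coeff (comp_jet g q) j)"
      by (intro ext fourier_coeff_diff tc)+
    have "wiener_le 1 (fourier_coeff ?a) (3 * (?k * C1))"
      using wiener_le_1_interp_error[OF tc(1) _ K s2, unfolded e, OF C1[OF q R]] unfolding fa .
    then have w1: "wiener_le 1 (fourier_coeff (\<lambda>x. ?a x * deriv (deriv q) x)) (2 powr 1 * (3 * (?k * C1)) * R)"
      by (rule wiener_le_mult[OF torus_cont_diff[OF tc(4,1)] q'' _ _ Rq, rotated]) simp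
    have w2: "wiener_le 1 (fourier_coeff ?g) (3 * (?k * C2))"
      using wiener_le_1_interp_error[OF tc(2) _ K s2, unfolded e, OF C2[OF q R]] unfolding fg .
    have "f_disc a g K q x - nonlin a g q x = ?a x * deriv (deriv q) x + ?g x" for x
      unfolding f_disc_comp_jet nonlin_comp_jet by (simp add: algebra_simps)
    then have "fourier_coeff (f_disc a g K q) j - fourier_coeff (nonlin a g q) j
        = fourier_coeff (\<lambda>x. ?a x * deriv (deriv q) x) j + fourier_coeff ?g j" for j
      unfolding fourier_coeff_diff[OF torus_cont_f_disc[OF q] torus_cont_nonlin[OF q], symmetric]
      by (simp add: fourier_coeff_add torus_cont_add torus_cont_mult torus_cont_diff tc)
    then have "wiener_le 1 (\<lambda>j. fourier_coeff (f_disc a g K q) j - fourier_coeff (nonlin a g q) j)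
        (2 powr 1 * (3 * (?k * C1)) * R + 3 * (?k * C2))"
      using wiener_le_add[OF w1 w2] by simp
    moreover have "0 \<le> R" "0 \<le> C1" "0 \<le> C2"
      using wiener_le_nonneg[OF R] wiener_le_nonneg[OF C1[OF q R]] wiener_le_nonneg[OF C2[OF q R]] by auto
    ultimately show "wiener_le 1 (\<lambda>j. fourier_coeff (f_disc a g K q) j - fourier_coeff (nonlin a g q) j)
        ((2 powr 1 * (3 * \<bar>C1\<bar>) * \<bar>R\<bar> + 3 * \<bar>C2\<bar>) * ?k)"
      by (simp add: algebra_simps)
  qed simp
qed

text \<open>In contrast to \<open>wiener_le_0_comp_jet\<close>, weight 1 on \<open>q\<close> is
  enough, since the derivative of a(q) contains no q''. The numerical solution has no more than
  this, its error being controlled only in H^2.\<close>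

lemma wiener_le_0_comp_a1:
  obtains C where "\<And>K q. q \<in> trig_polys K \<Longrightarrow> wiener_le 1 (fourier_coeff q) R \<Longrightarrow> wiener_le 0 (fourier_coeff (comp_jet a1 q)) C"
proof -
  obtain B where B: "0 \<le> B" "\<And>p. p \<in> box2 R \<Longrightarrow> \<bar>a1 p\<bar> \<le> B"
    using smooth_fun_bounded_box2[OF a1] by metis
  obtain B1 where B1: "0 \<le> B1" "\<And>p. p \<in> box2 R \<Longrightarrow> \<bar>partial_1 a1 p\<bar> \<le> B1"
    using smooth_fun_bounded_box2[OF smooth_fun_partial_1[OF a1]] by metis
  have p2: "partial_2 a1 p = 0" for p
  proof -
    have "(a1 has_derivative (\<lambda>v. frechet_derivative a (at (fst p)) (fst v))) (at p)"
      by (rule has_derivative_compose[OF has_derivative_fst[OF has_derivative_ident]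
            smooth_fun_has_derivative_frechet[OF a]])
    moreover have "frechet_derivative a (at (fst p)) 0 = 0"
      using linear_0[OF has_derivative_linear[OF smooth_fun_has_derivative_frechet[OF a]]] .
    ultimately show ?thesis
      unfolding partial_2_def by (simp flip: frechet_derivative_at)
  qed
  show ?thesis
  proof (rule that)
    fix K q assume q: "q \<in> trig_polys K" and R: "wiener_le 1 (fourier_coeff q) R"
    note q' = trig_polys_deriv(1)[OF q]
    have box: "(q x, deriv q x) \<in> box2 R" for x
      by (rule jet_in_box2[OF q R])
    then have q'_le: "\<bar>deriv q x\<bar> \<le> R" for x
      by (simp add: box2_def)
    have "sob_le 1 (fourier_coeff (comp_jet a1 q)) (B + B1 * R)"
    proof (rule sob_le_1_bessel)
      show "(comp_jet a1 q has_real_derivative comp_jet (partial_1 a1) q x * deriv q x) (at x)" for x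
        using trig_polys_has_derivative_jet[OF a1 q, of x] by (simp add: comp_jet_def p2)
      show "torus_fun (comp_jet a1 q)" "continuous_on UNIV (\<lambda>x. comp_jet (partial_1 a1) q x * deriv q x)"
        using torus_cont_comp_jet[OF a1 q] torus_cont_comp_jet[OF smooth_fun_partial_1[OF a1] q] trig_polys_torus_cont[OF q']
        by (auto simp: torus_cont_def intro!: continuous_intros)
      show "\<bar>comp_jet a1 q x\<bar> \<le> B" for x
        using B(2)[OF box] by (simp add: comp_jet_def)
      show "\<bar>comp_jet (partial_1 a1) q x * deriv q x\<bar> \<le> B1 * R" for x
        unfolding abs_mult comp_jet_def by (intro mult_mono B1 box q'_le) auto
    qed
    then show "wiener_le 0 (fourier_coeff (comp_jet a1 q)) (3 * (B + B1 * R))"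
      by (intro wiener_le_sob_le) simp
  qed
qed

text \<open>The argument \<open>w\<close> is known only to be close to \<open>q\<close> in H^2. Its
  second derivative therefore enters only through that of w - q, in l^2 and against the interpolant
  of a(w) in l^1. The differences of compositions are bounded pointwise, and
  \<open>sob_le_0_interp\<close> takes care of their interpolants.\<close>

lemma sob_le_0_f_disc_Lipschitz:
  obtains C where "0 \<le> C" "\<And>K q w e. q \<in> trig_polys K \<Longrightarrow> w \<in> trig_polys K \<Longrightarrow> wiener_le 2 (fourier_coeff q) R \<Longrightarrow>
    sob_le 2 (\<lambda>j. fourier_coeff w j - fourier_coeff q j) e \<Longrightarrow> e \<le> 3 \<Longrightarrow>
    sob_le 0 (\<lambda>j. fourier_coeff (f_disc a g K w) j - fourier_coeff (f_disc a g K q) j) (C * e)"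
proof -
  \<comment> \<open>The 9 is the embedding constant 3 times the bound 3 on \<open>e\<close>, so that
    \<open>w\<close> stays in the ball of radius \<open>R'\<close>.\<close>
  define R' where "R' = R + 9"
  obtain C1 where C1: "0 \<le> C1" "\<And>N p q d x. p \<in> trig_polys N \<Longrightarrow> q \<in> trig_polys N \<Longrightarrow>
    wiener_le 1 (fourier_coeff p) R' \<Longrightarrow> wiener_le 1 (fourier_coeff q) R' \<Longrightarrow>
    wiener_le 1 (\<lambda>j. fourier_coeff p j - fourier_coeff q j) d \<Longrightarrow> \<bar>comp_jet a1 p x - comp_jet a1 q x\<bar> \<le> C1 * d"
    by (rule comp_jet_diff[OF a1, where R = R'], rule that)
  obtain C2 where C2: "0 \<le> C2" "\<And>N p q d x. p \<in> trig_polys N \<Longrightarrow> q \<in> trig_polys N \<Longrightarrow>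
    wiener_le 1 (fourier_coeff p) R' \<Longrightarrow> wiener_le 1 (fourier_coeff q) R' \<Longrightarrow>
    wiener_le 1 (\<lambda>j. fourier_coeff p j - fourier_coeff q j) d \<Longrightarrow> \<bar>comp_jet g p x - comp_jet g q x\<bar> \<le> C2 * d"
    by (rule comp_jet_diff[OF g, where R = R'], rule that)
  obtain C3 where C3: "\<And>K q. q \<in> trig_polys K \<Longrightarrow> wiener_le 1 (fourier_coeff q) R' \<Longrightarrow>
      wiener_le 0 (fourier_coeff (comp_jet a1 q)) C3"
    by (rule wiener_le_0_comp_a1[where R = R'], rule that)
  show ?thesis
  proof (rule that[of "\<bar>C3\<bar> + \<bar>R\<bar> * (C1 * 3) + C2 * 3"])
    fix K q w e assume q: "q \<in> trig_polys K" and w: "w \<in> trig_polys K" and R: "wiener_le 2 (fourier_coeff q) R"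
      and e: "sob_le 2 (\<lambda>j. fourier_coeff w j - fourier_coeff q j) e" and e3: "e \<le> 3"
    define r where "r = (\<lambda>x. w x - q x)"
    have r: "r \<in> trig_polys K"
      unfolding r_def by (rule trig_polys_diff[OF w q])
    note q' = trig_polys_deriv(1)[OF q] and q'' = trig_polys_deriv(1)[OF trig_polys_deriv(1)[OF q]]
    note w' = trig_polys_deriv(1)[OF w]
    note r' = trig_polys_deriv(1)[OF r] and r'' = trig_polys_deriv(1)[OF trig_polys_deriv(1)[OF r]]
    have fr: "fourier_coeff r = (\<lambda>j. fourier_coeff w j - fourier_coeff q j)"
      unfolding r_def by (intro ext fourier_coeff_diff trig_polys_torus_cont[OF w] trig_polys_torus_cont[OF q])
    have dr: "deriv r = (\<lambda>x. deriv w x - deriv q x)"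
      unfolding r_def by (intro ext DERIV_imp_deriv DERIV_diff trig_polys_deriv(2)[OF w] trig_polys_deriv(2)[OF q])
    have ddr: "deriv (deriv r) = (\<lambda>x. deriv (deriv w) x - deriv (deriv q) x)"
      unfolding dr by (intro ext DERIV_imp_deriv DERIV_diff trig_polys_deriv(2)[OF w'] trig_polys_deriv(2)[OF q'])
    have e1: "wiener_le 1 (\<lambda>j. fourier_coeff w j - fourier_coeff q j) (3 * e)"
      by (rule wiener_le_sob_le) (use e in simp)
    have R1: "wiener_le 1 (fourier_coeff q) R"
      using wiener_le_weaken[OF R] by simp
    have "wiener_le 1 (\<lambda>j. fourier_coeff q j + (fourier_coeff w j - fourier_coeff q j)) (R + 3 * e)"
      by (rule wiener_le_add[OF R1 e1])
    then have wR: "wiener_le 1 (fourier_coeff w) R'"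
      by (rule wiener_le_mono[where D = 1]) (use e3 in \<open>auto simp: R'_def\<close>)
    have qR: "wiener_le 1 (fourier_coeff q) R'"
      by (rule wiener_le_weaken[OF R1]) (auto simp: R'_def)
    have tc: "torus_cont (comp_jet a1 w)" "torus_cont (comp_jet a1 q)" "torus_cont (comp_jet g w)" "torus_cont (comp_jet g q)"
      by (rule torus_cont_comp_jet[OF a1 q] torus_cont_comp_jet[OF g q] torus_cont_comp_jet[OF a1 w] torus_cont_comp_jet[OF g w])+
    let ?e1 = "\<lambda>x. trig_interp K (comp_jet a1 w) x * deriv (deriv r) x"
    let ?e2 = "\<lambda>x. deriv (deriv q) x * trig_interp K (\<lambda>x. comp_jet a1 w x - comp_jet a1 q x) x"
    let ?e3 = "trig_interp K (\<lambda>x. comp_jet g w x - comp_jet g q x)"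
    have 1: "sob_le 0 (fourier_coeff ?e1) (2 powr 0 * C3 * e)"
    proof (rule sob_le_mult_wiener_sob[OF trig_polys_torus_cont[OF trig_interp_in] r''])
      show "wiener_le 0 (fourier_coeff (trig_interp K (comp_jet a1 w))) C3"
        unfolding fourier_coeff_trig_interp by (rule wiener_le_0_interp[OF tc(1) C3[OF w wR]])
      show "sob_le 0 (fourier_coeff (deriv (deriv r))) e"
        using sob_le_deriv_trig[OF r', of 0 e] sob_le_deriv_trig[OF r, of 1 e] e fr by simp
    qed simp
    have 2: "sob_le 0 (fourier_coeff ?e2) (2 powr 0 * R * (C1 * (3 * e)))"
    proof (rule sob_le_mult_wiener_sob[OF trig_polys_torus_cont[OF q''] trig_interp_in])
      show "wiener_le 0 (fourier_coeff (deriv (deriv q))) R"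
        using wiener_le_deriv_trig[OF q', of 0 R] wiener_le_deriv_trig[OF q, of 1 R] R by simp
      show "sob_le 0 (fourier_coeff (trig_interp K (\<lambda>x. comp_jet a1 w x - comp_jet a1 q x))) (C1 * (3 * e))"
        by (rule sob_le_0_interp) (rule C1(2)[OF w q wR qR e1])
    qed simp
    have 3: "sob_le 0 (fourier_coeff ?e3) (C2 * (3 * e))"
      by (rule sob_le_0_interp) (rule C2(2)[OF w q wR qR e1])
    have "f_disc a g K w x - f_disc a g K q x = (?e1 x + ?e2 x) + ?e3 x" for x
      unfolding f_disc_comp_jet ddr trig_interp_diff by (simp add: algebra_simps)
    moreover have "torus_cont ?e1" "torus_cont ?e2" "torus_cont ?e3"
      by (intro torus_cont_mult trig_polys_torus_cont[OF trig_interp_in] trig_polys_torus_cont[OF r''] trig_polys_torus_cont[OF q''])+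
    ultimately have "fourier_coeff (f_disc a g K w) j - fourier_coeff (f_disc a g K q) j
        = (fourier_coeff ?e1 j + fourier_coeff ?e2 j) + fourier_coeff ?e3 j" for j
      unfolding fourier_coeff_diff[OF torus_cont_f_disc[OF w] torus_cont_f_disc[OF q], symmetric]
      by (simp add: fourier_coeff_add torus_cont_add)
    then have "sob_le 0 (\<lambda>j. fourier_coeff (f_disc a g K w) j - fourier_coeff (f_disc a g K q) j)
        ((2 powr 0 * C3 * e + 2 powr 0 * R * (C1 * (3 * e))) + C2 * (3 * e))"
      using sob_le_add[OF sob_le_add[OF 1 2] 3] by simp
    moreover have "0 \<le> R" "0 \<le> C3"
      using wiener_le_nonneg[OF R] wiener_le_nonneg[OF C3[OF w wR]] by auto
    ultimately show "sob_le 0 (\<lambda>j. fourier_coeff (f_disc a g K w) j - fourier_coeff (f_disc a g K q) j)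
        ((\<bar>C3\<bar> + \<bar>R\<bar> * (C1 * 3) + C2 * 3) * e)"
      by (simp add: algebra_simps)
  qed (use C1 C2 in simp)
qed

end

section \<open>Time derivatives of Fourier coefficients\<close>

lemma has_vector_derivative_complexI:
  fixes f :: "real \<Rightarrow> complex"
  assumes "((\<lambda>y. (f y - f x) / of_real (y - x)) \<longlongrightarrow> f') (at x within S)"
  shows "(f has_vector_derivative f') (at x within S)"
  unfolding has_vector_derivative_def has_derivative_iff_norm
proof
  have "((\<lambda>y. cmod ((f y - f x) / of_real (y - x) - f')) \<longlongrightarrow> 0) (at x within S)"
    by (rule tendsto_norm_zero[OF LIM_zero[OF assms]])
  moreover have "\<forall>\<^sub>F y in at x within S. cmod ((f y - f x) / of_real (y - x) - f')
      = norm (f y - f x - (y - x) *\<^sub>R f') / norm (y - x)"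
  proof (rule eventually_at_filter[THEN iffD2], rule always_eventually, intro allI impI)
    fix y assume "y \<noteq> x"
    then have "(f y - f x) / of_real (y - x) - f' = (f y - f x - (y - x) *\<^sub>R f') / of_real (y - x)"
      by (simp add: field_simps scaleR_conv_of_real)
    then show "cmod ((f y - f x) / of_real (y - x) - f') = norm (f y - f x - (y - x) *\<^sub>R f') / norm (y - x)"
      by (simp add: norm_divide del: of_real_diff)
  qed
  ultimately show "((\<lambda>y. norm (f y - f x - (y - x) *\<^sub>R f') / norm (y - x)) \<longlongrightarrow> 0) (at x within S)"
    by (rule Lim_transform_eventually)
qed (rule bounded_linear_scaleR_left)

text \<open>By the mean value theorem the difference quotients in time are bounded by
  \<open>B\<close> uniformly in x, so dominated convergence applies along every sequence of times
  tending to \<open>t\<close>.\<close>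

lemma fourier_coeff_has_vector_derivative:
  fixes w w' :: "real \<Rightarrow> real \<Rightarrow> real"
  assumes w: "\<And>t. t \<in> {0..T} \<Longrightarrow> torus_cont (w t)" and w': "torus_cont (w' t)"
    and d: "\<And>t x. t \<in> {0..T} \<Longrightarrow> ((\<lambda>\<tau>. w \<tau> x) has_real_derivative w' t x) (at t within {0..T})"
    and B: "\<And>t x. t \<in> {0..T} \<Longrightarrow> \<bar>w' t x\<bar> \<le> B" and t: "t \<in> {0..T}"
  shows "((\<lambda>t. fourier_coeff (w t) j) has_vector_derivative fourier_coeff (w' t) j) (at t within {0..T})"
proof (rule has_vector_derivative_complexI, unfold tendsto_at_iff_sequentially comp_def, intro allI impI)
  fix X assume X: "\<forall>i. X i \<in> {0..T} - {t}" "X \<longlonglongrightarrow> t"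
  define v where "v N x = inverse (X N - t) * (w (X N) x - w t x)" for N x
  have tc: "torus_cont (\<lambda>x. w (X N) x - w t x)" for N
    using X(1) w t by (intro torus_cont_diff) auto
  have "(\<lambda>N. fourier_coeff (v N) j) \<longlonglongrightarrow> fourier_coeff (w' t) j"
  proof (rule fourier_coeff_tendsto[OF _ _ w'])
    show "torus_cont (v N)" for N
      using tc[of N] unfolding v_def torus_cont_def torus_fun_def by (auto intro!: continuous_intros)
    show "\<bar>v N x\<bar> \<le> B" for N x
    proof -
      have "\<bar>w (X N) x - w t x\<bar> \<le> B * \<bar>X N - t\<bar>"
        using field_differentiable_bound[of "{0..T}" "\<lambda>\<tau>. w \<tau> x" "\<lambda>t. w' t x" B "X N" t] d B X(1) t by auto
      moreover have "X N \<noteq> t" using X(1) by auto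
      ultimately show ?thesis
        by (simp add: v_def abs_mult divide_simps)
    qed
    show "(\<lambda>N. v N x) \<longlonglongrightarrow> w' t x" for x
    proof -
      have "((\<lambda>y. (w y x - w t x) / (y - t)) \<longlongrightarrow> w' t x) (at t within {0..T})"
        using d[OF t, of x] by (simp add: has_field_derivative_iff)
      then have "(\<lambda>N. (w (X N) x - w t x) / (X N - t)) \<longlonglongrightarrow> w' t x"
        using X unfolding tendsto_at_iff_sequentially comp_def by blast
      then show ?thesis
        by (simp add: v_def divide_inverse mult.commute)
    qed
  qed
  moreover have "fourier_coeff (v N) j = (fourier_coeff (w (X N)) j - fourier_coeff (w t) j) / of_real (X N - t)" for N
    unfolding v_def fourier_coeff_cmult using X(1) w t
    by (subst fourier_coeff_diff) (auto simp: divide_inverse mult.commute)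
  ultimately show "(\<lambda>N. (fourier_coeff (w (X N)) j - fourier_coeff (w t) j) / of_real (X N - t)) \<longlonglongrightarrow> fourier_coeff (w' t) j"
    by simp
qed

text \<open>The increment is tested against itself, which reduces the claim to the real mean value theorem.\<close>

lemma L2_mvt:
  fixes D D' :: "int \<Rightarrow> real \<Rightarrow> complex"
  assumes b: "0 \<le> b" and J: "finite J"
    and d: "\<And>j \<tau>. j \<in> J \<Longrightarrow> \<tau> \<in> {0..b} \<Longrightarrow> (D j has_vector_derivative D' j \<tau>) (at \<tau> within {0..b})"
    and B: "\<And>\<tau>. \<tau> \<in> {0..b} \<Longrightarrow> L2_set (\<lambda>j. cmod (D' j \<tau>)) J \<le> B"
  shows "L2_set (\<lambda>j. cmod (D j b - D j 0)) J \<le> B * b"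
proof -
  define z where "z j = D j b - D j 0" for j
  define \<phi> where "\<phi> \<tau> = (\<Sum>j\<in>J. Re (cnj (z j) * D j \<tau>))" for \<tau>
  let ?Z = "L2_set (\<lambda>j. cmod (z j)) J"
  have d\<phi>: "(\<phi> has_vector_derivative (\<Sum>j\<in>J. Re (cnj (z j) * D' j \<tau>))) (at \<tau> within {0..b})" if "\<tau> \<in> {0..b}" for \<tau>
    unfolding \<phi>_def
    by (intro has_vector_derivative_sum bounded_linear.has_vector_derivative[OF bounded_linear_Re]
          has_vector_derivative_mult_right d that)
  have aux: "\<bar>Re (cnj x * y)\<bar> \<le> \<bar>cmod x\<bar> * \<bar>cmod y\<bar>" for x y
    by (metis abs_norm_cancel abs_Re_le_cmod complex_mod_cnj norm_mult)
  have le: "\<bar>\<Sum>j\<in>J. Re (cnj (z j) * D' j \<tau>)\<bar> \<le> ?Z * B" if "\<tau> \<in> {0..b}" for \<tau>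
  proof -
    have "\<bar>\<Sum>j\<in>J. Re (cnj (z j) * D' j \<tau>)\<bar> \<le> (\<Sum>j\<in>J. \<bar>cmod (z j)\<bar> * \<bar>cmod (D' j \<tau>)\<bar>)"
      by (rule order.trans[OF sum_abs], rule sum_mono, rule aux)
    also have "\<dots> \<le> ?Z * L2_set (\<lambda>j. cmod (D' j \<tau>)) J"
      by (rule L2_set_mult_ineq)
    also have "\<dots> \<le> ?Z * B"
      by (intro mult_left_mono B that) simp
    finally show ?thesis .
  qed
  have "\<bar>\<phi> b - \<phi> 0\<bar> \<le> ?Z * B * \<bar>b - 0\<bar>"
    using field_differentiable_bound[of "{0..b}" \<phi> "\<lambda>\<tau>. \<Sum>j\<in>J. Re (cnj (z j) * D' j \<tau>)" "?Z * B" b 0] d\<phi> le b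
    by (simp add: has_real_derivative_iff_has_vector_derivative)
  moreover have "\<phi> b - \<phi> 0 = ?Z\<^sup>2"
  proof -
    have "\<phi> b - \<phi> 0 = (\<Sum>j\<in>J. Re (cnj (z j) * z j))"
      by (simp only: \<phi>_def z_def sum_subtractf[symmetric] right_diff_distrib minus_complex.sel)
    also have "\<dots> = (\<Sum>j\<in>J. (cmod (z j))\<^sup>2)"
      by (simp only: mult_cnj_cmod Re_complex_of_real)
    also have "\<dots> = ?Z\<^sup>2"
      by (simp add: L2_set_def sum_nonneg)
    finally show ?thesis .
  qed
  ultimately have "?Z * ?Z \<le> ?Z * (B * b)"
    using b by (simp add: power2_eq_square mult_ac)
  moreover have "0 \<le> B"
    using B[of 0] b order.trans[OF L2_set_nonneg] by auto
  ultimately have "?Z \<le> B * b"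
    using b by (cases "?Z = 0") (auto simp: mult_le_cancel_left_pos less_le)
  then show ?thesis
    by (simp add: z_def)
qed

text \<open>Rests on x^2 \<le> \<eta>^(-2) + \<eta> x^3, by cases on whether x \<eta> exceeds 1.
  With \<open>A\<close> of size \<eta>^3, as for a first difference over a time \<eta>^3, both terms
  have size \<eta>.\<close>

lemma sob_le_interpolate_2:
  assumes "sob_le 0 c A" "sob_le 3 c B" "0 < \<eta>"
  shows "sob_le 2 c (A / \<eta>\<^sup>2 + \<eta> * B)"
proof (rule sob_leI)
  fix J :: "int set" assume J: "finite J"
  have k: "0 \<le> 1 / \<eta>\<^sup>2" "0 \<le> \<eta>" "0 \<le> \<eta> ^ 4"
    using assms(3) by auto
  have le: "x\<^sup>2 \<le> 1 / \<eta>\<^sup>2 + \<eta> * x ^ 3" if "0 < x" for x :: real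
  proof (cases "x * \<eta> \<le> 1")
    case True
    then have "(x * \<eta>)\<^sup>2 \<le> 1\<^sup>2" using that assms(3) by (intro power_mono) auto
    then have "x\<^sup>2 \<le> 1 / \<eta>\<^sup>2" using assms(3) by (simp add: field_simps power_mult_distrib)
    then show ?thesis using that assms(3) by (simp add: add_increasing2)
  next
    case False
    then have "x\<^sup>2 * 1 \<le> x\<^sup>2 * (x * \<eta>)" by (intro mult_left_mono) auto
    also have "\<dots> = \<eta> * x ^ 3" by (simp add: power2_eq_square power3_eq_cube)
    finally show ?thesis by (simp add: add_increasing)
  qed
  have "L2_set (\<lambda>j. jap j powr 2 * cmod (c j)) J
      \<le> L2_set (\<lambda>j. 1 / \<eta>\<^sup>2 * (jap j powr 0 * cmod (c j)) + \<eta> * (jap j powr 3 * cmod (c j))) J"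
  proof (rule L2_set_mono)
    fix j
    have "jap j powr 2 \<le> 1 / \<eta>\<^sup>2 + \<eta> * jap j powr 3"
      using le[OF jap_pos[of j]] by simp
    then have "jap j powr 2 * cmod (c j) \<le> (1 / \<eta>\<^sup>2 + \<eta> * jap j powr 3) * cmod (c j)"
      by (rule mult_right_mono) simp
    then show "jap j powr 2 * cmod (c j) \<le> 1 / \<eta>\<^sup>2 * (jap j powr 0 * cmod (c j)) + \<eta> * (jap j powr 3 * cmod (c j))"
      by (simp add: algebra_simps)
  qed auto
  also have "\<dots> \<le> L2_set (\<lambda>j. 1 / \<eta>\<^sup>2 * (jap j powr 0 * cmod (c j))) J + L2_set (\<lambda>j. \<eta> * (jap j powr 3 * cmod (c j))) J"
    by (rule L2_set_triangle_ineq)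
  also have "\<dots> = 1 / \<eta>\<^sup>2 * L2_set (\<lambda>j. jap j powr 0 * cmod (c j)) J + \<eta> * L2_set (\<lambda>j. jap j powr 3 * cmod (c j)) J"
    by (simp only: L2_set_right_distrib k)
  also have "\<dots> \<le> 1 / \<eta>\<^sup>2 * A + \<eta> * B"
    by (intro add_mono mult_left_mono sob_leD[OF assms(1) J] sob_leD[OF assms(2) J] k)
  finally show "L2_set (\<lambda>j. jap j powr 2 * cmod (c j)) J \<le> A / \<eta>\<^sup>2 + \<eta> * B"
    by simp
qed

text \<open>Rests on x \<le> \<eta>^(-2) + \<eta>^4 x^3, by cases on whether x \<eta>^2 exceeds 1.
  With \<open>A\<close> of size \<eta>^6, as for a second difference over a time \<eta>^3, both
  terms have size \<eta>^4.\<close>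

lemma sob_le_interpolate_1:
  assumes "sob_le 0 c A" "sob_le 3 c B" "0 < \<eta>"
  shows "sob_le 1 c (A / \<eta>\<^sup>2 + \<eta> ^ 4 * B)"
proof (rule sob_leI)
  fix J :: "int set" assume J: "finite J"
  have k: "0 \<le> 1 / \<eta>\<^sup>2" "0 \<le> \<eta>" "0 \<le> \<eta> ^ 4"
    using assms(3) by auto
  have le: "x \<le> 1 / \<eta>\<^sup>2 + \<eta> ^ 4 * x ^ 3" if "0 < x" for x :: real
  proof (cases "x * \<eta>\<^sup>2 \<le> 1")
    case True
    then have "x \<le> 1 / \<eta>\<^sup>2" using assms(3) by (simp add: field_simps)
    then show ?thesis using that assms(3) by (simp add: add_increasing2)
  next
    case False
    then have "x * 1\<^sup>2 \<le> x * (x * \<eta>\<^sup>2)\<^sup>2" using that by (intro mult_left_mono power_mono) auto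
    also have "\<dots> = \<eta> ^ 4 * x ^ 3" by (simp add: power2_eq_square power3_eq_cube power4_eq_xxxx)
    finally show ?thesis by (simp add: add_increasing)
  qed
  have "L2_set (\<lambda>j. jap j powr 1 * cmod (c j)) J
      \<le> L2_set (\<lambda>j. 1 / \<eta>\<^sup>2 * (jap j powr 0 * cmod (c j)) + \<eta> ^ 4 * (jap j powr 3 * cmod (c j))) J"
  proof (rule L2_set_mono)
    fix j
    have "jap j powr 1 \<le> 1 / \<eta>\<^sup>2 + \<eta> ^ 4 * jap j powr 3"
      using le[OF jap_pos[of j]] by simp
    then have "jap j powr 1 * cmod (c j) \<le> (1 / \<eta>\<^sup>2 + \<eta> ^ 4 * jap j powr 3) * cmod (c j)"
      by (rule mult_right_mono) simp
    then show "jap j powr 1 * cmod (c j) \<le> 1 / \<eta>\<^sup>2 * (jap j powr 0 * cmod (c j)) + \<eta> ^ 4 * (jap j powr 3 * cmod (c j))"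
      by (simp add: algebra_simps)
  qed auto
  also have "\<dots> \<le> L2_set (\<lambda>j. 1 / \<eta>\<^sup>2 * (jap j powr 0 * cmod (c j))) J + L2_set (\<lambda>j. \<eta> ^ 4 * (jap j powr 3 * cmod (c j))) J"
    by (rule L2_set_triangle_ineq)
  also have "\<dots> = 1 / \<eta>\<^sup>2 * L2_set (\<lambda>j. jap j powr 0 * cmod (c j)) J + \<eta> ^ 4 * L2_set (\<lambda>j. jap j powr 3 * cmod (c j)) J"
    by (simp only: L2_set_right_distrib k)
  also have "\<dots> \<le> 1 / \<eta>\<^sup>2 * A + \<eta> ^ 4 * B"
    by (intro add_mono mult_left_mono sob_leD[OF assms(1) J] sob_leD[OF assms(2) J] k)
  finally show "L2_set (\<lambda>j. jap j powr 1 * cmod (c j)) J \<le> A / \<eta>\<^sup>2 + \<eta> ^ 4 * B"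
    by simp
qed

text \<open>As a function of the distance r, the symmetric sum has as derivative a difference of
  \<open>\<phi>'\<close> over the distance 2r, which is at most 2 B \<sigma>.\<close>

lemma second_difference_bound:
  fixes \<phi> \<phi>' \<phi>'' :: "real \<Rightarrow> real"
  assumes d: "\<And>t. t \<in> {0..T} \<Longrightarrow> (\<phi> has_real_derivative \<phi>' t) (at t within {0..T})"
      "\<And>t. t \<in> {0..T} \<Longrightarrow> (\<phi>' has_real_derivative \<phi>'' t) (at t within {0..T})"
    and B: "\<And>t. t \<in> {0..T} \<Longrightarrow> \<bar>\<phi>'' t\<bar> \<le> B" and m: "0 \<le> \<sigma>" "0 \<le> m - \<sigma>" "m + \<sigma> \<le> T"
  shows "\<bar>\<phi> (m + \<sigma>) + \<phi> (m - \<sigma>) - 2 * \<phi> m\<bar> \<le> 2 * B * \<sigma>\<^sup>2"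
proof -
  have B0: "0 \<le> B"
    using B[of m] m by auto
  have lip: "\<bar>\<phi>' x - \<phi>' y\<bar> \<le> B * \<bar>x - y\<bar>" if "x \<in> {0..T}" "y \<in> {0..T}" for x y
    using field_differentiable_bound[of "{0..T}" \<phi>' \<phi>'' B x y] d B that by auto
  let ?\<psi> = "\<lambda>r. \<phi> (m + r) + \<phi> (m - r)"
  have "((\<lambda>r. \<phi> (m + r) + \<phi> (m - r)) has_real_derivative \<phi>' (m + r) - \<phi>' (m - r)) (at r within {0..\<sigma>})"
    if r: "r \<in> {0..\<sigma>}" for r
  proof -
    have "m + r \<in> {0..T}" "m - r \<in> {0..T}"
      using r m by auto
    have sub: "(\<lambda>r. m + r) ` {0..\<sigma>} \<subseteq> {0..T}" "(\<lambda>r. m - r) ` {0..\<sigma>} \<subseteq> {0..T}"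
      using m by auto
    have "((\<lambda>r. m + r) has_real_derivative 1) (at r within {0..\<sigma>})" "((\<lambda>r. m - r) has_real_derivative - 1) (at r within {0..\<sigma>})"
      by (auto intro!: derivative_eq_intros)
    note c = DERIV_image_chain[OF DERIV_subset[OF d(1)[OF \<open>m + r \<in> {0..T}\<close>] sub(1)] this(1)]
      DERIV_image_chain[OF DERIV_subset[OF d(1)[OF \<open>m - r \<in> {0..T}\<close>] sub(2)] this(2)]
    show ?thesis
      using DERIV_add[OF c] by (simp add: o_def)
  qed
  moreover have "\<bar>\<phi>' (m + r) - \<phi>' (m - r)\<bar> \<le> 2 * B * \<sigma>" if r: "r \<in> {0..\<sigma>}" for r
  proof -
    have "\<bar>\<phi>' (m + r) - \<phi>' (m - r)\<bar> \<le> B * \<bar>(m + r) - (m - r)\<bar>"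
      by (rule lip) (use r m in auto)
    also have "\<dots> \<le> B * (2 * \<sigma>)"
      using r B0 by (intro mult_left_mono) auto
    finally show ?thesis by simp
  qed
  ultimately have "\<bar>?\<psi> \<sigma> - ?\<psi> 0\<bar> \<le> 2 * B * \<sigma> * \<bar>\<sigma> - 0\<bar>"
    using field_differentiable_bound[of "{0..\<sigma>}" ?\<psi> "\<lambda>r. \<phi>' (m + r) - \<phi>' (m - r)" "2 * B * \<sigma>" \<sigma> 0] m by auto
  then show ?thesis
    using m(1) by (simp add: power2_eq_square mult_ac)
qed

section \<open>The exact solution\<close>

context quasilinear begin

lemma nonlin_first_increment:
  assumes R: "0 \<le> R"
  obtains C where "0 \<le> C"
    "\<And>y z w y' z' w' d. (y, z) \<in> box2 R \<Longrightarrow> (y', z') \<in> box2 R \<Longrightarrow> \<bar>w\<bar> \<le> R \<Longrightarrow>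
      \<bar>y - y'\<bar> \<le> d \<Longrightarrow> \<bar>z - z'\<bar> \<le> d \<Longrightarrow> \<bar>w - w'\<bar> \<le> d \<Longrightarrow>
      \<bar>(a y * w + g (y, z)) - (a y' * w' + g (y', z'))\<bar> \<le> C * d"
proof -
  obtain B0 where B0: "0 \<le> B0" "\<And>p. p \<in> box2 R \<Longrightarrow> \<bar>a1 p\<bar> \<le> B0"
    using smooth_fun_bounded_box2[OF a1] by metis
  obtain B1 where B1: "0 \<le> B1" "\<And>p q. p \<in> box2 R \<Longrightarrow> q \<in> box2 R \<Longrightarrow>
      \<bar>a1 p - a1 q\<bar> \<le> B1 * (\<bar>fst p - fst q\<bar> + \<bar>snd p - snd q\<bar>)"
    using smooth_fun_Lipschitz_box2[OF a1] by metis
  obtain B2 where B2: "0 \<le> B2" "\<And>p q. p \<in> box2 R \<Longrightarrow> q \<in> box2 R \<Longrightarrow>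
      \<bar>g p - g q\<bar> \<le> B2 * (\<bar>fst p - fst q\<bar> + \<bar>snd p - snd q\<bar>)"
    using smooth_fun_Lipschitz_box2[OF g] by metis
  show ?thesis
  proof (rule that[of "B1 * R + B0 + B2 * 2"])
    fix y z w y' z' w' d
    assume b: "(y, z) \<in> box2 R" "(y', z') \<in> box2 R" and w: "\<bar>w\<bar> \<le> R"
      and d: "\<bar>y - y'\<bar> \<le> d" "\<bar>z - z'\<bar> \<le> d" "\<bar>w - w'\<bar> \<le> d"
    have d0: "0 \<le> d" using d(1) by linarith
    \<comment> \<open>\<open>a1\<close> ignores its second argument; evaluating it at 0 there
      removes the increments of z from the bound.\<close>
    have b0: "(y, 0) \<in> box2 R" "(y', 0) \<in> box2 R"
      using b R by (auto simp: box2_def)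
    have "\<bar>a y - a y'\<bar> \<le> B1 * \<bar>y - y'\<bar>"
      using B1(2)[OF b0] by simp
    also have "\<dots> \<le> B1 * d" by (intro mult_left_mono d B1)
    finally have 1: "\<bar>(a y - a y') * w\<bar> \<le> (B1 * d) * R"
      unfolding abs_mult using B1(1) d0 by (intro mult_mono w) auto
    have 2: "\<bar>a y' * (w - w')\<bar> \<le> B0 * d"
      unfolding abs_mult using B0(2)[OF b(2)] B0(1) by (intro mult_mono d) auto
    have "\<bar>g (y, z) - g (y', z')\<bar> \<le> B2 * (\<bar>y - y'\<bar> + \<bar>z - z'\<bar>)"
      using B2(2)[OF b] by simp
    also have "\<dots> \<le> B2 * (d + d)" by (intro mult_left_mono add_mono d B2)
    finally have 3: "\<bar>g (y, z) - g (y', z')\<bar> \<le> B2 * (d + d)" .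
    have "(a y * w + g (y, z)) - (a y' * w' + g (y', z')) = (a y - a y') * w + a y' * (w - w') + (g (y, z) - g (y', z'))"
      by (simp add: algebra_simps)
    then have "\<bar>(a y * w + g (y, z)) - (a y' * w' + g (y', z'))\<bar> \<le> (B1 * d) * R + B0 * d + B2 * (d + d)"
      using 1 2 3 by linarith
    then show "\<bar>(a y * w + g (y, z)) - (a y' * w' + g (y', z'))\<bar> \<le> (B1 * R + B0 + B2 * 2) * d"
      by (simp add: algebra_simps)
  qed (use B0 B1 B2 R in auto)
qed

lemma nonlin_second_increment:
  assumes R: "0 \<le> R"
  obtains C where "0 \<le> C"
    "\<And>y z w y1 z1 w1 y2 z2 w2 d e. (y, z) \<in> box2 R \<Longrightarrow> (y1, z1) \<in> box2 R \<Longrightarrow> (y2, z2) \<in> box2 R \<Longrightarrow> \<bar>w\<bar> \<le> R \<Longrightarrow>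
      \<bar>y1 - y\<bar> \<le> d \<Longrightarrow> \<bar>z1 - z\<bar> \<le> d \<Longrightarrow> \<bar>w1 - w\<bar> \<le> d \<Longrightarrow>
      \<bar>y2 - y\<bar> \<le> d \<Longrightarrow> \<bar>z2 - z\<bar> \<le> d \<Longrightarrow> \<bar>w2 - w\<bar> \<le> d \<Longrightarrow>
      \<bar>y1 + y2 - 2 * y\<bar> \<le> e \<Longrightarrow> \<bar>z1 + z2 - 2 * z\<bar> \<le> e \<Longrightarrow> \<bar>w1 + w2 - 2 * w\<bar> \<le> e \<Longrightarrow>
      \<bar>(a y1 * w1 + g (y1, z1)) + (a y2 * w2 + g (y2, z2)) - 2 * (a y * w + g (y, z))\<bar> \<le> C * (e + d\<^sup>2)"
proof -
  obtain B0 where B0: "0 \<le> B0" "\<And>p. p \<in> box2 R \<Longrightarrow> \<bar>a1 p\<bar> \<le> B0"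
    using smooth_fun_bounded_box2[OF a1] by metis
  obtain B1 where B1: "0 \<le> B1" "\<And>p q. p \<in> box2 R \<Longrightarrow> q \<in> box2 R \<Longrightarrow>
      \<bar>a1 p - a1 q\<bar> \<le> B1 * (\<bar>fst p - fst q\<bar> + \<bar>snd p - snd q\<bar>)"
    using smooth_fun_Lipschitz_box2[OF a1] by metis
  obtain B2 where B2: "0 \<le> B2" "\<And>p q r. p \<in> box2 R \<Longrightarrow> q \<in> box2 R \<Longrightarrow> r \<in> box2 R \<Longrightarrow>
      \<bar>a1 p + a1 r - 2 * a1 q\<bar> \<le> B2 * (\<bar>fst p + fst r - 2 * fst q\<bar> + \<bar>snd p + snd r - 2 * snd q\<bar>
        + (\<bar>fst p - fst q\<bar> + \<bar>snd p - snd q\<bar>)\<^sup>2 + (\<bar>fst r - fst q\<bar> + \<bar>snd r - snd q\<bar>)\<^sup>2)"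
    by (rule smooth_fun_second_difference[OF a1, where R = R], rule that)
  obtain B3 where B3: "0 \<le> B3" "\<And>p q r. p \<in> box2 R \<Longrightarrow> q \<in> box2 R \<Longrightarrow> r \<in> box2 R \<Longrightarrow>
      \<bar>g p + g r - 2 * g q\<bar> \<le> B3 * (\<bar>fst p + fst r - 2 * fst q\<bar> + \<bar>snd p + snd r - 2 * snd q\<bar>
        + (\<bar>fst p - fst q\<bar> + \<bar>snd p - snd q\<bar>)\<^sup>2 + (\<bar>fst r - fst q\<bar> + \<bar>snd r - snd q\<bar>)\<^sup>2)"
    by (rule smooth_fun_second_difference[OF g, where R = R], rule that)
  show ?thesis
  proof (rule that[of "2 * B2 * R + B0 + 2 * B1 + 8 * B3"])
    fix y z w y1 z1 w1 y2 z2 w2 d e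
    assume b: "(y, z) \<in> box2 R" "(y1, z1) \<in> box2 R" "(y2, z2) \<in> box2 R" and w: "\<bar>w\<bar> \<le> R"
      and d: "\<bar>y1 - y\<bar> \<le> d" "\<bar>z1 - z\<bar> \<le> d" "\<bar>w1 - w\<bar> \<le> d" "\<bar>y2 - y\<bar> \<le> d" "\<bar>z2 - z\<bar> \<le> d" "\<bar>w2 - w\<bar> \<le> d"
      and e: "\<bar>y1 + y2 - 2 * y\<bar> \<le> e" "\<bar>z1 + z2 - 2 * z\<bar> \<le> e" "\<bar>w1 + w2 - 2 * w\<bar> \<le> e"
    have d0: "0 \<le> d" and e0: "0 \<le> e" using d(1) e(1) by linarith+
    have b0: "(y, 0) \<in> box2 R" "(y1, 0) \<in> box2 R" "(y2, 0) \<in> box2 R"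
      using b R by (auto simp: box2_def)
    have sq: "x\<^sup>2 \<le> c\<^sup>2" if "0 \<le> x" "x \<le> c" for x c :: real
      using that by (intro power_mono)
    have "\<bar>a y1 + a y2 - 2 * a y\<bar> \<le> B2 * (\<bar>y1 + y2 - 2 * y\<bar> + \<bar>y1 - y\<bar>\<^sup>2 + \<bar>y2 - y\<bar>\<^sup>2)"
      using B2(2)[OF b0(2,1,3)] by simp
    also have "\<dots> \<le> B2 * (e + d\<^sup>2 + d\<^sup>2)"
      by (intro mult_left_mono add_mono e sq d B2) auto
    also have "\<dots> \<le> B2 * (2 * (e + d\<^sup>2))"
      using e0 by (intro mult_left_mono B2) auto
    finally have 1: "\<bar>w * (a y1 + a y2 - 2 * a y)\<bar> \<le> R * (B2 * (2 * (e + d\<^sup>2)))"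
      unfolding abs_mult by (intro mult_mono w R) auto
    have "\<bar>a y * (w1 + w2 - 2 * w)\<bar> \<le> B0 * e"
      unfolding abs_mult using B0(2)[OF b(1)] B0(1) by (intro mult_mono e) auto
    also have "\<dots> \<le> B0 * (e + d\<^sup>2)"
      by (intro mult_left_mono B0) auto
    finally have 2: "\<bar>a y * (w1 + w2 - 2 * w)\<bar> \<le> B0 * (e + d\<^sup>2)" .
    have prod: "\<bar>(a y' - a y) * (w' - w)\<bar> \<le> B1 * (e + d\<^sup>2)"
      if "(y', 0) \<in> box2 R" "\<bar>y' - y\<bar> \<le> d" "\<bar>w' - w\<bar> \<le> d" for y' w'
    proof -
      have "\<bar>a y' - a y\<bar> \<le> B1 * \<bar>y' - y\<bar>"
        using B1(2)[OF that(1) b0(1)] by simp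
      also have "\<dots> \<le> B1 * d" by (intro mult_left_mono that B1)
      finally have "\<bar>(a y' - a y) * (w' - w)\<bar> \<le> (B1 * d) * d"
        unfolding abs_mult using B1(1) d0 by (intro mult_mono that) auto
      also have "\<dots> = B1 * d\<^sup>2" by (simp add: power2_eq_square)
      also have "\<dots> \<le> B1 * (e + d\<^sup>2)" using e0 by (intro mult_left_mono B1) auto
      finally show ?thesis .
    qed
    note 3 = prod[OF b0(2) d(1,3)] and 4 = prod[OF b0(3) d(4,6)]
    have "\<bar>g (y1, z1) + g (y2, z2) - 2 * g (y, z)\<bar>
        \<le> B3 * (\<bar>y1 + y2 - 2 * y\<bar> + \<bar>z1 + z2 - 2 * z\<bar> + (\<bar>y1 - y\<bar> + \<bar>z1 - z\<bar>)\<^sup>2 + (\<bar>y2 - y\<bar> + \<bar>z2 - z\<bar>)\<^sup>2)"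
      using B3(2)[OF b(2,1,3)] by simp
    also have "\<dots> \<le> B3 * (e + e + (d + d)\<^sup>2 + (d + d)\<^sup>2)"
      by (intro mult_left_mono add_mono e sq d B3) auto
    also have "\<dots> \<le> B3 * (8 * (e + d\<^sup>2))"
      using e0 by (intro mult_left_mono B3) (auto simp: power2_eq_square algebra_simps)
    finally have 5: "\<bar>g (y1, z1) + g (y2, z2) - 2 * g (y, z)\<bar> \<le> B3 * (8 * (e + d\<^sup>2))" .
    \<comment> \<open>The discrete product rule for a second difference. Besides second differences
      of the factors it contains two products of increments, which are of size d^2.\<close>
    have "(a y1 * w1 + g (y1, z1)) + (a y2 * w2 + g (y2, z2)) - 2 * (a y * w + g (y, z))
        = w * (a y1 + a y2 - 2 * a y) + a y * (w1 + w2 - 2 * w) + (a y1 - a y) * (w1 - w) + (a y2 - a y) * (w2 - w)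
          + (g (y1, z1) + g (y2, z2) - 2 * g (y, z))"
      by (simp add: algebra_simps)
    then have "\<bar>(a y1 * w1 + g (y1, z1)) + (a y2 * w2 + g (y2, z2)) - 2 * (a y * w + g (y, z))\<bar>
        \<le> R * (B2 * (2 * (e + d\<^sup>2))) + B0 * (e + d\<^sup>2) + B1 * (e + d\<^sup>2) + B1 * (e + d\<^sup>2) + B3 * (8 * (e + d\<^sup>2))"
      using 1 2 3 4 5 by linarith
    then show "\<bar>(a y1 * w1 + g (y1, z1)) + (a y2 * w2 + g (y2, z2)) - 2 * (a y * w + g (y, z))\<bar>
        \<le> (2 * B2 * R + B0 + 2 * B1 + 8 * B3) * (e + d\<^sup>2)"
      by (simp add: algebra_simps)
  qed (use B0 B1 B2 B3 R in auto)
qed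

end

text \<open>One constant \<open>C\<close> for all nonlinear estimates on the ball of radius 3M. It
  is fixed by a, g, s and M alone, before \<kappa>, T, h, K or a solution are given, and this order
  of choice is what the final thresholds rely on.\<close>

locale quasilinear_bounds = quasilinear +
  fixes s M C :: real
  assumes s: "0 \<le> s" and M: "0 \<le> M" and C: "0 \<le> C"
    and sob_3_nonlin: "\<And>K q. q \<in> trig_polys K \<Longrightarrow> wiener_le 4 (fourier_coeff q) (3 * M) \<Longrightarrow>
      sob_le 5 (fourier_coeff q) (3 * M) \<Longrightarrow> sob_le 3 (fourier_coeff (nonlin a g q)) C"
    and nonlin_truncation: "\<And>K u. torus_fun u \<Longrightarrow> C_diff 2 u \<Longrightarrow> 1 \<le> K \<Longrightarrow> sob_le (5 + s) (fourier_coeff u) M \<Longrightarrow>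
      sob_le 1 (\<lambda>j. fourier_coeff (nonlin a g u) j - fourier_coeff (nonlin a g (trig_proj K u)) j) (C * real K powr (- s - 2))"
    and f_disc_consistency: "\<And>K q. q \<in> trig_polys K \<Longrightarrow> 1 \<le> K \<Longrightarrow> wiener_le (4 + s) (fourier_coeff q) (3 * M) \<Longrightarrow>
      sob_le 1 (\<lambda>j. fourier_coeff (f_disc a g K q) j - fourier_coeff (nonlin a g q) j) (C * real K powr (- s - 2))"
    and f_disc_Lipschitz: "\<And>K q w e. q \<in> trig_polys K \<Longrightarrow> w \<in> trig_polys K \<Longrightarrow> wiener_le 2 (fourier_coeff q) (3 * M) \<Longrightarrow>
      sob_le 2 (\<lambda>j. fourier_coeff w j - fourier_coeff q j) e \<Longrightarrow> e \<le> 3 \<Longrightarrow>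
      sob_le 0 (\<lambda>j. fourier_coeff (f_disc a g K w) j - fourier_coeff (f_disc a g K q) j) (C * e)"
    and first_increment: "\<And>y z w y' z' w' d. (y, z) \<in> box2 (3 * M) \<Longrightarrow> (y', z') \<in> box2 (3 * M) \<Longrightarrow> \<bar>w\<bar> \<le> 3 * M \<Longrightarrow>
      \<bar>y - y'\<bar> \<le> d \<Longrightarrow> \<bar>z - z'\<bar> \<le> d \<Longrightarrow> \<bar>w - w'\<bar> \<le> d \<Longrightarrow>
      \<bar>(a y * w + g (y, z)) - (a y' * w' + g (y', z'))\<bar> \<le> C * d"
    and second_increment: "\<And>y z w y1 z1 w1 y2 z2 w2 d e. (y, z) \<in> box2 (3 * M) \<Longrightarrow> (y1, z1) \<in> box2 (3 * M) \<Longrightarrow>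
      (y2, z2) \<in> box2 (3 * M) \<Longrightarrow> \<bar>w\<bar> \<le> 3 * M \<Longrightarrow>
      \<bar>y1 - y\<bar> \<le> d \<Longrightarrow> \<bar>z1 - z\<bar> \<le> d \<Longrightarrow> \<bar>w1 - w\<bar> \<le> d \<Longrightarrow>
      \<bar>y2 - y\<bar> \<le> d \<Longrightarrow> \<bar>z2 - z\<bar> \<le> d \<Longrightarrow> \<bar>w2 - w\<bar> \<le> d \<Longrightarrow>
      \<bar>y1 + y2 - 2 * y\<bar> \<le> e \<Longrightarrow> \<bar>z1 + z2 - 2 * z\<bar> \<le> e \<Longrightarrow> \<bar>w1 + w2 - 2 * w\<bar> \<le> e \<Longrightarrow>
      \<bar>(a y1 * w1 + g (y1, z1)) + (a y2 * w2 + g (y2, z2)) - 2 * (a y * w + g (y, z))\<bar> \<le> C * (e + d\<^sup>2)"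

lemma (in quasilinear) quasilinear_bounds_exists:
  assumes s: "0 \<le> s" and M: "0 \<le> M"
  obtains C where "quasilinear_bounds a g s M C"
proof -
  have R: "0 \<le> 3 * M" using M by simp
  obtain C1 where C1: "\<And>K q. q \<in> trig_polys K \<Longrightarrow> wiener_le 4 (fourier_coeff q) (3 * M) \<Longrightarrow>
      sob_le 5 (fourier_coeff q) (3 * M) \<Longrightarrow> sob_le 3 (fourier_coeff (nonlin a g q)) C1"
    by (rule sob_le_3_nonlin[where R = "3 * M"], rule that)
  obtain C2 where C2: "0 \<le> C2" "\<And>K u. torus_fun u \<Longrightarrow> C_diff 2 u \<Longrightarrow> 1 \<le> K \<Longrightarrow> sob_le (5 + s) (fourier_coeff u) M \<Longrightarrow>
      sob_le 1 (\<lambda>j. fourier_coeff (nonlin a g u) j - fourier_coeff (nonlin a g (trig_proj K u)) j) (C2 * real K powr (- s - 2))"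
    by (rule sob_le_1_nonlin_truncation[OF s, where M = M], rule that)
  obtain C3 where C3: "0 \<le> C3" "\<And>K q. q \<in> trig_polys K \<Longrightarrow> 1 \<le> K \<Longrightarrow> wiener_le (4 + s) (fourier_coeff q) (3 * M) \<Longrightarrow>
      wiener_le 1 (\<lambda>j. fourier_coeff (f_disc a g K q) j - fourier_coeff (nonlin a g q) j) (C3 * real K powr (- s - 2))"
    by (rule wiener_le_1_f_disc_consistency[OF s, where R = "3 * M"], rule that)
  obtain C4 where C4: "0 \<le> C4" "\<And>K q w e. q \<in> trig_polys K \<Longrightarrow> w \<in> trig_polys K \<Longrightarrow> wiener_le 2 (fourier_coeff q) (3 * M) \<Longrightarrow>
      sob_le 2 (\<lambda>j. fourier_coeff w j - fourier_coeff q j) e \<Longrightarrow> e \<le> 3 \<Longrightarrow>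
      sob_le 0 (\<lambda>j. fourier_coeff (f_disc a g K w) j - fourier_coeff (f_disc a g K q) j) (C4 * e)"
    by (rule sob_le_0_f_disc_Lipschitz[where R = "3 * M"], rule that)
  obtain C5 where C5: "0 \<le> C5" "\<And>y z w y' z' w' d. (y, z) \<in> box2 (3 * M) \<Longrightarrow> (y', z') \<in> box2 (3 * M) \<Longrightarrow> \<bar>w\<bar> \<le> 3 * M \<Longrightarrow>
      \<bar>y - y'\<bar> \<le> d \<Longrightarrow> \<bar>z - z'\<bar> \<le> d \<Longrightarrow> \<bar>w - w'\<bar> \<le> d \<Longrightarrow>
      \<bar>(a y * w + g (y, z)) - (a y' * w' + g (y', z'))\<bar> \<le> C5 * d"
    by (rule nonlin_first_increment[OF R], rule that)
  obtain C6 where C6: "0 \<le> C6" "\<And>y z w y1 z1 w1 y2 z2 w2 d e. (y, z) \<in> box2 (3 * M) \<Longrightarrow> (y1, z1) \<in> box2 (3 * M) \<Longrightarrow>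
      (y2, z2) \<in> box2 (3 * M) \<Longrightarrow> \<bar>w\<bar> \<le> 3 * M \<Longrightarrow>
      \<bar>y1 - y\<bar> \<le> d \<Longrightarrow> \<bar>z1 - z\<bar> \<le> d \<Longrightarrow> \<bar>w1 - w\<bar> \<le> d \<Longrightarrow>
      \<bar>y2 - y\<bar> \<le> d \<Longrightarrow> \<bar>z2 - z\<bar> \<le> d \<Longrightarrow> \<bar>w2 - w\<bar> \<le> d \<Longrightarrow>
      \<bar>y1 + y2 - 2 * y\<bar> \<le> e \<Longrightarrow> \<bar>z1 + z2 - 2 * z\<bar> \<le> e \<Longrightarrow> \<bar>w1 + w2 - 2 * w\<bar> \<le> e \<Longrightarrow>
      \<bar>(a y1 * w1 + g (y1, z1)) + (a y2 * w2 + g (y2, z2)) - 2 * (a y * w + g (y, z))\<bar> \<le> C6 * (e + d\<^sup>2)"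
    by (rule nonlin_second_increment[OF R], rule that)
  define C where "C = \<bar>C1\<bar> + C2 + C3 + C4 + C5 + C6"
  have le: "C1 \<le> C" "C2 \<le> C" "C3 \<le> C" "C4 \<le> C" "C5 \<le> C" "C6 \<le> C" "0 \<le> C"
    using C2(1) C3(1) C4(1) C5(1) C6(1) by (auto simp: C_def)
  have "quasilinear_bounds a g s M C"
  proof (unfold_locales, goal_cases)
    case (4 K q)
    then show ?case using sob_le_weaken[OF C1 _ le(1)] by blast
  next
    case (5 K u)
    show ?case
      by (rule sob_le_weaken[OF C2(2)[OF 5]]) (auto intro!: mult_right_mono le)
  next
    case (6 K q)
    show ?case
      by (rule sob_le_weaken[OF sob_le_wiener_le[OF C3(2)[OF 6]]]) (auto intro!: mult_right_mono le)
  next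
    case (7 K q w e)
    show ?case
      by (rule sob_le_weaken[OF C4(2)[OF 7]]) (use sob_le_nonneg[OF 7(4)] in \<open>auto intro!: mult_right_mono le\<close>)
  next
    case (8 y z w y' z' w' d)
    then have "0 \<le> d" by linarith
    then show ?case
      using C5(2)[OF 8] mult_right_mono[OF le(5), of d] by linarith
  next
    case (9 y z w y1 z1 w1 y2 z2 w2 d e)
    have "0 \<le> e + d\<^sup>2"
      using order.trans[OF abs_ge_zero 9(11)] by simp
    then show ?case
      using C6(2)[OF 9] mult_right_mono[OF le(6), of "e + d\<^sup>2"] by linarith
  qed (use s M le in auto)
  then show ?thesis by (rule that)
qed

section \<open>The exact solution mode by mode\<close>

locale exact_solution = quasilinear_bounds +
  fixes \<kappa> T :: real and u ut :: "real \<Rightarrow> real \<Rightarrow> real"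
  assumes T: "0 < T" and \<kappa>: "0 < \<kappa>" "\<kappa> \<le> 1"
    and u: "\<And>t. t \<in> {0..T} \<Longrightarrow> torus_fun (u t)" "\<And>t. t \<in> {0..T} \<Longrightarrow> C_diff 2 (u t)"
      "\<And>t. t \<in> {0..T} \<Longrightarrow> torus_cont (ut t)"
    and du: "\<And>t x. t \<in> {0..T} \<Longrightarrow> ((\<lambda>\<tau>. u \<tau> x) has_real_derivative ut t x) (at t within {0..T})"
    and dut: "\<And>t x. t \<in> {0..T} \<Longrightarrow> ((\<lambda>\<tau>. ut \<tau> x) has_real_derivative
        deriv (deriv (u t)) x - u t x + \<kappa> * nonlin a g (u t) x) (at t within {0..T})"
    and su: "\<And>t. t \<in> {0..T} \<Longrightarrow> sob_le (5 + s) (fourier_coeff (u t)) M"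
    and sut: "\<And>t. t \<in> {0..T} \<Longrightarrow> sob_le (4 + s) (fourier_coeff (ut t)) M"
begin

definition U :: "real \<Rightarrow> int \<Rightarrow> complex" where "U t = fourier_coeff (u t)"
definition V :: "real \<Rightarrow> int \<Rightarrow> complex" where "V t = fourier_coeff (ut t)"
definition F :: "real \<Rightarrow> int \<Rightarrow> complex" where "F t = fourier_coeff (nonlin a g (u t))"

lemma wiener_U: "t \<in> {0..T} \<Longrightarrow> wiener_le (4 + s) (U t) (3 * M)"
  unfolding U_def by (rule wiener_le_sob_le) (use su in \<open>simp add: add_ac\<close>)

lemma wiener_V: "t \<in> {0..T} \<Longrightarrow> wiener_le (3 + s) (V t) (3 * M)"
  unfolding V_def by (rule wiener_le_sob_le) (use sut in \<open>simp add: add_ac\<close>)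

lemma u_jet_bounds:
  assumes t: "t \<in> {0..T}"
  shows "(u t x, deriv (u t) x) \<in> box2 (3 * M)" "\<bar>deriv (deriv (u t)) x\<bar> \<le> 3 * M"
proof -
  note fc = C_diff_2_fourier_coeff[OF u(1,2)[OF t]]
  have 2: "wiener_le 2 (fourier_coeff (u t)) (3 * M)"
    using wiener_le_weaken[OF wiener_U[OF t], of 2] s by (simp add: U_def)
  have 1: "wiener_le 1 (fourier_coeff (deriv (u t))) (3 * M)"
    unfolding fc by (rule wiener_le_deriv) (use 2 in simp)
  have 0: "wiener_le 0 (fourier_coeff (deriv (deriv (u t)))) (3 * M)"
    unfolding fc(5) by (rule wiener_le_deriv) (use 1 in simp)
  show "\<bar>deriv (deriv (u t)) x\<bar> \<le> 3 * M"
    by (rule torus_cont_abs_le[OF fc(3) 0])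
  show "(u t x, deriv (u t) x) \<in> box2 (3 * M)"
    using torus_cont_abs_le[OF fc(1) wiener_le_weaken[OF 2]] torus_cont_abs_le[OF fc(2) wiener_le_weaken[OF 1]]
    by (simp add: box2_def)
qed

lemma U_deriv:
  assumes t: "t \<in> {0..T}"
  shows "((\<lambda>t. U t j) has_vector_derivative V t j) (at t within {0..T})"
  unfolding U_def V_def
proof (rule fourier_coeff_has_vector_derivative[where B = "3 * M"])
  show "\<bar>ut t x\<bar> \<le> 3 * M" if "t \<in> {0..T}" for t x
    using torus_cont_abs_le[OF u(3)[OF that] wiener_le_weaken[OF wiener_V[OF that, unfolded V_def]]] s by simp
qed (use u C_diff_2_fourier_coeff(1) t du in auto)

lemma V_deriv:
  assumes t: "t \<in> {0..T}"
  shows "((\<lambda>t. V t j) has_vector_derivative - (of_real ((jap j)\<^sup>2) * U t j) + of_real \<kappa> * F t j) (at t within {0..T})"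
proof -
  obtain B1 where B1: "\<And>p. p \<in> box2 (3 * M) \<Longrightarrow> \<bar>a1 p\<bar> \<le> B1"
    using smooth_fun_bounded_box2[OF a1] by metis
  obtain B2 where B2: "\<And>p. p \<in> box2 (3 * M) \<Longrightarrow> \<bar>g p\<bar> \<le> B2"
    using smooth_fun_bounded_box2[OF g] by metis
  let ?w = "\<lambda>t x. deriv (deriv (u t)) x - u t x + \<kappa> * nonlin a g (u t) x"
  note fc = C_diff_2_fourier_coeff[OF u(1,2)[OF t]]
  note tn = torus_cont_nonlin_C_diff[OF u(1,2)[OF t]]
  have tcn: "torus_cont (\<lambda>x. \<kappa> * nonlin a g (u t) x)"
    using tn by (auto simp: torus_cont_def torus_fun_def intro!: continuous_intros)
  have "((\<lambda>t. fourier_coeff (ut t) j) has_vector_derivative fourier_coeff (?w t) j) (at t within {0..T})"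
  proof (rule fourier_coeff_has_vector_derivative[OF u(3) _ dut _ t])
    show "torus_cont (?w t)"
      by (intro torus_cont_add torus_cont_diff fc tcn)
    show "\<bar>?w t x\<bar> \<le> 3 * M + 3 * M + (B1 * (3 * M) + B2)" if t: "t \<in> {0..T}" for t x
    proof -
      note b = u_jet_bounds[OF t, of x]
      have "\<bar>a (u t x) * deriv (deriv (u t)) x\<bar> \<le> B1 * (3 * M)"
        unfolding abs_mult using B1[OF b(1)] by (intro mult_mono b(2)) auto
      then have n: "\<bar>nonlin a g (u t) x\<bar> \<le> B1 * (3 * M) + B2"
        unfolding nonlin_def using B2[OF b(1)] by linarith
      have "\<bar>\<kappa> * nonlin a g (u t) x\<bar> \<le> 1 * \<bar>nonlin a g (u t) x\<bar>"
        unfolding abs_mult using \<kappa> by (intro mult_right_mono) auto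
      then show ?thesis
        using n b by (auto simp: box2_def)
    qed
  qed
  moreover have "fourier_coeff (?w t) j = - (of_real ((jap j)\<^sup>2) * U t j) + of_real \<kappa> * F t j"
  proof -
    have e: "of_real ((jap j)\<^sup>2) = (of_int j)\<^sup>2 + (1::complex)"
      unfolding jap_square by simp
    have "fourier_coeff (?w t) j = fourier_coeff (\<lambda>x. deriv (deriv (u t)) x - u t x) j + fourier_coeff (\<lambda>x. \<kappa> * nonlin a g (u t) x) j"
      by (rule fourier_coeff_add[OF torus_cont_diff[OF fc(3,1)] tcn])
    also have "\<dots> = (\<i> * of_int j * (\<i> * of_int j * U t j) - U t j) + of_real \<kappa> * F t j"
      by (simp only: fourier_coeff_diff[OF fc(3,1)] fourier_coeff_cmult fc(4,5) U_def F_def)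
    also have "\<dots> = - (of_real ((jap j)\<^sup>2) * U t j) + of_real \<kappa> * F t j"
      unfolding e by (simp add: algebra_simps power2_eq_square)
    finally show ?thesis .
  qed
  ultimately show ?thesis
    by (simp add: V_def)
qed

text \<open>The comparison function for the numerical solution. Since the nonlinear estimates
  concern trigonometric polynomials, it is \<open>F0\<close>, the nonlinearity at \<open>q\<close>,
  that has an H^3 bound, and \<open>F\<close> is compared with it.\<close>

definition q :: "nat \<Rightarrow> real \<Rightarrow> real \<Rightarrow> real" where "q K t = trig_proj K (u t)"
definition F0 :: "nat \<Rightarrow> real \<Rightarrow> int \<Rightarrow> complex" where "F0 K t = fourier_coeff (nonlin a g (q K t))"

lemma q_in: "q K t \<in> trig_polys K"
  unfolding q_def by (rule trig_proj_in)

lemma fourier_coeff_q: "fourier_coeff (q K t) = freq_trunc K (U t)"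
  unfolding q_def U_def by (rule fourier_coeff_trig_proj_trunc)

lemma q_bounds:
  assumes t: "t \<in> {0..T}"
  shows "wiener_le (4 + s) (fourier_coeff (q K t)) (3 * M)" "wiener_le 4 (fourier_coeff (q K t)) (3 * M)"
    "wiener_le 2 (fourier_coeff (q K t)) (3 * M)" "sob_le 5 (fourier_coeff (q K t)) (3 * M)"
proof -
  show w: "wiener_le (4 + s) (fourier_coeff (q K t)) (3 * M)"
    unfolding fourier_coeff_q by (rule wiener_le_trunc[OF wiener_U[OF t]])
  show "wiener_le 4 (fourier_coeff (q K t)) (3 * M)" "wiener_le 2 (fourier_coeff (q K t)) (3 * M)"
    using wiener_le_weaken[OF w] s by auto
  show "sob_le 5 (fourier_coeff (q K t)) (3 * M)"
    unfolding fourier_coeff_q U_def by (rule sob_le_trunc, rule sob_le_weaken[OF su[OF t]]) (use s M in auto)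
qed

lemma sob_3_F0: "t \<in> {0..T} \<Longrightarrow> sob_le 3 (F0 K t) C"
  unfolding F0_def by (intro sob_3_nonlin[OF q_in] q_bounds)

lemma sob_1_F_F0: "t \<in> {0..T} \<Longrightarrow> 1 \<le> K \<Longrightarrow> sob_le 1 (\<lambda>j. F t j - F0 K t j) (C * real K powr (- s - 2))"
  unfolding F_def F0_def q_def by (rule nonlin_truncation) (use u su in auto)

text \<open>The difference of \<open>F\<close> and \<open>F0\<close> is small only in H^1, but the
  power of \<open>K\<close> in its bound pays for the factor (2K)^2 of the inverse estimate. This
  leaves 4C, to which \<open>F0\<close> adds C.\<close>

lemma sob_3_F_trunc:
  assumes t: "t \<in> {0..T}" and K: "1 \<le> K"
  shows "sob_le 3 (freq_trunc K (F t)) (5 * C)"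
proof -
  have 1: "sob_le 3 (freq_trunc K (F0 K t)) C"
    by (rule sob_le_trunc[OF sob_3_F0[OF t]])
  have "sob_le (1 + 2) (freq_trunc K (\<lambda>j. F t j - F0 K t j)) ((2 * real K) powr 2 * (C * real K powr (- s - 2)))"
    by (rule sob_le_inverse[OF sob_1_F_F0[OF t K] K]) simp
  then have 2: "sob_le 3 (freq_trunc K (\<lambda>j. F t j - F0 K t j)) ((2 * real K) powr 2 * (C * real K powr (- s - 2)))"
    by simp
  have "(2 * real K) powr 2 * (C * real K powr (- s - 2)) = 4 * C * (real K powr 2 * real K powr (- s - 2))"
    by (simp add: powr_mult)
  also have "\<dots> = 4 * C * real K powr (- s)"
    by (subst powr_add[symmetric]) simp
  also have "\<dots> \<le> 4 * C * 1"
    using K s C by (intro mult_left_mono) (auto simp: powr_minus ge_one_powr_ge_zero inverse_le_1_iff)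
  finally have le: "(2 * real K) powr 2 * (C * real K powr (- s - 2)) \<le> 4 * C" by simp
  have "sob_le 3 (\<lambda>j. freq_trunc K (F0 K t) j + freq_trunc K (\<lambda>j. F t j - F0 K t j) j) (C + 4 * C)"
    by (rule sob_le_add[OF 1 sob_le_weaken[OF 2 _ le]]) simp
  moreover have "(\<lambda>j. freq_trunc K (F0 K t) j + freq_trunc K (\<lambda>j. F t j - F0 K t j) j) = freq_trunc K (F t)"
    by (auto simp: freq_trunc_def)
  ultimately show ?thesis by simp
qed

text \<open>At a fixed point x, the truncated solution and its first two derivatives in x are sums
  of this form, so one multiplier \<open>z\<close> treats all three. In the constant, 3M bounds the
  velocity as well as the linear part of the acceleration, and 15C = 3 * 5C bounds the
  forcing.\<close>

lemma jet_increments: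
  assumes K: "1 \<le> K" and z: "\<And>j. cmod (z j) \<le> (jap j)\<^sup>2"
  defines "\<phi> \<equiv> \<lambda>t. Re (\<Sum>j\<in>{- int K..int K}. z j * U t j)" and "D \<equiv> 3 * M + 15 * C"
  shows "t \<in> {0..T} \<Longrightarrow> t' \<in> {0..T} \<Longrightarrow> \<bar>\<phi> t - \<phi> t'\<bar> \<le> D * \<bar>t - t'\<bar>"
    and "0 \<le> \<sigma> \<Longrightarrow> 0 \<le> m - \<sigma> \<Longrightarrow> m + \<sigma> \<le> T \<Longrightarrow> \<bar>\<phi> (m + \<sigma>) + \<phi> (m - \<sigma>) - 2 * \<phi> m\<bar> \<le> 2 * D * \<sigma>\<^sup>2"
proof -
  let ?J = "{- int K..int K}"
  let ?F = "\<lambda>t j. - (of_real ((jap j)\<^sup>2) * U t j) + of_real \<kappa> * F t j"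
  let ?\<phi>1 = "\<lambda>t. Re (\<Sum>j\<in>?J. z j * V t j)" and ?\<phi>2 = "\<lambda>t. Re (\<Sum>j\<in>?J. z j * ?F t j)"
  have sum_le: "\<bar>Re (\<Sum>j\<in>?J. z j * c j)\<bar> \<le> B" if "wiener_le 2 (freq_trunc K c) B" for c B
  proof -
    have "\<bar>Re (\<Sum>j\<in>?J. z j * c j)\<bar> \<le> (\<Sum>j\<in>?J. cmod (z j * c j))"
      by (rule order.trans[OF abs_Re_le_cmod norm_sum])
    also have "\<dots> \<le> (\<Sum>j\<in>?J. jap j powr 2 * cmod (freq_trunc K c j))"
    proof (rule sum_mono)
      fix j assume "j \<in> ?J"
      then show "cmod (z j * c j) \<le> jap j powr 2 * cmod (freq_trunc K c j)"
        using mult_right_mono[OF z[of j], of "cmod (c j)"] by (auto simp: freq_trunc_def norm_mult)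
    qed
    also have "\<dots> \<le> B"
      by (rule wiener_leD[OF that]) simp
    finally show ?thesis .
  qed
  have d1: "(\<phi> has_real_derivative ?\<phi>1 t) (at t within {0..T})" if t: "t \<in> {0..T}" for t
    unfolding \<phi>_def has_real_derivative_iff_has_vector_derivative
    by (intro bounded_linear.has_vector_derivative[OF bounded_linear_Re] has_vector_derivative_sum
          has_vector_derivative_mult_right U_deriv t)
  have d2: "(?\<phi>1 has_real_derivative ?\<phi>2 t) (at t within {0..T})" if t: "t \<in> {0..T}" for t
    unfolding has_real_derivative_iff_has_vector_derivative
    by (intro bounded_linear.has_vector_derivative[OF bounded_linear_Re] has_vector_derivative_sum
          has_vector_derivative_mult_right V_deriv t)
  have b1: "\<bar>?\<phi>1 t\<bar> \<le> D" if t: "t \<in> {0..T}" for t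
  proof (rule sum_le, rule wiener_le_trunc)
    show "wiener_le 2 (V t) D"
      by (rule wiener_le_weaken[OF wiener_V[OF t]]) (use s C in \<open>auto simp: D_def\<close>)
  qed
  have b2: "\<bar>?\<phi>2 t\<bar> \<le> D" if t: "t \<in> {0..T}" for t
  proof (rule sum_le)
    have w1: "wiener_le 2 (\<lambda>j. freq_trunc K (\<lambda>j. of_real ((jap j)\<^sup>2) * U t j) j) (3 * M)"
    proof (rule wiener_le_trunc, rule wiener_le_mono[where D = 1])
      show "wiener_le 4 (U t) (3 * M)"
        by (rule wiener_le_weaken[OF wiener_U[OF t]]) (use s in auto)
      fix j
      have "jap j powr 2 * (jap j)\<^sup>2 = jap j powr 4"
        by (simp flip: power_add)
      then have "jap j powr 2 * cmod (of_real ((jap j)\<^sup>2) * U t j) = jap j powr 4 * cmod (U t j)"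
        by (simp only: norm_mult norm_of_real abs_power2 mult.assoc[symmetric])
      then show "jap j powr 2 * cmod (of_real ((jap j)\<^sup>2) * U t j) \<le> 1 * (jap j powr 4 * cmod (U t j))"
        by linarith
    qed auto
    have w2: "wiener_le 2 (\<lambda>j. freq_trunc K (\<lambda>j. of_real \<kappa> * F t j) j) (15 * C)"
    proof (rule wiener_le_mono[where D = \<kappa>])
      show "wiener_le 2 (freq_trunc K (F t)) (3 * (5 * C))"
        by (rule wiener_le_sob_le) (use sob_3_F_trunc[OF t K] in simp)
      show "\<kappa> * (3 * (5 * C)) \<le> 15 * C"
        using mult_right_mono[OF \<kappa>(2), of "15 * C"] C by simp
    qed (use \<kappa> in \<open>auto simp: freq_trunc_def norm_mult\<close>)
    have "freq_trunc K (?F t) = (\<lambda>j. freq_trunc K (\<lambda>j. of_real \<kappa> * F t j) j - freq_trunc K (\<lambda>j. of_real ((jap j)\<^sup>2) * U t j) j)"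
      by (auto simp: freq_trunc_def)
    then show "wiener_le 2 (freq_trunc K (?F t)) D"
      using wiener_le_diff[OF w2 w1] by (simp add: D_def add.commute)
  qed
  show "\<bar>\<phi> t - \<phi> t'\<bar> \<le> D * \<bar>t - t'\<bar>" if "t \<in> {0..T}" "t' \<in> {0..T}"
    using field_differentiable_bound[of "{0..T}" \<phi> ?\<phi>1 D t t'] d1 b1 that by auto
  show "\<bar>\<phi> (m + \<sigma>) + \<phi> (m - \<sigma>) - 2 * \<phi> m\<bar> \<le> 2 * D * \<sigma>\<^sup>2" if "0 \<le> \<sigma>" "0 \<le> m - \<sigma>" "m + \<sigma> \<le> T"
    by (rule second_difference_bound[OF d1 d2 b2 that])
qed

end

section \<open>The local error of the midpoint filters\<close>

lemma L2_set_scale_le: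
  assumes "0 \<le> r" "L2_set f J \<le> B"
  shows "L2_set (\<lambda>j. r * f j) J \<le> r * B"
  using mult_left_mono[OF assms(2,1)] by (simp add: L2_set_right_distrib[OF assms(1)])

lemma abs_sin_diff_le: "\<bar>sin x - sin y\<bar> \<le> \<bar>x - y\<bar>" for x y :: real
  using field_differentiable_bound[of UNIV sin cos 1 x y] by (auto intro: DERIV_sin)

lemma abs_cos_diff_le: "\<bar>cos x - cos y\<bar> \<le> \<bar>x - y\<bar>" for x y :: real
  using field_differentiable_bound[of UNIV cos "\<lambda>x. - sin x" 1 x y] by (auto intro: DERIV_cos)

lemma abs_cos_diff_one_le: "\<bar>cos y - 1\<bar> \<le> y\<^sup>2 / 2" for y :: real
proof -
  have "cos y = 1 - 2 * (sin (y / 2))\<^sup>2"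
    using cos_double_sin[of "y / 2"] by simp
  moreover have "(sin (y / 2))\<^sup>2 \<le> (y / 2)\<^sup>2"
    using abs_sin_x_le_abs_x[of "y / 2"] by (simp only: abs_le_square_iff)
  ultimately show ?thesis
    by (simp add: power_divide)
qed

lemma mult_sinc: "x * sinc x = sin x"
  by simp

lemma coeff_assumptionD:
  assumes "coeff_assumption c b1 bb1" "0 \<le> \<xi>"
  shows "\<bar>\<xi> * bb1 (\<xi>\<^sup>2)\<bar> \<le> c" "\<bar>\<xi>\<^sup>2 * bb1 (\<xi>\<^sup>2)\<bar> \<le> c" "\<bar>bb1 (\<xi>\<^sup>2) - 1/2 * sinc (\<xi>/2)\<bar> \<le> c * \<xi>"
    "\<bar>\<xi> * b1 (\<xi>\<^sup>2)\<bar> \<le> c" "\<bar>b1 (\<xi>\<^sup>2) - cos (\<xi>/2)\<bar> \<le> c * \<xi>\<^sup>2"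
  using assms unfolding coeff_assumption_def by blast+

lemma coeff_assumption_nonneg: "coeff_assumption c b1 bb1 \<Longrightarrow> 0 \<le> c"
  using coeff_assumptionD(1)[of c b1 bb1 0] by simp

text \<open>Up to \<xi> = 1 the comparison with the cosine gives the bound, beyond it the decay of
  b1.\<close>

lemma coeff_b1_bounded:
  assumes "coeff_assumption c b1 bb1" "0 \<le> \<xi>"
  shows "\<bar>b1 (\<xi>\<^sup>2)\<bar> \<le> 1 + c"
proof (cases "\<xi> \<le> 1")
  case True
  have "\<bar>b1 (\<xi>\<^sup>2) - cos (\<xi>/2)\<bar> \<le> c * \<xi>\<^sup>2"
    by (rule coeff_assumptionD[OF assms])
  also have "\<dots> \<le> c * 1"
    using True assms coeff_assumption_nonneg by (intro mult_left_mono power_le_one) auto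
  finally show ?thesis
    using abs_cos_le_one[of "\<xi>/2"] by linarith
next
  case False
  then have "1 * \<bar>b1 (\<xi>\<^sup>2)\<bar> \<le> \<bar>\<xi>\<bar> * \<bar>b1 (\<xi>\<^sup>2)\<bar>"
    by (intro mult_right_mono) auto
  then show ?thesis
    using coeff_assumptionD(4)[OF assms] by (simp add: abs_mult)
qed

text \<open>With \<xi> = h \<omega> the two sines add up to 2 sin(\<xi>/2) cos(\<sigma> \<omega>).
  The factor \<xi> in front of bb1 raises its first-order approximation property to second order,
  and sin(\<xi>/2) (cos(\<sigma> \<omega>) - 1) is a product of two first-order terms.\<close>

lemma coeff_bb1_midpoint:
  assumes A: "coeff_assumption c b1 bb1" "0 < h" "0 < \<omega>" and \<sigma>: "0 \<le> \<sigma>" "\<sigma> \<le> h / 2"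
  shows "\<bar>sin ((h / 2 - \<sigma>) * \<omega>) + sin ((h / 2 + \<sigma>) * \<omega>) - 2 * (h * \<omega> * bb1 ((h * \<omega>)\<^sup>2))\<bar> \<le> (1 + 2 * c) * (h * \<omega>)\<^sup>2"
proof -
  define \<xi> where "\<xi> = h * \<omega>"
  have \<xi>: "0 < \<xi>" using A by (simp add: \<xi>_def)
  have "sin ((h / 2 - \<sigma>) * \<omega>) + sin ((h / 2 + \<sigma>) * \<omega>) = 2 * sin (\<xi> / 2) * cos (\<sigma> * \<omega>)"
    by (simp add: \<xi>_def left_diff_distrib distrib_right sin_add sin_diff)
  then have "sin ((h / 2 - \<sigma>) * \<omega>) + sin ((h / 2 + \<sigma>) * \<omega>) - 2 * (\<xi> * bb1 (\<xi>\<^sup>2))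
      = 2 * (sin (\<xi> / 2) * (cos (\<sigma> * \<omega>) - 1)) + 2 * (sin (\<xi> / 2) - \<xi> * bb1 (\<xi>\<^sup>2))"
    by (simp add: algebra_simps)
  moreover have "\<bar>sin (\<xi> / 2) * (cos (\<sigma> * \<omega>) - 1)\<bar> \<le> (\<xi> / 2) * \<xi>"
    unfolding abs_mult
  proof (rule mult_mono)
    show "\<bar>sin (\<xi> / 2)\<bar> \<le> \<xi> / 2"
      using abs_sin_x_le_abs_x[of "\<xi> / 2"] \<xi> by simp
    have "\<bar>cos (\<sigma> * \<omega>) - 1\<bar> \<le> \<sigma> * \<omega>"
      using abs_cos_diff_le[of "\<sigma> * \<omega>" 0] A \<sigma> by simp
    also have "\<dots> \<le> \<xi>"
      unfolding \<xi>_def using A \<sigma> by (intro mult_right_mono) auto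
    finally show "\<bar>cos (\<sigma> * \<omega>) - 1\<bar> \<le> \<xi>" .
  qed (use \<xi> in auto)
  moreover have "\<bar>sin (\<xi> / 2) - \<xi> * bb1 (\<xi>\<^sup>2)\<bar> \<le> \<xi> * (c * \<xi>)"
  proof -
    have "sin (\<xi> / 2) - \<xi> * bb1 (\<xi>\<^sup>2) = \<xi> * (1/2 * sinc (\<xi> / 2) - bb1 (\<xi>\<^sup>2))"
      using mult_sinc[of "\<xi> / 2"] by (simp only: right_diff_distrib)
    then have "\<bar>sin (\<xi> / 2) - \<xi> * bb1 (\<xi>\<^sup>2)\<bar> = \<xi> * \<bar>bb1 (\<xi>\<^sup>2) - 1/2 * sinc (\<xi> / 2)\<bar>"
      using \<xi> by (simp only: abs_mult abs_minus_commute abs_of_pos)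
    then show ?thesis
      using coeff_assumptionD(3)[OF A(1), of \<xi>] \<xi> by simp
  qed
  moreover have "\<bar>A\<bar> \<le> 2 * x + 2 * y" if "A = 2 * P + 2 * Q" "\<bar>P\<bar> \<le> x" "\<bar>Q\<bar> \<le> y" for A P Q x y :: real
    using that by linarith
  ultimately have "\<bar>sin ((h / 2 - \<sigma>) * \<omega>) + sin ((h / 2 + \<sigma>) * \<omega>) - 2 * (\<xi> * bb1 (\<xi>\<^sup>2))\<bar> \<le> 2 * ((\<xi> / 2) * \<xi>) + 2 * (\<xi> * (c * \<xi>))"
    by blast
  also have "\<dots> = (1 + 2 * c) * \<xi>\<^sup>2"
    by (simp add: power2_eq_square algebra_simps)
  finally show ?thesis
    by (simp only: \<xi>_def)
qed

text \<open>The two cosines add up to 2 cos(\<xi>/2) cos(\<sigma> \<omega>). The first factor does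
  not vanish with \<xi>, so here the deviation of the second from 1 is estimated to second
  order.\<close>

lemma coeff_b1_midpoint:
  assumes A: "coeff_assumption c b1 bb1" "0 < h" "0 < \<omega>" and \<sigma>: "0 \<le> \<sigma>" "\<sigma> \<le> h / 2"
  shows "\<bar>cos ((h / 2 - \<sigma>) * \<omega>) + cos ((h / 2 + \<sigma>) * \<omega>) - 2 * b1 ((h * \<omega>)\<^sup>2)\<bar> \<le> (1 + 2 * c) * (h * \<omega>)\<^sup>2"
proof -
  define \<xi> where "\<xi> = h * \<omega>"
  have \<xi>: "0 < \<xi>" using A by (simp add: \<xi>_def)
  have "cos ((h / 2 - \<sigma>) * \<omega>) + cos ((h / 2 + \<sigma>) * \<omega>) = 2 * cos (\<xi> / 2) * cos (\<sigma> * \<omega>)"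
    by (simp add: \<xi>_def left_diff_distrib distrib_right cos_add cos_diff)
  then have "cos ((h / 2 - \<sigma>) * \<omega>) + cos ((h / 2 + \<sigma>) * \<omega>) - 2 * b1 (\<xi>\<^sup>2)
      = 2 * (cos (\<xi> / 2) * (cos (\<sigma> * \<omega>) - 1)) - 2 * (b1 (\<xi>\<^sup>2) - cos (\<xi> / 2))"
    by (simp add: algebra_simps)
  moreover have "\<bar>cos (\<xi> / 2) * (cos (\<sigma> * \<omega>) - 1)\<bar> \<le> 1 * (\<xi>\<^sup>2 / 2)"
    unfolding abs_mult
  proof (rule mult_mono)
    have "\<bar>cos (\<sigma> * \<omega>) - 1\<bar> \<le> (\<sigma> * \<omega>)\<^sup>2 / 2"
      by (rule abs_cos_diff_one_le)
    also have "\<dots> \<le> \<xi>\<^sup>2 / 2"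
      unfolding \<xi>_def using A \<sigma> by (intro divide_right_mono power_mono mult_right_mono) auto
    finally show "\<bar>cos (\<sigma> * \<omega>) - 1\<bar> \<le> \<xi>\<^sup>2 / 2" .
  qed auto
  moreover have "\<bar>b1 (\<xi>\<^sup>2) - cos (\<xi> / 2)\<bar> \<le> c * \<xi>\<^sup>2"
    by (rule coeff_assumptionD[OF A(1)]) (use \<xi> in simp)
  moreover have "\<bar>A\<bar> \<le> 2 * x + 2 * y" if "A = 2 * P - 2 * Q" "\<bar>P\<bar> \<le> x" "\<bar>Q\<bar> \<le> y" for A P Q x y :: real
    using that by linarith
  ultimately have "\<bar>cos ((h / 2 - \<sigma>) * \<omega>) + cos ((h / 2 + \<sigma>) * \<omega>) - 2 * b1 (\<xi>\<^sup>2)\<bar> \<le> 2 * (1 * (\<xi>\<^sup>2 / 2)) + 2 * (c * \<xi>\<^sup>2)"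
    by blast
  also have "\<dots> = (1 + 2 * c) * \<xi>\<^sup>2"
    by (simp add: algebra_simps)
  finally show ?thesis
    by (simp only: \<xi>_def)
qed

text \<open>Conservation of energy: in the scaled variables \<open>(jap j)\<^sup>2 * U\<close> and
  \<open>jap j * V\<close> the free flow rotates each mode.\<close>

lemma norm_rotate:
  fixes x y :: complex
  assumes "co\<^sup>2 + si\<^sup>2 = 1"
  shows "norm (of_real co * x + of_real si * y, - of_real si * x + of_real co * y) = norm (x, y)"
proof -
  have r: "(co * p + si * r)\<^sup>2 + (- si * p + co * r)\<^sup>2 = p\<^sup>2 + r\<^sup>2" for p r :: real
  proof -
    have "(co * p + si * r)\<^sup>2 + (- si * p + co * r)\<^sup>2 = (co\<^sup>2 + si\<^sup>2) * (p\<^sup>2 + r\<^sup>2)"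
      by (simp add: power2_eq_square algebra_simps)
    then show ?thesis using assms by simp
  qed
  have "(cmod (of_real co * x + of_real si * y))\<^sup>2 + (cmod (- of_real si * x + of_real co * y))\<^sup>2
      = ((co * Re x + si * Re y)\<^sup>2 + (- si * Re x + co * Re y)\<^sup>2) + ((co * Im x + si * Im y)\<^sup>2 + (- si * Im x + co * Im y)\<^sup>2)"
    by (simp add: cmod_power2)
  also have "\<dots> = (cmod x)\<^sup>2 + (cmod y)\<^sup>2"
    unfolding r by (simp add: cmod_power2)
  finally show ?thesis
    by (simp add: norm_Pair)
qed

lemma cmod_rotate_le:
  assumes "co\<^sup>2 + si\<^sup>2 = 1"
  shows "cmod (of_real co * x + of_real si * y) \<le> norm (x, y)"
  unfolding norm_rotate[OF assms, of x y, symmetric] by (simp add: norm_Pair)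

section \<open>Time increments of the nonlinearity along the projected solution\<close>

context exact_solution begin

definition Dc :: real where "Dc = 3 * M + 15 * C"

lemma Dc: "0 \<le> Dc"
  using M C by (simp add: Dc_def)

text \<open>Brings the jet at a fixed point x into the form required by
  \<open>jet_increments\<close>, where time enters only through \<open>U\<close>.\<close>

lemma q_jet:
  "q K t x = Re (\<Sum>j\<in>{- int K..int K}. cis (of_int j * x) * U t j)"
  "deriv (q K t) x = Re (\<Sum>j\<in>{- int K..int K}. (\<i> * of_int j * cis (of_int j * x)) * U t j)"
  "deriv (deriv (q K t)) x = Re (\<Sum>j\<in>{- int K..int K}. (\<i> * of_int j * (\<i> * of_int j * cis (of_int j * x))) * U t j)"
proof -
  note q1 = trig_polys_deriv[OF q_in, of K t]
  note q2 = trig_polys_deriv[OF q1(1)]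
  show "q K t x = Re (\<Sum>j\<in>{- int K..int K}. cis (of_int j * x) * U t j)"
    unfolding trig_polys_Re[OF q_in, of K t x] fourier_coeff_q
    by (intro arg_cong[where f = Re] sum.cong) (auto simp: freq_trunc_def)
  show "deriv (q K t) x = Re (\<Sum>j\<in>{- int K..int K}. (\<i> * of_int j * cis (of_int j * x)) * U t j)"
    unfolding trig_polys_Re[OF q1(1), of x] q1(3) fourier_coeff_q
    by (intro arg_cong[where f = Re] sum.cong) (auto simp: freq_trunc_def)
  show "deriv (deriv (q K t)) x = Re (\<Sum>j\<in>{- int K..int K}. (\<i> * of_int j * (\<i> * of_int j * cis (of_int j * x))) * U t j)"
    unfolding trig_polys_Re[OF q2(1), of x] q2(3) q1(3) fourier_coeff_q
    by (intro arg_cong[where f = Re] sum.cong) (auto simp: freq_trunc_def)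
qed

lemma multiplier_bounds:
  "cmod (cis (of_int j * x)) \<le> (jap j)\<^sup>2" "cmod (\<i> * of_int j * cis (of_int j * x)) \<le> (jap j)\<^sup>2"
  "cmod (\<i> * of_int j * (\<i> * of_int j * cis (of_int j * x))) \<le> (jap j)\<^sup>2"
proof -
  have 1: "1 \<le> jap j" and 2: "\<bar>of_int j\<bar> \<le> jap j"
    by (rule jap_ge_1 abs_le_jap)+
  show "cmod (cis (of_int j * x)) \<le> (jap j)\<^sup>2"
    using 1 by (simp add: one_le_power)
  have "\<bar>of_int j\<bar> * 1 \<le> jap j * jap j"
    using 1 2 by (intro mult_mono) auto
  then show "cmod (\<i> * of_int j * cis (of_int j * x)) \<le> (jap j)\<^sup>2"
    by (simp add: norm_mult power2_eq_square)
  have "\<bar>of_int j\<bar> * \<bar>of_int j\<bar> \<le> jap j * jap j"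
    using 2 by (intro mult_mono) auto
  then show "cmod (\<i> * of_int j * (\<i> * of_int j * cis (of_int j * x))) \<le> (jap j)\<^sup>2"
    by (simp add: norm_mult power2_eq_square)
qed

lemma q_jet_box:
  assumes t: "t \<in> {0..T}"
  shows "(q K t x, deriv (q K t) x) \<in> box2 (3 * M)" "\<bar>deriv (deriv (q K t)) x\<bar> \<le> 3 * M"
proof -
  show "(q K t x, deriv (q K t) x) \<in> box2 (3 * M)"
    by (rule jet_in_box2[OF q_in]) (rule wiener_le_weaken[OF q_bounds(3)[OF t]], auto)
  have "wiener_le 1 (fourier_coeff (deriv (q K t))) (3 * M)"
    using wiener_le_deriv_trig[OF q_in, of 1] q_bounds(3)[OF t] by simp
  then show "\<bar>deriv (deriv (q K t)) x\<bar> \<le> 3 * M"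
    using jet_in_box2[OF trig_polys_deriv(1)[OF q_in], of K t "3 * M" x] by (simp add: box2_def)
qed

lemma sob_0_F0_first:
  assumes K: "1 \<le> K" and t: "t \<in> {0..T}" "t' \<in> {0..T}"
  shows "sob_le 0 (\<lambda>j. F0 K t j - F0 K t' j) (C * (Dc * \<bar>t - t'\<bar>))"
proof -
  have "sob_le 0 (fourier_coeff (\<lambda>x. nonlin a g (q K t) x - nonlin a g (q K t') x)) (C * (Dc * \<bar>t - t'\<bar>))"
  proof (rule sob_le_0_bessel)
    show "torus_cont (\<lambda>x. nonlin a g (q K t) x - nonlin a g (q K t') x)"
      by (intro torus_cont_diff torus_cont_nonlin[OF q_in])
    fix x
    note inc = jet_increments(1)[OF K _ t, folded Dc_def]
    show "\<bar>nonlin a g (q K t) x - nonlin a g (q K t') x\<bar> \<le> C * (Dc * \<bar>t - t'\<bar>)"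
      unfolding nonlin_def
    proof (rule first_increment[OF q_jet_box(1)[OF t(1)] q_jet_box(1)[OF t(2)] q_jet_box(2)[OF t(1)]])
      show "\<bar>q K t x - q K t' x\<bar> \<le> Dc * \<bar>t - t'\<bar>"
        unfolding q_jet by (rule inc) (rule multiplier_bounds)
      show "\<bar>deriv (q K t) x - deriv (q K t') x\<bar> \<le> Dc * \<bar>t - t'\<bar>"
        unfolding q_jet by (rule inc) (rule multiplier_bounds)
      show "\<bar>deriv (deriv (q K t)) x - deriv (deriv (q K t')) x\<bar> \<le> Dc * \<bar>t - t'\<bar>"
        unfolding q_jet by (rule inc) (rule multiplier_bounds)
    qed
  qed
  moreover have "fourier_coeff (\<lambda>x. nonlin a g (q K t) x - nonlin a g (q K t') x) = (\<lambda>j. F0 K t j - F0 K t' j)"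
    unfolding F0_def by (intro ext fourier_coeff_diff torus_cont_nonlin[OF q_in])
  ultimately show ?thesis by simp
qed

lemma sob_0_F0_second:
  assumes K: "1 \<le> K" and m: "0 \<le> \<sigma>" "0 \<le> m - \<sigma>" "m + \<sigma> \<le> T"
  shows "sob_le 0 (\<lambda>j. (F0 K (m + \<sigma>) j - F0 K m j) + (F0 K (m - \<sigma>) j - F0 K m j)) (C * (2 * Dc * \<sigma>\<^sup>2 + (Dc * \<sigma>)\<^sup>2))"
proof -
  have t: "m + \<sigma> \<in> {0..T}" "m - \<sigma> \<in> {0..T}" "m \<in> {0..T}"
    using m by auto
  let ?N = "\<lambda>t. nonlin a g (q K t)"
  have "sob_le 0 (fourier_coeff (\<lambda>x. (?N (m + \<sigma>) x - ?N m x) + (?N (m - \<sigma>) x - ?N m x))) (C * (2 * Dc * \<sigma>\<^sup>2 + (Dc * \<sigma>)\<^sup>2))"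
  proof (rule sob_le_0_bessel)
    show "torus_cont (\<lambda>x. (?N (m + \<sigma>) x - ?N m x) + (?N (m - \<sigma>) x - ?N m x))"
      by (intro torus_cont_add torus_cont_diff torus_cont_nonlin[OF q_in])
    fix x
    have s1: "Dc * \<bar>(m + \<sigma>) - m\<bar> = Dc * \<sigma>" and s2: "Dc * \<bar>(m - \<sigma>) - m\<bar> = Dc * \<sigma>"
      using m by auto
    note i1 = jet_increments(1)[OF K _ t(1,3), folded Dc_def, unfolded s1]
    note i2 = jet_increments(1)[OF K _ t(2,3), folded Dc_def, unfolded s2]
    note i3 = jet_increments(2)[OF K _ m, folded Dc_def]
    have "\<bar>?N (m + \<sigma>) x + ?N (m - \<sigma>) x - 2 * ?N m x\<bar> \<le> C * (2 * Dc * \<sigma>\<^sup>2 + (Dc * \<sigma>)\<^sup>2)"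
      unfolding nonlin_def
    proof (rule second_increment[OF q_jet_box(1)[OF t(3)] q_jet_box(1)[OF t(1)] q_jet_box(1)[OF t(2)] q_jet_box(2)[OF t(3)]])
    qed (unfold q_jet, (rule i1 i2 i3, rule multiplier_bounds)+)
    then show "\<bar>(?N (m + \<sigma>) x - ?N m x) + (?N (m - \<sigma>) x - ?N m x)\<bar> \<le> C * (2 * Dc * \<sigma>\<^sup>2 + (Dc * \<sigma>)\<^sup>2)"
      by (simp add: algebra_simps)
  qed
  moreover have "fourier_coeff (\<lambda>x. (?N (m + \<sigma>) x - ?N m x) + (?N (m - \<sigma>) x - ?N m x))
      = (\<lambda>j. (F0 K (m + \<sigma>) j - F0 K m j) + (F0 K (m - \<sigma>) j - F0 K m j))"
    unfolding F0_def
    by (intro ext) (simp only: fourier_coeff_add fourier_coeff_diff torus_cont_diff torus_cont_nonlin[OF q_in])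
  ultimately show ?thesis by simp
qed

text \<open>H^2 is needed because these differences meet increments of the kernel, of size h
  \<open>jap j\<close>, which raise the weight by one. The factor h makes up for the low power of
  \<eta>.\<close>

lemma sob_2_F0_first:
  assumes K: "1 \<le> K" and t: "t \<in> {0..T}" "t' \<in> {0..T}" and \<eta>: "0 < \<eta>" "\<bar>t - t'\<bar> \<le> \<eta> ^ 3"
  shows "sob_le 2 (\<lambda>j. F0 K t j - F0 K t' j) ((C * Dc + 2 * C) * \<eta>)"
proof -
  have "C * (Dc * \<bar>t - t'\<bar>) \<le> C * (Dc * \<eta> ^ 3)"
    by (intro mult_left_mono \<eta> C Dc)
  then have 0: "sob_le 0 (\<lambda>j. F0 K t j - F0 K t' j) (C * (Dc * \<eta> ^ 3))"
    by (intro sob_le_weaken[OF sob_0_F0_first[OF K t]]) auto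
  have "C * (Dc * \<eta> ^ 3) / \<eta>\<^sup>2 + \<eta> * (C + C) = (C * Dc + 2 * C) * \<eta>"
    using \<eta> by (simp add: power3_eq_cube power2_eq_square algebra_simps)
  then show ?thesis
    using sob_le_interpolate_2[OF 0 sob_le_diff[OF sob_3_F0[OF t(1)] sob_3_F0[OF t(2)]] \<eta>(1)] by simp
qed

lemma sob_1_F0_second:
  assumes K: "1 \<le> K" and m: "0 \<le> \<sigma>" "0 \<le> m - \<sigma>" "m + \<sigma> \<le> T" and \<eta>: "0 < \<eta>" "\<sigma> \<le> \<eta> ^ 3"
  shows "sob_le 1 (\<lambda>j. (F0 K (m + \<sigma>) j - F0 K m j) + (F0 K (m - \<sigma>) j - F0 K m j)) ((C * (2 * Dc + Dc\<^sup>2) + 4 * C) * \<eta> ^ 4)"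
proof -
  have t: "m + \<sigma> \<in> {0..T}" "m - \<sigma> \<in> {0..T}" "m \<in> {0..T}"
    using m by auto
  have "2 * Dc * \<sigma>\<^sup>2 + (Dc * \<sigma>)\<^sup>2 = (2 * Dc + Dc\<^sup>2) * \<sigma>\<^sup>2"
    by (simp add: power2_eq_square algebra_simps)
  also have "\<dots> \<le> (2 * Dc + Dc\<^sup>2) * (\<eta> ^ 3)\<^sup>2"
    using Dc m \<eta> by (intro mult_left_mono power_mono) auto
  finally have "C * (2 * Dc * \<sigma>\<^sup>2 + (Dc * \<sigma>)\<^sup>2) \<le> C * ((2 * Dc + Dc\<^sup>2) * (\<eta> ^ 3)\<^sup>2)"
    by (rule mult_left_mono) (rule C)
  then have 0: "sob_le 0 (\<lambda>j. (F0 K (m + \<sigma>) j - F0 K m j) + (F0 K (m - \<sigma>) j - F0 K m j)) (C * ((2 * Dc + Dc\<^sup>2) * (\<eta> ^ 3)\<^sup>2))"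
    by (intro sob_le_weaken[OF sob_0_F0_second[OF K m]]) auto
  note 3 = sob_le_add[OF sob_le_diff[OF sob_3_F0[OF t(1)] sob_3_F0[OF t(3)]] sob_le_diff[OF sob_3_F0[OF t(2)] sob_3_F0[OF t(3)]]]
  have "C * ((2 * Dc + Dc\<^sup>2) * (\<eta> ^ 3)\<^sup>2) / \<eta>\<^sup>2 + \<eta> ^ 4 * ((C + C) + (C + C)) = (C * (2 * Dc + Dc\<^sup>2) + 4 * C) * \<eta> ^ 4"
  proof -
    have "(\<eta> ^ 3)\<^sup>2 / \<eta>\<^sup>2 = \<eta> ^ 4"
      using \<eta> by (simp add: field_simps flip: power_mult power_add)
    then have "C * ((2 * Dc + Dc\<^sup>2) * (\<eta> ^ 3)\<^sup>2) / \<eta>\<^sup>2 = C * (2 * Dc + Dc\<^sup>2) * \<eta> ^ 4"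
      by (simp only: times_divide_eq_right[symmetric] mult.assoc)
    then show ?thesis
      by (simp add: algebra_simps)
  qed
  then show ?thesis
    using sob_le_interpolate_1[OF 0 3 \<eta>(1)] by simp
qed

definition G :: "nat \<Rightarrow> real \<Rightarrow> int \<Rightarrow> complex" where "G K t = fourier_coeff (f_disc a g K (q K t))"

text \<open>The constants that accumulate in \<open>defect_rate\<close>: the first summand belongs
  to the power of \<open>K\<close>, the others to \<eta>^4.\<close>

definition Bc :: "real \<Rightarrow> real" where
  "Bc c = (4 + 2 * c) * C + 2 * (C * Dc + 2 * C) + (C * (2 * Dc + Dc\<^sup>2) + 4 * C) + (1 + 2 * c) * C"

lemma Bc: "0 \<le> c \<Longrightarrow> 0 \<le> Bc c"
  unfolding Bc_def using C Dc by (intro add_nonneg_nonneg mult_nonneg_nonneg) auto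

text \<open>The rate of change of the local error at distance \<open>\<sigma>\<close> on both sides
  of the midpoint \<open>m\<close>. \<open>Sa\<close> and \<open>Sb\<close> are the kernel values at
  m + \<sigma> and m - \<sigma>, \<open>S\<close> is the value at \<open>m\<close>, and
  \<open>b\<close> is the filter. Once the kernel is frozen at the midpoint, the two first
  differences in time combine to a second difference.\<close>

lemma defect_rate:
  assumes K: "1 \<le> K" and \<eta>: "0 < \<eta>" "\<eta> \<le> 1" "h = \<eta> ^ 3" and m: "0 \<le> m - h / 2" "m + h / 2 \<le> T"
    and \<sigma>: "0 \<le> \<sigma>" "\<sigma> \<le> h / 2" and c: "0 \<le> c"
    and Sa: "\<And>j. \<bar>Sa j\<bar> \<le> 1" "\<And>j. \<bar>Sa j - S j\<bar> \<le> h * jap j"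
    and Sb: "\<And>j. \<bar>Sb j\<bar> \<le> 1" "\<And>j. \<bar>Sb j - S j\<bar> \<le> h * jap j"
    and S: "\<And>j. \<bar>S j\<bar> \<le> 1" and b: "\<And>j. \<bar>b j\<bar> \<le> 1 + c" "\<And>j. \<bar>Sa j + Sb j - 2 * b j\<bar> \<le> (1 + 2 * c) * (h * jap j)\<^sup>2"
    and J: "finite J"
  shows "L2_set (\<lambda>j. jap j * cmod (of_real (Sa j) * F (m + \<sigma>) j + of_real (Sb j) * F (m - \<sigma>) j - of_real (2 * b j) * G K m j)) J
    \<le> Bc c * (\<eta> ^ 4 + real K powr (- s - 2))"
proof -
  let ?k = "real K powr (- s - 2)"
  have h: "0 < h" "h \<le> 1"
    using \<eta> by (auto simp: power_le_one)
  have t: "m + \<sigma> \<in> {0..T}" "m - \<sigma> \<in> {0..T}" "m \<in> {0..T}"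
    using m \<sigma> by auto
  let ?e1 = "\<lambda>j. F (m + \<sigma>) j - F0 K (m + \<sigma>) j" and ?e2 = "\<lambda>j. F (m - \<sigma>) j - F0 K (m - \<sigma>) j"
  let ?e3 = "\<lambda>j. G K m j - F0 K m j"
  let ?e4 = "\<lambda>j. F0 K (m + \<sigma>) j - F0 K m j" and ?e5 = "\<lambda>j. F0 K (m - \<sigma>) j - F0 K m j"
  let ?n = "\<lambda>r e j. jap j powr r * cmod (e j)"
  have "L2_set (\<lambda>j. jap j * cmod (of_real (Sa j) * F (m + \<sigma>) j + of_real (Sb j) * F (m - \<sigma>) j - of_real (2 * b j) * G K m j)) J
      \<le> L2_set (\<lambda>j. ?n 1 ?e1 j + ?n 1 ?e2 j + 2 * (1 + c) * ?n 1 ?e3 j + h * ?n 2 ?e4 j + h * ?n 2 ?e5 j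
          + ?n 1 (\<lambda>j. ?e4 j + ?e5 j) j + (1 + 2 * c) * h\<^sup>2 * ?n 3 (F0 K m) j) J"
  proof (rule L2_set_mono)
    fix j
    have eq: "of_real (Sa j) * F (m + \<sigma>) j + of_real (Sb j) * F (m - \<sigma>) j - of_real (2 * b j) * G K m j
        = of_real (Sa j) * ?e1 j + of_real (Sb j) * ?e2 j + - of_real (2 * b j) * ?e3 j + of_real (Sa j - S j) * ?e4 j
          + of_real (Sb j - S j) * ?e5 j + of_real (S j) * (?e4 j + ?e5 j) + of_real (Sa j + Sb j - 2 * b j) * F0 K m j"
      by (simp add: algebra_simps)
    have "jap j * cmod (of_real (Sa j) * F (m + \<sigma>) j + of_real (Sb j) * F (m - \<sigma>) j - of_real (2 * b j) * G K m j)
        \<le> jap j * (1 * cmod (?e1 j) + 1 * cmod (?e2 j) + 2 * (1 + c) * cmod (?e3 j) + h * jap j * cmod (?e4 j)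
          + h * jap j * cmod (?e5 j) + 1 * cmod (?e4 j + ?e5 j) + (1 + 2 * c) * (h * jap j)\<^sup>2 * cmod (F0 K m j))"
      unfolding eq
    proof (rule mult_left_mono)
      have le: "cmod (of_real r * z) \<le> R * cmod z" if "\<bar>r\<bar> \<le> R" for r R z
        using mult_right_mono[OF that norm_ge_zero[of z]] by (simp add: norm_mult)
      have b': "\<bar>- (2 * b j)\<bar> \<le> 2 * (1 + c)" using b(1)[of j] by simp
      have "cmod (- of_real (2 * b j) * ?e3 j) \<le> 2 * (1 + c) * cmod (?e3 j)"
        using le[OF b'] by simp
      then show "cmod (of_real (Sa j) * ?e1 j + of_real (Sb j) * ?e2 j + - of_real (2 * b j) * ?e3 j + of_real (Sa j - S j) * ?e4 j
          + of_real (Sb j - S j) * ?e5 j + of_real (S j) * (?e4 j + ?e5 j) + of_real (Sa j + Sb j - 2 * b j) * F0 K m j)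
        \<le> 1 * cmod (?e1 j) + 1 * cmod (?e2 j) + 2 * (1 + c) * cmod (?e3 j) + h * jap j * cmod (?e4 j)
          + h * jap j * cmod (?e5 j) + 1 * cmod (?e4 j + ?e5 j) + (1 + 2 * c) * (h * jap j)\<^sup>2 * cmod (F0 K m j)"
        by (intro norm_triangle_mono le Sa Sb S b)
    qed simp
    also have "\<dots> = ?n 1 ?e1 j + ?n 1 ?e2 j + 2 * (1 + c) * ?n 1 ?e3 j + h * ?n 2 ?e4 j + h * ?n 2 ?e5 j
          + ?n 1 (\<lambda>j. ?e4 j + ?e5 j) j + (1 + 2 * c) * h\<^sup>2 * ?n 3 (F0 K m) j"
      by (simp add: power2_eq_square power3_eq_cube algebra_simps)
    finally show "jap j * cmod (of_real (Sa j) * F (m + \<sigma>) j + of_real (Sb j) * F (m - \<sigma>) j - of_real (2 * b j) * G K m j)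
        \<le> ?n 1 ?e1 j + ?n 1 ?e2 j + 2 * (1 + c) * ?n 1 ?e3 j + h * ?n 2 ?e4 j + h * ?n 2 ?e5 j
          + ?n 1 (\<lambda>j. ?e4 j + ?e5 j) j + (1 + 2 * c) * h\<^sup>2 * ?n 3 (F0 K m) j" .
  qed simp
  also have "\<dots> \<le> C * ?k + C * ?k + 2 * (1 + c) * (C * ?k) + h * ((C * Dc + 2 * C) * \<eta>) + h * ((C * Dc + 2 * C) * \<eta>)
      + (C * (2 * Dc + Dc\<^sup>2) + 4 * C) * \<eta> ^ 4 + (1 + 2 * c) * h\<^sup>2 * C"
  proof (intro order.trans[OF L2_set_triangle_ineq] add_mono L2_set_scale_le)
    show "L2_set (?n 1 ?e1) J \<le> C * ?k" "L2_set (?n 1 ?e2) J \<le> C * ?k"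
      using sob_leD[OF sob_1_F_F0[OF t(1) K] J] sob_leD[OF sob_1_F_F0[OF t(2) K] J] by auto
    show "L2_set (?n 1 ?e3) J \<le> C * ?k"
      using sob_leD[OF f_disc_consistency[OF q_in K q_bounds(1)[OF t(3)]] J] by (simp add: G_def F0_def)
    show "L2_set (?n 2 ?e4) J \<le> (C * Dc + 2 * C) * \<eta>"
      by (rule sob_leD[OF sob_2_F0_first[OF K t(1,3) \<eta>(1)] J]) (use \<sigma> h \<eta> in auto)
    show "L2_set (?n 2 ?e5) J \<le> (C * Dc + 2 * C) * \<eta>"
      by (rule sob_leD[OF sob_2_F0_first[OF K t(2,3) \<eta>(1)] J]) (use \<sigma> h \<eta> in auto)
    show "L2_set (?n 1 (\<lambda>j. ?e4 j + ?e5 j)) J \<le> (C * (2 * Dc + Dc\<^sup>2) + 4 * C) * \<eta> ^ 4"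
      by (rule sob_leD[OF sob_1_F0_second[OF K \<sigma>(1) _ _ \<eta>(1)] J]) (use m \<sigma> h \<eta> in auto)
    show "L2_set (?n 3 (F0 K m)) J \<le> C"
      by (rule sob_leD[OF sob_3_F0[OF t(3)] J])
  qed (use h c C Dc in auto)
  \<comment> \<open>The relation h = \<eta>^3 turns h \<eta> into \<eta>^4.\<close>
  also have "\<dots> = ((4 + 2 * c) * C) * ?k + (2 * (C * Dc + 2 * C) + (C * (2 * Dc + Dc\<^sup>2) + 4 * C)) * \<eta> ^ 4 + (1 + 2 * c) * C * h\<^sup>2"
    unfolding \<eta>(3) by (simp add: power3_eq_cube power4_eq_xxxx algebra_simps)
  also have "\<dots> \<le> Bc c * ?k + (2 * (C * Dc + 2 * C) + (C * (2 * Dc + Dc\<^sup>2) + 4 * C)) * \<eta> ^ 4 + (1 + 2 * c) * C * \<eta> ^ 4"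
  proof (intro add_mono mult_right_mono mult_left_mono)
    show "(4 + 2 * c) * C \<le> Bc c"
      unfolding Bc_def using C Dc c by (simp add: add_increasing2)
    show "h\<^sup>2 \<le> \<eta> ^ 4"
      unfolding \<eta>(3) power_mult[symmetric] using \<eta> by (intro power_decreasing) auto
  qed (use C c Dc in auto)
  also have "\<dots> \<le> Bc c * ?k + Bc c * \<eta> ^ 4"
  proof -
    have "2 * (C * Dc + 2 * C) + (C * (2 * Dc + Dc\<^sup>2) + 4 * C) + (1 + 2 * c) * C \<le> Bc c"
      unfolding Bc_def using C c by simp
    from mult_right_mono[OF this, of "\<eta> ^ 4"] \<eta> show ?thesis
      by (simp add: algebra_simps)
  qed
  finally show ?thesis
    by (simp add: algebra_simps)
qed

end

section \<open>Variation of constants and the local error\<close>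

lemma has_vector_derivative_cos_mult:
  fixes f :: "real \<Rightarrow> complex"
  assumes "(f has_vector_derivative f') (at p within S)"
  shows "((\<lambda>p. of_real (cos ((H - p) * \<omega>)) * f p) has_vector_derivative
      of_real (cos ((H - p) * \<omega>)) * f' + of_real (\<omega> * sin ((H - p) * \<omega>)) * f p) (at p within S)"
    and "((\<lambda>p. of_real (sin ((H - p) * \<omega>)) * f p) has_vector_derivative
      of_real (sin ((H - p) * \<omega>)) * f' - of_real (\<omega> * cos ((H - p) * \<omega>)) * f p) (at p within S)"
proof -
  have c: "((\<lambda>p. complex_of_real (cos ((H - p) * \<omega>))) has_vector_derivative of_real (\<omega> * sin ((H - p) * \<omega>))) (at p within S)"
    by (intro has_vector_derivative_of_real)
       (auto simp flip: has_real_derivative_iff_has_vector_derivative intro!: derivative_eq_intros)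
  have s: "((\<lambda>p. complex_of_real (sin ((H - p) * \<omega>))) has_vector_derivative of_real (- (\<omega> * cos ((H - p) * \<omega>)))) (at p within S)"
    by (intro has_vector_derivative_of_real)
       (auto simp flip: has_real_derivative_iff_has_vector_derivative intro!: derivative_eq_intros)
  show "((\<lambda>p. of_real (cos ((H - p) * \<omega>)) * f p) has_vector_derivative
      of_real (cos ((H - p) * \<omega>)) * f' + of_real (\<omega> * sin ((H - p) * \<omega>)) * f p) (at p within S)"
    using has_vector_derivative_mult[OF c assms] .
  show "((\<lambda>p. of_real (sin ((H - p) * \<omega>)) * f p) has_vector_derivative
      of_real (sin ((H - p) * \<omega>)) * f' - of_real (\<omega> * cos ((H - p) * \<omega>)) * f p) (at p within S)"
    using has_vector_derivative_mult[OF s assms] by simp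
qed

lemma trig_polys_lincomb:
  assumes v: "v \<in> trig_polys K" and w: "w \<in> trig_polys K"
  shows "(\<lambda>x. v x + z * w x) \<in> trig_polys K"
    and "fourier_coeff (\<lambda>x. v x + z * w x) = (\<lambda>j. fourier_coeff v j + of_real z * fourier_coeff w j)"
proof -
  have zw: "(\<lambda>x. z * w x) \<in> trig_polys K"
    by (rule trig_polys_cmult[OF w])
  show "(\<lambda>x. v x + z * w x) \<in> trig_polys K"
    by (rule trig_polys_add[OF v zw])
  show "fourier_coeff (\<lambda>x. v x + z * w x) = (\<lambda>j. fourier_coeff v j + of_real z * fourier_coeff w j)"
    by (intro ext) (simp only: fourier_coeff_add[OF trig_polys_torus_cont[OF v] trig_polys_torus_cont[OF zw]] fourier_coeff_cmult)
qed

lemma midpoint_value_coeffs: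
  assumes v: "v \<in> trig_polys K" and w: "w \<in> trig_polys K"
  shows "midpoint_value h (v, w) \<in> trig_polys K"
    and "fourier_coeff (midpoint_value h (v, w)) = (\<lambda>j. of_real (cos (h / 2 * jap j)) * fourier_coeff v j
        + of_real (sin (h / 2 * jap j) / jap j) * fourier_coeff w j)"
proof -
  have m: "midpoint_value h (v, w) = (\<lambda>x. omega_mult (\<lambda>\<omega>. cos (h * \<omega> / 2)) v x + h / 2 * omega_mult (\<lambda>\<omega>. sinc (h * \<omega> / 2)) w x)"
    by (simp add: midpoint_value_def fun_eq_iff)
  note o = omega_mult_trig_polys[OF v, of "\<lambda>\<omega>. cos (h * \<omega> / 2)"] omega_mult_trig_polys[OF w, of "\<lambda>\<omega>. sinc (h * \<omega> / 2)"]
  show "midpoint_value h (v, w) \<in> trig_polys K"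
    unfolding m by (rule trig_polys_lincomb[OF o(1,3)])
  have "h / 2 * sinc (h * jap j / 2) = sin (h / 2 * jap j) / jap j" for j
    using mult_sinc[of "h * jap j / 2"] by (simp add: field_simps)
  then have e: "complex_of_real (h / 2) * of_real (sinc (h * jap j / 2)) = of_real (sin (h / 2 * jap j) / jap j)" for j
    by (metis of_real_mult)
  show "fourier_coeff (midpoint_value h (v, w)) = (\<lambda>j. of_real (cos (h / 2 * jap j)) * fourier_coeff v j
        + of_real (sin (h / 2 * jap j) / jap j) * fourier_coeff w j)"
    unfolding m trig_polys_lincomb(2)[OF o(1,3)] o(2,4) mult.assoc[symmetric] e by simp
qed

lemma trig_step_coeffs:
  fixes a b1 bb1 :: "real \<Rightarrow> real" and g :: "real \<times> real \<Rightarrow> real" and h \<kappa> :: real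
  assumes v: "v \<in> trig_polys K" and w: "w \<in> trig_polys K"
  defines "N \<equiv> trig_step a g b1 bb1 \<kappa> h K (v, w)"
    and "Gn \<equiv> freq_trunc K (fourier_coeff (f_disc a g K (midpoint_value h (v, w))))"
  shows "fst N \<in> trig_polys K" "snd N \<in> trig_polys K"
    and "fourier_coeff (fst N) = (\<lambda>j. of_real (cos (h * jap j)) * fourier_coeff v j
        + of_real (sin (h * jap j) / jap j) * fourier_coeff w j + of_real (\<kappa> * h\<^sup>2 * bb1 ((h * jap j)\<^sup>2)) * Gn j)"
    and "fourier_coeff (snd N) = (\<lambda>j. - of_real (jap j * sin (h * jap j)) * fourier_coeff v j
        + of_real (cos (h * jap j)) * fourier_coeff w j + of_real (\<kappa> * h * b1 ((h * jap j)\<^sup>2)) * Gn j)"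
proof -
  let ?F = "f_hat a g K (midpoint_value h (v, w))"
  have F: "?F \<in> trig_polys K" "fourier_coeff ?F = Gn"
    unfolding f_hat_def Gn_def by (rule trig_proj_in fourier_coeff_trig_proj_trunc)+
  let ?o1 = "omega_mult (\<lambda>\<omega>. cos (h * \<omega>)) v" and ?o2 = "omega_mult (\<lambda>\<omega>. sinc (h * \<omega>)) w"
  let ?o3 = "omega_mult (\<lambda>\<omega>. bb1 (h\<^sup>2 * \<omega>\<^sup>2)) ?F"
  let ?o4 = "omega_mult (\<lambda>\<omega>. \<omega> * sin (h * \<omega>)) v" and ?o5 = "omega_mult (\<lambda>\<omega>. cos (h * \<omega>)) w"
  let ?o6 = "omega_mult (\<lambda>\<omega>. b1 (h\<^sup>2 * \<omega>\<^sup>2)) ?F"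
  have N1: "fst N = (\<lambda>x. (?o1 x + h * ?o2 x) + \<kappa> * h\<^sup>2 * ?o3 x)"
    and N2: "snd N = (\<lambda>x. (?o5 x + (- 1) * ?o4 x) + \<kappa> * h * ?o6 x)"
    by (simp_all add: N_def trig_step_def Let_def fun_eq_iff)
  note o = omega_mult_trig_polys[OF v, of "\<lambda>\<omega>. cos (h * \<omega>)"] omega_mult_trig_polys[OF w, of "\<lambda>\<omega>. sinc (h * \<omega>)"]
    omega_mult_trig_polys[OF F(1), of "\<lambda>\<omega>. bb1 (h\<^sup>2 * \<omega>\<^sup>2)"]
    omega_mult_trig_polys[OF v, of "\<lambda>\<omega>. \<omega> * sin (h * \<omega>)"] omega_mult_trig_polys[OF w, of "\<lambda>\<omega>. cos (h * \<omega>)"]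
    omega_mult_trig_polys[OF F(1), of "\<lambda>\<omega>. b1 (h\<^sup>2 * \<omega>\<^sup>2)"]
  note l1 = trig_polys_lincomb[OF o(1,3)] and l2 = trig_polys_lincomb[OF o(9,7)]
  show "fst N \<in> trig_polys K"
    unfolding N1 by (rule trig_polys_lincomb[OF l1(1) o(5)])
  show "snd N \<in> trig_polys K"
    unfolding N2 by (rule trig_polys_lincomb[OF l2(1) o(11)])
  have "h * sinc (h * jap j) = sin (h * jap j) / jap j" for j
    using mult_sinc[of "h * jap j"] by (simp add: field_simps)
  then have e: "complex_of_real h * of_real (sinc (h * jap j)) = of_real (sin (h * jap j) / jap j)" for j
    by (metis of_real_mult)
  show "fourier_coeff (fst N) = (\<lambda>j. of_real (cos (h * jap j)) * fourier_coeff v j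
        + of_real (sin (h * jap j) / jap j) * fourier_coeff w j + of_real (\<kappa> * h\<^sup>2 * bb1 ((h * jap j)\<^sup>2)) * Gn j)"
    unfolding N1 trig_polys_lincomb(2)[OF l1(1) o(5)] l1(2) o(2,4,6) F(2) mult.assoc[symmetric] e
    by (simp add: power_mult_distrib)
  show "fourier_coeff (snd N) = (\<lambda>j. - of_real (jap j * sin (h * jap j)) * fourier_coeff v j
        + of_real (cos (h * jap j)) * fourier_coeff w j + of_real (\<kappa> * h * b1 ((h * jap j)\<^sup>2)) * Gn j)"
    unfolding N2 trig_polys_lincomb(2)[OF l2(1) o(11)] l2(2) o(8,10,12) F(2)
    by (simp add: power_mult_distrib mult.assoc)
qed

context exact_solution begin

text \<open>The free flow takes the exact state at time \<open>p\<close> to time \<open>H\<close>.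
  Differentiation in \<open>p\<close> cancels the linear part of the equation and leaves the
  forcing. This is Duhamel's formula without an integral: local errors become increments in
  \<open>p\<close>, to which \<open>L2_mvt\<close> applies.\<close>

definition flowU :: "real \<Rightarrow> int \<Rightarrow> real \<Rightarrow> complex" where
  "flowU H j p = of_real (cos ((H - p) * jap j)) * U p j + of_real (sin ((H - p) * jap j) / jap j) * V p j"

definition flowV :: "real \<Rightarrow> int \<Rightarrow> real \<Rightarrow> complex" where
  "flowV H j p = - of_real (jap j * sin ((H - p) * jap j)) * U p j + of_real (cos ((H - p) * jap j)) * V p j"

lemma flow_same: "flowU H j H = U H j" "flowV H j H = V H j"
  by (simp_all add: flowU_def flowV_def)

lemma flow_deriv:
  assumes p: "p \<in> {0..T}"
  shows "(flowU H j has_vector_derivative of_real (\<kappa> * (sin ((H - p) * jap j) / jap j)) * F p j) (at p within {0..T})"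
    and "(flowV H j has_vector_derivative of_real (\<kappa> * cos ((H - p) * jap j)) * F p j) (at p within {0..T})"
proof -
  note dU = has_vector_derivative_cos_mult[OF U_deriv[OF p], of H "jap j"]
  note dV = has_vector_derivative_cos_mult[OF V_deriv[OF p], of H "jap j"]
  have "((\<lambda>p. of_real (cos ((H - p) * jap j)) * U p j + of_real (inverse (jap j)) * (of_real (sin ((H - p) * jap j)) * V p j))
      has_vector_derivative of_real (\<kappa> * (sin ((H - p) * jap j) / jap j)) * F p j) (at p within {0..T})"
    by (rule has_vector_derivative_eq_rhs[OF has_vector_derivative_add[OF dU(1) has_vector_derivative_mult_right[OF dV(2)]]])
       (simp add: field_simps power2_eq_square)
  then show "(flowU H j has_vector_derivative of_real (\<kappa> * (sin ((H - p) * jap j) / jap j)) * F p j) (at p within {0..T})"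
    by (simp add: flowU_def[abs_def] divide_inverse mult_ac)
  have "((\<lambda>p. - of_real (jap j) * (of_real (sin ((H - p) * jap j)) * U p j) + of_real (cos ((H - p) * jap j)) * V p j)
      has_vector_derivative of_real (\<kappa> * cos ((H - p) * jap j)) * F p j) (at p within {0..T})"
    by (rule has_vector_derivative_eq_rhs[OF has_vector_derivative_add[OF has_vector_derivative_mult_right[OF dU(2)] dV(1)]])
       (simp add: field_simps power2_eq_square)
  then show "(flowV H j has_vector_derivative of_real (\<kappa> * cos ((H - p) * jap j)) * F p j) (at p within {0..T})"
    by (simp add: flowV_def[abs_def] mult_ac)
qed

lemma symmetric_deriv:
  fixes f f' :: "real \<Rightarrow> complex"
  assumes f: "\<And>p. p \<in> {0..T} \<Longrightarrow> (f has_vector_derivative f' p) (at p within {0..T})"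
    and m: "0 \<le> m - b" "m + b \<le> T" and r: "r \<in> {0..b}"
  shows "((\<lambda>r. f (m + r) - f (m - r)) has_vector_derivative f' (m + r) + f' (m - r)) (at r within {0..b})"
proof -
  have in1: "m + r \<in> {0..T}" "m - r \<in> {0..T}"
    using m r by auto
  have sub: "(\<lambda>r. m + r) ` {0..b} \<subseteq> {0..T}" "(\<lambda>r. m - r) ` {0..b} \<subseteq> {0..T}"
    using m r by auto
  have l: "((\<lambda>r. m + r) has_vector_derivative 1) (at r within {0..b})" "((\<lambda>r. m - r) has_vector_derivative - 1) (at r within {0..b})"
    by (auto simp flip: has_real_derivative_iff_has_vector_derivative intro!: derivative_eq_intros)
  note d1 = vector_diff_chain_within[OF l(1) has_vector_derivative_within_subset[OF f[OF in1(1)] sub(1)]]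
  note d2 = vector_diff_chain_within[OF l(2) has_vector_derivative_within_subset[OF f[OF in1(2)] sub(2)]]
  show ?thesis
    using has_vector_derivative_diff[OF d1 d2] by (simp add: o_def)
qed

text \<open>The increment of \<open>\<Phi>\<close> over one step against a midpoint rule with filter
  \<open>b\<close>. Moving outward from the midpoint pairs symmetric times, so that
  \<open>defect_rate\<close> applies. The kernel \<open>S\<close> is kept general because the two
  components need a sine and a cosine.\<close>

lemma midpoint_quadrature:
  assumes K: "1 \<le> K" and \<eta>: "0 < \<eta>" "\<eta> \<le> 1" "h = \<eta> ^ 3" and t: "0 \<le> t" "t + h \<le> T" and J: "finite J" and c: "0 \<le> c"
    and \<Phi>: "\<And>j p. p \<in> {0..T} \<Longrightarrow> (\<Phi> j has_vector_derivative of_real (\<kappa> * S j (t + h - p)) * F p j) (at p within {0..T})"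
    and S: "\<And>j x. \<bar>S j x\<bar> \<le> 1" "\<And>j x y. \<bar>S j x - S j y\<bar> \<le> jap j * \<bar>x - y\<bar>"
    and b: "\<And>j. \<bar>b j\<bar> \<le> 1 + c"
      "\<And>j r. 0 \<le> r \<Longrightarrow> r \<le> h / 2 \<Longrightarrow> \<bar>S j (h / 2 - r) + S j (h / 2 + r) - 2 * b j\<bar> \<le> (1 + 2 * c) * (h * jap j)\<^sup>2"
  shows "L2_set (\<lambda>j. cmod (of_real (jap j) * (\<Phi> j (t + h) - \<Phi> j t) - of_real (\<kappa> * (h * jap j * b j)) * G K (t + h / 2) j)) J
    \<le> \<kappa> * (Bc c * (\<eta> ^ 4 + real K powr (- s - 2))) * h"
proof -
  let ?Q = "Bc c * (\<eta> ^ 4 + real K powr (- s - 2))"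
  define m where "m = t + h / 2"
  have h: "0 < h" using \<eta> by simp
  have m: "0 \<le> m - h / 2" "m + h / 2 \<le> T" and me: "m + h / 2 = t + h" "m - h / 2 = t"
    using t by (auto simp: m_def)
  \<comment> \<open>The same comparison on the interval of half-width \<open>r\<close> around the
    midpoint. It vanishes at r = 0 and is the desired defect at r = h/2.\<close>
  define D where "D j r = of_real (jap j) * (\<Phi> j (m + r) - \<Phi> j (m - r)) - of_real r * of_real (2 * \<kappa> * jap j * b j) * G K m j" for j r
  define I where "I j r = of_real (S j (h / 2 - r)) * F (m + r) j + of_real (S j (h / 2 + r)) * F (m - r) j
      - of_real (2 * b j) * G K m j" for j r
  have "L2_set (\<lambda>j. cmod (D j (h / 2) - D j 0)) J \<le> (\<kappa> * ?Q) * (h / 2)"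
  proof (rule L2_mvt[where D' = "\<lambda>j r. of_real (\<kappa> * jap j) * I j r"])
    fix j r assume r: "r \<in> {0..h / 2}"
    have e: "t + h - (m + r) = h / 2 - r" "t + h - (m - r) = h / 2 + r"
      by (auto simp: m_def)
    have id: "(complex_of_real has_vector_derivative 1) (at r within {0..h / 2})"
      using has_vector_derivative_of_real[OF DERIV_ident] by simp
    note sym = symmetric_deriv[where f = "\<Phi> j" and f' = "\<lambda>p. of_real (\<kappa> * S j (t + h - p)) * F p j", OF \<Phi> m r]
    have "(D j has_vector_derivative of_real (jap j) * (of_real (\<kappa> * S j (t + h - (m + r))) * F (m + r) j
        + of_real (\<kappa> * S j (t + h - (m - r))) * F (m - r) j) - 1 * of_real (2 * \<kappa> * jap j * b j) * G K m j) (at r within {0..h / 2})"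
      unfolding D_def
      by (rule has_vector_derivative_diff[OF has_vector_derivative_mult_right[OF sym]
            has_vector_derivative_mult_left[OF has_vector_derivative_mult_left[OF id]]])
    then show "(D j has_vector_derivative of_real (\<kappa> * jap j) * I j r) (at r within {0..h / 2})"
      by (rule has_vector_derivative_eq_rhs) (simp only: e, simp add: I_def algebra_simps)
  next
    fix r assume r: "r \<in> {0..h / 2}"
    have "L2_set (\<lambda>j. jap j * cmod (I j r)) J \<le> ?Q"
      unfolding I_def
    proof (rule defect_rate[OF K \<eta> m _ _ c, where S = "\<lambda>j. S j (h / 2)"])
      fix j
      have rj: "r * jap j \<le> h * jap j"
        using r h by (intro mult_right_mono) auto
      show "\<bar>S j (h / 2 - r) - S j (h / 2)\<bar> \<le> h * jap j" "\<bar>S j (h / 2 + r) - S j (h / 2)\<bar> \<le> h * jap j"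
        using S(2)[of j "h / 2 - r" "h / 2"] S(2)[of j "h / 2 + r" "h / 2"] r by (auto simp: mult.commute intro!: order.trans[OF _ rj])
    qed (use r J S(1) b in auto)
    then have "L2_set (\<lambda>j. \<kappa> * (jap j * cmod (I j r))) J \<le> \<kappa> * ?Q"
      by (intro L2_set_scale_le) (use \<kappa> in auto)
    moreover have "cmod (of_real (\<kappa> * jap j) * I j r) = \<kappa> * (jap j * cmod (I j r))" for j
      unfolding norm_mult norm_of_real using \<kappa> by simp
    ultimately show "L2_set (\<lambda>j. cmod (of_real (\<kappa> * jap j) * I j r)) J \<le> \<kappa> * ?Q" by simp
  qed (use h J in auto)
  also have "\<dots> \<le> \<kappa> * ?Q * h"
    using \<kappa> Bc[OF c] h \<eta> by (intro mult_left_mono mult_nonneg_nonneg) auto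
  finally have "L2_set (\<lambda>j. cmod (D j (h / 2) - D j 0)) J \<le> \<kappa> * ?Q * h" .
  moreover have "D j (h / 2) - D j 0 = of_real (jap j) * (\<Phi> j (t + h) - \<Phi> j t) - of_real (\<kappa> * (h * jap j * b j)) * G K (t + h / 2) j" for j
    unfolding D_def me by (simp add: m_def)
  ultimately show ?thesis
    by (simp only:)
qed

text \<open>The weight \<open>(jap j)\<^sup>2\<close> is split: one factor goes into
  \<open>\<Phi>\<close>, where it cancels the division by \<open>jap j\<close> in the sine kernel
  and leaves a kernel bounded by 1; the other is the weight in
  \<open>midpoint_quadrature\<close>.\<close>

lemma defect_U:
  assumes A: "coeff_assumption c b1 bb1" and K: "1 \<le> K" and \<eta>: "0 < \<eta>" "\<eta> \<le> 1" "h = \<eta> ^ 3"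
    and t: "0 \<le> t" "t + h \<le> T" and J: "finite J"
  shows "L2_set (\<lambda>j. cmod (of_real ((jap j)\<^sup>2) * (U (t + h) j - flowU (t + h) j t)
      - of_real (\<kappa> * (h\<^sup>2 * (jap j)\<^sup>2 * bb1 ((h * jap j)\<^sup>2))) * G K (t + h / 2) j)) J
    \<le> \<kappa> * (Bc c * (\<eta> ^ 4 + real K powr (- s - 2))) * h"
proof -
  have h: "0 < h" using \<eta> by simp
  have "L2_set (\<lambda>j. cmod (of_real (jap j) * (of_real (jap j) * flowU (t + h) j (t + h) - of_real (jap j) * flowU (t + h) j t)
      - of_real (\<kappa> * (h * jap j * (h * jap j * bb1 ((h * jap j)\<^sup>2)))) * G K (t + h / 2) j)) J
    \<le> \<kappa> * (Bc c * (\<eta> ^ 4 + real K powr (- s - 2))) * h"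
  proof (rule midpoint_quadrature[OF K \<eta> t J coeff_assumption_nonneg[OF A], where S = "\<lambda>j x. sin (x * jap j)"])
    show "((\<lambda>p. of_real (jap j) * flowU (t + h) j p) has_vector_derivative of_real (\<kappa> * sin ((t + h - p) * jap j)) * F p j) (at p within {0..T})"
      if "p \<in> {0..T}" for j p
      by (rule has_vector_derivative_eq_rhs[OF has_vector_derivative_mult_right[OF flow_deriv(1)[OF that]]]) simp
    show "\<bar>sin (x * jap j) - sin (y * jap j)\<bar> \<le> jap j * \<bar>x - y\<bar>" for j x y
      using abs_sin_diff_le[of "x * jap j" "y * jap j"] by (simp add: abs_mult mult.commute flip: left_diff_distrib)
    show "\<bar>h * jap j * bb1 ((h * jap j)\<^sup>2)\<bar> \<le> 1 + c" for j
      using coeff_assumptionD(1)[OF A, of "h * jap j"] h by simp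
  qed (auto intro: coeff_bb1_midpoint[OF A h])
  then show ?thesis
    by (simp add: flow_same power2_eq_square algebra_simps)
qed

lemma defect_V:
  assumes A: "coeff_assumption c b1 bb1" and K: "1 \<le> K" and \<eta>: "0 < \<eta>" "\<eta> \<le> 1" "h = \<eta> ^ 3"
    and t: "0 \<le> t" "t + h \<le> T" and J: "finite J"
  shows "L2_set (\<lambda>j. cmod (of_real (jap j) * (V (t + h) j - flowV (t + h) j t)
      - of_real (\<kappa> * (h * jap j * b1 ((h * jap j)\<^sup>2))) * G K (t + h / 2) j)) J
    \<le> \<kappa> * (Bc c * (\<eta> ^ 4 + real K powr (- s - 2))) * h"
proof -
  have h: "0 < h" using \<eta> by simp
  have "L2_set (\<lambda>j. cmod (of_real (jap j) * (flowV (t + h) j (t + h) - flowV (t + h) j t)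
      - of_real (\<kappa> * (h * jap j * b1 ((h * jap j)\<^sup>2))) * G K (t + h / 2) j)) J
    \<le> \<kappa> * (Bc c * (\<eta> ^ 4 + real K powr (- s - 2))) * h"
  proof (rule midpoint_quadrature[OF K \<eta> t J coeff_assumption_nonneg[OF A] flow_deriv(2)])
    show "\<bar>cos (x * jap j) - cos (y * jap j)\<bar> \<le> jap j * \<bar>x - y\<bar>" for j x y
      using abs_cos_diff_le[of "x * jap j" "y * jap j"] by (simp add: abs_mult mult.commute flip: left_diff_distrib)
    show "\<bar>b1 ((h * jap j)\<^sup>2)\<bar> \<le> 1 + c" for j
      by (rule coeff_b1_bounded[OF A]) (use h in simp)
  qed (auto intro: coeff_b1_midpoint[OF A h])
  then show ?thesis
    by (simp only: flow_same)
qed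

text \<open>The midpoint stage of the scheme is the free flow alone and misses the forcing over half
  a step. The sine kernel divided by \<open>jap j\<close> is at most h, on an interval of length
  h/2. The modes are limited to those up to \<open>K\<close> because the H^3 bound on
  \<open>F\<close> from \<open>sob_3_F_trunc\<close> is for its truncation.\<close>

lemma midpoint_defect:
  assumes K: "1 \<le> K" and h: "0 < h" and t: "0 \<le> t" "t + h \<le> T"
    and J: "finite J" "J \<subseteq> {- int K..int K}"
  shows "L2_set (\<lambda>j. cmod (of_real ((jap j)\<^sup>2) * (U (t + h / 2) j - flowU (t + h / 2) j t))) J \<le> 5 * C * (\<kappa> * h\<^sup>2)"
proof -
  define m where "m = t + h / 2"
  define D where "D j r = of_real ((jap j)\<^sup>2) * flowU m j (t + r)" for j r
  define D' where "D' j r = of_real ((jap j)\<^sup>2) * (of_real (\<kappa> * (sin ((m - (t + r)) * jap j) / jap j)) * F (t + r) j)" for j r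
  have "L2_set (\<lambda>j. cmod (D j (h / 2) - D j 0)) J \<le> (\<kappa> * h * (5 * C)) * (h / 2)"
  proof (rule L2_mvt[where D' = D'])
    show "(D j has_vector_derivative D' j r) (at r within {0..h / 2})" if r: "r \<in> {0..h / 2}" for j r
    proof -
      have p: "t + r \<in> {0..T}" using r t h by auto
      have sub: "(\<lambda>r. t + r) ` {0..h / 2} \<subseteq> {0..T}" using t h by auto
      have "((\<lambda>r. t + r) has_vector_derivative 1) (at r within {0..h / 2})"
        by (auto simp flip: has_real_derivative_iff_has_vector_derivative intro!: derivative_eq_intros)
      from vector_diff_chain_within[OF this has_vector_derivative_within_subset[OF flow_deriv(1)[OF p] sub]]
      show ?thesis
        unfolding D_def D'_def by (intro has_vector_derivative_mult_right) (simp add: o_def)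
    qed
    show "L2_set (\<lambda>j. cmod (D' j r)) J \<le> \<kappa> * h * (5 * C)" if r: "r \<in> {0..h / 2}" for r
    proof -
      have p: "t + r \<in> {0..T}" using r t h by auto
      have "L2_set (\<lambda>j. cmod (D' j r)) J \<le> L2_set (\<lambda>j. \<kappa> * h * (jap j powr 3 * cmod (freq_trunc K (F (t + r)) j))) J"
      proof (rule L2_set_mono)
        fix j assume "j \<in> J"
        then have f: "freq_trunc K (F (t + r)) j = F (t + r) j"
          using subsetD[OF J(2) \<open>j \<in> J\<close>] by (auto simp: freq_trunc_def)
        have "\<bar>sin ((m - (t + r)) * jap j)\<bar> \<le> \<bar>(m - (t + r)) * jap j\<bar>"
          by (rule abs_sin_x_le_abs_x)
        also have "\<dots> \<le> h * jap j"
          unfolding abs_mult using r h by (intro mult_mono) (auto simp: m_def)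
        finally have "\<bar>\<kappa> * (sin ((m - (t + r)) * jap j) / jap j)\<bar> \<le> \<kappa> * h"
          using \<kappa> by (simp add: abs_mult field_simps)
        then have "(jap j)\<^sup>2 * (\<bar>\<kappa> * (sin ((m - (t + r)) * jap j) / jap j)\<bar> * cmod (F (t + r) j))
            \<le> (jap j)\<^sup>2 * (\<kappa> * h * cmod (F (t + r) j))"
          by (intro mult_left_mono mult_right_mono) auto
        also have "\<dots> \<le> jap j powr 3 * (\<kappa> * h * cmod (F (t + r) j))"
        proof (rule mult_right_mono)
          show "(jap j)\<^sup>2 \<le> jap j powr 3"
            using jap_ge_1[of j] by (simp add: power_increasing)
        qed (use \<kappa> h in auto)
        finally show "cmod (D' j r) \<le> \<kappa> * h * (jap j powr 3 * cmod (freq_trunc K (F (t + r)) j))"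
          unfolding D'_def norm_mult norm_of_real f by (simp add: mult_ac)
      qed simp
      also have "\<dots> \<le> \<kappa> * h * (5 * C)"
        by (rule L2_set_scale_le) (use \<kappa> h sob_leD[OF sob_3_F_trunc[OF p K] J(1)] in auto)
      finally show ?thesis .
    qed
  qed (use h J in auto)
  also have "\<dots> \<le> 5 * C * (\<kappa> * h\<^sup>2)"
    using \<kappa> C h by (simp add: power2_eq_square mult_nonneg_nonneg)
  finally have "L2_set (\<lambda>j. cmod (D j (h / 2) - D j 0)) J \<le> 5 * C * (\<kappa> * h\<^sup>2)" .
  moreover have "D j (h / 2) - D j 0 = of_real ((jap j)\<^sup>2) * (U (t + h / 2) j - flowU (t + h / 2) j t)" for j
    unfolding D_def by (simp add: m_def[symmetric] flow_same right_diff_distrib)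
  ultimately show ?thesis
    by (simp only:)
qed

end

section \<open>Error propagation\<close>

lemma L2_set_subset_le: "finite I \<Longrightarrow> J \<subseteq> I \<Longrightarrow> L2_set f J \<le> L2_set f I"
  unfolding L2_set_def by (intro real_sqrt_le_mono sum_mono2) auto

lemma L2_set_restrict: "finite J \<Longrightarrow> (\<And>j. j \<in> J - I \<Longrightarrow> f j = 0) \<Longrightarrow> L2_set f J = L2_set f (J \<inter> I)"
  unfolding L2_set_def by (intro arg_cong[where f = sqrt] sum.mono_neutral_right) auto

lemma trig_integrator_in:
  "fst (trig_integrator a g b1 bb1 \<kappa> h K u0 v0 n) \<in> trig_polys K \<and> snd (trig_integrator a g b1 bb1 \<kappa> h K u0 v0 n) \<in> trig_polys K"
proof (induction n)
  case (Suc n)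
  obtain v w where vw: "trig_integrator a g b1 bb1 \<kappa> h K u0 v0 n = (v, w)"
    by fastforce
  then show ?case
    using Suc trig_step_coeffs(1,2)[of v K w a g b1 bb1 \<kappa> h] by simp
qed (simp add: trig_proj_in)

context exact_solution begin

text \<open>Both components are joined mode by mode in one Euclidean norm, so that
  \<open>norm_rotate\<close> applies. The modes beyond \<open>K\<close> are added in
  \<open>energy_error\<close>.\<close>

definition err :: "nat \<Rightarrow> real \<Rightarrow> (real \<Rightarrow> real) \<times> (real \<Rightarrow> real) \<Rightarrow> real" where
  "err K t w = L2_set (\<lambda>j. norm (of_real ((jap j)\<^sup>2) * (fourier_coeff (fst w) j - U t j),
      of_real (jap j) * (fourier_coeff (snd w) j - V t j))) {- int K..int K}"

text \<open>The new error is the rotated old error plus the filtered difference of the values of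
  \<open>f_disc\<close>, minus the local defects; the factors 2 count the two components. The
  midpoint stage inherits the old error plus the missing forcing, and the bound 3 keeps this sum
  within the range of \<open>f_disc_Lipschitz\<close>.\<close>

lemma one_step:
  assumes A: "coeff_assumption c b1 bb1" and K: "1 \<le> K" and \<eta>: "0 < \<eta>" "\<eta> \<le> 1" "h = \<eta> ^ 3"
    and t: "0 \<le> t" "t + h \<le> T" and vw: "v \<in> trig_polys K" "w \<in> trig_polys K"
    and small: "err K t (v, w) + 5 * C * (\<kappa> * h\<^sup>2) \<le> 3"
  shows "err K (t + h) (trig_step a g b1 bb1 \<kappa> h K (v, w))
    \<le> err K t (v, w) + 2 * (\<kappa> * (Bc c * (\<eta> ^ 4 + real K powr (- s - 2))) * h)
      + 2 * (\<kappa> * c * (C * (err K t (v, w) + 5 * C * (\<kappa> * h\<^sup>2))))"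
proof -
  define m where "m = t + h / 2"
  define E where "E = err K t (v, w)"
  define e where "e = E + 5 * C * (\<kappa> * h\<^sup>2)"
  define W where "W = midpoint_value h (v, w)"
  define I where "I = {- int K..int K}"
  define x where "x j = of_real ((jap j)\<^sup>2) * (fourier_coeff v j - U t j)" for j
  define y where "y j = of_real (jap j) * (fourier_coeff w j - V t j)" for j
  let ?Q = "Bc c * (\<eta> ^ 4 + real K powr (- s - 2))"
  have h: "0 < h" using \<eta> by simp
  have c: "0 \<le> c" by (rule coeff_assumption_nonneg[OF A])
  have I: "finite I" by (simp add: I_def)
  have mt: "m \<in> {0..T}" using t h by (auto simp: m_def)
  have E: "E = L2_set (\<lambda>j. norm (x j, y j)) I"
    by (simp add: E_def err_def x_def y_def I_def)
  note Wc = midpoint_value_coeffs[OF vw, of h, folded W_def]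
  have W: "sob_le 2 (\<lambda>j. fourier_coeff W j - fourier_coeff (q K m) j) e"
  proof (rule sob_leI)
    fix J :: "int set" assume J: "finite J"
    have "L2_set (\<lambda>j. jap j powr 2 * cmod (fourier_coeff W j - fourier_coeff (q K m) j)) J
        = L2_set (\<lambda>j. jap j powr 2 * cmod (fourier_coeff W j - fourier_coeff (q K m) j)) (J \<inter> I)"
    proof (rule L2_set_restrict[OF J])
      fix j assume "j \<in> J - I"
      then have "\<not> \<bar>j\<bar> \<le> int K" by (auto simp: I_def)
      then show "jap j powr 2 * cmod (fourier_coeff W j - fourier_coeff (q K m) j) = 0"
        using trig_polys_coeffs(2)[OF Wc(1)] trig_polys_coeffs(2)[OF q_in] by simp
    qed
    also have "\<dots> \<le> L2_set (\<lambda>j. norm (x j, y j) + cmod (of_real ((jap j)\<^sup>2) * (U m j - flowU m j t))) (J \<inter> I)"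
    proof (rule L2_set_mono)
      fix j assume j: "j \<in> J \<inter> I"
      have q: "fourier_coeff (q K m) j = U m j"
        using j by (auto simp: fourier_coeff_q freq_trunc_def I_def)
      have mt: "m - t = h / 2" by (simp add: m_def)
      let ?P = "of_real (cos (h / 2 * jap j)) * x j + of_real (sin (h / 2 * jap j)) * y j"
      have P: "of_real ((jap j)\<^sup>2) * (fourier_coeff W j - U m j) = ?P - of_real ((jap j)\<^sup>2) * (U m j - flowU m j t)"
        unfolding Wc(2) flowU_def mt x_def y_def by (simp add: field_simps power2_eq_square)
      have "cmod ?P \<le> norm (x j, y j)"
        by (rule cmod_rotate_le) simp
      then have "cmod (of_real ((jap j)\<^sup>2) * (fourier_coeff W j - U m j))
          \<le> norm (x j, y j) + cmod (of_real ((jap j)\<^sup>2) * (U m j - flowU m j t))"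
        unfolding P by (intro order.trans[OF norm_triangle_ineq4] add_mono order.refl)
      moreover have "jap j powr 2 * cmod (fourier_coeff W j - U m j) = cmod (of_real ((jap j)\<^sup>2) * (fourier_coeff W j - U m j))"
        unfolding norm_mult norm_of_real by simp
      ultimately show "jap j powr 2 * cmod (fourier_coeff W j - fourier_coeff (q K m) j)
          \<le> norm (x j, y j) + cmod (of_real ((jap j)\<^sup>2) * (U m j - flowU m j t))"
        unfolding q by linarith
    qed simp
    also have "\<dots> \<le> L2_set (\<lambda>j. norm (x j, y j)) (J \<inter> I) + L2_set (\<lambda>j. cmod (of_real ((jap j)\<^sup>2) * (U m j - flowU m j t))) (J \<inter> I)"
      by (rule L2_set_triangle_ineq)
    also have "\<dots> \<le> e"
      unfolding e_def E m_def using J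
      by (intro add_mono L2_set_subset_le I midpoint_defect[OF K h t]) (auto simp: I_def)
    finally show "L2_set (\<lambda>j. jap j powr 2 * cmod (fourier_coeff W j - fourier_coeff (q K m) j)) J \<le> e" .
  qed
  have "e \<le> 3"
    using small by (simp add: e_def E_def)
  note Lip = f_disc_Lipschitz[OF q_in Wc(1) q_bounds(3)[OF mt] W this]
  let ?N = "trig_step a g b1 bb1 \<kappa> h K (v, w)"
  let ?Gn = "freq_trunc K (fourier_coeff (f_disc a g K W))"
  note N = trig_step_coeffs[OF vw, of a g b1 bb1 \<kappa> h, folded W_def]
  let ?dU = "\<lambda>j. of_real ((jap j)\<^sup>2) * (U (t + h) j - flowU (t + h) j t)
      - of_real (\<kappa> * (h\<^sup>2 * (jap j)\<^sup>2 * bb1 ((h * jap j)\<^sup>2))) * G K m j"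
  let ?dV = "\<lambda>j. of_real (jap j) * (V (t + h) j - flowV (t + h) j t)
      - of_real (\<kappa> * (h * jap j * b1 ((h * jap j)\<^sup>2))) * G K m j"
  let ?dG = "\<lambda>j. fourier_coeff (f_disc a g K W) j - G K m j"
  have "err K (t + h) ?N \<le> L2_set (\<lambda>j. norm (x j, y j) + cmod (?dU j) + cmod (?dV j) + 2 * (\<kappa> * c) * (jap j powr 0 * cmod (?dG j))) I"
    unfolding err_def I_def[symmetric]
  proof (rule L2_set_mono)
    fix j assume "j \<in> I"
    then have Gn: "?Gn j = fourier_coeff (f_disc a g K W) j"
      by (auto simp: freq_trunc_def I_def)
    let ?\<xi> = "h * jap j"
    let ?rx = "of_real (cos ?\<xi>) * x j + of_real (sin ?\<xi>) * y j" and ?ry = "- of_real (sin ?\<xi>) * x j + of_real (cos ?\<xi>) * y j"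
    let ?zx = "of_real (\<kappa> * (h\<^sup>2 * (jap j)\<^sup>2 * bb1 (?\<xi>\<^sup>2))) * ?dG j" and ?zy = "of_real (\<kappa> * (h * jap j * b1 (?\<xi>\<^sup>2))) * ?dG j"
    have th: "t + h - t = h" by simp
    have X: "of_real ((jap j)\<^sup>2) * (fourier_coeff (fst ?N) j - U (t + h) j) = ?rx + (?zx - ?dU j)"
      unfolding N(3) Gn flowU_def th x_def y_def by (simp add: field_simps power2_eq_square)
    have Y: "of_real (jap j) * (fourier_coeff (snd ?N) j - V (t + h) j) = ?ry + (?zy - ?dV j)"
      unfolding N(4) Gn flowV_def th x_def y_def by (simp add: field_simps power2_eq_square)
    \<comment> \<open>The weights combine with the step size to \<xi>^2 here and to \<xi> in the
      second component, exactly the powers that the bounds on bb1 and b1 absorb.\<close>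
    have "cmod ?zx \<le> \<kappa> * c * cmod (?dG j)"
    proof -
      have "\<bar>\<kappa> * (h\<^sup>2 * (jap j)\<^sup>2 * bb1 (?\<xi>\<^sup>2))\<bar> \<le> \<kappa> * c"
        using mult_left_mono[OF coeff_assumptionD(2)[OF A, of ?\<xi>], of \<kappa>] h \<kappa> by (simp add: abs_mult power_mult_distrib)
      then show ?thesis
        unfolding norm_mult norm_of_real by (rule mult_right_mono) simp
    qed
    moreover have "cmod ?zy \<le> \<kappa> * c * cmod (?dG j)"
    proof -
      have "\<bar>\<kappa> * (h * jap j * b1 (?\<xi>\<^sup>2))\<bar> \<le> \<kappa> * c"
        using mult_left_mono[OF coeff_assumptionD(4)[OF A, of ?\<xi>], of \<kappa>] h \<kappa> by (simp add: abs_mult)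
      then show ?thesis
        unfolding norm_mult norm_of_real by (rule mult_right_mono) simp
    qed
    moreover have "norm (?rx + (?zx - ?dU j), ?ry + (?zy - ?dV j)) \<le> norm (x j, y j) + ((cmod ?zx + cmod (?dU j)) + (cmod ?zy + cmod (?dV j)))"
    proof -
      have "norm (?rx + (?zx - ?dU j), ?ry + (?zy - ?dV j)) = norm ((?rx, ?ry) + (?zx - ?dU j, ?zy - ?dV j))"
        by simp
      also have "\<dots> \<le> norm (?rx, ?ry) + norm (?zx - ?dU j, ?zy - ?dV j)"
        by (rule norm_triangle_ineq)
      also have "norm (?rx, ?ry) = norm (x j, y j)"
        by (rule norm_rotate) simp
      also have "norm (?zx - ?dU j, ?zy - ?dV j) \<le> cmod (?zx - ?dU j) + cmod (?zy - ?dV j)"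
        by (rule norm_Pair_le)
      also have "\<dots> \<le> (cmod ?zx + cmod (?dU j)) + (cmod ?zy + cmod (?dV j))"
        by (intro add_mono norm_triangle_ineq4)
      finally show ?thesis by simp
    qed
    ultimately show "norm (of_real ((jap j)\<^sup>2) * (fourier_coeff (fst ?N) j - U (t + h) j),
        of_real (jap j) * (fourier_coeff (snd ?N) j - V (t + h) j))
      \<le> norm (x j, y j) + cmod (?dU j) + cmod (?dV j) + 2 * (\<kappa> * c) * (jap j powr 0 * cmod (?dG j))"
      unfolding X Y by simp
  qed simp
  also have "\<dots> \<le> E + \<kappa> * ?Q * h + \<kappa> * ?Q * h + 2 * (\<kappa> * c) * (C * e)"
  proof (intro order.trans[OF L2_set_triangle_ineq] add_mono L2_set_scale_le)
    show "L2_set (\<lambda>j. norm (x j, y j)) I \<le> E"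
      by (simp add: E)
    show "L2_set (\<lambda>j. cmod (?dU j)) I \<le> \<kappa> * ?Q * h"
      unfolding m_def by (rule defect_U[OF A K \<eta> t I])
    show "L2_set (\<lambda>j. cmod (?dV j)) I \<le> \<kappa> * ?Q * h"
      unfolding m_def by (rule defect_V[OF A K \<eta> t I])
    show "L2_set (\<lambda>j. jap j powr 0 * cmod (?dG j)) I \<le> C * e"
      using sob_leD[OF Lip I] by (simp add: G_def)
  qed (use \<kappa> c in auto)
  finally show ?thesis
    by (simp add: e_def E_def mult_ac)
qed

text \<open>A discrete Gronwall argument in which the a-priori bound reproduces itself: the claimed
  bound is at most 2, the forcing missed by the midpoint stage at most 1, and their sum is the 3
  that the next step requires. In \<open>R\<close>, 10 c C^2 is 2 c C times the 5C of
  \<open>midpoint_defect\<close>.\<close>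

lemma err_bound:
  fixes b1 bb1 :: "real \<Rightarrow> real" and c L h :: real and K :: nat
  defines "R \<equiv> (\<lambda>h \<eta>. 2 * (Bc c * (\<eta> ^ 4 + real K powr (- s - 2))) + 10 * c * C\<^sup>2 * (\<kappa> * h))"
    and "w \<equiv> trig_integrator a g b1 bb1 \<kappa> h K (u 0) (ut 0)"
  assumes A: "coeff_assumption c b1 bb1" and K: "1 \<le> K" and \<eta>: "0 < \<eta>" "\<eta> \<le> 1" "h = \<eta> ^ 3"
    and L: "\<kappa> \<le> L * h" and small: "5 * C * (\<kappa> * h\<^sup>2) \<le> 1"
    and R: "exp (2 * c * C * (L * T)) * (\<kappa> * T * R h \<eta>) \<le> 2"
  shows "real n * h \<le> T \<Longrightarrow> err K (real n * h) (w n) \<le> exp (2 * c * C * (L * T)) * (\<kappa> * T * R h \<eta>)"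
proof -
  have h: "0 < h" using \<eta> by simp
  have c: "0 \<le> c" by (rule coeff_assumption_nonneg[OF A])
  let ?a = "2 * c * C * \<kappa>"
  have a0: "0 \<le> ?a" using c C \<kappa> by simp
  have R0: "0 \<le> R h \<eta>"
    unfolding R_def using Bc[OF c] c C \<kappa> h \<eta> by (intro add_nonneg_nonneg mult_nonneg_nonneg) auto
  have main: "(1 + ?a) ^ n * (real n * (\<kappa> * h * R h \<eta>)) \<le> exp (2 * c * C * (L * T)) * (\<kappa> * T * R h \<eta>)"
    if n: "real n * h \<le> T" for n
  proof (rule mult_mono)
    have "(1 + ?a) ^ n \<le> exp ?a ^ n"
      using a0 by (intro power_mono exp_ge_add_one_self) auto
    also have "\<dots> = exp (real n * ?a)"
      by (rule exp_of_nat_mult[symmetric])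
    also have "\<dots> \<le> exp (2 * c * C * (L * T))"
    proof -
      have L0: "0 \<le> L"
        using L \<kappa> h by (metis less_le_trans less_imp_le zero_less_mult_pos2)
      have "real n * \<kappa> \<le> real n * (L * h)"
        by (intro mult_left_mono L) auto
      also have "\<dots> = L * (real n * h)" by simp
      also have "\<dots> \<le> L * T" by (intro mult_left_mono n L0)
      finally have "2 * c * C * (real n * \<kappa>) \<le> 2 * c * C * (L * T)"
        using c C by (intro mult_left_mono) auto
      then show ?thesis by (simp add: mult_ac)
    qed
    finally show "(1 + ?a) ^ n \<le> exp (2 * c * C * (L * T))" .
    have "\<kappa> * R h \<eta> * (real n * h) \<le> \<kappa> * R h \<eta> * T"
      using \<kappa> R0 by (intro mult_left_mono n) auto
    then show "real n * (\<kappa> * h * R h \<eta>) \<le> \<kappa> * T * R h \<eta>"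
      by (simp add: mult_ac)
  qed (use a0 \<kappa> h R0 in auto)
  have "err K (real n * h) (w n) \<le> (1 + ?a) ^ n * (real n * (\<kappa> * h * R h \<eta>))" if "real n * h \<le> T" for n
    using that
  proof (induction n)
    case 0
    have "err K 0 (w 0) = 0"
      unfolding err_def w_def by (rule L2_set_0')
        (auto simp: fourier_coeff_trig_proj_trunc freq_trunc_def U_def V_def zero_prod_def)
    then show ?case by simp
  next
    case (Suc n)
    let ?e = "err K (real n * h) (w n)" and ?k = "\<kappa> * h * R h \<eta>"
    have t: "0 \<le> real n * h" "real n * h + h \<le> T"
      using Suc.prems h by (auto simp: algebra_simps)
    have n: "real n * h \<le> T"
      using t h by linarith
    note IH = Suc.IH[OF n]
    have w_in: "fst (w n) \<in> trig_polys K" "snd (w n) \<in> trig_polys K"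
      unfolding w_def using trig_integrator_in by blast+
    have "?e + 5 * C * (\<kappa> * h\<^sup>2) \<le> 3"
      using IH main[OF n] R small by linarith
    then have "err K (real n * h + h) (trig_step a g b1 bb1 \<kappa> h K (fst (w n), snd (w n)))
        \<le> ?e + 2 * (\<kappa> * (Bc c * (\<eta> ^ 4 + real K powr (- s - 2))) * h) + 2 * (\<kappa> * c * (C * (?e + 5 * C * (\<kappa> * h\<^sup>2))))"
      using one_step[OF A K \<eta> t w_in] by simp
    also have "\<dots> = (1 + ?a) * ?e + ?k"
      by (simp add: R_def power2_eq_square algebra_simps)
    also have "\<dots> \<le> (1 + ?a) * ((1 + ?a) ^ n * (real n * ?k)) + (1 + ?a) ^ Suc n * ?k"
    proof (intro add_mono mult_left_mono IH)
      have "1 * ?k \<le> (1 + ?a) ^ Suc n * ?k"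
        using a0 \<kappa> h R0 by (intro mult_right_mono one_le_power) auto
      then show "?k \<le> (1 + ?a) ^ Suc n * ?k" by simp
    qed (use a0 in simp)
    also have "\<dots> = (1 + ?a) ^ Suc n * (real (Suc n) * ?k)"
      by (simp add: algebra_simps)
    finally have "err K (real n * h + h) (w (Suc n)) \<le> (1 + ?a) ^ Suc n * (real (Suc n) * ?k)"
      by (simp add: w_def)
    then show ?case
      by (simp add: algebra_simps)
  qed
  then show "err K (real n * h) (w n) \<le> exp (2 * c * C * (L * T)) * (\<kappa> * T * R h \<eta>)" if "real n * h \<le> T"
    using main that order.trans by blast
qed

end

section \<open>Passage to the energy norm and choice of the thresholds\<close>

lemma energy_norm_le:
  assumes B: "0 \<le> B" and le: "\<And>J. finite J \<Longrightarrow>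
    L2_set (\<lambda>j. norm (of_real ((jap j)\<^sup>2) * fourier_coeff v j, of_real (jap j) * fourier_coeff w j)) J \<le> B"
  shows "energy_norm 1 (v, w) \<le> B"
proof -
  define f where "f j = jap j powr (2 * (1 + 1)) * (cmod (fourier_coeff v j))\<^sup>2" for j
  define f' where "f' j = jap j powr (2 * 1) * (cmod (fourier_coeff w j))\<^sup>2" for j
  have fin: "(\<Sum>j\<in>J. f j + f' j) \<le> B\<^sup>2" if "finite J" for J
  proof -
    have "(norm (of_real ((jap j)\<^sup>2) * fourier_coeff v j, of_real (jap j) * fourier_coeff w j))\<^sup>2 = f j + f' j" for j
      by (simp add: norm_Pair f_def f'_def norm_mult power_mult_distrib norm_power flip: power_mult)
    then have "(\<Sum>j\<in>J. f j + f' j)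
        = (L2_set (\<lambda>j. norm (of_real ((jap j)\<^sup>2) * fourier_coeff v j, of_real (jap j) * fourier_coeff w j)) J)\<^sup>2"
      by (simp add: L2_set_def sum_nonneg f_def f'_def)
    also have "\<dots> \<le> B\<^sup>2"
      by (intro power_mono le that) simp
    finally show ?thesis .
  qed
  have nn: "0 \<le> f j" "0 \<le> f' j" for j
    by (auto simp: f_def f'_def)
  have sf: "f summable_on UNIV"
  proof (rule nonneg_bdd_above_summable_on)
    show "bdd_above (sum f ` {F. F \<subseteq> UNIV \<and> finite F})"
      using fin nn by (intro bdd_aboveI[of _ "B\<^sup>2"]) (auto intro!: order.trans[OF _ fin] sum_mono)
  qed (use nn in auto)
  have sf': "f' summable_on UNIV"
  proof (rule nonneg_bdd_above_summable_on)
    show "bdd_above (sum f' ` {F. F \<subseteq> UNIV \<and> finite F})"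
      using fin nn by (intro bdd_aboveI[of _ "B\<^sup>2"]) (auto intro!: order.trans[OF _ fin] sum_mono)
  qed (use nn in auto)
  have "(sobolev_norm (1 + 1) v)\<^sup>2 + (sobolev_norm 1 w)\<^sup>2 = infsum f UNIV + infsum f' UNIV"
    unfolding sobolev_norm_def f_def[symmetric] f'_def[symmetric] using nn by (simp add: infsum_nonneg)
  also have "\<dots> = infsum (\<lambda>j. f j + f' j) UNIV"
    by (rule infsum_add[symmetric, OF sf sf'])
  also have "\<dots> \<le> B\<^sup>2"
    by (rule infsum_le_finite_sums[OF summable_on_add[OF sf sf']]) (rule fin)
  finally show ?thesis
    unfolding energy_norm_def using B by (simp add: real_le_lsqrt)
qed

text \<open>Membership in the space is essential: for a divergent series \<open>sobolev_norm\<close>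
  has the default value 0, and a bound on it would say nothing about partial sums.\<close>

lemma in_sobolev_sob_le:
  assumes v: "in_sobolev r v" and M: "sobolev_norm r v \<le> M"
  shows "sob_le r (fourier_coeff v) M"
proof (rule sob_leI)
  fix J :: "int set" assume J: "finite J"
  have sq: "(jap j powr r * cmod (fourier_coeff v j))\<^sup>2 = jap j powr (2 * r) * (cmod (fourier_coeff v j))\<^sup>2" for j
    by (simp add: power_mult_distrib powr_power mult.commute)
  have "(\<Sum>j\<in>J. jap j powr (2 * r) * (cmod (fourier_coeff v j))\<^sup>2)
      \<le> (\<Sum>\<^sub>\<infinity>j\<in>UNIV. jap j powr (2 * r) * (cmod (fourier_coeff v j))\<^sup>2)"
    by (rule finite_sum_le_infsum) (use v J in \<open>auto simp: in_sobolev_def\<close>)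
  then have "L2_set (\<lambda>j. jap j powr r * cmod (fourier_coeff v j)) J \<le> sobolev_norm r v"
    unfolding L2_set_def sq sobolev_norm_def by (rule real_sqrt_le_mono)
  then show "L2_set (\<lambda>j. jap j powr r * cmod (fourier_coeff v j)) J \<le> M"
    using M by linarith
qed

lemma sobolev_norm_le_energy_norm:
  "sobolev_norm (r + 1) v \<le> energy_norm r (v, w)" "sobolev_norm r w \<le> energy_norm r (v, w)"
  unfolding energy_norm_def by (auto intro!: real_le_rsqrt)

text \<open>Beyond \<open>K\<close> the numerical solution has no modes, so the tails of u and of
  its time derivative remain. Each of them loses s + 2 derivatives to the power of \<open>K\<close>,
  at a cost of M.\<close>

theorem (in exact_solution) energy_error:
  assumes A: "coeff_assumption c b1 bb1" and K: "1 \<le> K" and w: "fst w \<in> trig_polys K" "snd w \<in> trig_polys K"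
    and t: "t \<in> {0..T}"
  shows "energy_norm 1 (\<lambda>x. fst w x - u t x, \<lambda>x. snd w x - ut t x) \<le> err K t w + 2 * M * real K powr (- s - 2)"
proof (rule energy_norm_le)
  let ?k = "real K powr (- s - 2)"
  define I where "I = {- int K..int K}"
  show "0 \<le> err K t w + 2 * M * ?k"
    using M by (simp add: err_def)
  have tc: "torus_cont (fst w)" "torus_cont (snd w)" "torus_cont (u t)" "torus_cont (ut t)"
    using w u t C_diff_2_fourier_coeff(1) trig_polys_torus_cont by auto
  have e: "- (s + 2) = - s - 2" by simp
  have tU: "sob_le 2 (\<lambda>j. U t j - freq_trunc K (U t) j) (?k * M)"
    using sob_le_tail[of 2 "s + 2" "U t" M K] sob_le_weaken[OF su[OF t, folded U_def], of "2 + (s + 2)" M] K s unfolding e by auto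
  have tV: "sob_le 1 (\<lambda>j. V t j - freq_trunc K (V t) j) (?k * M)"
    using sob_le_tail[of 1 "s + 2" "V t" M K] sob_le_weaken[OF sut[OF t, folded V_def], of "1 + (s + 2)" M] K s unfolding e by auto
  fix J :: "int set" assume J: "finite J"
  let ?n = "\<lambda>j. norm (of_real ((jap j)\<^sup>2) * (fourier_coeff (fst w) j - U t j), of_real (jap j) * (fourier_coeff (snd w) j - V t j))"
  let ?x = "\<lambda>j. jap j powr 2 * cmod (U t j - freq_trunc K (U t) j)" and ?y = "\<lambda>j. jap j powr 1 * cmod (V t j - freq_trunc K (V t) j)"
  have "L2_set (\<lambda>j. norm (of_real ((jap j)\<^sup>2) * fourier_coeff (\<lambda>x. fst w x - u t x) j, of_real (jap j) * fourier_coeff (\<lambda>x. snd w x - ut t x) j)) J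
      = L2_set ?n J"
    by (simp add: fourier_coeff_diff tc U_def V_def)
  also have "\<dots> \<le> L2_set (\<lambda>j. (if j \<in> I then ?n j else 0) + ?x j + ?y j) J"
  proof (rule L2_set_mono)
    fix j
    show "?n j \<le> (if j \<in> I then ?n j else 0) + ?x j + ?y j"
    proof (cases "j \<in> I")
      case False
      then have j: "\<not> \<bar>j\<bar> \<le> int K" by (auto simp: I_def)
      have "?n j \<le> cmod (of_real ((jap j)\<^sup>2) * (fourier_coeff (fst w) j - U t j)) + cmod (of_real (jap j) * (fourier_coeff (snd w) j - V t j))"
        by (rule norm_Pair_le)
      also have "\<dots> = ?x j + ?y j"
        using trig_polys_coeffs(2)[OF w(1) j] trig_polys_coeffs(2)[OF w(2) j] j
        by (simp add: freq_trunc_def norm_mult norm_power)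
      finally show ?thesis using False by simp
    qed simp
  qed simp
  also have "\<dots> \<le> err K t w + ?k * M + ?k * M"
  proof (intro order.trans[OF L2_set_triangle_ineq] add_mono)
    have "L2_set (\<lambda>j. if j \<in> I then ?n j else 0) J = L2_set (\<lambda>j. if j \<in> I then ?n j else 0) (J \<inter> I)"
      by (rule L2_set_restrict[OF J]) auto
    also have "\<dots> = L2_set ?n (J \<inter> I)"
      by (rule L2_set_cong) auto
    also have "\<dots> \<le> err K t w"
      unfolding err_def I_def by (rule L2_set_subset_le) auto
    finally show "L2_set (\<lambda>j. if j \<in> I then ?n j else 0) J \<le> err K t w" .
  qed (rule sob_leD[OF tU J] sob_leD[OF tV J])+
  finally show "L2_set (\<lambda>j. norm (of_real ((jap j)\<^sup>2) * fourier_coeff (\<lambda>x. fst w x - u t x) j, of_real (jap j) * fourier_coeff (\<lambda>x. snd w x - ut t x) j)) J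
      \<le> err K t w + 2 * M * ?k"
    by simp
qed

text \<open>\<open>L\<close> is the constant implied in \<kappa> \<lesssim> h. \<open>C\<close> is
  chosen before the coefficient functions, T and L, and only the two thresholds may depend on these.
  The condition \<open>1 \<le> K\<close> excludes K = 0, where \<open>powr\<close> has the default
  value 0.\<close>

theorem theorem3p4:
  fixes a :: "real \<Rightarrow> real" and g :: "real \<times> real \<Rightarrow> real" and c M s :: real
  assumes "smooth_fun a" and "smooth_fun g" and "a 0 = 0" and "g (0, 0) = 0"
    and "0 \<le> s" and "0 < M"
  shows "\<exists>C. \<forall>b1 bb1 T \<delta> A0 L.
    coeff_assumption c b1 bb1 \<longrightarrow> 0 < T \<longrightarrow> 0 < \<delta> \<longrightarrow> \<delta> < 1 \<longrightarrow> 0 \<le> A0 \<longrightarrow> 0 < L \<longrightarrow>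
    (\<exists>h0>0. \<exists>\<kappa>0>0. \<forall>\<kappa> h K u0 v0 u ut n.
       0 < \<kappa> \<longrightarrow> \<kappa> < \<kappa>0 \<longrightarrow> \<kappa> \<le> L * h \<longrightarrow> h < h0 \<longrightarrow> 1 \<le> K \<longrightarrow>
       qwave_solution a g \<kappa> T u0 v0 u ut \<longrightarrow>
       (\<forall>t\<in>{0..T}. in_sobolev (5 + s) (u t) \<and> in_sobolev (4 + s) (ut t) \<and>
                   energy_norm (4 + s) (u t, ut t) \<le> M \<and>
                   (\<forall>x. \<delta> \<le> 1 + \<kappa> * a (u t x) \<and> \<kappa> * a (u t x) \<le> A0)) \<longrightarrow>
       real n * h \<le> T \<longrightarrow>
       energy_norm 1
         (\<lambda>x. fst (trig_integrator a g b1 bb1 \<kappa> h K u0 v0 n) x - u (real n * h) x,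
          \<lambda>x. snd (trig_integrator a g b1 bb1 \<kappa> h K u0 v0 n) x - ut (real n * h) x)
       \<le> C * h\<^sup>2 + C * real K powr (- s - 2))"
proof -
  interpret quasilinear a g
    using assms by unfold_locales
  obtain C where "quasilinear_bounds a g s M C"
    using quasilinear_bounds_exists[of s M] assms by (metis less_imp_le)
  then interpret quasilinear_bounds a g s M C .
  show ?thesis
  \<comment> \<open>The 2M is the truncation error of the exact solution. The 1 bounds the error
    against its projection, once the thresholds have absorbed all other constants.\<close>
  proof (rule exI[of _ "2 * M + 1"], intro allI impI)
    fix b1 bb1 :: "real \<Rightarrow> real" and T \<delta> A0 L :: real
    assume A: "coeff_assumption c b1 bb1" and T: "0 < T" and L: "0 < L"
    have c: "0 \<le> c" by (rule coeff_assumption_nonneg[OF A])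
    \<comment> \<open>\<open>Bc\<close> depends on M, C and c only, so it is available before any
      solution is given. The absolute value provides B \<ge> 0 before the locale can be
      interpreted.\<close>
    define B where "B = \<bar>exact_solution.Bc M C c\<bar>"
    define b where "b = 10 * c * C\<^sup>2"
    define X where "X = exp (2 * c * C * (L * T))"
    \<comment> \<open>L + 1 lets \<open>P\<close> dominate the error constants both with and without
      a factor L. In \<open>Z\<close>, the summand 5C makes the midpoint stage small, and 4P pushes
      each of two error terms below h^2/4.\<close>
    define P where "P = X * T * (L + 1) * (2 * B + b)"
    define Z where "Z = 1 + 5 * C + 4 * P"
    have B: "0 \<le> B" and b: "0 \<le> b" and X: "0 \<le> X"
      using c by (auto simp: B_def b_def X_def)
    have P: "0 \<le> P"
      unfolding P_def using X T L B b by (intro mult_nonneg_nonneg) auto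
    have Z: "1 \<le> Z" "5 * C \<le> Z" "4 * P \<le> Z"
      using C P by (auto simp: Z_def)
    show "\<exists>h0>0. \<exists>\<kappa>0>0. \<forall>\<kappa> h K u0 v0 u ut n.
       0 < \<kappa> \<longrightarrow> \<kappa> < \<kappa>0 \<longrightarrow> \<kappa> \<le> L * h \<longrightarrow> h < h0 \<longrightarrow> 1 \<le> K \<longrightarrow>
       qwave_solution a g \<kappa> T u0 v0 u ut \<longrightarrow>
       (\<forall>t\<in>{0..T}. in_sobolev (5 + s) (u t) \<and> in_sobolev (4 + s) (ut t) \<and>
                   energy_norm (4 + s) (u t, ut t) \<le> M \<and>
                   (\<forall>x. \<delta> \<le> 1 + \<kappa> * a (u t x) \<and> \<kappa> * a (u t x) \<le> A0)) \<longrightarrow>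
       real n * h \<le> T \<longrightarrow>
       energy_norm 1
         (\<lambda>x. fst (trig_integrator a g b1 bb1 \<kappa> h K u0 v0 n) x - u (real n * h) x,
          \<lambda>x. snd (trig_integrator a g b1 bb1 \<kappa> h K u0 v0 n) x - ut (real n * h) x)
       \<le> (2 * M + 1) * h\<^sup>2 + (2 * M + 1) * real K powr (- s - 2)"
    \<comment> \<open>The cube makes \<eta>, the cube root of h, smaller than 1/Z, which is also the
      threshold for \<kappa>.\<close>
    proof (rule exI[of _ "(1 / Z) ^ 3"], intro exI[of _ "1 / Z"] conjI allI impI)
      fix \<kappa> h :: real and K :: nat and u0 v0 :: "real \<Rightarrow> real" and u ut :: "real \<Rightarrow> real \<Rightarrow> real" and n :: nat
      assume kap: "0 < \<kappa>" "\<kappa> < 1 / Z" "\<kappa> \<le> L * h" and h: "h < (1 / Z) ^ 3" and K: "1 \<le> K"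
        and sol: "qwave_solution a g \<kappa> T u0 v0 u ut" and n: "real n * h \<le> T"
        and reg: "\<forall>t\<in>{0..T}. in_sobolev (5 + s) (u t) \<and> in_sobolev (4 + s) (ut t) \<and>
                   energy_norm (4 + s) (u t, ut t) \<le> M \<and>
                   (\<forall>x. \<delta> \<le> 1 + \<kappa> * a (u t x) \<and> \<kappa> * a (u t x) \<le> A0)"
      have h0: "0 < h"
        using kap L by (metis less_le_trans zero_less_mult_pos)
      define \<eta> where "\<eta> = root 3 h"
      have \<eta>: "0 < \<eta>" "h = \<eta> ^ 3"
        using h0 by (auto simp: \<eta>_def)
      have \<eta>Z: "\<eta> < 1 / Z"
        using h \<eta> Z by (intro power_less_imp_less_base[of \<eta> 3]) auto
      have Z1: "1 / Z \<le> 1"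
        using Z by simp
      have \<eta>1: "\<eta> \<le> 1" and \<kappa>1: "\<kappa> \<le> 1"
        using \<eta>Z kap Z1 by linarith+
      interpret exact_solution a g s M C \<kappa> T u ut
      proof unfold_locales
        fix t assume t: "t \<in> {0..T}"
        note sol_t = sol[unfolded qwave_solution_def, THEN conjunct2, THEN conjunct2, rule_format, OF t]
        show "torus_fun (u t)" "C_diff 2 (u t)" "torus_cont (ut t)"
          using sol_t by (auto simp: torus_cont_def)
        show "((\<lambda>\<tau>. u \<tau> x) has_real_derivative ut t x) (at t within {0..T})" for x
          using sol_t by blast
        show "((\<lambda>\<tau>. ut \<tau> x) has_real_derivative deriv (deriv (u t)) x - u t x + \<kappa> * nonlin a g (u t) x) (at t within {0..T})" for x
        proof -
          have "deriv (deriv (u t)) x - u t x + \<kappa> * nonlin a g (u t) x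
              = deriv (deriv (u t)) x - u t x + \<kappa> * a (u t x) * deriv (deriv (u t)) x + \<kappa> * g (u t x, deriv (u t) x)"
            by (simp add: nonlin_def algebra_simps)
          then show ?thesis
            using sol_t by presburger
        qed
        have e: "4 + s + 1 = 5 + s" by simp
        have r: "in_sobolev (5 + s) (u t)" "in_sobolev (4 + s) (ut t)" "energy_norm (4 + s) (u t, ut t) \<le> M"
          using reg t by auto
        note n = sobolev_norm_le_energy_norm[of "4 + s", unfolded e]
        show "sob_le (5 + s) (fourier_coeff (u t)) M"
          by (rule in_sobolev_sob_le[OF r(1) order.trans[OF n(1) r(3)]])
        show "sob_le (4 + s) (fourier_coeff (ut t)) M"
          by (rule in_sobolev_sob_le[OF r(2) order.trans[OF n(2) r(3)]])
      qed (use T kap \<kappa>1 in auto)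
      define k where "k = real K powr (- s - 2)"
      have k: "0 \<le> k" "k \<le> 1"
        using powr_mono[of "- s - 2" 0 "real K"] K s by (auto simp: k_def)
      have B_eq: "Bc c = B"
        using Bc[OF c] by (simp add: B_def)
      have u0: "u 0 = u0" "ut 0 = v0"
        using sol by (auto simp: qwave_solution_def)
      have \<kappa>Z: "\<kappa> * y \<le> 1" and \<eta>Z': "\<eta> * y \<le> 1" if "0 \<le> y" "y \<le> Z" for y
      proof -
        have "\<kappa> * y \<le> (1 / Z) * Z" "\<eta> * y \<le> (1 / Z) * Z"
          using that kap \<eta> \<eta>Z by (intro mult_mono; simp)+
        then show "\<kappa> * y \<le> 1" "\<eta> * y \<le> 1"
          using Z by auto
      qed
      have "X * T * 1 * (2 * B) \<le> P"
        unfolding P_def using X T L B b by (intro mult_mono) auto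
      then have P1: "X * T * (2 * B) \<le> P"
        by simp
      have P2: "X * T * L * (2 * B) \<le> P" and P3: "X * T * L * b \<le> P"
        unfolding P_def using X T L B b by (intro mult_mono; auto)+
      define R where "R = 2 * (Bc c * (\<eta> ^ 4 + k)) + 10 * c * C\<^sup>2 * (\<kappa> * h)"
      \<comment> \<open>In the term with \<open>k\<close> the small factor is \<kappa> itself. In
        the other two, one \<kappa> is traded for L h: then h \<eta>^4 = \<eta> h^2 leaves \<eta> as
        the small factor, and the term with \<kappa>^2 h keeps the second \<kappa>.\<close>
      have "X * (\<kappa> * T * R) = \<kappa> * (X * T * (2 * B)) * k + \<kappa> * (X * T * (2 * B) * \<eta> ^ 4) + \<kappa> * (\<kappa> * (X * T * b) * h)"
        by (simp add: R_def B_eq b_def algebra_simps)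
      also have "\<dots> \<le> k + h\<^sup>2 / 4 + h\<^sup>2 / 4"
      proof (intro add_mono)
        have "\<kappa> * (X * T * (2 * B)) \<le> 1"
          using X T B P1 P Z by (intro \<kappa>Z mult_nonneg_nonneg) auto
        from mult_right_mono[OF this k(1)] show "\<kappa> * (X * T * (2 * B)) * k \<le> k"
          by simp
        have "\<kappa> * (X * T * (2 * B) * \<eta> ^ 4) \<le> (L * h) * (X * T * (2 * B) * \<eta> ^ 4)"
          using X T B \<eta> by (intro mult_right_mono kap mult_nonneg_nonneg) auto
        also have "\<dots> = \<eta> * (X * T * L * (2 * B)) * h\<^sup>2"
          unfolding \<eta>(2) by (simp add: power2_eq_square power3_eq_cube power4_eq_xxxx mult_ac)
        also have "\<dots> \<le> (1 / 4) * h\<^sup>2"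
        proof (rule mult_right_mono)
          have "\<eta> * (X * T * L * (2 * B)) \<le> \<eta> * P"
            using P2 \<eta> by (intro mult_left_mono) auto
          moreover have "\<eta> * (4 * P) \<le> 1"
            using P Z by (intro \<eta>Z') auto
          ultimately show "\<eta> * (X * T * L * (2 * B)) \<le> 1 / 4" by linarith
        qed simp
        finally show "\<kappa> * (X * T * (2 * B) * \<eta> ^ 4) \<le> h\<^sup>2 / 4" by simp
        have "\<kappa> * (\<kappa> * (X * T * b) * h) \<le> (L * h) * (\<kappa> * (X * T * b) * h)"
          using X T b kap(1) h0 by (intro mult_right_mono kap(3) mult_nonneg_nonneg) auto
        also have "\<dots> = \<kappa> * (X * T * L * b) * h\<^sup>2"
          by (simp add: power2_eq_square mult_ac)
        also have "\<dots> \<le> (1 / 4) * h\<^sup>2"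
        proof (rule mult_right_mono)
          have "\<kappa> * (X * T * L * b) \<le> \<kappa> * P"
            using P3 kap by (intro mult_left_mono) auto
          moreover have "\<kappa> * (4 * P) \<le> 1"
            using P Z by (intro \<kappa>Z) auto
          ultimately show "\<kappa> * (X * T * L * b) \<le> 1 / 4" by linarith
        qed simp
        finally show "\<kappa> * (\<kappa> * (X * T * b) * h) \<le> h\<^sup>2 / 4" by simp
      qed
      finally have le: "X * (\<kappa> * T * R) \<le> h\<^sup>2 + k"
        using zero_le_power2[of h] by linarith
      have h1: "h \<le> 1"
        unfolding \<eta>(2) using \<eta>1 \<eta> by (intro power_le_one) auto
      then have "h\<^sup>2 \<le> 1"
        using h0 by (intro power_le_one) auto
      \<comment> \<open>This is the a-priori bound that \<open>err_bound\<close> has as a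
        premise.\<close>
      then have le2: "X * (\<kappa> * T * R) \<le> 2"
        using le k by linarith
      have small: "5 * C * (\<kappa> * h\<^sup>2) \<le> 1"
      proof -
        have "(5 * C * \<kappa>) * h\<^sup>2 \<le> 1 * 1"
          using \<kappa>Z[of "5 * C"] C Z \<open>h\<^sup>2 \<le> 1\<close> by (intro mult_mono) (auto simp: mult_ac)
        then show ?thesis by (simp add: mult_ac)
      qed
      let ?w = "trig_integrator a g b1 bb1 \<kappa> h K u0 v0 n"
      have "err K (real n * h) ?w \<le> h\<^sup>2 + k"
        using err_bound[OF A K \<eta>(1) \<eta>1 \<eta>(2) kap(3) small, of n] le le2 n unfolding u0 X_def R_def k_def by linarith
      moreover have "real n * h \<in> {0..T}"
        using n h0 by auto
      then have "energy_norm 1 (\<lambda>x. fst ?w x - u (real n * h) x, \<lambda>x. snd ?w x - ut (real n * h) x)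
          \<le> err K (real n * h) ?w + 2 * M * k"
        unfolding k_def using trig_integrator_in by (intro energy_error[OF A K]) auto
      moreover have "0 \<le> 2 * M * h\<^sup>2"
        using M by simp
      ultimately show "energy_norm 1 (\<lambda>x. fst ?w x - u (real n * h) x, \<lambda>x. snd ?w x - ut (real n * h) x)
          \<le> (2 * M + 1) * h\<^sup>2 + (2 * M + 1) * real K powr (- s - 2)"
        unfolding k_def[symmetric] by (simp add: algebra_simps)
    qed (use Z in auto)
  qed
qed

end
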